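(* Let $p>1$, $\beta>0$, $\gamma\in[0,1]$ and $s\in(0,1]$ (with $s\in(0,1)$ if $\gamma\in[0,1)$, and $s=1$ if $\gamma=1$) be such that $1/p<s<N/p$. Let $\alpha>-sp$ and $p<q<p^{*}_{\gamma,s,\alpha}$, and assume moreover that $$\alpha-\beta+(q-p)\left(\frac{1-N}{p}\right)<0.$$ Then the problem $$\mathcal{L}_{s,p,\gamma}\,u+|x|^\beta|u|^{p-2}u=|x|^\alpha|u|^{q-2}u\ \text{ in }\mathbb{R}^N,\qquad u>0,$$ admits a radial weak solution $u\in\mathcal{W}^{s,p}_\beta(\mathbb{R}^N)$.
   Context: Weighted Lebesgue norms: $\|u\|_{p,\beta}=\left(\int_{\mathbb{R}^N}|x|^\beta|u|^p\,dx\right)^{1/p}$, and $L^p_\beta(\mathbb{R}^N)$ is the space of functions with $\|u\|_{p,\beta}<\infty$. Seminorms: for $s\in(0,1)$, $[u]_{s,p}=\left(\int_{\mathbb{R}^N}\int_{\mathbb{R}^N}\frac{|u(x)-u(y)|^p}{|x-y|^{N+sp}}\,dx\,dy\right)^{1/p}$; for $s=1$, $[u]_{1,p}=\left(\int_{\mathbb{R}^N}|\nabla u|^p\,dx\right)^{1/p}$. Set $W^{s,p}_\beta(\mathbb{R}^N)=\{u\in L^p_\beta(\mathbb{R}^N):[u]_{s,p}<\infty\}$ with norm $\|u\|_{s,p,\beta}=\|u\|_{p,\beta}+[u]_{s,p}$, and let $W^{s,p}_{rad,\beta}(\mathbb{R}^N)$ be its subset of radial functions. The solution space is $\mathcal{W}^{s,p}_\beta(\mathbb{R}^N)=W^{s,p}_{rad,\beta}(\mathbb{R}^N)$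 if $\gamma=0$ (with norm $\|\cdot\|_{s,p,\beta}$), and $\mathcal{W}^{s,p}_\beta(\mathbb{R}^N)=W^{1,p}_{rad,\beta}(\mathbb{R}^N)$ if $\gamma\in(0,1]$ (with norm $\|\cdot\|_{1,p,\beta}$). The operator is $\mathcal{L}_{s,p,\gamma}u=\gamma(-\Delta_p)u+(1-\gamma)(-\Delta_p)^s u$, where $-\Delta_p u=-\mathrm{div}(|\nabla u|^{p-2}\nabla u)$ and, for $s\in(0,1)$, $(-\Delta_p)^s u(x)=\text{p.v.}\int_{\mathbb{R}^N}\frac{|u(x)-u(y)|^{p-2}(u(x)-u(y))}{|x-y|^{N+sp}}\,dy$. The case $\gamma=1$ is the purely local operator $-\Delta_p$ and is identified with $s=1$; when $\gamma=0$ or $\gamma\in(0,1)$ one takes $s\in(0,1)$. With $\Phi_r(t)=|t|^{r-2}t$ (for scalars and vectors), its weak form is $$\langle\mathcal{L}_{s,p,\gamma}u,v\rangle=\gamma\int_{\mathbb{R}^N}\Phi_p(\nabla u)\cdot\nabla v\,dx+(1-\gamma)\int_{\mathbb{R}^N}\int_{\mathbb{R}^N}\frac{\Phi_p(u(x)-u(y))(v(x)-v(y))}{|x-y|^{N+sp}}\,dx\,dy,$$ the first (second) term being absent if $\gamma=0$ ($\gamma=1$). Weak solution: $u\in\mathcal{W}^{s,p}_\beta(\mathbb{R}^N)$ (and $u>0$) such that $\langle\mathcal{L}_{s,p,\gamma}u,v\rangle+\int_{\mathbb{R}^N}|x|^\beta\Phi_p(u)v\,dx=\int_{\mathbb{R}^N}|x|^\alpha\Phi_q(u)v\,dx$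 for all $v\in\mathcal{W}^{s,p}_\beta(\mathbb{R}^N)$. Critical exponent: $p^{*}_{\gamma,s,\alpha}=\frac{p(N+\alpha)}{N-sp}$ if $\gamma=0$, and $p^{*}_{\gamma,s,\alpha}=\frac{p(N+\alpha)}{N-p}$ if $\gamma\in(0,1]$ (the latter presupposes $N>p$). *)

theory Defs
  imports "HOL-Analysis.Analysis"
begin

text \<open>
  Euclidean space \<open>\<real>\<^sup>N\<close> is a type of class \<^class>\<open>euclidean_space\<close>, with \<open>N = DIM('a)\<close>.
  Elements of the function spaces are represented by Borel functions; all notions below depend
  only on the class of a function modulo equality almost everywhere.
\<close>

primrec Ck :: "nat \<Rightarrow> ('a::euclidean_space \<Rightarrow> real) \<Rightarrow> bool" where
  "Ck 0 f \<longleftrightarrow> continuous_on UNIV f"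
| "Ck (Suc k) f \<longleftrightarrow>
     (\<forall>x. f differentiable (at x)) \<and> (\<forall>i\<in>Basis. Ck k (\<lambda>x. frechet_derivative f (at x) i))"

definition test_function :: "('a::euclidean_space \<Rightarrow> real) \<Rightarrow> bool" where
  "test_function \<phi> \<longleftrightarrow> (\<forall>k. Ck k \<phi>) \<and> compact (closure {x. \<phi> x \<noteq> 0})"

definition locally_integrable :: "('a::euclidean_space \<Rightarrow> 'b::euclidean_space) \<Rightarrow> bool" where
  "locally_integrable f \<longleftrightarrow> (\<forall>K. compact K \<longrightarrow> set_integrable lborel K f)"

definition has_weak_gradient ::
    "('a::euclidean_space \<Rightarrow> real) \<Rightarrow> ('a \<Rightarrow> 'a) \<Rightarrow> bool" where
  "has_weak_gradient u G \<longleftrightarrow>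
     locally_integrable u \<and> locally_integrable G \<and>
     (\<forall>\<phi>. test_function \<phi> \<longrightarrow> (\<forall>i\<in>Basis.
        (LINT x|lborel. u x * frechet_derivative \<phi> (at x) i) = - (LINT x|lborel. (G x \<bullet> i) * \<phi> x)))"

text \<open>The weak gradient is unique up to null sets, so the choice is immaterial.\<close>

definition weak_gradient :: "('a::euclidean_space \<Rightarrow> real) \<Rightarrow> 'a \<Rightarrow> 'a" where
  "weak_gradient u = (SOME G. has_weak_gradient u G)"

text \<open>
  The next three quantities are the \<open>p\<close>-th powers of \<open>\<parallel>u\<parallel>\<^bsub>p,\<beta>\<^esub>\<close>, of \<open>[u]\<^bsub>s,p\<^esub>\<close> for \<open>0 < s < 1\<close> and
  of \<open>[u]\<^bsub>1,p\<^esub>\<close>; only their finiteness matters.  The last one is infinite for functions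
  without a weak gradient.
\<close>

definition weighted_energy :: "real \<Rightarrow> real \<Rightarrow> ('a::euclidean_space \<Rightarrow> real) \<Rightarrow> ennreal" where
  "weighted_energy p \<beta> u = (\<integral>\<^sup>+x. ennreal (norm x powr \<beta> * \<bar>u x\<bar> powr p) \<partial>lborel)"

definition gagliardo_energy :: "real \<Rightarrow> real \<Rightarrow> ('a::euclidean_space \<Rightarrow> real) \<Rightarrow> ennreal" where
  "gagliardo_energy s p u =
     (\<integral>\<^sup>+y. (\<integral>\<^sup>+x. ennreal (\<bar>u x - u y\<bar> powr p / norm (x - y) powr (real DIM('a) + s * p)) \<partial>lborel)
       \<partial>lborel)"

definition gradient_energy :: "real \<Rightarrow> ('a::euclidean_space \<Rightarrow> real) \<Rightarrow> ennreal" where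
  "gradient_energy p u =
     (if \<exists>G. has_weak_gradient u G
      then \<integral>\<^sup>+x. ennreal (norm (weak_gradient u x) powr p) \<partial>lborel else \<infinity>)"

definition weighted_Lp :: "real \<Rightarrow> real \<Rightarrow> ('a::euclidean_space \<Rightarrow> real) set" where
  "weighted_Lp p \<beta> = {u \<in> borel_measurable lborel. weighted_energy p \<beta> u < \<infinity>}"

definition weighted_sobolev ::
    "real \<Rightarrow> real \<Rightarrow> real \<Rightarrow> ('a::euclidean_space \<Rightarrow> real) set" where
  "weighted_sobolev s p \<beta> =
     {u \<in> weighted_Lp p \<beta>. (if s = 1 then gradient_energy p u else gagliardo_energy s p u) < \<infinity>}"

definition radial :: "('a::euclidean_space \<Rightarrow> real) \<Rightarrow> bool" where
  "radial u \<longleftrightarrow> (\<exists>g. AE x in lborel. u x = g (norm x))"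

definition radial_sobolev ::
    "real \<Rightarrow> real \<Rightarrow> real \<Rightarrow> ('a::euclidean_space \<Rightarrow> real) set" where
  "radial_sobolev s p \<beta> = {u \<in> weighted_sobolev s p \<beta>. radial u}"

definition solution_space ::
    "real \<Rightarrow> real \<Rightarrow> real \<Rightarrow> real \<Rightarrow> ('a::euclidean_space \<Rightarrow> real) set" where
  "solution_space \<gamma> s p \<beta> = (if \<gamma> = 0 then radial_sobolev s p \<beta> else radial_sobolev 1 p \<beta>)"

definition Phi :: "real \<Rightarrow> 'b::real_normed_vector \<Rightarrow> 'b" where
  "Phi r t = (norm t powr (r - 2)) *\<^sub>R t"

definition local_integrand ::
    "real \<Rightarrow> ('a::euclidean_space \<Rightarrow> real) \<Rightarrow> ('a \<Rightarrow> real) \<Rightarrow> 'a \<Rightarrow> real" where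
  "local_integrand p u v x = Phi p (weak_gradient u x) \<bullet> weak_gradient v x"

definition nonlocal_integrand ::
    "real \<Rightarrow> real \<Rightarrow> ('a::euclidean_space \<Rightarrow> real) \<Rightarrow> ('a \<Rightarrow> real) \<Rightarrow> 'a \<times> 'a \<Rightarrow> real" where
  "nonlocal_integrand s p u v = (\<lambda>(x, y).
     Phi p (u x - u y) * (v x - v y) / norm (x - y) powr (real DIM('a) + s * p))"

definition operator_form ::
    "real \<Rightarrow> real \<Rightarrow> real \<Rightarrow> ('a::euclidean_space \<Rightarrow> real) \<Rightarrow> ('a \<Rightarrow> real) \<Rightarrow> real" where
  "operator_form \<gamma> s p u v =
     \<gamma> * (LINT x|lborel. local_integrand p u v x)
     + (1 - \<gamma>) * (LINT z|(lborel \<Otimes>\<^sub>M lborel). nonlocal_integrand s p u v z)"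

text \<open>
  The integral of a non-integrable function is \<open>0\<close> in HOL, so the convergence of every
  integral that occurs in the weak equation is required explicitly.
\<close>

definition weak_solution ::
    "real \<Rightarrow> real \<Rightarrow> real \<Rightarrow> real \<Rightarrow> real \<Rightarrow> real \<Rightarrow> ('a::euclidean_space \<Rightarrow> real) \<Rightarrow> bool" where
  "weak_solution \<gamma> s p q \<alpha> \<beta> u \<longleftrightarrow>
     u \<in> solution_space \<gamma> s p \<beta> \<and>
     (\<forall>v \<in> solution_space \<gamma> s p \<beta>.
        (\<gamma> \<noteq> 0 \<longrightarrow> integrable lborel (local_integrand p u v)) \<and>
        (\<gamma> \<noteq> 1 \<longrightarrow> integrable (lborel \<Otimes>\<^sub>M lborel) (nonlocal_integrand s p u v)) \<and>
        integrable lborel (\<lambda>x. norm x powr \<beta> * Phi p (u x) * v x) \<and>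
        integrable lborel (\<lambda>x. norm x powr \<alpha> * Phi q (u x) * v x) \<and>
        operator_form \<gamma> s p u v + (LINT x|lborel. norm x powr \<beta> * Phi p (u x) * v x)
          = (LINT x|lborel. norm x powr \<alpha> * Phi q (u x) * v x))"

definition critical_exponent :: "real \<Rightarrow> real \<Rightarrow> real \<Rightarrow> real \<Rightarrow> real \<Rightarrow> real" where
  "critical_exponent N p \<gamma> s \<alpha> =
     (if \<gamma> = 0 then p * (N + \<alpha>) / (N - s * p) else p * (N + \<alpha>) / (N - p))"

end

theory Submission imports Defs "HOL-Complex_Analysis.Great_Picard" begin

text \<open>
 The solution is a minimiser.  Let \<open>A u\<close> be the sum of the \<open>p\<close>-homogeneous energies in the equation and
 \<open>B u = \<integral>\<bar>x\<bar>\<^sup>\<alpha>\<bar>u\<bar>\<^sup>q\<close>.  A minimiser of \<open>A\<close> on \<open>B = 1\<close> among radial functions, made nonnegative and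
 rescaled, solves the weak equation tested with radial functions, and these are all the test functions
 of the problem.

 What makes the minimiser exist is that radial functions behave like functions of one variable.
 Since \<open>s p > 1\<close>, they are Hoelder continuous away from the origin (\<open>radial_Hoelder\<close>): in polar
 coordinates the \<open>N\<close>-dimensional Gagliardo kernel, integrated over a cone around \<open>x\<close> whose opening is
 adapted to \<open>\<bar>y\<bar> - \<bar>x\<bar>\<close>, dominates the one-dimensional kernel (\<open>kernel_lower_bound\<close>), and a Morrey
 estimate on the line applies (\<open>Morrey_one_sided\<close>).  A weak gradient is treated in the same way through
 fractional energies of order below one.  Hence a bound on \<open>A\<close> gives bounds of Strauss type
 \<open>\<bar>u x\<bar> \<le> C \<bar>x\<bar>\<^bsup>-(N-sp)/p\<^esup>\<close> near the origin and \<open>C \<bar>x\<bar>\<^bsup>-(N-1)/p\<^esup>\<close> far away (\<open>pointwise_bound\<close>), and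
 sequences with bounded \<open>A\<close> have subsequences converging almost everywhere (\<open>X_compact\<close>).  The
 first bound and the subcriticality of \<open>q\<close> control \<open>B\<close> at the origin; the second bound, the weighted norm
 and the last hypothesis on the exponents control it at infinity.  So \<open>B\<close> is continuous along such
 sequences (\<open>B_tendsto\<close>).  If \<open>\<gamma> > 0\<close>, uniform convexity makes the gradients of a minimising sequence
 converge strongly (\<open>minimizing_gradients_Cauchy\<close>).

 Positivity is tested with \<open>\<zeta> (\<epsilon> / (u + \<epsilon>))\<^bsup>p-1\<^esup>\<close>, where \<open>\<zeta>\<close> is a power of \<open>1 + \<bar>x\<bar>\<^sup>2\<close>.  If the operator
 has a nonlocal part, \<open>\<epsilon> \<rightarrow> 0\<close> leaves the interaction between \<open>{u = 0}\<close> and \<open>{u > 0}\<close>, which has the wrong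
 sign (\<open>zero_set_dichotomy_nonlocal\<close>).  If it is local, this is the estimate of \<open>\<nabla> ln (u + \<epsilon>)\<close> in \<open>L\<^sup>p\<close>,
 incompatible with a jump of \<open>ln u\<close> to \<open>-\<infinity>\<close> (\<open>zero_set_dichotomy_local\<close>).  In both cases one of the two sets
 is null, and \<open>B u \<noteq> 0\<close> excludes that it is the second.
\<close>

section \<open>Notation\<close>

text \<open>A nonnegative integral without a measure is taken over Lebesgue measure; \<open>quot\<close> is the integrand of
 the Gagliardo energy.\<close>

abbreviation (input) nn_lborel :: "('a::euclidean_space \<Rightarrow> ennreal) \<Rightarrow> ennreal" (binder "\<integral>" 10) where
 "nn_lborel \<equiv> nn_integral lborel"
abbreviation (input) seq_lim :: "(nat \<Rightarrow> 'a::topological_space) \<Rightarrow> 'a \<Rightarrow> bool" (infix "---->" 60) where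
 "X ----> L \<equiv> X \<longlonglongrightarrow> L"
abbreviation (input) scale (infixr "*R" 75) where "c *R x \<equiv> scaleR c x"
abbreviation (input) "Borel \<equiv> borel_measurable borel"
abbreviation (input) "Lp p f \<equiv> nn_integral lborel (%x. ennreal (norm (f x) powr p))"
abbreviation (input) "FD f x \<equiv> frechet_derivative f (at x)"
abbreviation (input) "I01 \<equiv> indicator {0..1::real}"
abbreviation (input) "lborel2 \<equiv> lborel \<Otimes>\<^sub>M lborel"
abbreviation (input) "quot p u d x y \<equiv> \<bar>u x - u y\<bar> powr p * norm (x - y) powr (- d)"

section \<open>Powers of norms\<close>

lemma powr_add_le:
 fixes a b p :: real
 assumes "0 <= p" "0 <= a" "0 <= b"
 shows "(a + b) powr p <= 2 powr p * (a powr p + b powr p)"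
proof -
 have "(a + b) powr p <= (2 * max a b) powr p"
  using assms by (intro powr_mono2) auto
 also have "... = 2 powr p * max a b powr p"
  using assms by (simp add: powr_mult)
 also have "max a b powr p <= a powr p + b powr p"
  by (auto simp: max_def)
 finally show ?thesis by (simp add: mult_left_mono)
qed

lemma powr_diff_le:
 fixes x y p :: real
 assumes p: "1 <= p" and "0 <= x" "0 <= y"
 shows "\<bar>x powr p - y powr p\<bar> <= p * (max x y) powr (p - 1) * \<bar>x - y\<bar>"
proof -
 have *: "\<bar>x powr p - y powr p\<bar> <= p * y powr (p - 1) * (y - x)" if "0 <= x" "x < y" for x y :: real
 proof (cases "x = 0")
  case True
  have "y powr p = y powr (p - 1) * y"
   using that by (simp add: powr_diff)
  thus ?thesis using True that p
   using mult_right_mono[of 1 p "y powr (p - 1) * y"] by (simp add: mult_ac)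
 next
  case False
  hence x: "0 < x" using that by simp
  have "\<exists>z>x. z < y & y powr p - x powr p = (y - x) * (p * z powr (p - 1))"
   using x that by (intro MVT2) (auto intro!: derivative_eq_intros simp: powr_diff)
  then obtain z where z: "x < z" "z < y" "y powr p - x powr p = (y - x) * (p * z powr (p - 1))"
   by blast
  have "z powr (p - 1) <= y powr (p - 1)"
   using z x p by (intro powr_mono2) auto
  hence "(y - x) * (p * z powr (p - 1)) <= (y - x) * (p * y powr (p - 1))"
   using p that by (intro mult_left_mono) auto
  moreover have "0 <= (y - x) * (p * z powr (p - 1))" using p that by auto
  ultimately show ?thesis using z by (simp add: abs_if mult_ac)
 qed
 consider "x < y" | "x = y" | "y < x" by linarith
 thus ?thesis
  by cases (use *[of x y] *[of y x] assms in \<open>auto simp: max_def abs_minus_commute\<close>)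
qed

text \<open>The graph of \<open>t \<mapsto> t\<^sup>p\<close> lies strictly above its tangents; Jensen's inequality and the strict
 convexity of norms both come from this.\<close>

lemma powr_above_tangent:
 fixes x b p :: real
 assumes p: "1 < p" and "0 <= x" "0 < b" "x ~= b"
 shows "b powr p + p * b powr (p - 1) * (x - b) < x powr p"
proof (cases "x = 0")
 case True
 have "b powr p = b powr (p - 1) * b"
  using assms by (simp add: powr_diff)
 thus ?thesis using True assms by simp
next
 case False
 hence x: "0 < x" using assms by simp
 show ?thesis
 proof (cases "b < x")
  case True
  have "\<exists>z>b. z < x & x powr p - b powr p = (x - b) * (p * z powr (p - 1))"
   using assms True by (intro MVT2) (auto intro!: derivative_eq_intros simp: powr_diff)
  then obtain z where z: "b < z" "z < x" "x powr p - b powr p = (x - b) * (p * z powr (p - 1))"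
   by blast
  have "b powr (p - 1) < z powr (p - 1)"
   using z assms by (intro powr_less_mono2) auto
  hence "(x - b) * (p * b powr (p - 1)) < (x - b) * (p * z powr (p - 1))"
   using p True by (intro mult_strict_left_mono) auto
  thus ?thesis using z by (simp add: mult_ac)
 next
  case False
  hence xb: "x < b" using assms by simp
  have "\<exists>z>x. z < b & b powr p - x powr p = (b - x) * (p * z powr (p - 1))"
   using x xb by (intro MVT2) (auto intro!: derivative_eq_intros simp: powr_diff)
  then obtain z where z: "x < z" "z < b" "b powr p - x powr p = (b - x) * (p * z powr (p - 1))"
   by blast
  have "z powr (p - 1) < b powr (p - 1)"
   using z x assms by (intro powr_less_mono2) auto
  hence "(b - x) * (p * z powr (p - 1)) < (b - x) * (p * b powr (p - 1))"
   using p xb by (intro mult_strict_left_mono) auto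
  thus ?thesis using z by (simp add: algebra_simps)
 qed
qed

lemma jensen_powr:
 fixes f :: "'x => real"
 assumes p: "1 < p" and f: "integrable M f"
  and L: "emeasure M (space M) = ennreal L" "0 < L"
 shows "ennreal (\<bar>\<integral>x. f x \<partial>M\<bar> powr p) <= ennreal (L powr (p - 1)) * (\<integral>\<^sup>+x. ennreal (\<bar>f x\<bar> powr p) \<partial>M)"
proof (cases "(\<integral>\<^sup>+x. ennreal (\<bar>f x\<bar> powr p) \<partial>M) = \<infinity>")
 case True
 thus ?thesis using L by (simp add: ennreal_mult_top)
next
 case False
 interpret finite_measure M using L by (intro finite_measureI) auto
 have [measurable]: "f : borel_measurable M" using f by auto
 have fp: "integrable M (%x. \<bar>f x\<bar> powr p)"
  using False by (intro integrableI_bounded) (auto simp: top.not_eq_extremum)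
 have meas: "measure M (space M) = L" using L by (simp add: measure_def)
 define b where "b = \<bar>\<integral>x. f x \<partial>M\<bar> / L"
 have bL: "\<bar>\<integral>x. f x \<partial>M\<bar> = b * L" using L by (simp add: b_def)
 show ?thesis
 proof (cases "b = 0")
  case True
  thus ?thesis using bL by simp
 next
  case False
  hence b: "0 < b" using L by (simp add: b_def)
  have tan: "b powr p + p * b powr (p - 1) * (\<bar>f x\<bar> - b) <= \<bar>f x\<bar> powr p" for x
   using powr_above_tangent[OF p, of "\<bar>f x\<bar>" b] b by (cases "\<bar>f x\<bar> = b") auto
  have "b powr p * L <= b powr p * L + p * b powr (p - 1) * ((\<integral>x. \<bar>f x\<bar> \<partial>M) - b * L)"
   using integral_abs_bound[of M f] bL p by simp
  also have "... = (\<integral>x. b powr p + p * b powr (p - 1) * (\<bar>f x\<bar> - b) \<partial>M)"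
   using f by (simp add: meas mult_ac)
  also have "... <= (\<integral>x. \<bar>f x\<bar> powr p \<partial>M)"
   using f fp tan by (intro integral_mono) auto
  finally have *: "b powr p * L <= (\<integral>x. \<bar>f x\<bar> powr p \<partial>M)" .
  have "\<bar>\<integral>x. f x \<partial>M\<bar> powr p = L powr (p - 1) * (b powr p * L)"
   using L b unfolding bL by (simp add: powr_mult powr_diff)
  also have "... <= L powr (p - 1) * (\<integral>x. \<bar>f x\<bar> powr p \<partial>M)"
   using * L by (intro mult_left_mono) auto
  finally have "ennreal (\<bar>\<integral>x. f x \<partial>M\<bar> powr p) <= ennreal (L powr (p - 1) * (\<integral>x. \<bar>f x\<bar> powr p \<partial>M))"
   by (rule ennreal_leI)
  thus ?thesis using fp L by (simp add: nn_integral_eq_integral ennreal_mult)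
 qed
qed

lemma norm_powr_has_derivative:
 fixes a b :: "'b::euclidean_space"
 assumes p: "1 < p"
 shows "((%t. norm (a + t *R b) powr p) has_real_derivative p * (Phi p a \<bullet> b)) (at 0)"
proof (cases "a = 0")
 case True
 have "((%t::real. \<bar>t\<bar> powr (p - 1) * norm b powr p) \<longlongrightarrow> 0 * norm b powr p) (at 0)"
  by (intro tendsto_intros tendsto_zero_powrI[where b="p - 1"])
    (use p in \<open>auto intro!: tendsto_eq_intros\<close>)
 hence "((%t::real. norm ((norm (t *R b) powr p) / t)) \<longlongrightarrow> 0) (at 0)"
 proof (rule Lim_transform_eventually[OF tendsto_eq_rhs])
  show "\<forall>\<^sub>F t in at 0. \<bar>t\<bar> powr (p - 1) * norm b powr p = norm (norm (t *R b) powr p / t)"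
   by (rule eventually_at_filter[THEN iffD2], rule always_eventually)
     (auto simp: powr_mult powr_diff abs_mult)
 qed simp
 hence "((%t::real. norm (t *R b) powr p / t) \<longlongrightarrow> 0) (at 0)"
  by (rule tendsto_norm_zero_cancel)
 thus ?thesis
  unfolding has_field_derivative_iff using True p by (simp add: Phi_def)
next
 case False
 define h where "h t = (a + t *R b) \<bullet> (a + t *R b)" for t
 have h: "h t = a \<bullet> a + 2 * t * (a \<bullet> b) + t^2 * (b \<bullet> b)" for t
  by (simp add: h_def inner_add_left inner_add_right inner_commute power2_eq_square algebra_simps)
 have pos: "0 < h 0" using False by (simp add: h_def)
 have dh: "(h has_real_derivative 2 * (a \<bullet> b)) (at 0)"
  unfolding h by (auto intro!: derivative_eq_intros)
 have "((%t. h t powr (p / 2)) has_real_derivative (p / 2) * h 0 powr (p / 2 - 1) * (2 * (a \<bullet> b))) (at 0)"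
  using pos by (auto intro!: derivative_eq_intros dh simp: powr_diff)
 moreover have sq: "(x^2) powr r = x powr (2 * r)" if "0 <= x" for x r :: real
  using that by (metis powr_numeral powr_powr)
 have "h t powr (p / 2) = norm (a + t *R b) powr p" for t
  by (simp add: h_def sq flip: power2_norm_eq_inner)
 moreover have "h 0 powr (p / 2 - 1) = norm a powr (p - 2)"
  by (simp add: h_def sq right_diff_distrib flip: power2_norm_eq_inner)
 ultimately show ?thesis by (simp add: Phi_def mult_ac)
qed

lemma norm_Phi: "norm (Phi p a) = norm a powr (p - 1)"
 by (cases "a = 0") (simp_all add: Phi_def powr_diff powr_numeral power2_eq_square)

lemma Phi_scaleR: "0 <= c ==> Phi p (c *R a) = c powr (p - 1) *R Phi p a"
 by (cases "c = 0") (simp_all add: Phi_def powr_mult powr_diff powr_numeral power2_eq_square)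

lemma Phi_measurable [measurable]:
 "f : borel_measurable M ==> (%x. Phi p (f x :: 'b::euclidean_space)) : borel_measurable M"
 unfolding Phi_def by measurable

lemma norm_powr_diff_quot_le:
 fixes a b :: "'b::euclidean_space"
 assumes p: "1 < p" and t: "\<bar>t\<bar> <= 1" "t ~= 0"
 shows "\<bar>(norm (a + t *R b) powr p - norm a powr p) / t\<bar> <= p * 2 powr p * (norm a powr p + norm b powr p)"
proof -
 have le: "norm (a + t *R b) <= norm a + norm b"
  using norm_triangle_ineq[of a "t *R b"] t mult_right_mono[of "\<bar>t\<bar>" 1 "norm b"] by simp
 have "\<bar>norm (a + t *R b) powr p - norm a powr p\<bar>
   <= p * (max (norm (a + t *R b)) (norm a)) powr (p - 1) * \<bar>norm (a + t *R b) - norm a\<bar>"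
  using p by (intro powr_diff_le) auto
 also have "... <= p * (norm a + norm b) powr (p - 1) * (\<bar>t\<bar> * (norm a + norm b))"
 proof (intro mult_mono mult_left_mono powr_mono2)
  have "\<bar>norm (a + t *R b) - norm a\<bar> <= norm (t *R b)"
   using norm_triangle_ineq3[of "a + t *R b" a] by simp
  also have "... <= \<bar>t\<bar> * (norm a + norm b)" by (simp add: algebra_simps)
  finally show "\<bar>norm (a + t *R b) - norm a\<bar> <= \<bar>t\<bar> * (norm a + norm b)" .
 qed (use p le in \<open>auto intro: le_max_iff_disj[THEN iffD2]\<close>)
 also have "... = \<bar>t\<bar> * (p * (norm a + norm b) powr p)"
  using p by (cases "norm a + norm b = 0") (simp_all add: powr_diff add_nonneg_eq_0_iff)
 also have "... <= \<bar>t\<bar> * (p * (2 powr p * (norm a powr p + norm b powr p)))"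
  using p by (intro mult_left_mono powr_add_le) auto
 finally show ?thesis using t by (simp add: field_simps abs_mult)
qed

lemma Phi_inner_le:
 fixes a b :: "'b::euclidean_space"
 assumes p: "1 < p"
 shows "\<bar>Phi p a \<bullet> b\<bar> <= norm a powr p + norm b powr p"
proof -
 have "\<bar>Phi p a \<bullet> b\<bar> <= norm (Phi p a) * norm b" by (rule Cauchy_Schwarz_ineq2)
 also have "... = norm a powr (p - 1) * norm b" by (simp add: norm_Phi)
 also have "... <= max (norm a) (norm b) powr (p - 1) * max (norm a) (norm b)"
  using p by (intro mult_mono powr_mono2) auto
 also have "... = max (norm a) (norm b) powr p"
 proof -
  have "x powr (p - 1) * x = x powr p" if "0 <= x" for x :: real
   using that p by (cases "x = 0") (simp_all add: powr_diff)
  thus ?thesis by (simp add: max_def)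
 qed
 also have "... <= norm a powr p + norm b powr p" by (auto simp: max_def)
 finally show ?thesis .
qed

lemma integrable_norm_powr:
 fixes f :: "'x => 'b::euclidean_space"
 assumes [measurable]: "f : borel_measurable M" and "(\<integral>\<^sup>+x. ennreal (norm (f x) powr p) \<partial>M) < \<infinity>"
 shows "integrable M (%x. norm (f x) powr p)"
 using assms by (intro integrableI_bounded) auto

lemma integrable_Phi_inner:
 fixes f g :: "'x => 'b::euclidean_space"
 assumes p: "1 < p" and [measurable]: "f : borel_measurable M" "g : borel_measurable M"
  and f: "(\<integral>\<^sup>+x. ennreal (norm (f x) powr p) \<partial>M) < \<infinity>"
  and g: "(\<integral>\<^sup>+x. ennreal (norm (g x) powr p) \<partial>M) < \<infinity>"
 shows "integrable M (%x. Phi p (f x) \<bullet> g x)"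
proof (rule Bochner_Integration.integrable_bound)
 show "integrable M (%x. norm (f x) powr p + norm (g x) powr p)"
  using f g by (intro Bochner_Integration.integrable_add integrable_norm_powr) auto
qed (use Phi_inner_le[OF p] in auto)

text \<open>All four integrals of the variational problem are of the form \<open>\<integral>\<bar>T u\<bar>\<^sup>p\<close> with \<open>T\<close> linear, so this
 one computation yields their first variations.  The domination comes from
 \<open>norm_powr_diff_quot_le\<close>.\<close>

lemma has_derivative_integral_norm_powr:
 fixes f g :: "'x => 'b::euclidean_space"
 assumes p: "1 < p" and [measurable]: "f : borel_measurable M" "g : borel_measurable M"
  and f: "(\<integral>\<^sup>+x. ennreal (norm (f x) powr p) \<partial>M) < \<infinity>"
  and g: "(\<integral>\<^sup>+x. ennreal (norm (g x) powr p) \<partial>M) < \<infinity>"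
 shows "((%t. \<integral>x. norm (f x + t *R g x) powr p \<partial>M) has_real_derivative
      p * (\<integral>x. Phi p (f x) \<bullet> g x \<partial>M)) (at 0)"
proof -
 have fi: "integrable M (%x. norm (f x) powr p)" and gi: "integrable M (%x. norm (g x) powr p)"
  using f g by (auto intro: integrable_norm_powr)
 have int: "integrable M (%x. norm (f x + t *R g x) powr p)" for t
 proof (rule Bochner_Integration.integrable_bound)
  show "integrable M (%x. 2 powr p * (norm (f x) powr p + \<bar>t\<bar> powr p * norm (g x) powr p))"
   using fi gi by auto
  show "AE x in M. norm (norm (f x + t *R g x) powr p)
    <= norm (2 powr p * (norm (f x) powr p + \<bar>t\<bar> powr p * norm (g x) powr p))"
  proof (rule AE_I2)
   fix x
   have "norm (f x + t *R g x) powr p <= (norm (f x) + norm (t *R g x)) powr p"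
    using p by (intro powr_mono2 norm_triangle_ineq) auto
   also have "... <= 2 powr p * (norm (f x) powr p + norm (t *R g x) powr p)"
    using p by (intro powr_add_le) auto
   finally show "norm (norm (f x + t *R g x) powr p)
    <= norm (2 powr p * (norm (f x) powr p + \<bar>t\<bar> powr p * norm (g x) powr p))"
    by (simp add: powr_mult)
  qed
 qed simp
 show ?thesis
  unfolding has_field_derivative_iff tendsto_at_iff_sequentially
 proof (intro allI impI, unfold o_def)
  fix t :: "nat => real"
  assume t0: "\<forall>i. t i : UNIV - {0}" and "t ----> 0"
  then obtain n0 where n0: "!!n. n \<ge> n0 ==> \<bar>t n\<bar> < 1"
   using LIMSEQ_D[of t 0 1] by auto
  define \<tau> where "\<tau> n = t (n + n0)" for n
  have \<tau>: "\<tau> n ~= 0" "\<bar>\<tau> n\<bar> <= 1" for n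
   using t0 n0[of "n + n0"] by (auto simp: \<tau>_def)
  have \<tau>lim: "\<tau> ----> 0"
   unfolding \<tau>_def using \<open>t ----> 0\<close> by (rule LIMSEQ_ignore_initial_segment)
  have "(%n. \<integral>x. (norm (f x + \<tau> n *R g x) powr p - norm (f x) powr p) / \<tau> n \<partial>M)
    ----> (\<integral>x. p * (Phi p (f x) \<bullet> g x) \<partial>M)"
  proof (rule integral_dominated_convergence[where w="%x. p * 2 powr p * (norm (f x) powr p + norm (g x) powr p)"])
   show "AE x in M. (%n. (norm (f x + \<tau> n *R g x) powr p - norm (f x) powr p) / \<tau> n)
     ----> p * (Phi p (f x) \<bullet> g x)"
   proof (rule AE_I2)
    fix x
    have "((%s. (norm (f x + s *R g x) powr p - norm (f x) powr p) / s) \<longlongrightarrow> p * (Phi p (f x) \<bullet> g x)) (at 0)"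
     using norm_powr_has_derivative[OF p, of "f x" "g x"] by (simp add: has_field_derivative_iff)
    thus "(%n. (norm (f x + \<tau> n *R g x) powr p - norm (f x) powr p) / \<tau> n)
     ----> p * (Phi p (f x) \<bullet> g x)"
     using \<tau> \<tau>lim unfolding tendsto_at_iff_sequentially o_def by auto
   qed
   show "AE x in M. norm ((norm (f x + \<tau> n *R g x) powr p - norm (f x) powr p) / \<tau> n)
     <= p * 2 powr p * (norm (f x) powr p + norm (g x) powr p)" for n
    using norm_powr_diff_quot_le[OF p \<tau>(2) \<tau>(1)] by auto
  qed (use fi gi in auto)
  hence "(%n. ((\<integral>x. norm (f x + \<tau> n *R g x) powr p \<partial>M) - (\<integral>x. norm (f x + 0 *R g x) powr p \<partial>M)) / (\<tau> n - 0))
    ----> p * (\<integral>x. Phi p (f x) \<bullet> g x \<partial>M)"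
   using int fi by (simp add: Bochner_Integration.integral_diff)
  thus "(%n. ((\<integral>x. norm (f x + t n *R g x) powr p \<partial>M) - (\<integral>x. norm (f x + 0 *R g x) powr p \<partial>M)) / (t n - 0))
    ----> p * (\<integral>x. Phi p (f x) \<bullet> g x \<partial>M)"
   unfolding \<tau>_def by (rule LIMSEQ_offset)
 qed
qed

definition convexity_gap :: "real => 'b::real_normed_vector => 'b => real" where
 "convexity_gap p a b = (norm a powr p + norm b powr p) / 2 - norm ((1/2) *R (a + b)) powr p"

lemma midpoint_powr_le:
 fixes x y :: real
 assumes p: "1 < p" and "0 <= x" "0 <= y" "x ~= y"
 shows "((x + y) / 2) powr p < (x powr p + y powr p) / 2"
proof -
 define b where "b = (x + y) / 2"
 have b: "0 < b" "x ~= b" "y ~= b" "(x - b) + (y - b) = 0" using assms by (auto simp: b_def field_simps)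
 have "b powr p + p * b powr (p - 1) * (x - b) + (b powr p + p * b powr (p - 1) * (y - b)) < x powr p + y powr p"
  using powr_above_tangent[OF p, of x b] powr_above_tangent[OF p, of y b] b assms by simp
 moreover have "p * b powr (p - 1) * (x - b) + p * b powr (p - 1) * (y - b) = 0"
  using b(4) by (metis distrib_left mult_zero_right)
 ultimately show ?thesis by (simp add: b_def)
qed

lemma convexity_gap_pos:
 fixes a b :: "'b::euclidean_space"
 assumes p: "1 < p" and "a ~= b"
 shows "0 < convexity_gap p a b"
proof (cases "norm a = norm b")
 case True
 have "norm (a + b)^2 + norm (a - b)^2 = 2 * norm a ^2 + 2 * norm b^2"
  by (simp add: power2_norm_eq_inner inner_add_left inner_add_right inner_diff_left inner_diff_right inner_commute)
 moreover have "0 < norm (a - b)^2" using assms by simp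
 ultimately have "norm (a + b)^2 < (2 * norm a)^2" using True
  by (smt (verit) four_x_squared power_mult_distrib)
 hence "norm (a + b) < 2 * norm a" by (rule power_less_imp_less_base) simp
 hence "norm ((1/2) *R (a + b)) powr p < norm a powr p"
  using p by (intro powr_less_mono2) auto
 thus ?thesis using True by (simp add: convexity_gap_def)
next
 case False
 have "norm ((1/2) *R (a + b)) powr p <= ((norm a + norm b) / 2) powr p"
  using p norm_triangle_ineq[of a b] by (intro powr_mono2) auto
 also have "... < (norm a powr p + norm b powr p) / 2"
  using midpoint_powr_le[OF p _ _ False] by simp
 finally show ?thesis by (simp add: convexity_gap_def)
qed

lemma convexity_gap_nonneg:
 fixes a b :: "'b::euclidean_space"
 shows "1 < p ==> 0 <= convexity_gap p a b"
 using convexity_gap_pos[of p a b] by (cases "a = b") (auto simp: convexity_gap_def simp flip: scaleR_2)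

lemma convexity_gap_scaleR:
 "0 <= c ==> convexity_gap p (c *R a) (c *R b) = c powr p * convexity_gap p a b"
proof -
 assume c: "0 <= c"
 have "norm ((1/2) *R (c *R a + c *R b)) = c * norm ((1/2) *R (a + b))"
  using c by (simp flip: scaleR_add_right)
 thus ?thesis using c
  by (simp add: convexity_gap_def powr_mult algebra_simps add_divide_distrib)
qed

text \<open>Uniform convexity of \<open>L\<^sup>p\<close> in pointwise form.  Pairs with \<open>\<bar>a - b\<bar> \<ge> \<delta> max \<bar>a\<bar> \<bar>b\<bar>\<close> are, after
 scaling, in a compact set on which the gap has a positive minimum; the other pairs contribute
 at most \<open>\<delta>\<^sup>p (\<bar>a\<bar>\<^sup>p + \<bar>b\<bar>\<^sup>p)\<close>.  This covers \<open>p < 2\<close> and \<open>p \<ge> 2\<close> alike.\<close>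

lemma norm_diff_powr_le_gap:
 assumes p: "1 < p" and e: "0 < e"
 obtains c where "0 < c"
  "!!a b :: 'b::euclidean_space. norm (a - b) powr p
    <= e * (norm a powr p + norm b powr p) + c * convexity_gap p a b"
proof -
 define \<delta> where "\<delta> = e powr (1 / p)"
 have \<delta>: "0 < \<delta>" "\<delta> powr p = e" using e p by (auto simp: \<delta>_def powr_powr)
 define K where "K = {z::'b\<times>'b. max (norm (fst z)) (norm (snd z)) = 1 & \<delta> <= norm (fst z - snd z)}"
 have cont: "continuous_on K (%z. convexity_gap p (fst z) (snd z))"
  unfolding convexity_gap_def using p by (intro continuous_intros continuous_on_powr') auto
 have "compact K"
 proof (rule compact_eq_bounded_closed[THEN iffD2], intro conjI)
  show "bounded K"
  proof (rule boundedI[of _ 2])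
   fix z assume "z : K"
   hence "norm (fst z) <= 1" "norm (snd z) <= 1" by (auto simp: K_def max_def split: if_splits)
   thus "norm z <= 2" using norm_Pair_le[of "fst z" "snd z"] by simp
  qed
  have "K = {z. max (norm (fst z)) (norm (snd z)) = 1} \<inter> {z. \<delta> <= norm (fst z - snd z)}"
   by (auto simp: K_def)
  thus "closed K"
   by (auto intro!: closed_Int closed_Collect_eq closed_Collect_le continuous_intros)
 qed
 obtain m where m: "0 < m" "!!z. z : K ==> m <= convexity_gap p (fst z) (snd z)"
 proof (cases "K = {}")
  case True
  thus ?thesis using that[of 1] by auto
 next
  case False
  obtain z where z: "z : K" "!!y. y : K ==> convexity_gap p (fst z) (snd z) <= convexity_gap p (fst y) (snd y)"
   using continuous_attains_inf[OF \<open>compact K\<close> False cont] by auto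
  moreover have "fst z ~= snd z" using z(1) \<delta> by (auto simp: K_def)
  ultimately show ?thesis using that convexity_gap_pos[OF p] by blast
 qed
 show thesis
 proof (rule that[of "2 powr p / m"])
  show "0 < 2 powr p / m" using m by simp
  fix a b :: 'b
  define r where "r = max (norm a) (norm b)"
  have r0: "0 <= r" "norm a <= r" "norm b <= r" by (auto simp: r_def intro: le_max_iff_disj[THEN iffD2])
  have rp: "r powr p <= norm a powr p + norm b powr p" by (auto simp: r_def max_def)
  show "norm (a - b) powr p <= e * (norm a powr p + norm b powr p) + 2 powr p / m * convexity_gap p a b"
  proof (cases "norm (a - b) <= \<delta> * r")
   case True
   hence "norm (a - b) powr p <= (\<delta> * r) powr p" using p by (intro powr_mono2) auto
   also have "... = e * r powr p" using \<delta> r0 by (simp add: powr_mult)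
   also have "... <= e * (norm a powr p + norm b powr p)" using rp e by (intro mult_left_mono) auto
   finally show ?thesis using convexity_gap_nonneg[OF p, of a b] m
    by (smt (verit, best) divide_nonneg_pos mult_nonneg_nonneg powr_ge_zero)
  next
   case False
   hence r: "0 < r" using r0 by (cases "r = 0") auto
   define a' b' where "a' = (1/r) *R a" and "b' = (1/r) *R b"
   have ab: "a = r *R a'" "b = r *R b'" using r by (auto simp: a'_def b'_def)
   have "max (norm a') (norm b') = 1"
   proof -
    have "max (norm a') (norm b') = r / r" using r
     by (auto simp: a'_def b'_def r_def max_def divide_simps split: if_splits)
    thus ?thesis using r by simp
   qed
   moreover have "\<delta> <= norm (a' - b')"
   proof -
    have "norm (a - b) = r * norm (a' - b')" unfolding ab using r by (simp flip: scaleR_diff_right)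
    thus ?thesis using False r by (simp add: mult.commute)
   qed
   ultimately have "m <= convexity_gap p a' b'" using m(2)[of "(a', b')"] by (simp add: K_def)
   hence "r powr p * m <= convexity_gap p a b"
    using r unfolding ab by (simp add: convexity_gap_scaleR)
   moreover have "norm (a - b) powr p <= (2 * r) powr p"
    using norm_triangle_ineq4[of a b] r0 p by (intro powr_mono2) auto
   ultimately have "norm (a - b) powr p <= 2 powr p / m * convexity_gap p a b"
    using r m by (simp add: powr_mult field_simps mult_left_mono)
     (smt (verit, best) mult.commute mult.left_commute mult_left_mono powr_ge_zero)
   thus ?thesis using e by (smt (verit) mult_nonneg_nonneg powr_ge_zero)
  qed
 qed
qed

section \<open>Lebesgue measure in polar form\<close>

lemma nn_integral_lborel_shift:
 fixes h :: "'a::euclidean_space"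
 assumes [measurable]: "f : Borel"
 shows "(\<integral>x. f (x + h)) = (\<integral>x. f x)"
proof -
 have "(\<integral>x. f x) = (\<integral>\<^sup>+x. f x \<partial>(distr lborel borel ((+) h)))"
  by (simp only: lborel_distr_plus)
 also have "... = (\<integral>x. f (x + h))"
  by (subst nn_integral_distr) (auto simp: add.commute)
 finally show ?thesis by simp
qed

lemma AE_lborel_shift:
 fixes h :: "'a::euclidean_space"
 assumes "AE x in lborel. P x"
 shows "AE x in lborel. P (x + h)"
proof -
 obtain N where N: "{x. ~ P x} \<subseteq> N" "N : sets lborel" "emeasure lborel N = 0"
  using assms by (auto elim!: AE_E)
 have [measurable]: "N : sets borel" using N by simp
 have "AE x in lborel. x ~: N" using N by (intro AE_not_in) auto
 hence "(\<integral>x. indicator N x) = 0" using N by simp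
 hence "(\<integral>x. indicator N (x + h)) = 0"
  using nn_integral_lborel_shift[of "indicator N" h] by simp
 hence "AE x in lborel. indicator N (x + h) = (0::ennreal)"
  by (subst (asm) nn_integral_0_iff_AE) auto
 thus ?thesis by eventually_elim (use N(1) in \<open>auto split: split_indicator_asm\<close>)
qed

lemma nn_integral_lborel_scale:
 fixes f :: "'a::euclidean_space => ennreal"
 assumes c: "0 < c" and [measurable]: "f : Borel"
 shows "(\<integral>x. f x) = ennreal (c ^ DIM('a)) * (\<integral>x. f (c *R x))"
proof -
 have "(\<integral>x. f x) = (\<integral>\<^sup>+x. f x \<partial>(density (distr lborel borel (%x. 0 + c *R x)) (%_. \<bar>c\<bar>^DIM('a))))"
  using lborel_affine[of c "0::'a"] c by simp
 also have "... = (\<integral>x. ennreal (c ^ DIM('a)) * f (c *R x))"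
  using c by (subst nn_integral_density) (auto simp: nn_integral_distr)
 finally show ?thesis by (simp add: nn_integral_cmult)
qed

lemma AE_lborel_scale:
 fixes P :: "'a::euclidean_space => bool"
 assumes c: "0 < c" and "AE x in lborel. P x"
 shows "AE x in lborel. P (c *R x)"
proof -
 obtain N where N: "{x. ~ P x} \<subseteq> N" "N : sets lborel" "emeasure lborel N = 0"
  using assms(2) by (auto elim!: AE_E)
 have [measurable]: "N : sets borel" using N by simp
 have "(\<integral>x. indicator N x) = 0" using N by simp
 hence "(\<integral>x::'a. indicator N (c *R x)) = 0"
  using nn_integral_lborel_scale[OF c, of "indicator N"] c by simp
 hence "AE x in (lborel :: 'a measure). indicator N (c *R x) = (0::ennreal)"
  by (subst (asm) nn_integral_0_iff_AE) auto
 thus ?thesis by eventually_elim (use N(1) in \<open>auto split: split_indicator_asm\<close>)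
qed

lemma emeasure_cone_cball:
 fixes C :: "'a::euclidean_space set"
 assumes C: "cone C" and [measurable]: "C : sets borel" and r: "0 <= r"
 shows "emeasure lborel (C \<inter> cball 0 r) = ennreal (r ^ DIM('a) * measure lborel (C \<inter> cball 0 1))"
proof (cases "r = 0")
 case True
 have "emeasure lborel (C \<inter> cball 0 0) <= emeasure lborel {0::'a}"
  by (intro emeasure_mono) auto
 thus ?thesis using True by simp
next
 case False
 hence r: "0 < r" using r by simp
 have fin: "emeasure lborel (C \<inter> cball 0 1) ~= \<infinity>"
  using emeasure_mono[of "C \<inter> cball 0 1" "cball 0 1" lborel] emeasure_lborel_cball_finite[of "0::'a" 1]
  by (auto simp: top_unique)
 have iff: "r *R x : C \<inter> cball 0 r \<longleftrightarrow> x : C \<inter> cball 0 1" for x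
 proof -
  have "x : C" if "r *R x : C"
   using C r that by (metis cone_def inverse_nonnegative_iff_nonnegative less_imp_le real_vector.scale_scale
     left_inverse less_irrefl real_vector.scale_one)
  moreover have "r *R x : C" if "x : C" using C r that by (auto simp: cone_def)
  ultimately show ?thesis using r by auto
 qed
 have "emeasure lborel (C \<inter> cball 0 r) = (\<integral>x. indicator (C \<inter> cball 0 r) x)" by simp
 also have "... = ennreal (r ^ DIM('a)) * (\<integral>x. indicator (C \<inter> cball 0 r) (r *R x))"
  by (intro nn_integral_lborel_scale[OF r] borel_measurable_indicator sets.Int) auto
 also have "(\<integral>x. indicator (C \<inter> cball 0 r) (r *R x)) = (\<integral>x. indicator (C \<inter> cball 0 1) x)"
  by (intro nn_integral_cong) (simp add: indicator_def iff del: mem_cball Int_iff)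
 also have "... = ennreal (measure lborel (C \<inter> cball 0 1))"
  using fin by (simp add: emeasure_eq_ennreal_measure)
 finally show ?thesis using r by (simp add: ennreal_mult)
qed

text \<open>Polar coordinates for functions of \<open>\<bar>x\<bar>\<close>, over a cone instead of the whole space.  The
 volumes of the truncated cones follow from scaling; the opening of the cone
 enters only through the volume of its unit part.\<close>

lemma nn_integral_cone:
 fixes C :: "'a::euclidean_space set"
 assumes C: "cone C" and [measurable]: "C : sets borel" "h : Borel"
 shows "(\<integral>x. h (norm x) * indicator C x) =
  (\<integral>t. h t * ennreal (measure lborel (C \<inter> cball 0 1) * DIM('a) * t ^ (DIM('a) - 1)) * indicator {0..} t)"
proof -
 define \<kappa> where "\<kappa> = measure lborel (C \<inter> cball 0 1)"
 define \<mu> where "\<mu> = distr (density lborel (indicator C)) borel (norm :: 'a => real)"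
 define \<nu> where "\<nu> = density lborel (%t::real. ennreal (\<kappa> * DIM('a) * t ^ (DIM('a) - 1)) * indicator {0..} t)"
 have \<kappa>: "0 <= \<kappa>" by (simp add: \<kappa>_def)
 have \<mu>: "emeasure \<mu> {..a} = ennreal (\<kappa> * (max a 0) ^ DIM('a))" for a
 proof -
  have [measurable]: "norm -` {..a} : sets (borel :: 'a measure)"
   using measurable_sets[of norm "borel :: 'a measure" borel "{..a}"] by simp
  have "emeasure \<mu> {..a} = (\<integral>x::'a. indicator C x * indicator (norm -` {..a}) x)"
   unfolding \<mu>_def by (subst emeasure_distr) (auto simp: emeasure_density)
  also have "... = (\<integral>x::'a. indicator (C \<inter> norm -` {..a}) x)"
   by (simp add: indicator_inter_arith)
  also have "... = ennreal (\<kappa> * (max a 0) ^ DIM('a))"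
  proof (cases "0 <= a")
   case True
   have "C \<inter> norm -` {..a} = C \<inter> cball 0 a" by auto
   thus ?thesis using emeasure_cone_cball[OF C _ True] True
    by (simp add: \<kappa>_def mult.commute)
  next
   case False
   hence "norm -` {..a} = ({} :: 'a set)" by (auto dest: order_trans[OF norm_ge_zero])
   thus ?thesis using False by (simp add: max_def zero_power)
  qed
  finally show ?thesis .
 qed
 have \<nu>: "emeasure \<nu> {..a} = ennreal (\<kappa> * (max a 0) ^ DIM('a))" for a
 proof -
  have "emeasure \<nu> {..a} = (\<integral>t. ennreal (\<kappa> * DIM('a) * t ^ (DIM('a) - 1)) * indicator {0..a} t)"
   unfolding \<nu>_def by (subst emeasure_density) (auto intro!: nn_integral_cong split: split_indicator)
  also have "... = ennreal (\<kappa> * (max a 0) ^ DIM('a))"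
  proof (cases "0 <= a")
   case True
   have "(\<integral>t. ennreal (\<kappa> * DIM('a) * t ^ (DIM('a) - 1)) * indicator {0..a} t)
     = ennreal (\<kappa> * a ^ DIM('a) - \<kappa> * 0 ^ DIM('a))"
    using True \<kappa> by (intro nn_integral_FTC_Icc) (auto intro!: derivative_eq_intros)
   thus ?thesis using True by (simp add: zero_power)
  qed (simp add: zero_power)
  finally show ?thesis .
 qed
 have "\<mu> = \<nu>"
 proof (rule measure_eqI_generator_eq[where \<Omega>=UNIV and E="range (%a::real. {..a})" and A="%n::nat. {..real n}"])
  show "Int_stable (range (%a::real. {..a}))"
   by (auto simp: Int_stable_def intro!: image_eqI[where x="min _ _"])
  show "(\<Union>i::nat. {..real i}) = UNIV" by (auto intro: real_arch_simple)
  show "sets \<mu> = sigma_sets UNIV (range (%a::real. {..a}))"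
     "sets \<nu> = sigma_sets UNIV (range (%a::real. {..a}))"
   by (simp_all add: \<mu>_def \<nu>_def) (simp_all add: borel_eq_atMost)
 qed (use \<mu> \<nu> in auto)
 have "(\<integral>x. h (norm x) * indicator C x) = (\<integral>\<^sup>+t. h t \<partial>\<mu>)"
  unfolding \<mu>_def by (subst nn_integral_distr) (auto simp: nn_integral_density mult.commute)
 also have "... = (\<integral>\<^sup>+t. h t \<partial>\<nu>)" using \<open>\<mu> = \<nu>\<close> by simp
 also have "... = (\<integral>t. h t * ennreal (\<kappa> * DIM('a) * t ^ (DIM('a) - 1)) * indicator {0..} t)"
  unfolding \<nu>_def by (subst nn_integral_density) (auto simp: mult_ac)
 finally show ?thesis by (simp add: \<kappa>_def)
qed

abbreviation ball_volume :: "'a::euclidean_space itself => real" where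
 "ball_volume _ \<equiv> measure lborel (cball (0::'a) 1)"

lemma nn_integral_radial:
 assumes [measurable]: "h : Borel"
 shows "(\<integral>\<^sup>+x. h (norm x) \<partial>(lborel :: 'a::euclidean_space measure)) =
  (\<integral>t. h t * ennreal (ball_volume TYPE('a) * DIM('a) * t ^ (DIM('a) - 1)) * indicator {0..} t)"
 using nn_integral_cone[of "UNIV :: 'a set" h] by (simp add: cone_univ)

lemma ball_volume_pos: "0 < ball_volume TYPE('a::euclidean_space)"
 using content_ball_pos[of 1 "0::'a"] content_cball_pos[of 1 "0::'a"] by (simp add: measure_def)

lemma AE_norm:
 assumes "AE r in lborel. 0 < r --> P r"
 shows "AE x in (lborel :: 'a::euclidean_space measure). P (norm x)"
proof -
 obtain N where N: "{r. ~ (0 < r --> P r)} \<subseteq> N" "N : sets lborel" "emeasure lborel N = 0"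
  using assms by (auto elim!: AE_E)
 have [measurable]: "N : sets borel" using N by simp
 have "AE t in lborel. t ~: N" using N by (intro AE_not_in) auto
 hence "(\<integral>x::'a. indicator N (norm x)) = 0"
  by (subst nn_integral_radial) (auto simp: nn_integral_0_iff_AE)
 hence "AE x in (lborel :: 'a measure). indicator N (norm x) = (0::ennreal)"
  by (subst (asm) nn_integral_0_iff_AE) auto
 moreover have "AE x in (lborel :: 'a measure). x ~= 0" by (rule AE_lborel_singleton)
 ultimately show ?thesis
 proof eventually_elim
  case (elim x)
  hence "norm x ~: N" "0 < norm x" by (auto split: split_indicator_asm)
  thus ?case using N(1) by blast
 qed
qed

lemma nn_integral_powr_cball:
 fixes b \<rho> :: real
 assumes b: "0 < b" and \<rho>: "0 <= \<rho>"
 shows "(\<integral>\<^sup>+x. ennreal (norm x powr (b - DIM('a))) * indicator (cball 0 \<rho>) x \<partial>(lborel :: 'a::euclidean_space measure))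
  = ennreal (ball_volume TYPE('a) * DIM('a) / b * \<rho> powr b)"
proof -
 let ?c = "ball_volume TYPE('a) * DIM('a)"
 have "(\<integral>x::'a. ennreal (norm x powr (b - DIM('a))) * indicator (cball 0 \<rho>) x)
  = (\<integral>x::'a. ennreal (norm x powr (b - DIM('a))) * indicator {..\<rho>} (norm x))"
  by (intro nn_integral_cong) (auto split: split_indicator)
 also have "... = (\<integral>t. (ennreal (t powr (b - DIM('a))) * indicator {..\<rho>} t) * ennreal (?c * t ^ (DIM('a) - 1)) * indicator {0..} t)"
  by (subst nn_integral_radial) auto
 also have "... = (\<integral>t. ennreal ?c * (ennreal (t powr (b - 1)) * indicator {0..\<rho>} t))"
 proof (intro nn_integral_cong_AE)
  have "AE t in lborel. t ~= (0::real)" by (rule AE_lborel_singleton)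
  thus "AE t in lborel. ennreal (t powr (b - DIM('a))) * indicator {..\<rho>} t * ennreal (?c * t ^ (DIM('a) - 1)) * indicator {0..} t
   = ennreal ?c * (ennreal (t powr (b - 1)) * indicator {0..\<rho>} t)"
  proof eventually_elim
   case (elim t)
   show ?case
   proof (cases "0 < t")
    case True
    have "t ^ (DIM('a) - 1) = t powr (DIM('a) - 1)"
     using True DIM_positive[where 'a='a] by (simp add: powr_realpow of_nat_diff flip: powr_realpow)
    hence "t powr (b - DIM('a)) * t ^ (DIM('a) - 1) = t powr (b - 1)"
     by (simp add: powr_add[symmetric])
    hence "t powr (b - DIM('a)) * (?c * t ^ (DIM('a) - 1)) = ?c * t powr (b - 1)"
     by (metis mult.left_commute)
    thus ?thesis using True
     by (auto simp: ennreal_mult[symmetric] split: split_indicator)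
   qed (use elim in \<open>auto split: split_indicator\<close>)
  qed
 qed
 also have "... = ennreal ?c * (\<integral>t. ennreal (t powr (b - 1)) * indicator {0..\<rho>} t)"
  by (subst nn_integral_cmult) auto
 also have "(\<integral>t. ennreal (t powr (b - 1)) * indicator {0..\<rho>} t) = ennreal (\<rho> powr b / b)"
  using nn_integral_has_integral_lebesgue'[of "{0..\<rho>}" "%t. t powr (b - 1)"]
   has_integral_powr_from_0[of "b - 1" \<rho>] b \<rho>
  by (simp add: nn_integral_completion)
 finally show ?thesis using b by (simp add: ennreal_mult[symmetric] mult.assoc)
qed

lemma nn_integral_powr_outside:
 fixes b \<rho> :: real
 assumes b: "0 < b" and \<rho>: "0 < \<rho>"
 shows "(\<integral>\<^sup>+x. ennreal (norm x powr (- b - DIM('a))) * indicator {x. \<rho> <= norm x} x \<partial>(lborel :: 'a::euclidean_space measure))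
  = ennreal (ball_volume TYPE('a) * DIM('a) / b * \<rho> powr (- b))"
proof -
 let ?c = "ball_volume TYPE('a) * DIM('a)"
 have "(\<integral>x::'a. ennreal (norm x powr (- b - DIM('a))) * indicator {x. \<rho> <= norm x} x)
  = (\<integral>x::'a. ennreal (norm x powr (- b - DIM('a))) * indicator {\<rho>..} (norm x))"
  by (intro nn_integral_cong) (auto split: split_indicator)
 also have "... = (\<integral>t. (ennreal (t powr (- b - DIM('a))) * indicator {\<rho>..} t) * ennreal (?c * t ^ (DIM('a) - 1)) * indicator {0..} t)"
  by (subst nn_integral_radial) auto
 also have "... = (\<integral>t. ennreal ?c * (ennreal (t powr (- b - 1)) * indicator {\<rho>..} t))"
 proof (intro nn_integral_cong)
  fix t :: real
  show "ennreal (t powr (- b - DIM('a))) * indicator {\<rho>..} t * ennreal (?c * t ^ (DIM('a) - 1)) * indicator {0..} t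
   = ennreal ?c * (ennreal (t powr (- b - 1)) * indicator {\<rho>..} t)"
  proof (cases "\<rho> <= t")
   case True
   have "t ^ (DIM('a) - 1) = t powr (DIM('a) - 1)"
    using True \<rho> DIM_positive[where 'a='a] by (simp add: powr_realpow of_nat_diff flip: powr_realpow)
   hence "t powr (- b - DIM('a)) * t ^ (DIM('a) - 1) = t powr (- b - 1)"
    by (simp add: powr_add[symmetric])
   hence "t powr (- b - DIM('a)) * (?c * t ^ (DIM('a) - 1)) = ?c * t powr (- b - 1)"
    by (metis mult.left_commute)
   thus ?thesis using True \<rho>
    by (auto simp: ennreal_mult[symmetric] split: split_indicator)
  qed simp
 qed
 also have "... = ennreal ?c * (\<integral>t. ennreal (t powr (- b - 1)) * indicator {\<rho>..} t)"
  by (subst nn_integral_cmult) auto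
 also have "(\<integral>t. ennreal (t powr (- b - 1)) * indicator {\<rho>..} t) = ennreal (\<rho> powr (- b) / b)"
  using nn_integral_has_integral_lebesgue'[of "{\<rho>..}" "%t. t powr (- b - 1)"]
   has_integral_powr_to_inf[of "- b - 1" \<rho>] b \<rho>
  by (simp add: nn_integral_completion)
 finally show ?thesis using b by (simp add: ennreal_mult[symmetric] mult.assoc)
qed

subsection \<open>Thin cones\<close>

definition cone_around :: "'a::euclidean_space => real => 'a set" where
 "cone_around e \<theta> = {y. norm (y - norm y *R e) <= \<theta> * norm y}"

lemma cone_cone_around: "cone (cone_around e \<theta>)"
 unfolding cone_def cone_around_def
proof (intro ballI allI impI)
 fix y c assume y: "y : {y. norm (y - norm y *R e) <= \<theta> * norm y}" and c: "(0::real) <= c"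
 have "c *R y - norm (c *R y) *R e = c *R (y - norm y *R e)"
  using c by (simp add: algebra_simps)
 hence "norm (c *R y - norm (c *R y) *R e) = c * norm (y - norm y *R e)"
  using c by (simp only: norm_scaleR abs_of_nonneg)
 also have "... <= c * (\<theta> * norm y)" using c y by (intro mult_left_mono) auto
 finally show "c *R y : {y. norm (y - norm y *R e) <= \<theta> * norm y}"
  using c by (simp add: mult_ac)
qed

lemma cone_around_measurable [measurable]: "cone_around e \<theta> : sets borel"
 unfolding cone_around_def by (intro borel_closed closed_Collect_le continuous_intros)

text \<open>A cone of opening \<open>\<theta>\<close> contains about \<open>1/\<theta>\<close> disjoint balls of radius comparable to \<open>\<theta>\<close>, lined up
 along its axis.  The resulting bound \<open>\<theta>\<^bsup>N-1\<^esup>\<close> is the area of a spherical cap.\<close>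

lemma measure_cone_around_ge:
 fixes e :: "'a::euclidean_space"
 assumes e: "norm e = 1" and \<theta>: "0 < \<theta>" "\<theta> <= 1"
 shows "ball_volume TYPE('a) / (2 * 6 ^ DIM('a)) * \<theta> ^ (DIM('a) - 1)
      <= measure lborel (cone_around e \<theta> \<inter> cball 0 1)"
proof -
 define n where "n = nat \<lfloor>1 / \<theta>\<rfloor>"
 have n1: "1 / \<theta> - 1 < real n" "real n <= 1 / \<theta>"
  using \<theta> by (auto simp: n_def)
 have n\<theta>: "real n * \<theta> <= 1" using n1(2) \<theta> by (simp add: field_simps)
 have n2: "1 / (2 * \<theta>) <= real n"
 proof (cases "\<theta> <= 1/2")
  case True
  have "1 / (2 * \<theta>) = 1 / \<theta> - 1 / (2 * \<theta>)" using \<theta> by (simp add: field_simps)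
  moreover have "1 <= 1 / (2 * \<theta>)" using True \<theta> by (simp add: field_simps)
  ultimately show ?thesis using n1(1) by linarith
 next
  case False
  have "1 <= 1 / \<theta>" using \<theta> by simp
  hence "1 <= \<lfloor>1 / \<theta>\<rfloor>" by (simp only: le_floor_iff of_int_1)
  hence "1 <= n" using nat_mono[of 1 "\<lfloor>1 / \<theta>\<rfloor>"] by (simp add: n_def)
  moreover have "1 / (2 * \<theta>) <= 1" using False \<theta> by (simp add: field_simps)
  ultimately show ?thesis by linarith
 qed
 define t where "t j = 1/2 + real j * \<theta> / 3" for j :: nat
 define B where "B j = ball (t j *R e) (\<theta> / 6)" for j
 have sub: "B j \<subseteq> cone_around e \<theta> \<inter> cball 0 1" if j: "j < n" for j
 proof
  fix y assume "y : B j"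
  hence d: "norm (y - t j *R e) < \<theta> / 6" by (simp add: B_def dist_norm norm_minus_commute)
  have t: "1/2 <= t j" using \<theta> by (simp add: t_def)
  have "(real j + 1) * \<theta> <= real n * \<theta>" using j \<theta> by (intro mult_right_mono) auto
  hence t1: "t j <= 1/2 + (1 - \<theta>) / 3" using n\<theta> by (simp add: t_def field_simps)
  have nt: "norm (t j *R e) = t j" using t e by simp
  have ny: "\<bar>norm y - t j\<bar> < \<theta> / 6"
   using norm_triangle_ineq3[of y "t j *R e"] d nt by linarith
  have "norm y - t j < \<theta> / 6" using ny by (simp only: abs_less_iff)
  hence "norm y <= 1" using t1 \<theta> by (simp add: field_simps)
  moreover have "norm (y - norm y *R e) <= \<theta> * norm y"
  proof -
   have "norm (y - norm y *R e) <= norm (y - t j *R e) + norm ((t j - norm y) *R e)"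
    using norm_triangle_ineq[of "y - t j *R e" "(t j - norm y) *R e"] by (simp add: algebra_simps)
   also have "norm ((t j - norm y) *R e) = \<bar>norm y - t j\<bar>" using e by simp
   finally have "norm (y - norm y *R e) <= \<theta> / 3" using d ny by linarith
   moreover have "1 / 3 <= norm y" using ny t \<theta> by linarith
   hence "\<theta> * (1/3) <= \<theta> * norm y" using \<theta> by (intro mult_left_mono) auto
   ultimately show ?thesis by linarith
  qed
  ultimately show "y : cone_around e \<theta> \<inter> cball 0 1" by (simp add: cone_around_def)
 qed
 have disj: "disjoint_family_on B {..<n}"
 proof (unfold disjoint_family_on_def, intro ballI impI)
  fix i j assume "i : {..<n}" "j : {..<n}" "i ~= j"
  have "\<theta> / 3 <= \<bar>t i - t j\<bar>"
  proof -
   have "1 <= \<bar>real i - real j\<bar>" using \<open>i ~= j\<close> by linarith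
   hence "1 * (\<theta> / 3) <= \<bar>real i - real j\<bar> * (\<theta> / 3)" using \<theta> by (intro mult_right_mono) auto
   also have "... = \<bar>(real i - real j) * (\<theta> / 3)\<bar>" using \<theta> by (simp add: abs_mult)
   also have "(real i - real j) * (\<theta> / 3) = t i - t j" by (simp add: t_def field_simps)
   finally show ?thesis by simp
  qed
  also have "... = dist (t i *R e) (t j *R e)"
   using e by (simp add: dist_norm flip: scaleR_diff_left)
  finally have "\<theta> / 6 + \<theta> / 6 <= dist (t i *R e) (t j *R e)" by simp
  thus "B i \<inter> B j = {}" unfolding B_def by (rule disjoint_ballI)
 qed
 have fin: "emeasure lborel (cone_around e \<theta> \<inter> cball 0 1) ~= \<infinity>"
  using emeasure_mono[of "cone_around e \<theta> \<inter> cball 0 1" "cball 0 1" lborel] emeasure_lborel_cball_finite[of "0::'a" 1]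
  by (auto simp: top_unique)
 have volB: "measure lborel (B j) = ball_volume TYPE('a) * (\<theta> / 6) ^ DIM('a)" for j
  using \<theta> content_ball[of "\<theta>/6" "t j *R e"] content_cball[of 1 "0::'a"]
  by (simp add: B_def)
 have "real n * (ball_volume TYPE('a) * (\<theta> / 6) ^ DIM('a)) = (\<Sum>j<n. measure lborel (B j))"
  by (simp add: volB)
 also have "... = measure lborel (\<Union>j<n. B j)"
 proof (intro measure_finite_Union[symmetric] disj)
  show "emeasure lborel (B j) ~= \<infinity>" for j
   unfolding B_def using emeasure_lborel_ball_finite[of "t j *R e" "\<theta> / 6"] by (simp add: less_top)
 qed (auto simp: B_def)
 also have "... <= measure lborel (cone_around e \<theta> \<inter> cball 0 1)"
  using sub fin by (intro measure_mono_fmeasurable) (auto simp: fmeasurable_def less_top B_def)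
 finally have *: "real n * (ball_volume TYPE('a) * (\<theta> / 6) ^ DIM('a)) <= measure lborel (cone_around e \<theta> \<inter> cball 0 1)" .
 have "ball_volume TYPE('a) / (2 * 6 ^ DIM('a)) * \<theta> ^ (DIM('a) - 1)
  = 1 / (2 * \<theta>) * (ball_volume TYPE('a) * (\<theta> / 6) ^ DIM('a))"
  using \<theta> DIM_positive[where 'a='a] by (simp add: power_divide power_diff)
 also have "... <= real n * (ball_volume TYPE('a) * (\<theta> / 6) ^ DIM('a))"
  using n2 \<theta> by (intro mult_right_mono) auto
 finally show ?thesis using * by linarith
qed

text \<open>By Fubini some ray through the origin meets the exceptional null set in a null set, and \<open>u\<close> along
 that ray is a Borel profile.\<close>

lemma radial_Borel_profile:
 fixes u :: "'a::euclidean_space => real"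
 assumes [measurable]: "u : Borel" and "radial u"
 obtains g where "g : Borel" "AE x in lborel. u x = g (norm x)"
proof -
 obtain g0 where g0: "AE x in lborel. u x = g0 (norm x)" using assms by (auto simp: radial_def)
 then obtain N where N: "{x. u x ~= g0 (norm x)} \<subseteq> N" "N : sets lborel" "emeasure lborel N = 0"
  by (auto elim!: AE_E)
 have [measurable]: "N : sets borel" using N by simp
 have "AE x in lborel. x ~: N" using N by (intro AE_not_in) auto
 hence ray: "AE x in lborel. t *R x ~: N" if "0 < t" for t
  by (rule AE_lborel_scale[OF that, of "%x. x ~: N"])
 have "AE t in lborel. AE x::'a in lborel. 0 < t --> t *R x ~: N"
 proof (rule AE_I2)
  fix t :: real
  show "AE x::'a in lborel. 0 < t --> t *R x ~: N"
   using ray[of t] by (cases "0 < t") auto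
 qed
 moreover have "(AE t in lborel. AE x::'a in lborel. 0 < t --> t *R x ~: N) \<longleftrightarrow>
    (AE x::'a in lborel. AE t in lborel. 0 < t --> t *R x ~: N)"
  by (rule pair_sigma_finite.AE_commute[OF pair_sigma_finite.intro[OF sigma_finite_lborel sigma_finite_lborel]]) measurable
 ultimately have "AE x::'a in lborel. AE t in lborel. 0 < t --> t *R x ~: N" by simp
 moreover have "AE x::'a in lborel. x ~= 0" by (rule AE_lborel_singleton)
 ultimately have "AE x::'a in lborel. x ~= 0 & (AE t in lborel. 0 < t --> t *R x ~: N)" by auto
 moreover have "ae_filter (lborel::'a measure) ~= bot" by (simp add: ae_filter_eq_bot_iff)
 ultimately have "\<exists>x::'a. x ~= 0 & (AE t in lborel. 0 < t --> t *R x ~: N)"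
  by (rule eventually_happens'[rotated])
 then obtain x0 where x0: "x0 ~= 0" "AE t in lborel. 0 < t --> t *R x0 ~: N" by blast
 define \<rho> where "\<rho> = norm x0"
 have \<rho>: "0 < \<rho>" using x0 by (simp add: \<rho>_def)
 define g where "g r = u ((r / \<rho>) *R x0)" for r
 have [measurable]: "g : Borel" unfolding g_def by measurable
 have "AE r in lborel. 0 < (1/\<rho>) *R r --> ((1/\<rho>) *R r) *R x0 ~: N"
  using AE_lborel_scale[OF _ x0(2), of "1/\<rho>"] \<rho> by simp
 hence "AE r in lborel. 0 < r --> g r = g0 r"
 proof eventually_elim
  case (elim r)
  show ?case
  proof
   assume r: "0 < r"
   hence "(r / \<rho>) *R x0 ~: N" using elim \<rho> by auto
   hence "u ((r / \<rho>) *R x0) = g0 (norm ((r / \<rho>) *R x0))" using N(1) by blast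
   moreover have "norm ((r / \<rho>) *R x0) = r" using r \<rho> by (simp add: \<rho>_def)
   ultimately show "g r = g0 r" by (simp add: g_def)
  qed
 qed
 hence "AE x in (lborel :: 'a measure). g (norm x) = g0 (norm x)" by (rule AE_norm)
 with g0 have "AE x in lborel. u x = g (norm x)" by eventually_elim simp
 thus thesis by (intro that[of g]) measurable
qed

section \<open>Radial functions of finite fractional energy\<close>

definition kernel_const :: "'a::euclidean_space itself => real => real" where
 "kernel_const T k = ball_volume T / (2 * 6 ^ DIM('a)) * DIM('a) * 3 powr (- (real DIM('a) + k)) / 2 ^ (DIM('a) - 1)"

lemma kernel_const_pos: "0 < kernel_const TYPE('a::euclidean_space) k"
 using ball_volume_pos[where 'a='a] DIM_positive[where 'a='a] by (simp add: kernel_const_def)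

lemma dyadic_scale:
 fixes z :: real
 assumes "0 < z" "z < 1"
 obtains m where "1 / 2 ^ Suc m <= z" "z < 1 / 2 ^ m"
proof -
 obtain n0 where "(1/2) ^ n0 < z" using real_arch_pow_inv[of z "1/2"] assms by auto
 hence ex: "\<exists>n. (1/2) ^ n <= z" by (intro exI[of _ n0]) simp
 define n where "n = (LEAST n. (1/2) ^ n <= z)"
 have n: "(1/2) ^ n <= z" unfolding n_def by (rule LeastI_ex[OF ex])
 hence "n ~= 0" using assms by (intro notI) simp
 then obtain m where m: "n = Suc m" by (cases n) auto
 have "~ (1/2) ^ m <= z" using not_less_Least[of m "%n. (1/2) ^ n <= z"] m unfolding n_def by simp
 thus thesis using that[of m] n m by (simp add: power_divide)
qed

text \<open>Restrict the integration over \<open>y\<close> to a cone around \<open>x\<close> of opening \<open>||y| - |x|| / |x|\<close>, up to dyadic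
 rounding.  There \<open>|x - y| \<le> 3 (|y| - |x|)\<close>, and the area of the spherical cap cancels all but one
 of the \<open>N\<close> dimensions in the kernel.  This is the reduction of the radial Gagliardo seminorm
 to the one-dimensional one.\<close>

lemma kernel_lower_bound:
 fixes x :: "'a::euclidean_space" and k l :: real
 assumes k: "0 < k" and x: "x ~= 0" and l: "0 < l" and [measurable]: "F : Borel"
 shows "ennreal (kernel_const TYPE('a) k) *
   (\<integral>t. F t * ennreal ((t - norm x) powr (- (1 + k))) * indicator {norm x<..<min (2 * norm x) (norm x + l)} t)
  <= (\<integral>y. F (norm y) * ennreal (norm (x - y) powr (- (real DIM('a) + k))) * indicator (cball x (3 * l)) y)"
proof -
 define r where "r = norm x"
 define e where "e = (1 / r) *R x"
 define c where "c = kernel_const TYPE('a) k"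
 have r: "0 < r" using x by (simp add: r_def)
 have e: "norm e = 1" "x = r *R e" using r by (auto simp: e_def r_def)
 have c: "0 <= c" using kernel_const_pos[where 'a='a, of k] by (simp add: c_def)
 define I where "I m = {t. r / 2 ^ Suc m <= t - r & t - r < r / 2 ^ m & t < r + l}" for m :: nat
 define \<theta> where "\<theta> m = (1::real) / 2 ^ Suc m" for m
 define J where "J m = cone_around e (\<theta> m) \<inter> norm -` I m" for m
 define D1 where "D1 = density lborel (%t. F t * ennreal ((t - r) powr (- (1 + k))))"
 define D2 where "D2 = density lborel (%y. F (norm y) * ennreal (norm (x - y) powr (- (real DIM('a) + k))))"
 have \<theta>: "0 < \<theta> m" "\<theta> m <= 1" for m
  using one_le_power[of "2::real" "Suc m"] by (auto simp: \<theta>_def divide_le_eq simp del: one_le_power)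
 have I_meas [measurable]: "I m : sets borel" for m unfolding I_def by measurable
 have J_meas [measurable]: "J m : sets borel" for m
  unfolding J_def using measurable_sets[of norm "borel :: 'a measure" borel "I m"] by auto
 have I_disj: "disjoint_family I"
 proof (unfold disjoint_family_on_def, intro ballI impI)
  have *: "I m \<inter> I n = {}" if "m < n" for m n
  proof -
   have "r / 2 ^ n <= r / 2 ^ Suc m"
    using that r by (intro divide_left_mono power_increasing) auto
   thus ?thesis by (auto simp: I_def)
  qed
  fix m n :: nat assume "m ~= n"
  thus "I m \<inter> I n = {}" using *[of m n] *[of n m] by (cases m n rule: linorder_cases) auto
 qed
 hence J_disj: "disjoint_family J" unfolding disjoint_family_on_def J_def by blast
 have UN_I: "{r<..<min (2 * r) (r + l)} \<subseteq> (\<Union>m. I m)"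
 proof
  fix t assume "t : {r<..<min (2 * r) (r + l)}"
  hence t: "0 < (t - r) / r" "(t - r) / r < 1" "t < r + l" using r by (auto simp: field_simps)
  obtain m where "1 / 2 ^ Suc m <= (t - r) / r" "(t - r) / r < 1 / 2 ^ m"
   using dyadic_scale[OF t(1,2)] by blast
  hence "t : I m" using r t(3) by (simp add: I_def field_simps)
  thus "t : (\<Union>m. I m)" by blast
 qed
 have near: "norm (x - y) <= 3 * (norm y - r)" "norm y - r <= norm (x - y)" "0 < norm y - r" if "y : J m" for y m
 proof -
  have y: "norm (y - norm y *R e) <= \<theta> m * norm y" "r * \<theta> m <= norm y - r" "norm y - r < r / 2 ^ m"
   using that by (auto simp: J_def I_def cone_around_def \<theta>_def)
  show "0 < norm y - r" using y(2) r \<theta>[of m] by (smt (verit) mult_pos_pos)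
  have "r / 2 ^ m <= r" using r by (simp add: divide_le_eq mult_le_cancel_left1)
  hence "norm y <= 2 * r" using y(3) by simp
  hence "\<theta> m * norm y <= \<theta> m * (2 * r)" using \<theta>[of m] by (intro mult_left_mono) auto
  also have "\<theta> m * (2 * r) = 2 * (r * \<theta> m)" by simp
  also have "... <= 2 * (norm y - r)" using y(2) by simp
  finally have "\<theta> m * norm y <= 2 * (norm y - r)" .
  have "norm (x - y) <= norm (r *R e - norm y *R e) + norm (y - norm y *R e)"
   unfolding e(2) using norm_triangle_ineq4[of "r *R e - norm y *R e" "y - norm y *R e"] by simp
  also have "norm (r *R e - norm y *R e) = norm y - r"
   using e \<open>0 < norm y - r\<close> by (simp flip: scaleR_diff_left)
  also have "norm y - r + norm (y - norm y *R e) <= norm y - r + 2 * (norm y - r)"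
   using y(1) \<open>\<theta> m * norm y <= 2 * (norm y - r)\<close> by (intro add_left_mono) (rule order_trans)
  finally show "norm (x - y) <= 3 * (norm y - r)" by simp
  show "norm y - r <= norm (x - y)" unfolding r_def
   using norm_triangle_ineq2[of y x] by (simp add: norm_minus_commute)
 qed
 have J_sub: "(\<Union>m. J m) \<subseteq> cball x (3 * l)"
 proof
  fix y assume "y : (\<Union>m. J m)"
  then obtain m where y: "y : J m" by blast
  hence "norm y - r < l" by (auto simp: J_def I_def)
  thus "y : cball x (3 * l)" using near(1)[OF y] by (simp add: dist_norm)
 qed
 have step: "ennreal c * emeasure D1 (I m) <= emeasure D2 (J m)" for m
 proof -
  define h where "h t = F t * ennreal ((3 * (t - r)) powr (- (real DIM('a) + k))) * indicator (I m) t" for t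
  have [measurable]: "h : Borel" unfolding h_def by measurable
  define \<kappa> where "\<kappa> = measure lborel (cone_around e (\<theta> m) \<inter> cball 0 1)"
  have \<kappa>: "ball_volume TYPE('a) / (2 * 6 ^ DIM('a)) * \<theta> m ^ (DIM('a) - 1) <= \<kappa>"
   unfolding \<kappa>_def by (rule measure_cone_around_ge[OF e(1) \<theta>])
  have "ennreal c * emeasure D1 (I m) = (\<integral>t. ennreal c * (F t * ennreal ((t - r) powr (- (1 + k))) * indicator (I m) t))"
   unfolding D1_def by (subst emeasure_density) (auto simp: nn_integral_cmult)
  also have "... <= (\<integral>t. h t * ennreal (\<kappa> * DIM('a) * t ^ (DIM('a) - 1)) * indicator {0..} t)"
  proof (rule nn_integral_mono)
   fix t :: real
   show "ennreal c * (F t * ennreal ((t - r) powr (- (1 + k))) * indicator (I m) t)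
    <= h t * ennreal (\<kappa> * DIM('a) * t ^ (DIM('a) - 1)) * indicator {0..} t"
   proof (cases "t : I m")
    case True
    define d where "d = t - r"
    have d: "r * \<theta> m <= d" "d / 2 <= r * \<theta> m" using True by (auto simp: I_def \<theta>_def d_def)
    have d0: "0 < d" using d(1) r \<theta>[of m] by (smt (verit) mult_pos_pos)
    hence t0: "r <= t" "0 <= t" using r by (auto simp: d_def)
    have "c * d powr (- (1 + k)) = ball_volume TYPE('a) / (2 * 6 ^ DIM('a)) * DIM('a) * (3 powr (- (real DIM('a) + k)) * d powr (- (real DIM('a) + k))) * (d / 2) ^ (DIM('a) - 1)"
    proof -
     have "d powr (- (1 + k)) = d powr (- (real DIM('a) + k)) * d powr (DIM('a) - 1)"
      unfolding powr_add[symmetric] by (rule arg_cong[where f="%a. d powr a"]) simp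
     also have "d powr (DIM('a) - 1) = d ^ (DIM('a) - 1)"
      using d0 DIM_positive[where 'a='a] by (simp add: powr_realpow of_nat_diff flip: powr_realpow)
     finally show ?thesis by (simp add: c_def kernel_const_def power_divide field_simps)
    qed
    also have "... <= ball_volume TYPE('a) / (2 * 6 ^ DIM('a)) * DIM('a) * (3 powr (- (real DIM('a) + k)) * d powr (- (real DIM('a) + k))) * (r * \<theta> m) ^ (DIM('a) - 1)"
     using d d0 by (intro mult_left_mono power_mono) auto
    also have "... = ball_volume TYPE('a) / (2 * 6 ^ DIM('a)) * \<theta> m ^ (DIM('a) - 1) * (DIM('a) * (3 * d) powr (- (real DIM('a) + k)) * r ^ (DIM('a) - 1))"
     using d0 by (simp add: powr_mult power_mult_distrib)
    also have "... <= \<kappa> * (DIM('a) * (3 * d) powr (- (real DIM('a) + k)) * t ^ (DIM('a) - 1))"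
     using t0 r \<theta>[of m] \<kappa> by (intro mult_mono mult_left_mono power_mono) (auto simp: \<kappa>_def)
    finally have le: "c * d powr (- (1 + k)) <= (3 * d) powr (- (real DIM('a) + k)) * (\<kappa> * DIM('a) * t ^ (DIM('a) - 1))"
     by (simp add: mult_ac)
    have "ennreal c * (F t * ennreal (d powr (- (1 + k)))) = F t * ennreal (c * d powr (- (1 + k)))"
     using c by (simp add: ennreal_mult mult_ac)
    also have "... <= F t * ennreal ((3 * d) powr (- (real DIM('a) + k)) * (\<kappa> * DIM('a) * t ^ (DIM('a) - 1)))"
     using le by (intro mult_left_mono ennreal_leI) auto
    also have "... = F t * ennreal ((3 * d) powr (- (real DIM('a) + k))) * ennreal (\<kappa> * DIM('a) * t ^ (DIM('a) - 1))"
     using t0 by (subst ennreal_mult) (auto simp: \<kappa>_def mult.assoc)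
    finally show ?thesis using True t0 by (simp add: h_def d_def)
   qed simp
  qed
  also have "... = (\<integral>y. h (norm y) * indicator (cone_around e (\<theta> m)) y)"
   unfolding \<kappa>_def by (rule nn_integral_cone[OF cone_cone_around, symmetric]) measurable
  also have "... <= (\<integral>y. F (norm y) * ennreal (norm (x - y) powr (- (real DIM('a) + k))) * indicator (J m) y)"
  proof (rule nn_integral_mono)
   fix y :: 'a
   show "h (norm y) * indicator (cone_around e (\<theta> m)) y
    <= F (norm y) * ennreal (norm (x - y) powr (- (real DIM('a) + k))) * indicator (J m) y"
   proof (cases "y : J m")
    case True
    hence "norm y : I m" "y : cone_around e (\<theta> m)" by (auto simp: J_def)
    moreover have "(3 * (norm y - r)) powr (- (real DIM('a) + k)) <= norm (x - y) powr (- (real DIM('a) + k))"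
     using near[OF True] k by (intro powr_mono2') auto
    ultimately show ?thesis using True by (simp add: h_def mult_left_mono ennreal_leI)
   next
    case False
    hence "norm y ~: I m \<or> y ~: cone_around e (\<theta> m)" by (auto simp: J_def)
    thus ?thesis by (auto simp: h_def)
   qed
  qed
  also have "... = emeasure D2 (J m)" unfolding D2_def by (subst emeasure_density) auto
  finally show ?thesis .
 qed
 have "ennreal c * emeasure D1 {r<..<min (2 * r) (r + l)} <= ennreal c * emeasure D1 (\<Union>m. I m)"
  using UN_I by (intro mult_left_mono emeasure_mono) (auto simp: D1_def)
 also have "emeasure D1 (\<Union>m. I m) = (\<Sum>m. emeasure D1 (I m))"
  using I_disj by (intro suminf_emeasure[symmetric]) (auto simp: D1_def)
 also have "ennreal c * ... = (\<Sum>m. ennreal c * emeasure D1 (I m))" by (rule ennreal_suminf_cmult[symmetric])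
 also have "... <= (\<Sum>m. emeasure D2 (J m))" using step by (intro suminf_le) auto
 also have "... = emeasure D2 (\<Union>m. J m)"
  using J_disj by (intro suminf_emeasure) (auto simp: D2_def)
 also have "... <= emeasure D2 (cball x (3 * l))"
  using J_sub by (intro emeasure_mono) (auto simp: D2_def)
 finally show ?thesis
  unfolding D1_def D2_def c_def[symmetric] r_def[symmetric] by (simp add: emeasure_density)
qed

lemma radial_energy_lower:
 fixes u :: "'a::euclidean_space => real" and k l :: real
 assumes k: "0 < k" and l: "0 < l" and [measurable]: "u : Borel" "g : Borel"
  and ug: "AE x in lborel. u x = g (norm x)"
 shows "ennreal (kernel_const TYPE('a) k * ball_volume TYPE('a) * DIM('a)) *
   (\<integral>r. (\<integral>t. ennreal (\<bar>g r - g t\<bar> powr p * (t - r) powr (- (1 + k))) * indicator {r<..<min (2 * r) (r + l)} t)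
     * ennreal (r ^ (DIM('a) - 1)) * indicator {0<..} r)
  <= (\<integral>x. (\<integral>y. ennreal (quot p u (real DIM('a) + k) x y) * indicator (cball x (3 * l)) y))"
proof -
 define c where "c = kernel_const TYPE('a) k"
 define w where "w = ball_volume TYPE('a) * DIM('a)"
 have c: "0 <= c" using kernel_const_pos[where 'a='a, of k] by (simp add: c_def)
 have w: "0 <= w" by (simp add: w_def)
 define G where "G r = (\<integral>t. ennreal (\<bar>g r - g t\<bar> powr p * (t - r) powr (- (1 + k))) * indicator {r<..<min (2 * r) (r + l)} t)" for r
 have G_meas [measurable]: "G : Borel"
 proof -
  have "(%r. \<integral>\<^sup>+t. ennreal (\<bar>g r - g t\<bar> powr p * (t - r) powr (- (1 + k))) * (if r < t & t < min (2 * r) (r + l) then 1 else 0) \<partial>lborel) : borel_measurable lborel"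
   by measurable
  moreover have "G = (%r. \<integral>\<^sup>+t. ennreal (\<bar>g r - g t\<bar> powr p * (t - r) powr (- (1 + k))) * (if r < t & t < min (2 * r) (r + l) then 1 else 0) \<partial>lborel)"
   unfolding G_def by (intro ext nn_integral_cong) (auto simp: indicator_def)
  ultimately show ?thesis by simp
 qed
 have "ennreal (c * w) * (\<integral>r. G r * ennreal (r ^ (DIM('a) - 1)) * indicator {0<..} r)
  = (\<integral>r. ennreal c * G r * ennreal (w * r ^ (DIM('a) - 1)) * indicator {0..} r)"
 proof (subst nn_integral_cmult[symmetric])
  show "(\<integral>r. ennreal (c * w) * (G r * ennreal (r ^ (DIM('a) - 1)) * indicator {0<..} r))
   = (\<integral>r. ennreal c * G r * ennreal (w * r ^ (DIM('a) - 1)) * indicator {0..} r)"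
  proof (rule nn_integral_cong_AE)
   have "AE r in lborel. r ~= (0::real)" by (rule AE_lborel_singleton)
   thus "AE r in lborel. ennreal (c * w) * (G r * ennreal (r ^ (DIM('a) - 1)) * indicator {0<..} r)
    = ennreal c * G r * ennreal (w * r ^ (DIM('a) - 1)) * indicator {0..} r"
    by eventually_elim (use c w in \<open>auto simp: ennreal_mult mult_ac split: split_indicator\<close>)
  qed
 qed measurable
 also have "... = (\<integral>x::'a. ennreal c * G (norm x))"
  unfolding w_def by (rule nn_integral_radial[symmetric]) measurable
 also have "... <= (\<integral>x. (\<integral>y. ennreal (quot p u (real DIM('a) + k) x y) * indicator (cball x (3 * l)) y))"
 proof (rule nn_integral_mono_AE)
  have "AE x in (lborel :: 'a measure). x ~= 0" by (rule AE_lborel_singleton)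
  with ug show "AE x in (lborel :: 'a measure). ennreal c * G (norm x)
   <= (\<integral>y. ennreal (quot p u (real DIM('a) + k) x y) * indicator (cball x (3 * l)) y)"
  proof eventually_elim
   case (elim x)
   have "ennreal c * G (norm x) = ennreal c * (\<integral>t. ennreal (\<bar>u x - g t\<bar> powr p) * ennreal ((t - norm x) powr (- (1 + k))) * indicator {norm x<..<min (2 * norm x) (norm x + l)} t)"
    unfolding G_def using elim by (simp add: ennreal_mult)
   also have "... <= (\<integral>y. ennreal (\<bar>u x - g (norm y)\<bar> powr p) * ennreal (norm (x - y) powr (- (real DIM('a) + k))) * indicator (cball x (3 * l)) y)"
    unfolding c_def by (rule kernel_lower_bound[OF k elim(2) l]) measurable
   also have "... = (\<integral>y. ennreal (quot p u (real DIM('a) + k) x y) * indicator (cball x (3 * l)) y)"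
    by (intro nn_integral_cong_AE) (use ug in eventually_elim, auto simp: ennreal_mult)
   finally show ?case .
  qed
 qed
 finally show ?thesis unfolding G_def c_def w_def by (simp add: mult.assoc)
qed

subsection \<open>A Morrey estimate on the line\<close>

lemma average_powr_le:
 fixes f :: "real => real"
 assumes p: "1 < p" and [measurable]: "J : sets borel" and L: "emeasure lborel J = ennreal L" "0 < L"
  and f: "set_integrable lborel J f"
 shows "ennreal (\<bar>(LINT x:J|lborel. f x) / L\<bar> powr p)
  <= ennreal (1 / L) * (\<integral>x. ennreal (\<bar>f x\<bar> powr p) * indicator J x)"
proof -
 let ?M = "restrict_space lborel J"
 have int: "integrable ?M f" using f by (subst integrable_restrict_space) (auto simp: set_integrable_def)
 have "emeasure ?M (space ?M) = ennreal L"
  using L by (simp add: emeasure_restrict_space space_restrict_space)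
 from jensen_powr[OF p int this L(2)]
 have "ennreal (\<bar>LINT x:J|lborel. f x\<bar> powr p) <= ennreal (L powr (p - 1)) * (\<integral>x. ennreal (\<bar>f x\<bar> powr p) * indicator J x)"
  by (simp add: integral_restrict_space nn_integral_restrict_space set_lebesgue_integral_def)
 hence "ennreal (1 / L powr p) * ennreal (\<bar>LINT x:J|lborel. f x\<bar> powr p)
  <= ennreal (1 / L powr p) * (ennreal (L powr (p - 1)) * (\<integral>x. ennreal (\<bar>f x\<bar> powr p) * indicator J x))"
  by (rule mult_left_mono) simp
 moreover have "ennreal (1 / L powr p) * ennreal (L powr (p - 1)) = ennreal (1 / L)"
  using L by (simp add: ennreal_mult[symmetric] powr_diff)
 moreover have "ennreal (1 / L powr p) * ennreal (\<bar>LINT x:J|lborel. f x\<bar> powr p) = ennreal (\<bar>(LINT x:J|lborel. f x) / L\<bar> powr p)"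
  using L by (simp add: ennreal_mult[symmetric] powr_divide)
 ultimately show ?thesis by (simp add: mult.assoc[symmetric])
qed

lemma abs_diff_le_geometric:
 fixes a :: "nat => real"
 assumes a: "a ----> c" and q: "0 <= q" "q < 1" and B: "0 <= B" "!!n. \<bar>a n - a (Suc n)\<bar> <= B * q ^ n"
 shows "\<bar>c - a 0\<bar> <= B / (1 - q)"
proof -
 have "\<bar>a n - a 0\<bar> <= B / (1 - q)" for n
 proof -
  have "\<bar>a n - a 0\<bar> = \<bar>\<Sum>i<n. a (Suc i) - a i\<bar>" by (simp add: sum_lessThan_telescope)
  also have "... <= (\<Sum>i<n. B * q ^ i)"
   using B by (intro order_trans[OF sum_abs] sum_mono) (simp add: abs_minus_commute)
  also have "... = B * (\<Sum>i<n. q ^ i)" by (simp add: sum_distrib_left)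
  also have "(\<Sum>i<n. q ^ i) <= 1 / (1 - q)"
   using q by (simp add: sum_gp_strict divide_right_mono)
  finally show ?thesis using B by (simp add: mult_left_mono)
 qed
 moreover have "(%n. \<bar>a n - a 0\<bar>) ----> \<bar>c - a 0\<bar>" using a by (intro tendsto_intros)
 ultimately show ?thesis by (intro LIMSEQ_le_const2) auto
qed

lemma powr_dyadic:
 fixes l a :: real
 assumes "0 < l"
 shows "(l / 2 ^ n) powr a = l powr a * (2 powr (- a)) ^ n"
proof -
 have "(2 ^ n :: real) powr a = (2 powr a) ^ n"
 proof -
  have "(2 powr real n) powr a = (2 powr a) powr real n" by (simp add: powr_powr mult.commute)
  thus ?thesis using powr_realpow[of "2::real" n] powr_realpow[of "2 powr a" n] by simp
 qed
 thus ?thesis using assms by (simp add: powr_divide) (simp add: powr_minus power_inverse divide_inverse)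
qed

text \<open>The averages over shrinking intervals \<open>J n\<close> next to \<open>z\<close> form a geometric sequence because
 \<open>k > 1\<close>, and they tend to \<open>f z\<close> since the energy density at \<open>z\<close> itself is finite.\<close>

lemma Morrey_one_sided:
 fixes f :: "real => real" and J :: "nat => real set"
 assumes p: "1 < p" and k: "1 < k" and [measurable]: "f : Borel" "!!n. J n : sets borel"
  and l: "0 < l" and J: "!!n. emeasure lborel (J n) = ennreal (l / 2 ^ n)" "!!n. J (Suc n) \<subseteq> J n"
  and diam: "!!n x y. x : J n ==> y : J n ==> \<bar>x - y\<bar> <= l / 2 ^ n"
  and z: "!!n y. y : J n ==> z ~= y & \<bar>z - y\<bar> <= l / 2 ^ n"
  and E: "(\<integral>x. (\<integral>y. ennreal (\<bar>f x - f y\<bar> powr p * \<bar>x - y\<bar> powr (- (1 + k))) * indicator (J 0) y) * indicator (J 0) x) <= ennreal E"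
   "0 <= E"
  and fin: "(\<integral>y. ennreal (\<bar>f z - f y\<bar> powr p * \<bar>z - y\<bar> powr (- (1 + k))) * indicator (J 0) y) < \<infinity>"
 shows "\<bar>f z - (LINT y:J 0|lborel. f y) / l\<bar> <= (2 * E * l powr (k - 1)) powr (1 / p) / (1 - 2 powr (- ((k - 1) / p)))"
proof -
 define L where "L n = l / 2 ^ n" for n :: nat
 have L: "0 < L n" for n using l by (simp add: L_def)
 define a where "a n = (LINT y:J n|lborel. f y) / L n" for n
 obtain j where j: "0 <= j" "(\<integral>y. ennreal (\<bar>f z - f y\<bar> powr p * \<bar>z - y\<bar> powr (- (1 + k))) * indicator (J 0) y) = ennreal j"
  using fin unfolding infinity_ennreal_def less_top_ennreal by blast
 have J0: "J n \<subseteq> J 0" for n using lift_Suc_antimono_le[of J 0 n] J(2) by auto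
 have Jfin: "emeasure lborel (J n) < \<infinity>" for n by (simp add: J(1))
 have kernel: "\<bar>f x - f y\<bar> powr p <= L n powr (1 + k) * (\<bar>f x - f y\<bar> powr p * \<bar>x - y\<bar> powr (- (1 + k)))"
  if "\<bar>x - y\<bar> <= L n" for x y n
 proof (cases "x = y")
  case False
  hence "1 <= (L n / \<bar>x - y\<bar>) powr (1 + k)" using that k by (intro ge_one_powr_ge_zero) auto
  also have "... = L n powr (1 + k) * \<bar>x - y\<bar> powr (- (1 + k))"
   unfolding powr_minus_divide using L[of n] by (simp add: powr_divide)
  finally have "\<bar>f x - f y\<bar> powr p * 1 <= \<bar>f x - f y\<bar> powr p * (L n powr (1 + k) * \<bar>x - y\<bar> powr (- (1 + k)))"
   by (rule mult_left_mono) simp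
  thus ?thesis by (simp add: mult_ac)
 qed simp
 have near_z: "(\<integral>y. ennreal (\<bar>f z - f y\<bar> powr p) * indicator (J n) y) <= ennreal (L n powr (1 + k) * j)" for n
 proof -
  have "(\<integral>y. ennreal (\<bar>f z - f y\<bar> powr p) * indicator (J n) y)
   <= (\<integral>y. ennreal (L n powr (1 + k)) * (ennreal (\<bar>f z - f y\<bar> powr p * \<bar>z - y\<bar> powr (- (1 + k))) * indicator (J 0) y))"
   using kernel z J0[of n] by (intro nn_integral_mono)
    (auto simp: L_def ennreal_mult[symmetric] split: split_indicator intro!: ennreal_leI)
  also have "... = ennreal (L n powr (1 + k) * j)"
   using j by (simp add: nn_integral_cmult ennreal_mult)
  finally show ?thesis .
 qed
 have const: "set_integrable lborel (J n) (%y. c :: real)" for n c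
  using Jfin[of n] by (auto simp: set_integrable_def)
 have "set_integrable lborel (J n) (%y. f z - f y)" for n
  unfolding set_integrable_def
 proof (rule integrableI_bounded)
  have "(\<integral>y. ennreal (norm (indicator (J n) y *R (f z - f y))))
   <= (\<integral>y. indicator (J n) y + ennreal (\<bar>f z - f y\<bar> powr p) * indicator (J n) y)"
  proof (rule nn_integral_mono)
   fix y
   have "s <= 1 + s powr p" if "0 <= s" for s :: real
   proof (cases "s <= 1")
    case False
    hence "s powr 1 <= s powr p" using p by (intro powr_mono) auto
    thus ?thesis using False by simp
   qed (use that in \<open>smt (verit) powr_ge_zero\<close>)
   from this[of "\<bar>f z - f y\<bar>"] have "ennreal \<bar>f z - f y\<bar> <= ennreal (1 + \<bar>f z - f y\<bar> powr p)"
    by (intro ennreal_leI) simp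
   also have "... = 1 + ennreal (\<bar>f z - f y\<bar> powr p)" by simp
   finally show "ennreal (norm (indicator (J n) y *R (f z - f y)))
    <= indicator (J n) y + ennreal (\<bar>f z - f y\<bar> powr p) * indicator (J n) y"
    by (cases "y : J n") auto
  qed
  also have "... = emeasure lborel (J n) + (\<integral>y. ennreal (\<bar>f z - f y\<bar> powr p) * indicator (J n) y)"
   by (subst nn_integral_add) auto
  also have "... < \<infinity>" using Jfin[of n] near_z[of n] by (auto simp: less_top[symmetric] top_unique)
  finally show "(\<integral>y. ennreal (norm (indicator (J n) y *R (f z - f y)))) < \<infinity>" .
 qed measurable
 hence "set_integrable lborel (J n) (%y. f z - (f z - f y))" for n
  by (rule set_integral_diff(1)[OF const])
 hence f_int: "set_integrable lborel (J n) f" for n by simp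
 have avg: "ennreal (\<bar>c - a n\<bar> powr p) <= ennreal (1 / L n) * (\<integral>y. ennreal (\<bar>c - f y\<bar> powr p) * indicator (J n) y)" for c n
 proof -
  have "(LINT y:J n|lborel. c - f y) = c * L n - (LINT y:J n|lborel. f y)"
   using set_integral_diff(2)[OF const f_int, of n c] L[of n] J(1)[of n]
   by (simp add: set_lebesgue_integral_def measure_def L_def)
  hence "(LINT y:J n|lborel. c - f y) / L n = c - a n"
   using L[of n] by (simp add: a_def diff_divide_distrib)
  moreover have "set_integrable lborel (J n) (%y. c - f y)" by (rule set_integral_diff(1)[OF const f_int])
  ultimately show ?thesis
   using average_powr_le[OF p _ J(1)[of n], of "%y. c - f y"] L[of n] by (simp add: L_def)
 qed
 have step: "\<bar>a n - a (Suc n)\<bar> powr p <= 2 * E * L n powr (k - 1)" for n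
 proof -
  let ?h = "%x y. ennreal (\<bar>f x - f y\<bar> powr p * \<bar>x - y\<bar> powr (- (1 + k)))"
  have "ennreal (\<bar>a (Suc n) - a n\<bar> powr p) <= ennreal (1 / L n) * (\<integral>x. ennreal (\<bar>a (Suc n) - f x\<bar> powr p) * indicator (J n) x)"
   by (rule avg)
  also have "... <= ennreal (1 / L n) * (\<integral>x. ennreal (1 / L (Suc n) * L n powr (1 + k)) * ((\<integral>y. ?h x y * indicator (J 0) y) * indicator (J 0) x))"
  proof (intro mult_left_mono nn_integral_mono)
   fix x
   show "ennreal (\<bar>a (Suc n) - f x\<bar> powr p) * indicator (J n) x
    <= ennreal (1 / L (Suc n) * L n powr (1 + k)) * ((\<integral>y. ?h x y * indicator (J 0) y) * indicator (J 0) x)"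
   proof (cases "x : J n")
    case True
    hence x0: "x : J 0" using J0 by blast
    have "ennreal (\<bar>a (Suc n) - f x\<bar> powr p) <= ennreal (1 / L (Suc n)) * (\<integral>y. ennreal (\<bar>f x - f y\<bar> powr p) * indicator (J (Suc n)) y)"
     using avg[of "f x" "Suc n"] by (simp add: abs_minus_commute)
    also have "... <= ennreal (1 / L (Suc n)) * (\<integral>y. ennreal (L n powr (1 + k)) * (?h x y * indicator (J 0) y))"
    proof (intro mult_left_mono nn_integral_mono)
     fix y
     show "ennreal (\<bar>f x - f y\<bar> powr p) * indicator (J (Suc n)) y <= ennreal (L n powr (1 + k)) * (?h x y * indicator (J 0) y)"
     proof (cases "y : J (Suc n)")
      case y: True
      hence "y : J n" "y : J 0" using J(2) J0 by blast+
      moreover have "\<bar>x - y\<bar> <= L n" using diam[OF True \<open>y : J n\<close>] by (simp add: L_def)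
      ultimately show ?thesis using kernel[of x y n] y
       by (simp add: ennreal_mult[symmetric] ennreal_leI)
     qed simp
    qed simp
    also have "... = ennreal (1 / L (Suc n) * L n powr (1 + k)) * (\<integral>y. ?h x y * indicator (J 0) y)"
    proof -
     have "ennreal (1 / L (Suc n)) * ennreal (L n powr (1 + k)) = ennreal (1 / L (Suc n) * L n powr (1 + k))"
      using L[of "Suc n"] by (intro ennreal_mult[symmetric]) auto
     thus ?thesis by (subst nn_integral_cmult) (simp_all only: mult.assoc[symmetric], measurable)
    qed
    finally show ?thesis using True x0 by simp
   qed simp
  qed simp
  also have "... = ennreal (1 / L n) * (ennreal (1 / L (Suc n) * L n powr (1 + k)) * (\<integral>x. (\<integral>y. ?h x y * indicator (J 0) y) * indicator (J 0) x))"
   by (subst nn_integral_cmult) auto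
  also have "... <= ennreal (1 / L n) * (ennreal (1 / L (Suc n) * L n powr (1 + k)) * ennreal E)"
   using E by (intro mult_left_mono) auto
  also have "... = ennreal (1 / L n * (1 / L (Suc n) * L n powr (1 + k)) * E)"
   using E L[of n] L[of "Suc n"] by (simp add: ennreal_mult[symmetric] mult.assoc)
  also have "1 / L n * (1 / L (Suc n) * L n powr (1 + k)) * E = 2 * E * L n powr (k - 1)"
  proof -
   have "L (Suc n) = L n / 2" by (simp add: L_def)
   moreover have "L n powr (1 + k) = L n * L n * L n powr (k - 1)"
    using L[of n] by (simp add: powr_add powr_diff)
   ultimately show ?thesis using L[of n] by (simp add: field_simps)
  qed
  finally show ?thesis using E by (simp add: abs_minus_commute)
 qed
 define q where "q = 2 powr (- ((k - 1) / p))"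
 define B where "B = (2 * E * l powr (k - 1)) powr (1 / p)"
 have q: "0 <= q" "q < 1" using k p by (auto simp: q_def intro!: powr_less_one)
 have "\<bar>a n - a (Suc n)\<bar> <= B * q ^ n" for n
 proof -
  have "\<bar>a n - a (Suc n)\<bar> = (\<bar>a n - a (Suc n)\<bar> powr p) powr (1 / p)" using p by (simp add: powr_powr)
  also have "... <= (2 * E * L n powr (k - 1)) powr (1 / p)" using step p by (intro powr_mono2) auto
  also have "... = (2 * E * l powr (k - 1)) powr (1 / p) * ((2 powr (- (k - 1))) ^ n) powr (1 / p)"
   using E l by (simp add: L_def powr_dyadic powr_mult mult.assoc)
  also have "((2 powr (- (k - 1))) ^ n) powr (1 / p) = q ^ n"
  proof -
   have "((2 powr (- (k - 1))) ^ n) powr (1 / p) = 2 powr (- (k - 1) * real n * (1 / p))"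
    by (simp add: powr_powr flip: powr_realpow)
   also have "- (k - 1) * real n * (1 / p) = - ((k - 1) / p) * real n"
    by (simp add: minus_divide_left)
   also have "2 powr ... = q ^ n" by (simp only: q_def powr_powr[symmetric] powr_realpow[OF powr_gt_zero[THEN iffD2, OF zero_neq_numeral[symmetric]]])
   finally show ?thesis .
  qed
  finally show ?thesis by (simp add: B_def)
 qed
 moreover have "a ----> f z"
 proof -
  have le: "\<bar>f z - a n\<bar> <= (L n powr k * j) powr (1 / p)" for n
  proof -
   have "ennreal (\<bar>f z - a n\<bar> powr p) <= ennreal (1 / L n) * ennreal (L n powr (1 + k) * j)"
    using avg[of "f z" n] near_z[of n] by (meson mult_left_mono order_trans zero_le)
   also have "... = ennreal (L n powr k * j)"
    using L[of n] j by (simp add: ennreal_mult[symmetric] powr_add)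
   finally have "\<bar>f z - a n\<bar> powr p <= L n powr k * j" using j by simp
   hence "(\<bar>f z - a n\<bar> powr p) powr (1 / p) <= (L n powr k * j) powr (1 / p)" using p by (intro powr_mono2) auto
   thus ?thesis using p by (simp add: powr_powr)
  qed
  have "L ----> 0" unfolding L_def
   using tendsto_mult[OF tendsto_const[of l] LIMSEQ_realpow_zero[of "1/2::real"]] by (simp add: power_divide)
  hence "(%n. L n powr k) ----> 0"
   using L k by (intro tendsto_zero_powrI[where b=k]) (auto simp: less_imp_le)
  hence "(%n. L n powr k * j) ----> 0" by (rule tendsto_mult_left_zero)
  hence "(%n. (L n powr k * j) powr (1 / p)) ----> 0"
   using p j by (intro tendsto_zero_powrI[where b="1 / p"]) auto
  hence "(%n. f z - a n) ----> 0"
   by (rule Lim_null_comparison[rotated]) (simp add: le)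
  from tendsto_diff[OF tendsto_const[of "f z"] this] show ?thesis by simp
 qed
 ultimately have "\<bar>f z - a 0\<bar> <= B / (1 - q)"
  using q by (intro abs_diff_le_geometric) (auto simp: B_def)
 thus ?thesis by (simp add: a_def L_def B_def q_def)
qed

lemma Morrey_two_point:
 fixes f :: "real => real"
 assumes p: "1 < p" and k: "1 < k" and [measurable]: "f : Borel" and rt: "r < t"
  and E: "(\<integral>x. (\<integral>y. ennreal (\<bar>f x - f y\<bar> powr p * \<bar>x - y\<bar> powr (- (1 + k))) * indicator {r<..<t} y) * indicator {r<..<t} x) <= ennreal E"
   "0 <= E"
  and right: "(\<integral>y. ennreal (\<bar>f r - f y\<bar> powr p * \<bar>r - y\<bar> powr (- (1 + k))) * indicator {r<..<t} y) < \<infinity>"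
  and left: "(\<integral>y. ennreal (\<bar>f t - f y\<bar> powr p * \<bar>t - y\<bar> powr (- (1 + k))) * indicator {r<..<t} y) < \<infinity>"
 shows "\<bar>f r - f t\<bar> <= 2 * ((2 * E * (t - r) powr (k - 1)) powr (1 / p) / (1 - 2 powr (- ((k - 1) / p))))"
proof -
 define l where "l = t - r"
 have l: "0 < l" using rt by (simp add: l_def)
 have half: "0 < l / 2 ^ n" "l / 2 ^ Suc n <= l / 2 ^ n" "l / 2 ^ n <= l" for n
  using l by (auto simp: divide_simps)
 define J1 where "J1 n = {r<..<r + l / 2 ^ n}" for n :: nat
 define J2 where "J2 n = {t - l / 2 ^ n<..<t}" for n :: nat
 have J0: "J1 0 = {r<..<t}" "J2 0 = {r<..<t}" by (auto simp: J1_def J2_def l_def)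
 have 1: "\<bar>f r - (LINT y:J1 0|lborel. f y) / l\<bar> <= (2 * E * l powr (k - 1)) powr (1 / p) / (1 - 2 powr (- ((k - 1) / p)))"
 proof (rule Morrey_one_sided[where J=J1, OF p k _ _ l])
  show "emeasure lborel (J1 n) = ennreal (l / 2 ^ n)" for n using half[of n] by (simp add: J1_def)
  show "J1 (Suc n) \<subseteq> J1 n" for n using half(2)[of n] by (auto simp: J1_def)
 qed (use E right J0 in \<open>auto simp: J1_def\<close>)
 have 2: "\<bar>f t - (LINT y:J2 0|lborel. f y) / l\<bar> <= (2 * E * l powr (k - 1)) powr (1 / p) / (1 - 2 powr (- ((k - 1) / p)))"
 proof (rule Morrey_one_sided[where J=J2, OF p k _ _ l])
  show "emeasure lborel (J2 n) = ennreal (l / 2 ^ n)" for n using half[of n] by (simp add: J2_def)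
  show "J2 (Suc n) \<subseteq> J2 n" for n using half(2)[of n] by (auto simp: J2_def)
 qed (use E left J0 in \<open>auto simp: J2_def\<close>)
 show ?thesis using 1 2 unfolding J0 l_def by linarith
qed

text \<open>For radial functions the \<open>N\<close>-dimensional seminorm of order \<open>k/p > 1/p\<close> controls a Hoelder
 norm of the profile, with the decay factor \<open>\<bar>x\<bar>\<^bsup>-(N-1)/p\<^esup>\<close>.  The energy is only measured near the
 diagonal, with a power \<open>l\<^sup>e\<close> for the scale \<open>l\<close>: \<open>e = 0\<close> is the fractional space itself, and
 \<open>e > 0\<close> serves functions with a weak gradient, whose energy of lower order decays with \<open>l\<close>.\<close>

lemma radial_Hoelder:
 fixes k p :: real
 assumes p: "1 < p" and k: "1 < k"
 obtains C where "0 < C"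
  "!!(u :: 'a::euclidean_space => real) K e. u : Borel ==> radial u ==> 0 <= K ==>
   (!!l. 0 < l ==> (\<integral>x. (\<integral>y. ennreal (quot p u (real DIM('a) + k) x y) * indicator (cball x (3 * l)) y))
     <= ennreal (K powr p * l powr e)) ==>
   \<exists>Z\<in>null_sets lborel. \<forall>x y. x ~: Z --> y ~: Z --> norm x <= norm y --> norm y <= 2 * norm x -->
    \<bar>u x - u y\<bar> <= C * K * (norm y - norm x) powr ((e + k - 1) / p) * norm x powr (- (real DIM('a) - 1) / p)"
proof -
 define c where "c = kernel_const TYPE('a) k * ball_volume TYPE('a) * DIM('a)"
 have c: "0 < c" unfolding c_def
  using kernel_const_pos[where 'a='a] ball_volume_pos[where 'a='a] DIM_positive[where 'a='a] by simp
 define q where "q = 2 powr (- ((k - 1) / p))"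
 have q: "q < 1" using k p by (auto simp: q_def intro!: powr_less_one)
 define C where "C = 2 / (1 - q) * (4 / c) powr (1 / p)"
 show thesis
 proof (rule that[of C])
  show "0 < C" using q c by (simp add: C_def)
 next
  fix u :: "'a => real" and K e
  assume u_meas [measurable]: "u : Borel" and "radial u" and K: "0 <= K"
   and energy: "!!l. 0 < l ==> (\<integral>x. (\<integral>y. ennreal (quot p u (real DIM('a) + k) x y) * indicator (cball x (3 * l)) y))
     <= ennreal (K powr p * l powr e)"
  obtain g where g_meas [measurable]: "g : Borel" and g: "AE x in lborel. u x = g (norm x)"
   using radial_Borel_profile[OF u_meas \<open>radial u\<close>] .
  define h where "h r t = ennreal (\<bar>g r - g t\<bar> powr p * \<bar>r - t\<bar> powr (- (1 + k)))" for r t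
  have h_meas [measurable]: "case_prod h : borel_measurable (borel \<Otimes>\<^sub>M borel)" unfolding h_def by measurable
  have h_sym: "h r t = h t r" for r t by (simp add: h_def abs_minus_commute)
  have h_diag: "h r r = 0" for r by (simp add: h_def)
  define T where "T l r t = (if r < t & t < 2 * r & t < r + l then ennreal (r ^ (DIM('a) - 1)) else 0)" for l r t :: real
  have T_meas [measurable]: "case_prod (T l) : borel_measurable (borel \<Otimes>\<^sub>M borel)" for l
   unfolding T_def by measurable
  have main: "ennreal c * (\<integral>r. (\<integral>t. h r t * T l r t)) <= ennreal (K powr p * l powr e)" if l: "0 < l" for l
  proof -
   have "(\<integral>r. (\<integral>t. h r t * T l r t))
    = (\<integral>r. (\<integral>t. ennreal (\<bar>g r - g t\<bar> powr p * (t - r) powr (- (1 + k))) * indicator {r<..<min (2 * r) (r + l)} t)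
     * ennreal (r ^ (DIM('a) - 1)) * indicator {0<..} r)"
   proof (rule nn_integral_cong)
    fix r :: real
    have "(\<integral>t. h r t * T l r t) = (\<integral>t. (ennreal (\<bar>g r - g t\<bar> powr p * (t - r) powr (- (1 + k))) * indicator {r<..<min (2 * r) (r + l)} t) * (ennreal (r ^ (DIM('a) - 1)) * indicator {0<..} r))"
     by (rule nn_integral_cong) (auto simp: h_def T_def abs_minus_commute split: split_indicator)
    also have "... = (\<integral>t. ennreal (\<bar>g r - g t\<bar> powr p * (t - r) powr (- (1 + k))) * indicator {r<..<min (2 * r) (r + l)} t) * (ennreal (r ^ (DIM('a) - 1)) * indicator {0<..} r)"
     by (rule nn_integral_multc) measurable
    finally show "(\<integral>t. h r t * T l r t) = (\<integral>t. ennreal (\<bar>g r - g t\<bar> powr p * (t - r) powr (- (1 + k))) * indicator {r<..<min (2 * r) (r + l)} t)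
     * ennreal (r ^ (DIM('a) - 1)) * indicator {0<..} r" by (simp add: mult.assoc)
   qed
   thus ?thesis using radial_energy_lower[OF _ l u_meas g_meas g, of k p] energy[OF l] k
    unfolding c_def by simp
  qed
  have fin: "(\<integral>r. (\<integral>t. h r t * T l r t)) ~= \<infinity>" if "0 < l" for l
  proof
   assume "(\<integral>r. (\<integral>t. h r t * T l r t)) = \<infinity>"
   thus False using main[OF that] c by (simp add: ennreal_mult_top top_unique)
  qed
  have "AE r in lborel. \<forall>n. (\<integral>t. h r t * T (real (Suc n)) r t) ~= \<infinity>"
   unfolding AE_all_countable using fin by (intro allI nn_integral_PInf_AE) auto
  moreover have "AE t in lborel. \<forall>n. (\<integral>r. h r t * T (real (Suc n)) r t) ~= \<infinity>"
   unfolding AE_all_countable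
  proof (intro allI nn_integral_PInf_AE)
   fix n
   have "(\<integral>t. (\<integral>r. h r t * T (real (Suc n)) r t))
    = (\<integral>r. (\<integral>t. h r t * T (real (Suc n)) r t))"
    by (rule lborel_pair.Fubini') measurable
   thus "(\<integral>t. (\<integral>r. h r t * T (real (Suc n)) r t)) ~= \<infinity>" using fin[of "real (Suc n)"] by simp
  qed measurable
  ultimately have "AE r in lborel. 0 < r --> (\<forall>n. (\<integral>t. h r t * T (real (Suc n)) r t) ~= \<infinity>)
    & (\<forall>n. (\<integral>y. h y r * T (real (Suc n)) y r) ~= \<infinity>)"
   by eventually_elim simp
  from AE_norm[OF this, where 'a='a] g
  have "AE x::'a in lborel. u x = g (norm x) & (\<forall>n. (\<integral>t. h (norm x) t * T (real (Suc n)) (norm x) t) ~= \<infinity>)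
    & (\<forall>n. (\<integral>y. h y (norm x) * T (real (Suc n)) y (norm x)) ~= \<infinity>)"
   by eventually_elim simp
  then obtain Z where "Z : null_sets lborel" and Z': "!!x. x : space lborel - Z ==>
    u x = g (norm x) & (\<forall>n. (\<integral>t. h (norm x) t * T (real (Suc n)) (norm x) t) ~= \<infinity>)
    & (\<forall>n. (\<integral>y. h y (norm x) * T (real (Suc n)) y (norm x)) ~= \<infinity>)"
   by (rule AE_E3) blast
  hence Z: "Z : null_sets lborel"
   "!!x. x ~: Z ==> u x = g (norm x)"
   "!!x n. x ~: Z ==> (\<integral>t. h (norm x) t * T (real (Suc n)) (norm x) t) ~= \<infinity>"
   "!!x n. x ~: Z ==> (\<integral>y. h y (norm x) * T (real (Suc n)) y (norm x)) ~= \<infinity>"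
   by auto
  show "\<exists>Z\<in>null_sets lborel. \<forall>x y. x ~: Z --> y ~: Z --> norm x <= norm y --> norm y <= 2 * norm x -->
    \<bar>u x - u y\<bar> <= C * K * (norm y - norm x) powr ((e + k - 1) / p) * norm x powr (- (real DIM('a) - 1) / p)"
  proof (intro bexI[OF _ Z(1)] allI impI)
   fix x y :: 'a
   assume x: "x ~: Z" and y: "y ~: Z" and "norm x <= norm y" "norm y <= 2 * norm x"
   define r t where "r = norm x" and "t = norm y"
   show "\<bar>u x - u y\<bar> <= C * K * (norm y - norm x) powr ((e + k - 1) / p) * norm x powr (- (real DIM('a) - 1) / p)"
   proof (cases "norm x = norm y")
    case True
    thus ?thesis using Z(2)[OF x] Z(2)[OF y] by simp
   next
    case False
    hence rt: "r < t" "t <= 2 * r" "0 < r"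
     using \<open>norm x <= norm y\<close> \<open>norm y <= 2 * norm x\<close> unfolding r_def t_def by linarith+
    define l where "l = t - r"
    have l: "0 < l" using rt by (simp add: l_def)
    obtain n :: nat where "l < real n" using reals_Archimedean2[of l] by blast
    hence n: "l < real (Suc n)" by simp
    define w where "w = r ^ (DIM('a) - 1)"
    have w: "0 < w" using rt by (simp add: w_def)
    have w_le: "ennreal w <= ennreal (s ^ (DIM('a) - 1))" if "r < s" for s
     unfolding w_def using rt that by (intro ennreal_leI power_mono) auto
    have Tw: "h s s' * (ennreal w * indicator {s<..<t} s') * indicator {r<..<t} s <= h s s' * T l s s'" for s s'
     using w_le[of s] rt by (auto simp: T_def l_def split: split_indicator intro!: mult_left_mono)
    have right: "(\<integral>s. h r s * indicator {r<..<t} s) < \<infinity>"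
    proof -
     have "ennreal w * (\<integral>s. h r s * indicator {r<..<t} s) = (\<integral>s. ennreal w * (h r s * indicator {r<..<t} s))"
      by (rule nn_integral_cmult[symmetric]) measurable
     also have "... <= (\<integral>s. h r s * T (real (Suc n)) r s)"
      using rt n by (intro nn_integral_mono) (auto simp: T_def w_def l_def mult.commute split: split_indicator)
     also have "... < \<infinity>" using Z(3)[OF x, of n] by (simp add: r_def less_top)
     finally show ?thesis using w by (auto simp: ennreal_mult_less_top)
    qed
    have left: "(\<integral>s. h t s * indicator {r<..<t} s) < \<infinity>"
    proof -
     have "ennreal w * (\<integral>s. h t s * indicator {r<..<t} s) = (\<integral>s. ennreal w * (h t s * indicator {r<..<t} s))"
      by (rule nn_integral_cmult[symmetric]) measurable
     also have "... <= (\<integral>s. h s t * T (real (Suc n)) s t)"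
      using rt n w_le by (intro nn_integral_mono) (auto simp: T_def l_def mult.commute[of "ennreal w"] h_sym[of t] split: split_indicator intro!: mult_left_mono ennreal_leI)
     also have "... < \<infinity>" using Z(4)[OF y, of n] by (simp add: t_def less_top)
     finally show ?thesis using w by (auto simp: ennreal_mult_less_top)
    qed
    define U where "U = (\<integral>s. (\<integral>s'. h s s' * (if r < s & s < s' & s' < t then 1 else 0)))"
    have U: "ennreal (c * w) * U <= ennreal (K powr p * l powr e)"
    proof -
     have "ennreal w * U = (\<integral>s. (\<integral>s'. ennreal w * (h s s' * (if r < s & s < s' & s' < t then 1 else 0))))"
      unfolding U_def by (simp add: nn_integral_cmult)
     also have "... <= (\<integral>s. (\<integral>s'. h s s' * T l s s'))"
     proof (intro nn_integral_mono)
      fix s s' :: real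
      show "ennreal w * (h s s' * (if r < s & s < s' & s' < t then 1 else 0)) <= h s s' * T l s s'"
       using w_le[of s] rt by (auto simp: T_def l_def mult.commute[of "ennreal w"] intro!: mult_left_mono ennreal_leI)
     qed
     finally have "ennreal c * (ennreal w * U) <= ennreal c * (\<integral>s. (\<integral>s'. h s s' * T l s s'))"
      by (rule mult_left_mono) simp
     with main[OF l] have "ennreal c * (ennreal w * U) <= ennreal (K powr p * l powr e)" by (rule order_trans[rotated])
     thus ?thesis using c w by (simp add: ennreal_mult mult.assoc)
    qed
    define E where "E = 2 * (K powr p * l powr e / (c * w))"
    have E: "0 <= E" using c w by (simp add: E_def)
    have "(\<integral>s. (\<integral>s'. h s s' * indicator {r<..<t} s') * indicator {r<..<t} s)
     = (\<integral>s. (\<integral>s'. h s s' * (if r < s & s < s' & s' < t then 1 else 0) + h s' s * (if r < s' & s' < s & s < t then 1 else 0)))"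
    proof (rule nn_integral_cong)
     fix s :: real
     have "(\<integral>s'. h s s' * indicator {r<..<t} s') * indicator {r<..<t} s = (\<integral>s'. h s s' * indicator {r<..<t} s' * indicator {r<..<t} s)"
      by (rule nn_integral_multc[symmetric]) measurable
     also have "... = (\<integral>s'. h s s' * (if r < s & s < s' & s' < t then 1 else 0) + h s' s * (if r < s' & s' < s & s < t then 1 else 0))"
     proof (rule nn_integral_cong)
      fix s' :: real
      consider "s < s'" | "s = s'" | "s' < s" by linarith
      thus "h s s' * indicator {r<..<t} s' * indicator {r<..<t} s
       = h s s' * (if r < s & s < s' & s' < t then 1 else 0) + h s' s * (if r < s' & s' < s & s < t then 1 else 0)"
       by cases (auto simp: h_diag h_sym[of s' s] split: split_indicator)
     qed
     finally show "(\<integral>s'. h s s' * indicator {r<..<t} s') * indicator {r<..<t} s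
      = (\<integral>s'. h s s' * (if r < s & s < s' & s' < t then 1 else 0) + h s' s * (if r < s' & s' < s & s < t then 1 else 0))" .
    qed
    also have "... = U + (\<integral>s. (\<integral>s'. h s' s * (if r < s' & s' < s & s < t then 1 else 0)))"
     unfolding U_def by (simp add: nn_integral_add)
    also have "(\<integral>s. (\<integral>s'. h s' s * (if r < s' & s' < s & s < t then 1 else 0))) = U"
     unfolding U_def by (rule lborel_pair.Fubini') measurable
    also have "U + U <= ennreal E"
    proof -
     have "U ~= \<infinity>"
     proof
      assume "U = \<infinity>"
      hence "ennreal (c * w) * U = \<infinity>" using c w by (simp add: ennreal_mult_top)
      with U show False by (simp add: top_unique)
     qed
     hence "U < \<infinity>" by (simp add: less_top)
     then obtain U' where U': "U = ennreal U'" "0 <= U'" unfolding infinity_ennreal_def less_top_ennreal by blast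
     hence "c * w * U' <= K powr p * l powr e" using U c w by (simp add: ennreal_mult[symmetric])
     hence "U' <= K powr p * l powr e / (c * w)" using c w by (simp add: field_simps)
     thus ?thesis using U' by (simp add: ennreal_plus[symmetric] E_def del: ennreal_plus)
    qed
    finally have "\<bar>g r - g t\<bar> <= 2 * ((2 * E * (t - r) powr (k - 1)) powr (1 / p) / (1 - 2 powr (- ((k - 1) / p))))"
     using right left unfolding h_def by (intro Morrey_two_point[OF p k _ rt(1) _ E]) auto
    also have "(2 * E * (t - r) powr (k - 1)) powr (1 / p)
     = (4 / c) powr (1 / p) * K * l powr ((e + k - 1) / p) * r powr (- (real DIM('a) - 1) / p)"
    proof -
     have "w = r powr (real DIM('a) - 1)"
      using rt DIM_positive[where 'a='a] by (simp add: w_def powr_realpow of_nat_diff flip: powr_realpow)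
     moreover define Q where "Q = 4 / c"
     ultimately have "2 * E * (t - r) powr (k - 1) = Q * K powr p * l powr (e + k - 1) * r powr (- (real DIM('a) - 1))"
      unfolding E_def l_def[symmetric] by (simp add: powr_add powr_diff powr_minus field_simps)
     moreover have "0 <= Q" using c by (simp add: Q_def)
     ultimately show ?thesis unfolding Q_def[symmetric] using K p l rt by (simp add: powr_mult powr_powr)
    qed
    finally show ?thesis using Z(2)[OF x] Z(2)[OF y] unfolding r_def[symmetric] t_def[symmetric]
     by (simp add: C_def q_def l_def mult_ac)
   qed
  qed
 qed
qed

section \<open>Test functions\<close>

lemma Ck_Suc_D: "Ck (Suc k) f ==> Ck k f"
proof (induction k arbitrary: f)
 case 0
 thus ?case by (auto intro!: differentiable_imp_continuous_on simp: differentiable_on_def differentiable_at_withinI)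
next
 case (Suc k)
 thus ?case by (metis Ck.simps(2))
qed

lemma Ck_const: "Ck k (%x. c)"
proof (induction k arbitrary: c)
 case (Suc k)
 have "FD (%x::'a. c) x i = 0" for x i
  by (simp add: frechet_derivative_const)
 thus ?case using Suc[of 0] by simp
qed simp

lemma Ck_add: "Ck k f ==> Ck k g ==> Ck k (%x. f x + g x)"
proof (induction k arbitrary: f g)
 case (Suc k)
 have d: "((%x. f x + g x) has_derivative (%h. FD f x h + FD g x h)) (at x)" for x
  using Suc.prems by (intro has_derivative_add) (auto simp: frechet_derivative_works[symmetric])
 have "FD (%x. f x + g x) x i = FD f x i + FD g x i" for x i
  using frechet_derivative_at[OF d[of x]] by metis
 moreover have "(%x. f x + g x) differentiable (at x)" for x using d by (auto simp: differentiable_def)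
 ultimately show ?case using Suc by auto
qed (auto intro!: continuous_intros)

lemma Ck_mult: "Ck k f ==> Ck k g ==> Ck k (%x. f x * g x)"
proof (induction k arbitrary: f g)
 case (Suc k)
 have d: "((%x. f x * g x) has_derivative (%h. f x * FD g x h + FD f x h * g x)) (at x)" for x
  using Suc.prems by (intro has_derivative_mult) (auto simp: frechet_derivative_works[symmetric])
 have "FD (%x. f x * g x) x i = f x * FD g x i + FD f x i * g x" for x i
  using frechet_derivative_at[OF d[of x]] by metis
 moreover have "(%x. f x * g x) differentiable (at x)" for x using d by (auto simp: differentiable_def)
 moreover have "Ck k f" "Ck k g" using Suc.prems by (auto intro: Ck_Suc_D)
 ultimately show ?case using Suc by (auto intro!: Ck_add)
qed (auto intro!: continuous_intros)

lemma Ck_prod: "(!!i. i : I ==> Ck k (f i)) ==> Ck k (%x. \<Prod>i\<in>I. f i x)"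
 by (induction I rule: infinite_finite_induct) (auto intro: Ck_const Ck_mult)

lemma Ck_comp_affine:
 fixes h :: "real => real" and v :: "'a::euclidean_space"
 shows "Ck k h ==> Ck k (%x. h (x \<bullet> v + c))"
proof (induction k arbitrary: h)
 case 0
 thus ?case by (auto intro!: continuous_intros continuous_on_compose2[of UNIV h])
next
 case (Suc k)
 have d: "((%x. h (x \<bullet> v + c)) has_derivative (%i. frechet_derivative h (at (x \<bullet> v + c)) (i \<bullet> v))) (at x)" for x
 proof -
  have "(h has_derivative frechet_derivative h (at (x \<bullet> v + c))) (at (x \<bullet> v + c))"
   using Suc.prems by (simp add: frechet_derivative_works[symmetric])
  moreover have "((%x. x \<bullet> v + c) has_derivative (%i. i \<bullet> v)) (at x)"
   by (auto intro!: derivative_eq_intros)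
  ultimately show ?thesis by (rule has_derivative_compose[rotated])
 qed
 have lin: "FD h s t = t * FD h s 1" for s t
 proof -
  have "linear (FD h s)"
   using Suc.prems by (intro linear_frechet_derivative) auto
  from linear_cmul[OF this, of t 1] show ?thesis by simp
 qed
 have "frechet_derivative (%x. h (x \<bullet> v + c)) (at x) i = (i \<bullet> v) * frechet_derivative h (at (x \<bullet> v + c)) 1" for x i
  using frechet_derivative_at[OF d[of x]] lin by metis
 moreover have "(%x. h (x \<bullet> v + c)) differentiable (at x)" for x using d by (auto simp: differentiable_def)
 moreover have "Ck k (%t. FD h t 1)" using Suc.prems by simp
 ultimately show ?case using Suc.IH by (auto intro!: Ck_mult Ck_const)
qed

definition flat_exp :: "nat => real => real" where
 "flat_exp m t = (if 0 < t then (1 / t) ^ m * exp (- (1 / t)) else 0)"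

text \<open>The functions \<open>t\<^sup>-\<^sup>m e\<^sup>-\<^sup>1\<^sup>/\<^sup>t\<close> are closed under differentiation up to linear combinations, which
 makes the smoothness of \<open>flat_exp 0\<close> a single induction.\<close>

lemma flat_exp_has_derivative:
 "(flat_exp m has_real_derivative flat_exp (m + 2) t - real m * flat_exp (m + 1) t) (at t)"
proof -
 consider "0 < t" | "t < 0" | "t = 0" by linarith
 thus ?thesis
 proof cases
  case 1
  have "((%t. (1 / t) ^ m * exp (- (1 / t))) has_real_derivative flat_exp (m + 2) t - real m * flat_exp (m + 1) t) (at t)"
   using 1 by (auto intro!: derivative_eq_intros simp: flat_exp_def)
    (cases m; simp add: field_simps power2_eq_square power_add)
  thus ?thesis
   by (rule has_field_derivative_transform_within_open[of _ _ _ "{0<..}"]) (use 1 in \<open>auto simp: flat_exp_def\<close>)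
 next
  case 2
  have "((%t. 0) has_real_derivative flat_exp (m + 2) t - real m * flat_exp (m + 1) t) (at t)"
   using 2 by (auto simp: flat_exp_def)
  thus ?thesis
   by (rule has_field_derivative_transform_within_open[of _ _ _ "{..<0}"]) (use 2 in \<open>auto simp: flat_exp_def\<close>)
 next
  case 3
  have "((%h. flat_exp m h / h) \<longlongrightarrow> 0) (at_right 0)"
  proof (rule Lim_transform_eventually)
   show "((%h. inverse h ^ (m + 1) / exp (inverse h)) \<longlongrightarrow> (0::real)) (at_right 0)"
    by (rule filterlim_compose[OF tendsto_power_div_exp_0 filterlim_inverse_at_top_right])
   show "\<forall>\<^sub>F h in at_right 0. inverse h ^ (m + 1) / exp (inverse h) = flat_exp m h / h"
    by (auto simp: eventually_at_filter flat_exp_def exp_minus divide_inverse intro!: always_eventually)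
  qed
  moreover have "((%h. flat_exp m h / h) \<longlongrightarrow> 0) (at_left 0)"
  proof (rule Lim_transform_eventually[OF tendsto_const])
   show "\<forall>\<^sub>F h in at_left 0. 0 = flat_exp m h / h"
    by (auto simp: eventually_at_filter flat_exp_def intro!: always_eventually)
  qed
  ultimately have "((%h. flat_exp m h / h) \<longlongrightarrow> 0) (at 0)" by (simp add: filterlim_split_at_real)
  thus ?thesis using 3 unfolding has_field_derivative_iff by (simp add: flat_exp_def)
 qed
qed

lemma Ck_flat_exp: "Ck k (flat_exp m)"
proof (induction k arbitrary: m)
 case 0
 have "isCont (flat_exp m) t" for t using flat_exp_has_derivative DERIV_isCont by blast
 thus ?case by (simp add: continuous_at_imp_continuous_on)
next
 case (Suc k)
 have d: "(flat_exp m has_derivative (%h. (flat_exp (m + 2) t - real m * flat_exp (m + 1) t) * h)) (at t)" for t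
  using flat_exp_has_derivative[of m t] by (simp add: has_field_derivative_def)
 have "FD (flat_exp m) t 1 = flat_exp (m + 2) t + (- real m) * flat_exp (m + 1) t" for t
  using frechet_derivative_at[OF d[of t]] by (metis add_uminus_conv_diff mult.right_neutral mult_minus_left)
 moreover have "flat_exp m differentiable (at t)" for t using d by (auto simp: differentiable_def)
 moreover have "Ck k (%t. flat_exp (m + 2) t + (- real m) * flat_exp (m + 1) t)"
  by (intro Ck_add Ck_mult Ck_const Suc.IH)
 ultimately show ?case by simp
qed

definition box_bump :: "'a::euclidean_space => 'a => nat => 'a => real" where
 "box_bump a b n x = (\<Prod>i\<in>Basis. flat_exp 0 (real n * (x \<bullet> i - a \<bullet> i)) * flat_exp 0 (real n * (b \<bullet> i - x \<bullet> i)))"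

lemma flat_exp_0_bounds: "0 <= flat_exp 0 t" "flat_exp 0 t <= 1"
 by (auto simp: flat_exp_def)

lemma box_bump_bounds: "0 <= box_bump a b n x" "box_bump a b n x <= 1"
 unfolding box_bump_def using flat_exp_0_bounds
 by (auto intro!: prod_nonneg prod_le_1 mult_le_one)

lemma box_bump_outside: "x ~: box a b ==> box_bump a b n x = 0"
proof -
 assume "x ~: box a b"
 then obtain i where i: "i : Basis" "x \<bullet> i <= a \<bullet> i \<or> b \<bullet> i <= x \<bullet> i" by (force simp: mem_box)
 hence "flat_exp 0 (real n * (x \<bullet> i - a \<bullet> i)) * flat_exp 0 (real n * (b \<bullet> i - x \<bullet> i)) = 0"
  by (auto simp: flat_exp_def zero_less_mult_iff)
 thus ?thesis unfolding box_bump_def using i(1) by (intro prod_zero) auto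
qed

lemma test_function_box_bump: "test_function (box_bump a b n)"
proof -
 have "Ck k (box_bump a b n)" for k
 proof -
  have "Ck k (%x. \<Prod>i\<in>Basis. flat_exp 0 (x \<bullet> (real n *R i) + (- (real n * (a \<bullet> i)))) * flat_exp 0 (x \<bullet> ((- real n) *R i) + real n * (b \<bullet> i)))"
   by (intro Ck_prod Ck_mult Ck_comp_affine Ck_flat_exp)
  moreover have "box_bump a b n = (%x. \<Prod>i\<in>Basis. flat_exp 0 (x \<bullet> (real n *R i) + (- (real n * (a \<bullet> i)))) * flat_exp 0 (x \<bullet> ((- real n) *R i) + real n * (b \<bullet> i)))"
   by (auto simp: box_bump_def algebra_simps)
  ultimately show ?thesis by simp
 qed
 moreover have "closure {x. box_bump a b n x ~= 0} \<subseteq> cbox a b"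
  using box_bump_outside box_subset_cbox by (intro closure_minimal closed_cbox) blast
 hence "compact (closure {x. box_bump a b n x ~= 0})"
  by (auto simp: compact_eq_bounded_closed intro: bounded_subset[OF bounded_cbox])
 ultimately show ?thesis by (simp add: test_function_def)
qed

lemma box_bump_tendsto: "(%n. box_bump a b n x) ----> indicator (box a b) x"
proof (cases "x : box a b")
 case True
 have *: "(%n. flat_exp 0 (real n * d)) ----> 1" if d: "0 < d" for d
 proof (rule Lim_transform_eventually)
  show "(%n. exp (- (1 / d * inverse (real n)))) ----> 1"
   using tendsto_exp[OF tendsto_minus[OF tendsto_mult_right_zero[OF lim_inverse_n, of "1 / d"]]] by simp
  show "\<forall>\<^sub>F n in sequentially. exp (- (1 / d * inverse (real n))) = flat_exp 0 (real n * d)"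
   using eventually_gt_at_top[of 0] by eventually_elim (use d in \<open>auto simp: flat_exp_def field_simps\<close>)
 qed
 have "(%n. flat_exp 0 (real n * (x \<bullet> i - a \<bullet> i)) * flat_exp 0 (real n * (b \<bullet> i - x \<bullet> i))) ----> 1" if "i : Basis" for i
  using tendsto_mult[OF * *, of "x \<bullet> i - a \<bullet> i" "b \<bullet> i - x \<bullet> i"] True that by (simp add: mem_box)
 hence "(%n. box_bump a b n x) ----> (\<Prod>i\<in>(Basis :: 'a set). 1)"
  unfolding box_bump_def by (rule tendsto_prod)
 thus ?thesis using True by simp
qed (simp add: box_bump_outside)

lemma loc_int_measurable:
 fixes f :: "'a::euclidean_space => 'b::euclidean_space"
 assumes "locally_integrable f"
 shows "f : Borel"
proof (rule borel_measurable_LIMSEQ_metric)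
 show "(%x. indicator (cball 0 (real n)) x *R f x) : Borel" for n
  using assms unfolding locally_integrable_def set_integrable_def by (auto dest!: spec[of _ "cball 0 (real n)"])
 show "(%n. indicator (cball 0 (real n)) x *R f x) ----> f x" for x
 proof (rule tendsto_eventually)
  obtain n0 where "norm x <= real n0" using real_arch_simple by blast
  thus "\<forall>\<^sub>F n in sequentially. indicator (cball 0 (real n)) x *R f x = f x"
   by (intro eventually_sequentiallyI[of n0]) (auto simp: indicator_def)
 qed
qed

lemma loc_int_mult:
 fixes f :: "'a::euclidean_space => 'b::euclidean_space"
 assumes f: "locally_integrable f" and [measurable]: "g : Borel"
  and K: "compact K" "!!x. x ~: K ==> g x = 0" "!!x. \<bar>g x\<bar> <= B"
 shows "integrable lborel (%x. g x *R f x)"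
proof (rule Bochner_Integration.integrable_bound)
 note [measurable] = loc_int_measurable[OF f]
 show "integrable lborel (%x. B *R (indicator K x *R f x))"
  using f K(1) by (intro integrable_scaleR_right) (auto simp: locally_integrable_def set_integrable_def)
 show "(%x. g x *R f x) : borel_measurable lborel" by simp
 have "norm (g x *R f x) <= norm (B *R (indicator K x *R f x))" for x
  using K(2)[of x] K(3)[of x] by (cases "x : K") (auto intro!: mult_right_mono)
 thus "AE x in lborel. norm (g x *R f x) <= norm (B *R (indicator K x *R f x))" by simp
qed

lemma test_functionE:
 fixes \<phi> :: "'a::euclidean_space => real"
 assumes "test_function \<phi>"
 obtains K B where "compact K" "!!x. x ~: K ==> \<phi> x = 0" "!!x. \<bar>\<phi> x\<bar> <= B"
  "!!x i. x ~: K ==> FD \<phi> x i = 0"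
  "!!x i. i : Basis ==> \<bar>FD \<phi> x i\<bar> <= B" "0 <= B"
proof -
 define K where "K = closure {x. \<phi> x ~= 0}"
 have K: "compact K" using assms by (simp add: test_function_def K_def)
 have out: "\<phi> x = 0" if "x ~: K" for x using that closure_subset[of "{x. \<phi> x ~= 0}"] by (auto simp: K_def)
 have dout: "FD \<phi> x i = 0" if x: "x ~: K" for x i
 proof -
  have "((%x. 0) has_derivative (%x. 0)) (at x)" by simp
  moreover have "open (- K)" using K by (simp add: compact_imp_closed open_Compl)
  ultimately have "(\<phi> has_derivative (%x. 0)) (at x)"
   by (rule has_derivative_transform_within_open) (use x out in auto)
  thus ?thesis using frechet_derivative_at by metis
 qed
 have bd: "\<exists>B. \<forall>x. \<bar>f x\<bar> <= B" if "continuous_on UNIV f" "!!x. x ~: K ==> f x = 0" for f :: "'a => real"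
 proof -
  have "bounded (f ` K)"
   using K that(1) by (intro compact_imp_bounded compact_continuous_image) (auto intro: continuous_on_subset)
  then obtain B where "\<forall>y\<in>f ` K. norm y <= B" by (auto simp: bounded_iff)
  hence "\<bar>f x\<bar> <= max B 0" for x using that(2)[of x] by (cases "x : K") (auto simp: le_max_iff_disj)
  thus ?thesis by blast
 qed
 have C1: "Ck (Suc 0) \<phi>" using assms unfolding test_function_def by blast
 obtain B0 where B0: "!!x. \<bar>\<phi> x\<bar> <= B0" using bd[of \<phi>] Ck_Suc_D[OF C1] out by auto
 have "\<exists>B. \<forall>x. \<bar>FD \<phi> x i\<bar> <= B" if "i : Basis" for i
  using bd[of "%x. FD \<phi> x i"] C1 that dout by auto
 then obtain Bi where Bi: "!!i x. i : Basis ==> \<bar>FD \<phi> x i\<bar> <= Bi i" by metis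
 define B where "B = max 0 B0 + (\<Sum>i\<in>Basis. \<bar>Bi i\<bar>)"
 have s: "\<bar>Bi i\<bar> <= (\<Sum>i\<in>Basis. \<bar>Bi i\<bar>)" if "i : Basis" for i using that by (intro member_le_sum) auto
 have s0: "0 <= (\<Sum>i\<in>(Basis::'a set). \<bar>Bi i\<bar>)" by (intro sum_nonneg) auto
 show thesis
 proof (rule that[OF K out _ dout])
  show "\<bar>\<phi> x\<bar> <= B" for x using B0[of x] s0 unfolding B_def by linarith
  show "\<bar>FD \<phi> x i\<bar> <= B" if "i : Basis" for x i using Bi[OF that, of x] s[OF that] unfolding B_def by linarith
  show "0 <= B" using s0 unfolding B_def by linarith
 qed
qed

lemma test_function_continuous:
 assumes "test_function \<phi>"
 shows "continuous_on UNIV \<phi>" "\<phi> differentiable (at x)"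
  "i : Basis ==> continuous_on UNIV (%x. FD \<phi> x i)"
proof -
 have C1: "Ck (Suc 0) \<phi>" using assms unfolding test_function_def by blast
 show "continuous_on UNIV \<phi>" using Ck_Suc_D[OF C1] by simp
 show "\<phi> differentiable (at x)" "i : Basis ==> continuous_on UNIV (%x. FD \<phi> x i)"
  using C1 by auto
qed

text \<open>The fundamental lemma of the calculus of variations: test functions approximate the
 indicators of boxes, and boxes determine a measure.\<close>

lemma du_Bois_Reymond:
 fixes f :: "'a::euclidean_space => real"
 assumes f: "locally_integrable f" and zero: "!!\<phi>. test_function \<phi> ==> (LINT x|lborel. f x * \<phi> x) = 0"
 shows "AE x in lborel. f x = 0"
proof -
 note f_meas [measurable] = loc_int_measurable[OF f]
 have cbox: "integrable lborel (%x. indicator (cbox a b) x * f x)" for a b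
  using f by (auto simp: locally_integrable_def set_integrable_def)
 have int_box: "integrable lborel (%x. indicator (box a b) x * f x)" for a b
  using set_integrable_subset[of lborel "cbox a b" f "box a b"] cbox[of a b] box_subset_cbox[of a b]
  by (auto simp: set_integrable_def)
 have box0: "(LINT x|lborel. indicator (box a b) x * f x) = 0" for a b
 proof -
  have bb [measurable]: "box_bump a b n : Borel" for n
   by (intro borel_measurable_continuous_onI test_function_continuous test_function_box_bump)
  have "(%n. LINT x|lborel. f x * box_bump a b n x) ----> (LINT x|lborel. f x * indicator (box a b) x)"
  proof (rule integral_dominated_convergence[where w="%x. \<bar>indicator (cbox a b) x * f x\<bar>"])
   show "AE x in lborel. (%n. f x * box_bump a b n x) ----> f x * indicator (box a b) x"
    by (intro AE_I2 tendsto_intros box_bump_tendsto)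
   show "AE x in lborel. norm (f x * box_bump a b n x) <= \<bar>indicator (cbox a b) x * f x\<bar>" for n
   proof (rule AE_I2)
    fix x
    show "norm (f x * box_bump a b n x) <= \<bar>indicator (cbox a b) x * f x\<bar>"
    proof (cases "x : cbox a b")
     case True
     thus ?thesis using box_bump_bounds[of a b n x] by (simp add: abs_mult mult_left_le)
    next
     case False
     hence "x ~: box a b" using box_subset_cbox by blast
     thus ?thesis using box_bump_outside[of x a b n] by simp
    qed
   qed
  qed (use cbox in auto)
  hence "(%n. 0) ----> (LINT x|lborel. f x * indicator (box a b) x)"
   using zero[OF test_function_box_bump] by simp
  thus ?thesis by (simp add: LIMSEQ_const_iff mult.commute)
 qed
 have "AE x in lborel. x : box (- (real m *R One)) (real m *R One) --> f x = 0" for m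
 proof -
  define Q where "Q = box (- (real m *R One)) (real m *R One :: 'a)"
  define fp fm where "fp x = indicator Q x * max 0 (f x)" and "fm x = indicator Q x * max 0 (- f x)" for x
  have fpm: "fp x - fm x = indicator Q x * f x" "0 <= fp x" "0 <= fm x" for x
   by (auto simp: fp_def fm_def max_def split: split_indicator)
  have [measurable]: "fp : Borel" "fm : Borel" unfolding fp_def fm_def Q_def by auto
  have ifp: "integrable lborel fp" "integrable lborel fm"
   by (rule Bochner_Integration.integrable_bound[OF int_box[of "- (real m *R One)" "real m *R One"]],
     auto simp: fp_def fm_def Q_def split: split_indicator)+
  have eqbox: "emeasure (density lborel fp) X = emeasure (density lborel fm) X" if X: "X : range (%(a, b). box a b)" for X
  proof -
   from X obtain a b where "X = box a b" by auto
   then obtain c d where cd: "X \<inter> Q = box c d" unfolding Q_def by (auto simp: box_Int_box)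
   have [measurable]: "X : sets borel" using X by auto
   have i: "integrable lborel (%x. indicator X x * fp x)" "integrable lborel (%x. indicator X x * fm x)"
    using ifp integrable_mult_indicator[of X lborel fp] integrable_mult_indicator[of X lborel fm] by auto
   have "(LINT x|lborel. indicator X x * fp x) - (LINT x|lborel. indicator X x * fm x)
    = (LINT x|lborel. indicator X x * fp x - indicator X x * fm x)" using i by simp
   also have "... = (LINT x|lborel. indicator (box c d) x * f x)"
    unfolding cd[symmetric] using fpm(1)
    by (intro Bochner_Integration.integral_cong) (auto simp: right_diff_distrib[symmetric] split: split_indicator)
   finally have eq: "(LINT x|lborel. indicator X x * fp x) = (LINT x|lborel. indicator X x * fm x)" using box0 by simp
   have "emeasure (density lborel fp) X = (\<integral>x. ennreal (indicator X x * fp x))"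
    by (subst emeasure_density) (auto intro!: nn_integral_cong split: split_indicator)
   also have "... = (\<integral>x. ennreal (indicator X x * fm x))"
    using i eq fpm by (subst (1 2) nn_integral_eq_integral) auto
   also have "... = emeasure (density lborel fm) X"
    by (subst emeasure_density) (auto intro!: nn_integral_cong split: split_indicator)
   finally show ?thesis .
  qed
  have "density lborel fp = density lborel fm"
  proof (rule measure_eqI_generator_eq[where E="range (%(a, b). box a b :: 'a set)" and \<Omega>=UNIV
     and A="%n::nat. box (- (real n *R One)) (real n *R One)"])
   show "Int_stable (range (%(a, b). box a b :: 'a set))" by (auto simp: Int_stable_def box_Int_box)
   show "emeasure (density lborel fp) (box (- (real n *R One)) (real n *R One)) ~= \<infinity>" for n
   proof -
    have "emeasure (density lborel fp) (box (- (real n *R One)) (real n *R One)) <= (\<integral>x. ennreal (fp x))"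
     by (subst emeasure_density) (auto intro!: nn_integral_mono split: split_indicator)
    also have "... < \<infinity>" using ifp(1) fpm(2) by (simp add: nn_integral_eq_integral)
    finally show ?thesis by simp
   qed
  qed (use eqbox in \<open>auto simp: UN_box_eq_UNIV borel_eq_box\<close>)
  hence "AE x in lborel. ennreal (fp x) = ennreal (fm x)"
   by (intro sigma_finite_measure.density_unique[OF sigma_finite_lborel]) auto
  thus ?thesis
  proof eventually_elim
   case (elim x)
   hence "fp x = fm x" using fpm(2,3)[of x] by simp
   hence "indicator Q x * f x = 0" using fpm(1)[of x] by simp
   thus ?case by (auto simp: Q_def split: split_indicator_asm)
  qed
 qed
 hence "AE x in lborel. \<forall>m::nat. x : box (- (real m *R One)) (real m *R One) --> f x = 0"
  unfolding AE_all_countable by blast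
 thus ?thesis
 proof eventually_elim
  case (elim x)
  have "x : (\<Union>m::nat. box (- (real m *R One)) (real m *R One))" by (simp add: UN_box_eq_UNIV)
  thus ?case using elim by blast
 qed
qed

section \<open>Weak gradients\<close>

lemma integrable_lborel_shift:
 fixes f :: "'a::euclidean_space => 'b::euclidean_space"
 assumes "integrable lborel f"
 shows "integrable lborel (%x. f (x + h))"
proof -
 have [measurable]: "f : Borel" using assms by auto
 have "integrable (distr lborel borel ((+) h)) f" using assms by (simp only: lborel_distr_plus)
 thus ?thesis by (subst (asm) integrable_distr_eq) (auto simp: add.commute)
qed

lemma integral_lborel_shift:
 fixes f :: "'a::euclidean_space => 'b::euclidean_space"
 assumes [measurable]: "f : Borel"
 shows "(LINT x|lborel. f (x + h)) = (LINT x|lborel. f x)"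
proof -
 have "(LINT x|lborel. f x) = (LINT x|distr lborel borel ((+) h). f x)" by (simp only: lborel_distr_plus)
 also have "... = (LINT x|lborel. f (x + h))" by (subst integral_distr) (auto simp: add.commute)
 finally show ?thesis by simp
qed

lemma loc_int_iff:
 fixes f :: "'a::euclidean_space => 'b::euclidean_space"
 shows "locally_integrable f \<longleftrightarrow> f : Borel &
  (\<forall>K. compact K --> (\<integral>x. ennreal (norm (f x)) * indicator K x) < \<infinity>)" (is "_ \<longleftrightarrow> ?R")
proof -
 have eq: "(\<integral>x. ennreal (norm (indicator K x *R f x))) = (\<integral>x. ennreal (norm (f x)) * indicator K x)" for K
  by (intro nn_integral_cong) (auto split: split_indicator)
 show ?thesis
 proof
  assume l: "locally_integrable f"
  hence "(\<integral>x. ennreal (norm (indicator K x *R f x))) < \<infinity>" if "compact K" for K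
   using that unfolding locally_integrable_def set_integrable_def integrable_iff_bounded by blast
  thus ?R using loc_int_measurable[OF l] eq by simp
 next
  assume R: ?R
  hence [measurable]: "f : Borel" by simp
  show "locally_integrable f" unfolding locally_integrable_def set_integrable_def
   using R eq by (intro allI impI integrableI_bounded) (auto intro!: borel_measurable_scaleR borel_measurable_indicator simp: borel_compact)
 qed
qed

lemma loc_int_mono:
 fixes f :: "'a::euclidean_space => 'b::euclidean_space" and g :: "'a => 'c::euclidean_space"
 assumes g: "locally_integrable g" and f: "f : Borel" and le: "AE x in lborel. norm (f x) <= norm (g x)"
 shows "locally_integrable f"
 unfolding loc_int_iff
proof (intro conjI allI impI f)
 fix K :: "'a set" assume "compact K"
 have "(\<integral>x. ennreal (norm (f x)) * indicator K x) <= (\<integral>x. ennreal (norm (g x)) * indicator K x)"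
  by (intro nn_integral_mono_AE) (use le in eventually_elim, auto split: split_indicator intro: ennreal_leI)
 also have "... < \<infinity>" using g \<open>compact K\<close> by (auto simp: loc_int_iff)
 finally show "(\<integral>x. ennreal (norm (f x)) * indicator K x) < \<infinity>" .
qed

lemma loc_int_add:
 fixes f g :: "'a::euclidean_space => 'b::euclidean_space"
 assumes "locally_integrable f" "locally_integrable g"
 shows "locally_integrable (%x. f x + g x)"
 using assms unfolding locally_integrable_def by (auto intro: set_integral_add)

lemma loc_int_scaleR:
 fixes f :: "'a::euclidean_space => 'b::euclidean_space"
 assumes "locally_integrable f"
 shows "locally_integrable (%x. c *R f x)"
 using assms unfolding locally_integrable_def set_integrable_def scaleR_left_commute[of _ c]
 by (auto intro!: integrable_scaleR_right simp del: scaleR_scaleR)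

lemma loc_int_inner:
 fixes f :: "'a::euclidean_space => 'b::euclidean_space"
 assumes "locally_integrable f"
 shows "locally_integrable (%x. f x \<bullet> h)"
proof -
 have "integrable lborel (%x. (indicator K x *R f x) \<bullet> h)" if "compact K" for K
  using assms that unfolding locally_integrable_def set_integrable_def by (intro integrable_inner_left) auto
 thus ?thesis unfolding locally_integrable_def set_integrable_def by simp
qed

lemma loc_int_const: "locally_integrable (%x::'a::euclidean_space. c :: 'b::euclidean_space)"
 unfolding locally_integrable_def set_integrable_def
 using emeasure_compact_finite by (auto intro!: integrable_scaleR_left integrable_real_indicator simp: borel_compact)

lemma loc_int_diff:
 fixes f g :: "'a::euclidean_space => 'b::euclidean_space"
 assumes "locally_integrable f" "locally_integrable g"
 shows "locally_integrable (%x. f x - g x)"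
 using loc_int_add[OF assms(1) loc_int_scaleR[OF assms(2), of "-1"]] by simp

lemma loc_int_shift:
 fixes f :: "'a::euclidean_space => 'b::euclidean_space"
 assumes "locally_integrable f"
 shows "locally_integrable (%x. f (x + h))"
 unfolding locally_integrable_def
proof (intro allI impI)
 fix K :: "'a set" assume K: "compact K"
 have "compact ((%x. x + h) ` K)" using compact_translation[OF K, of h] by (simp add: add.commute)
 hence "integrable lborel (%x. indicator ((%x. x + h) ` K) x *R f x)"
  using assms by (auto simp: locally_integrable_def set_integrable_def)
 from integrable_lborel_shift[OF this, of h]
 show "set_integrable lborel K (%x. f (x + h))"
  unfolding set_integrable_def by (rule Bochner_Integration.integrable_cong[THEN iffD1, rotated 2])
   (auto split: split_indicator)
qed

lemma loc_int_powr_norm: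
 fixes \<mu> :: real
 assumes p: "1 < p" and [measurable]: "f : Borel"
  and f: "(Lp p f) < \<infinity>"
 shows "locally_integrable (f :: 'a::euclidean_space => 'b::euclidean_space)"
 unfolding loc_int_iff
proof (intro conjI allI impI)
 fix K :: "'a set" assume K: "compact K"
 hence [measurable]: "K : sets borel" by (simp add: borel_compact)
 have "(\<integral>x. ennreal (norm (f x)) * indicator K x) <= (\<integral>x. indicator K x + ennreal (norm (f x) powr p))"
 proof (rule nn_integral_mono)
  fix x
  have "norm (f x) <= 1 + norm (f x) powr p"
  proof (cases "norm (f x) <= 1")
   case False
   hence "norm (f x) powr 1 <= norm (f x) powr p" using p by (intro powr_mono) auto
   thus ?thesis using False by simp
  qed (smt (verit) powr_ge_zero)
  hence "ennreal (norm (f x)) <= ennreal (1 + norm (f x) powr p)" by (rule ennreal_leI)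
  also have "... = 1 + ennreal (norm (f x) powr p)" by simp
  finally show "ennreal (norm (f x)) * indicator K x <= indicator K x + ennreal (norm (f x) powr p)"
   by (cases "x : K") auto
 qed
 also have "... = emeasure lborel K + (Lp p f)"
  by (subst nn_integral_add) auto
 also have "... < \<infinity>" using f emeasure_compact_finite[OF K] by (simp add: less_top)
 finally show "(\<integral>x. ennreal (norm (f x)) * indicator K x) < \<infinity>" .
qed simp

subsection \<open>Directional derivatives of test functions\<close>

lemma test_function_dir:
 fixes \<phi> :: "'a::euclidean_space => real"
 assumes "test_function \<phi>"
 shows "FD \<phi> x h = (\<Sum>i\<in>Basis. (h \<bullet> i) * FD \<phi> x i)"
proof -
 have lin: "linear (FD \<phi> x)"
  by (intro linear_frechet_derivative test_function_continuous(2) assms)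
 have "FD \<phi> x h = FD \<phi> x (\<Sum>i\<in>Basis. (h \<bullet> i) *R i)"
  by (simp add: euclidean_representation)
 also have "... = (\<Sum>i\<in>Basis. (h \<bullet> i) * FD \<phi> x i)"
  using lin by (simp add: linear_sum linear_cmul)
 finally show ?thesis .
qed

lemma test_function_dir_continuous:
 fixes \<phi> :: "'a::euclidean_space => real"
 assumes "test_function \<phi>"
 shows "continuous_on UNIV (%x. FD \<phi> x h)"
 unfolding test_function_dir[OF assms, of _ h]
 by (intro continuous_intros test_function_continuous(3)[OF assms])

lemma weak_gradient_dir:
 assumes wg: "has_weak_gradient u G" and \<phi>: "test_function \<phi>"
 shows "(LINT x|lborel. u x * FD \<phi> x h) = - (LINT x|lborel. (G x \<bullet> h) * \<phi> x)"
proof -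
 obtain K B where K: "compact K" "!!x. x ~: K ==> \<phi> x = 0" "!!x. \<bar>\<phi> x\<bar> <= B"
  "!!x i. x ~: K ==> FD \<phi> x i = 0"
  "!!x i. i : Basis ==> \<bar>FD \<phi> x i\<bar> <= B" "0 <= B"
  using test_functionE[OF \<phi>] by blast
 have u: "locally_integrable u" and G: "locally_integrable G"
  and eq: "!!i. i : Basis ==> (LINT x|lborel. u x * FD \<phi> x i) = - (LINT x|lborel. (G x \<bullet> i) * \<phi> x)"
  using wg \<phi> unfolding has_weak_gradient_def by blast+
 have [measurable]: "\<phi> : Borel" "(%x. FD \<phi> x i) : Borel" for i
  by (intro borel_measurable_continuous_onI test_function_continuous test_function_dir_continuous \<phi>)+
 have i1: "integrable lborel (%x. u x * FD \<phi> x i)" if "i : Basis" for i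
  using loc_int_mult[OF u _ K(1), of "%x. FD \<phi> x i" B] K(4) K(5)[OF that] by (simp add: mult.commute)
 have i2: "integrable lborel (%x. (G x \<bullet> i) * \<phi> x)" for i
  using loc_int_mult[OF loc_int_inner[OF G, of i] _ K(1-3)] by (simp add: mult.commute)
 have "(LINT x|lborel. u x * FD \<phi> x h) = (LINT x|lborel. (\<Sum>i\<in>Basis. (h \<bullet> i) * (u x * FD \<phi> x i)))"
  unfolding test_function_dir[OF \<phi>, of _ h] by (simp add: sum_distrib_left mult_ac)
 also have "... = (\<Sum>i\<in>Basis. (h \<bullet> i) * (LINT x|lborel. u x * FD \<phi> x i))"
  using i1 by (subst Bochner_Integration.integral_sum) auto
 also have "... = - (\<Sum>i\<in>Basis. (h \<bullet> i) * (LINT x|lborel. (G x \<bullet> i) * \<phi> x))"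
  using eq by (simp add: sum_negf)
 also have "(\<Sum>i\<in>Basis. (h \<bullet> i) * (LINT x|lborel. (G x \<bullet> i) * \<phi> x)) = (LINT x|lborel. (\<Sum>i\<in>Basis. (h \<bullet> i) * ((G x \<bullet> i) * \<phi> x)))"
  using i2 by (subst Bochner_Integration.integral_sum) auto
 also have "... = (LINT x|lborel. (G x \<bullet> h) * \<phi> x)"
  by (intro Bochner_Integration.integral_cong refl, subst (2) euclidean_inner) (simp add: sum_distrib_right sum_distrib_left mult_ac)
 finally show ?thesis .
qed

lemma Ck_shift: "Ck k f ==> Ck k (%x. f (x + c))"
proof (induction k arbitrary: f)
 case 0
 thus ?case by (auto intro!: continuous_intros continuous_on_compose2[of UNIV f])
next
 case (Suc k)
 have d: "((%x. f (x + c)) has_derivative frechet_derivative f (at (x + c))) (at x)" for x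
 proof -
  have "(f has_derivative frechet_derivative f (at (x + c))) (at (x + c))"
   using Suc.prems by (simp add: frechet_derivative_works[symmetric])
  moreover have "((%x. x + c) has_derivative (%i. i)) (at x)" by (auto intro!: derivative_eq_intros)
  ultimately show ?thesis by (rule has_derivative_compose[rotated])
 qed
 have "frechet_derivative (%x. f (x + c)) (at x) = frechet_derivative f (at (x + c))" for x
  using frechet_derivative_at[OF d[of x]] by simp
 moreover have "(%x. f (x + c)) differentiable (at x)" for x using d by (auto simp: differentiable_def)
 moreover have "Ck k (%x. frechet_derivative f (at (x + c)) i)" if "i : Basis" for i
  using Suc.IH[of "%x. FD f x i"] Suc.prems that by simp
 ultimately show ?case by simp
qed

lemma test_function_shift:
 fixes \<phi> :: "'a::euclidean_space => real"
 assumes \<phi>: "test_function \<phi>"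
 shows "test_function (%x. \<phi> (x + c))"
  "frechet_derivative (%x. \<phi> (x + c)) (at x) = frechet_derivative \<phi> (at (x + c))"
proof -
 define K where "K = closure {x. \<phi> x ~= 0}"
 have K: "compact K" using \<phi> by (simp add: test_function_def K_def)
 have "{x. \<phi> (x + c) ~= 0} \<subseteq> (%x. - c + x) ` K"
 proof
  fix x assume "x : {x. \<phi> (x + c) ~= 0}"
  hence "x + c : K" using closure_subset[of "{x. \<phi> x ~= 0}"] by (auto simp: K_def)
  thus "x : (%x. - c + x) ` K" by (intro image_eqI[of _ _ "x + c"]) auto
 qed
 hence "bounded (closure {x. \<phi> (x + c) ~= 0})"
  using compact_imp_bounded[OF compact_translation[OF K]] bounded_subset by (blast intro: bounded_closure)
 thus "test_function (%x. \<phi> (x + c))"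
  using \<phi> Ck_shift unfolding test_function_def by (auto simp: compact_eq_bounded_closed)
 have "(\<phi> has_derivative frechet_derivative \<phi> (at (x + c))) (at (x + c))"
  using test_function_continuous(2)[OF \<phi>] by (simp add: frechet_derivative_works[symmetric])
 moreover have "((%x. x + c) has_derivative (%i. i)) (at x)" by (auto intro!: derivative_eq_intros)
 ultimately have "((%x. \<phi> (x + c)) has_derivative frechet_derivative \<phi> (at (x + c))) (at x)"
  by (rule has_derivative_compose[rotated])
 thus "frechet_derivative (%x. \<phi> (x + c)) (at x) = frechet_derivative \<phi> (at (x + c))"
  using frechet_derivative_at by metis
qed

lemma test_function_line:
 fixes \<phi> :: "'a::euclidean_space => real"
 assumes \<phi>: "test_function \<phi>"
 shows "((%t. \<phi> (x - t *R h)) has_real_derivative - frechet_derivative \<phi> (at (x - t *R h)) h) (at t)"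
proof -
 have "(\<phi> has_derivative frechet_derivative \<phi> (at (x - t *R h))) (at (x - t *R h))"
  using test_function_continuous(2)[OF \<phi>] by (simp add: frechet_derivative_works[symmetric])
 moreover have "((%t. x - t *R h) has_derivative (%s. - (s *R h))) (at t)" by (auto intro!: derivative_eq_intros)
 ultimately have "((%t. \<phi> (x - t *R h)) has_derivative (%s. frechet_derivative \<phi> (at (x - t *R h)) (- (s *R h)))) (at t)"
  by (rule has_derivative_compose[rotated])
 moreover have "linear (frechet_derivative \<phi> (at (x - t *R h)))"
  by (intro linear_frechet_derivative test_function_continuous(2) \<phi>)
 hence "frechet_derivative \<phi> (at (x - t *R h)) (- (s *R h)) = - frechet_derivative \<phi> (at (x - t *R h)) h * s" for s
  by (simp add: linear_neg linear_cmul)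
 hence "(%s. frechet_derivative \<phi> (at (x - t *R h)) (- (s *R h))) = (*) (- frechet_derivative \<phi> (at (x - t *R h)) h)"
  by auto
 ultimately show ?thesis by (simp add: has_field_derivative_def)
qed

subsection \<open>Uniqueness and linearity\<close>

lemma weak_gradient_unique:
 assumes G: "has_weak_gradient u G" and H: "has_weak_gradient v H" and uv: "AE x in lborel. u x = v x"
 shows "AE x in lborel. G x = H x"
proof -
 have "AE x in lborel. (G x - H x) \<bullet> i = 0" if i: "i : Basis" for i
 proof (rule du_Bois_Reymond)
  have lG: "locally_integrable G" and lH: "locally_integrable H" and lu: "locally_integrable u" and lv: "locally_integrable v"
   using G H unfolding has_weak_gradient_def by blast+
  show "locally_integrable (%x. (G x - H x) \<bullet> i)"
   by (intro loc_int_inner loc_int_diff lG lH)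
  fix \<phi> :: "'a => real" assume \<phi>: "test_function \<phi>"
  obtain K B where K: "compact K" "!!x. x ~: K ==> \<phi> x = 0" "!!x. \<bar>\<phi> x\<bar> <= B"
   "!!x i. x ~: K ==> FD \<phi> x i = 0"
   "!!x i. i : Basis ==> \<bar>FD \<phi> x i\<bar> <= B" "0 <= B"
   using test_functionE[OF \<phi>] by blast
  have [measurable]: "\<phi> : Borel" "(%x. FD \<phi> x i) : Borel"
   by (intro borel_measurable_continuous_onI test_function_continuous \<phi> i)+
  note [measurable] = loc_int_measurable[OF lu] loc_int_measurable[OF lv]
  have "integrable lborel (%x. (G x \<bullet> i) * \<phi> x)" "integrable lborel (%x. (H x \<bullet> i) * \<phi> x)"
   using loc_int_mult[OF loc_int_inner[OF lG, of i] _ K(1-3)]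
      loc_int_mult[OF loc_int_inner[OF lH, of i] _ K(1-3)] by (simp_all add: mult.commute)
  hence "(LINT x|lborel. ((G x - H x) \<bullet> i) * \<phi> x) = (LINT x|lborel. (G x \<bullet> i) * \<phi> x) - (LINT x|lborel. (H x \<bullet> i) * \<phi> x)"
   by (simp add: inner_diff_left left_diff_distrib)
  also have "... = (LINT x|lborel. v x * FD \<phi> x i) - (LINT x|lborel. u x * FD \<phi> x i)"
   using weak_gradient_dir[OF G \<phi>, of i] weak_gradient_dir[OF H \<phi>, of i] by simp
  also have "(LINT x|lborel. v x * FD \<phi> x i) = (LINT x|lborel. u x * FD \<phi> x i)"
  proof (rule integral_cong_AE)
   show "AE x in lborel. v x * FD \<phi> x i = u x * FD \<phi> x i"
    using uv by eventually_elim simp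
  qed measurable
  finally show "(LINT x|lborel. ((G x - H x) \<bullet> i) * \<phi> x) = 0" by simp
 qed
 hence "AE x in lborel. \<forall>i\<in>Basis. (G x - H x) \<bullet> i = 0"
  by (intro AE_finite_allI) auto
 thus ?thesis
 proof eventually_elim
  case (elim x)
  hence "G x - H x = 0" by (simp only: euclidean_all_zero_iff)
  thus ?case by simp
 qed
qed

lemma weak_gradient_AE:
 assumes "has_weak_gradient u G"
 shows "has_weak_gradient u (weak_gradient u)" "AE x in lborel. weak_gradient u x = G x"
proof -
 show *: "has_weak_gradient u (weak_gradient u)"
  unfolding weak_gradient_def using someI[of "has_weak_gradient u" G] assms by simp
 show "AE x in lborel. weak_gradient u x = G x"
  by (rule weak_gradient_unique[OF * assms]) simp
qed

lemma has_weak_gradient_lincomb: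
 assumes G: "has_weak_gradient u G" and H: "has_weak_gradient v H"
 shows "has_weak_gradient (%x. a * u x + c * v x) (%x. a *R G x + c *R H x)"
proof -
 have lG: "locally_integrable G" and lH: "locally_integrable H" and lu: "locally_integrable u" and lv: "locally_integrable v"
  using G H unfolding has_weak_gradient_def by blast+
 show ?thesis unfolding has_weak_gradient_def
 proof (intro conjI allI impI ballI)
  show "locally_integrable (%x. a * u x + c * v x)"
   using loc_int_add[OF loc_int_scaleR[OF lu, of a] loc_int_scaleR[OF lv, of c]] by simp
  show "locally_integrable (%x. a *R G x + c *R H x)"
   by (intro loc_int_add loc_int_scaleR lG lH)
  fix \<phi> :: "'a => real" and i :: 'a assume \<phi>: "test_function \<phi>" and i: "i : Basis"
  obtain K B where K: "compact K" "!!x. x ~: K ==> \<phi> x = 0" "!!x. \<bar>\<phi> x\<bar> <= B"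
   "!!x i. x ~: K ==> FD \<phi> x i = 0"
   "!!x i. i : Basis ==> \<bar>FD \<phi> x i\<bar> <= B" "0 <= B"
   using test_functionE[OF \<phi>] by blast
  have [measurable]: "\<phi> : Borel" "(%x. FD \<phi> x i) : Borel"
   by (intro borel_measurable_continuous_onI test_function_continuous \<phi> i)+
  have "integrable lborel (%x. (G x \<bullet> i) * \<phi> x)" "integrable lborel (%x. (H x \<bullet> i) * \<phi> x)"
   using loc_int_mult[OF loc_int_inner[OF lG, of i] _ K(1-3)]
      loc_int_mult[OF loc_int_inner[OF lH, of i] _ K(1-3)] by (simp_all add: mult.commute)
  moreover have "integrable lborel (%x. u x * FD \<phi> x i)" "integrable lborel (%x. v x * FD \<phi> x i)"
   using loc_int_mult[OF lu _ K(1), of "%x. FD \<phi> x i" B]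
    loc_int_mult[OF lv _ K(1), of "%x. FD \<phi> x i" B] K(4) K(5)[OF i]
   by (simp_all add: mult.commute)
  ultimately show "(LINT x|lborel. (a * u x + c * v x) * FD \<phi> x i) = - (LINT x|lborel. ((a *R G x + c *R H x) \<bullet> i) * \<phi> x)"
   using weak_gradient_dir[OF G \<phi>, of i] weak_gradient_dir[OF H \<phi>, of i]
   by (simp add: inner_add_left distrib_right mult.assoc)
 qed
qed

subsection \<open>Translates\<close>

text \<open>A weakly differentiable function is the integral of its gradient along almost every translate of
 a segment.  Tested against \<open>\<phi>\<close>, this is the classical statement for \<open>\<phi>\<close>, moved over by
 Fubini.  Difference quotients and translation
 estimates are read off from it.\<close>

lemma translate_eq_integral:
 fixes u :: "'a::euclidean_space => real" and G :: "'a => 'a"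
 assumes wg: "has_weak_gradient u G"
 shows "AE x in lborel. u (x + h) - u x = (LINT t|lborel. I01 t * (G (x + t *R h) \<bullet> h))"
proof -
 have u: "locally_integrable u" and G: "locally_integrable G"
  using wg unfolding has_weak_gradient_def by blast+
 note [measurable] = loc_int_measurable[OF u] loc_int_measurable[OF G]
 define W where "W x = (LINT t|lborel. I01 t * (G (x + t *R h) \<bullet> h))" for x
 have tube: "compact ((%(y, t). y + t *R h) ` (K \<times> {0..1::real}))" if "compact K" for K :: "'a set"
  using that by (intro compact_continuous_image compact_Times)
   (auto intro!: continuous_intros simp: case_prod_beta)
 have tubeI: "x : (%(y, t). y + t *R h) ` (K \<times> {0..1::real})" if "x - t *R h : K" "t : {0..1}" for x t K
  using that by (intro image_eqI[of _ _ "(x - t *R h, t)"]) auto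
 have prod_int: "integrable lborel2 (%(x, t). f x * I01 t)"
  if f: "integrable lborel f" for f :: "'a => real"
 proof -
  have [measurable]: "f : Borel" using f by auto
  show ?thesis
  proof (rule integrableI_bounded)
   have "(\<integral>\<^sup>+z. ennreal (norm (case z of (x, t) => f x * I01 t)) \<partial>lborel2)
    = (\<integral>x. (\<integral>t. ennreal \<bar>f x\<bar> * I01 t))"
    by (subst lborel.nn_integral_fst[symmetric])
     (auto intro!: nn_integral_cong simp: abs_mult split: split_indicator)
   also have "... = (\<integral>x. ennreal \<bar>f x\<bar>)" by (simp add: nn_integral_cmult)
   also have "... < \<infinity>" using f by (simp add: integrable_iff_bounded)
   finally show "(\<integral>\<^sup>+z. ennreal (norm (case z of (x, t) => f x * I01 t)) \<partial>lborel2) < \<infinity>" .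
  qed measurable
 qed
 have Gint: "integrable lborel2 (%(x, t). g x * (I01 t * (G (x + t *R h) \<bullet> h)))"
  if [measurable]: "g : Borel" and K: "compact K" "!!x. x ~: K ==> g x = 0" "!!x. \<bar>g x\<bar> <= B"
  for g :: "'a => real" and K B
 proof (rule integrableI_bounded)
  define K' where "K' = (%(y, t). y + t *R h) ` (K \<times> {0..1::real})"
  have K': "compact K'" using tube K by (simp add: K'_def)
  hence [measurable]: "K' : sets borel" by (simp add: borel_compact)
  have "(\<integral>\<^sup>+z. ennreal (norm (case z of (x, t) => g x * (I01 t * (G (x + t *R h) \<bullet> h)))) \<partial>lborel2)
   = (\<integral>t. (\<integral>x. ennreal (\<bar>g x\<bar> * \<bar>G (x + t *R h) \<bullet> h\<bar>) * I01 t))"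
   by (subst lborel_pair.nn_integral_snd[symmetric]) (auto intro!: nn_integral_cong simp: abs_mult split: split_indicator)
  also have "... <= (\<integral>t. (\<integral>x. (ennreal (B * norm h) * (ennreal (norm (G x)) * indicator K' x))) * I01 t)"
  proof (rule nn_integral_mono)
   fix t :: real
   have "(\<integral>x. ennreal (\<bar>g x\<bar> * \<bar>G (x + t *R h) \<bullet> h\<bar>) * I01 t)
    = (\<integral>x. ennreal (\<bar>g (x + t *R h - t *R h)\<bar> * \<bar>G (x + t *R h) \<bullet> h\<bar>) * I01 t)" by simp
   also have "... = (\<integral>x. ennreal (\<bar>g (x - t *R h)\<bar> * \<bar>G x \<bullet> h\<bar>) * I01 t)"
    by (rule nn_integral_lborel_shift[where f="%x. ennreal (\<bar>g (x - t *R h)\<bar> * \<bar>G x \<bullet> h\<bar>) * I01 t"]) measurable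
   also have "... <= (\<integral>x. (ennreal (B * norm h) * (ennreal (norm (G x)) * indicator K' x)) * I01 t)"
   proof (rule nn_integral_mono)
    fix x
    show "ennreal (\<bar>g (x - t *R h)\<bar> * \<bar>G x \<bullet> h\<bar>) * I01 t
     <= (ennreal (B * norm h) * (ennreal (norm (G x)) * indicator K' x)) * I01 t"
    proof (cases "x - t *R h : K & t : {0..1}")
     case True
     have "\<bar>g (x - t *R h)\<bar> * \<bar>G x \<bullet> h\<bar> <= B * (norm (G x) * norm h)"
      using K(3)[of "x - t *R h"] Cauchy_Schwarz_ineq2[of "G x" h] by (intro mult_mono) auto
     moreover have "0 <= B" using K(3)[of 0] by linarith
     ultimately show ?thesis using True tubeI[of x t K]
      by (simp add: K'_def ennreal_mult[symmetric] mult_ac ennreal_leI)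
    next
     case False
     hence "\<bar>g (x - t *R h)\<bar> = 0 \<or> I01 t = (0::ennreal)" using K(2) by auto
     thus ?thesis by auto
    qed
   qed
   also have "... = (\<integral>x. (ennreal (B * norm h) * (ennreal (norm (G x)) * indicator K' x))) * I01 t"
    by (rule nn_integral_multc) measurable
   finally show "(\<integral>x. ennreal (\<bar>g x\<bar> * \<bar>G (x + t *R h) \<bullet> h\<bar>) * I01 t)
    <= (\<integral>x. (ennreal (B * norm h) * (ennreal (norm (G x)) * indicator K' x))) * I01 t" .
  qed
  also have "... = (\<integral>x. (ennreal (B * norm h) * (ennreal (norm (G x)) * indicator K' x)))"
   by (subst nn_integral_cmult) auto
  also have "... = ennreal (B * norm h) * (\<integral>x. ennreal (norm (G x)) * indicator K' x)"
   by (rule nn_integral_cmult) measurable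
  also have "... < \<infinity>" using G K' by (auto simp: loc_int_iff ennreal_mult_less_top)
  finally show "(\<integral>\<^sup>+z. ennreal (norm (case z of (x, t) => g x * (I01 t * (G (x + t *R h) \<bullet> h)))) \<partial>lborel2) < \<infinity>" .
 qed measurable
 have W: "locally_integrable W"
  unfolding locally_integrable_def
 proof (intro allI impI)
  fix K :: "'a set" assume K: "compact K"
  hence [measurable]: "K : sets borel" by (simp add: borel_compact)
  have "integrable lborel2 (%(x, t). indicator K x * (I01 t * (G (x + t *R h) \<bullet> h)))"
   by (rule Gint[OF _ K, of _ 1]) auto
  from lborel_pair.integrable_fst[OF this]
  show "set_integrable lborel K W" unfolding set_integrable_def W_def by simp
 qed
 have "AE x in lborel. u (x + h) - u x - W x = 0"
 proof (rule du_Bois_Reymond)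
  show "locally_integrable (%x. u (x + h) - u x - W x)"
   by (intro loc_int_diff loc_int_shift u W)
  fix \<phi> :: "'a => real" assume \<phi>: "test_function \<phi>"
  obtain K B where K: "compact K" "!!x. x ~: K ==> \<phi> x = 0" "!!x. \<bar>\<phi> x\<bar> <= B"
   "!!x i. x ~: K ==> FD \<phi> x i = 0"
   "!!x i. i : Basis ==> \<bar>FD \<phi> x i\<bar> <= B" "0 <= B"
   using test_functionE[OF \<phi>] by blast
  define D where "D x = FD \<phi> x h" for x
  have D_cont: "continuous_on UNIV D" unfolding D_def by (rule test_function_dir_continuous[OF \<phi>])
  have \<phi>_cont: "continuous_on UNIV \<phi>" by (rule test_function_continuous[OF \<phi>])
  have [measurable]: "\<phi> : Borel" "D : Borel"
   by (intro borel_measurable_continuous_onI \<phi>_cont D_cont)+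
  obtain B' where B': "!!x. \<bar>D x\<bar> <= B'"
  proof
   show "\<bar>D x\<bar> <= (\<Sum>i\<in>Basis. \<bar>h \<bullet> i\<bar> * B)" for x
    unfolding D_def test_function_dir[OF \<phi>, of x h]
    by (intro order_trans[OF sum_abs] sum_mono) (auto simp: abs_mult intro!: mult_left_mono K(5))
  qed
  have D0: "D x = 0" if "x ~: K" for x using K(4) that by (simp add: D_def)
  define K' where "K' = (%(y, t). y + t *R h) ` (K \<times> {0..1::real})"
  have K': "compact K'" using tube K by (simp add: K'_def)
  have [measurable]: "K' : sets borel" using K' by (simp add: borel_compact)
  have iu: "integrable lborel (%x. B' * (indicator K' x * \<bar>u x\<bar>))"
  proof -
   have "integrable lborel (%x. \<bar>indicator K' x *R u x\<bar>)"
    using u K' unfolding locally_integrable_def set_integrable_def by (intro integrable_abs) blast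
   thus ?thesis by (intro integrable_mult_right) (simp add: abs_mult)
  qed
  have f1: "integrable lborel2 (%(x, t). u x * (- D (x - t *R h) * I01 t))"
  proof (rule Bochner_Integration.integrable_bound[OF prod_int[OF iu]])
   show "AE z in lborel \<Otimes>\<^sub>M lborel. norm (case z of (x, t) => u x * (- D (x - t *R h) * I01 t))
    <= norm (case z of (x, t) => B' * (indicator K' x * \<bar>u x\<bar>) * I01 t)"
   proof (rule AE_I2, clarify)
    fix x :: 'a and t :: real
    have B0: "0 <= B'" using B'[of 0] by linarith
    show "norm (u x * (- D (x - t *R h) * I01 t)) <= norm (B' * (indicator K' x * \<bar>u x\<bar>) * I01 t)"
    proof (cases "x - t *R h : K & t : {0..1}")
     case True
     have "\<bar>u x\<bar> * \<bar>D (x - t *R h)\<bar> <= \<bar>u x\<bar> * B'" using B' by (intro mult_left_mono) auto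
     thus ?thesis using True tubeI[of x t K] B0 by (simp add: K'_def abs_mult mult.commute)
    next
     case False
     hence "D (x - t *R h) = 0 \<or> I01 t = (0::real)" using D0 by auto
     thus ?thesis by auto
    qed
   qed
  qed measurable
  have FTC: "\<phi> (x - h) - \<phi> x = (LINT t|lborel. - D (x - t *R h) * I01 t)" for x
  proof -
   have "(LINT t|lborel. - D (x - t *R h) * I01 t) = \<phi> (x - 1 *R h) - \<phi> (x - 0 *R h)"
   proof (rule integral_FTC_Icc_real)
    show "((%t. \<phi> (x - t *R h)) has_real_derivative - D (x - t *R h)) (at t)" for t
     unfolding D_def by (rule test_function_line[OF \<phi>])
    have "continuous_on UNIV (%t. - D (x - t *R h))"
     by (intro continuous_intros continuous_on_compose2[OF D_cont]) auto
    thus "isCont (%t. - D (x - t *R h)) t" for t by (simp add: continuous_on_eq_continuous_at)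
   qed simp
   thus ?thesis by simp
  qed
  have i0: "integrable lborel (%x. u x * \<phi> x)" "integrable lborel (%x. W x * \<phi> x)" "integrable lborel (%x. u (x + h) * \<phi> x)"
   using loc_int_mult[OF u _ K(1), of \<phi> B] loc_int_mult[OF W _ K(1), of \<phi> B]
    loc_int_mult[OF loc_int_shift[OF u, of h] _ K(1), of \<phi> B] K(2,3) by (simp_all add: mult.commute)
  have i1: "integrable lborel (%x. u x * \<phi> (x - h))"
   using integrable_lborel_shift[OF i0(3), of "- h"] by simp
  have "(LINT x|lborel. u (x + h) * \<phi> x) = (LINT x|lborel. u x * \<phi> (x - h))"
   using integral_lborel_shift[of "%x. u x * \<phi> (x - h)" h] by simp
  hence "(LINT x|lborel. u (x + h) * \<phi> x) - (LINT x|lborel. u x * \<phi> x) = (LINT x|lborel. u x * (\<phi> (x - h) - \<phi> x))"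
   using i0(1) i1 by (simp add: right_diff_distrib)
  also have "... = (LINT x|lborel. (LINT t|lborel. u x * (- D (x - t *R h) * I01 t)))"
   unfolding FTC by (intro Bochner_Integration.integral_cong refl integral_mult_right_zero[symmetric])
  also have "... = (LINT t|lborel. (LINT x|lborel. u x * (- D (x - t *R h) * I01 t)))"
   by (rule lborel_pair.Fubini_integral[OF f1, symmetric])
  also have "... = (LINT t|lborel. (LINT x|lborel. \<phi> x * (I01 t * (G (x + t *R h) \<bullet> h))))"
  proof (rule Bochner_Integration.integral_cong[OF refl])
   fix t :: real
   have "(LINT x|lborel. u x * D (x - t *R h)) = - (LINT x|lborel. (G x \<bullet> h) * \<phi> (x - t *R h))"
    using weak_gradient_dir[OF wg test_function_shift(1)[OF \<phi>, of "- t *R h"], of h]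
     test_function_shift(2)[OF \<phi>, of "- t *R h"] by (simp add: D_def)
   moreover have "(LINT x|lborel. (G x \<bullet> h) * \<phi> (x - t *R h)) = (LINT x|lborel. (G (x + t *R h) \<bullet> h) * \<phi> x)"
    using integral_lborel_shift[of "%x. (G x \<bullet> h) * \<phi> (x - t *R h)" "t *R h"] by simp
   ultimately have "(LINT x|lborel. u x * D (x - t *R h)) = - (LINT x|lborel. (G (x + t *R h) \<bullet> h) * \<phi> x)" by simp
   moreover have "(LINT x|lborel. u x * (- D (x - t *R h) * I01 t)) = - I01 t * (LINT x|lborel. u x * D (x - t *R h))"
    by (simp flip: integral_mult_right_zero integral_minus add: mult_ac)
   moreover have "(LINT x|lborel. \<phi> x * (I01 t * (G (x + t *R h) \<bullet> h))) = I01 t * (LINT x|lborel. (G (x + t *R h) \<bullet> h) * \<phi> x)"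
    by (simp flip: integral_mult_right_zero add: mult_ac)
   ultimately show "(LINT x|lborel. u x * (- D (x - t *R h) * I01 t))
    = (LINT x|lborel. \<phi> x * (I01 t * (G (x + t *R h) \<bullet> h)))" by simp
  qed
  also have "... = (LINT x|lborel. (LINT t|lborel. \<phi> x * (I01 t * (G (x + t *R h) \<bullet> h))))"
   by (rule lborel_pair.Fubini_integral[OF Gint[of \<phi>, OF _ K(1-3)]]) measurable
  also have "... = (LINT x|lborel. W x * \<phi> x)"
   unfolding W_def by (simp add: mult.commute)
  finally show "(LINT x|lborel. (u (x + h) - u x - W x) * \<phi> x) = 0"
   using i0 by (simp add: left_diff_distrib)
 qed
 thus ?thesis unfolding W_def by eventually_elim simp
qed

lemma translate_powr_le:
 fixes u :: "'a::euclidean_space => real" and G :: "'a => 'a"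
 assumes p: "1 < p" and wg: "has_weak_gradient u G" and B: "convex B" "B : sets borel"
 shows "(\<integral>x. ennreal (\<bar>u (x + h) - u x\<bar> powr p) * (indicator B x * indicator B (x + h)))
  <= ennreal (norm h powr p) * (\<integral>x. ennreal (norm (G x) powr p) * indicator B x)"
proof -
 note [measurable] = B(2)
 have G: "locally_integrable G" using wg unfolding has_weak_gradient_def by blast
 note [measurable] = loc_int_measurable[OF G]
 let ?M = "restrict_space lborel {0..1::real}"
 have pt: "ennreal (\<bar>LINT t|lborel. I01 t * (G (x + t *R h) \<bullet> h)\<bar> powr p)
  <= (\<integral>t. ennreal (norm h powr p) * (ennreal (norm (G (x + t *R h)) powr p) * I01 t))" for x
 proof (cases "integrable ?M (%t. G (x + t *R h) \<bullet> h)")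
  case True
  have "emeasure ?M (space ?M) = ennreal 1" by (simp add: emeasure_restrict_space space_restrict_space)
  from jensen_powr[OF p True this]
  have "ennreal (\<bar>LINT t|lborel. I01 t * (G (x + t *R h) \<bullet> h)\<bar> powr p)
   <= (\<integral>t. ennreal (\<bar>G (x + t *R h) \<bullet> h\<bar> powr p) * I01 t)"
   by (simp add: integral_restrict_space nn_integral_restrict_space)
  also have "... <= (\<integral>t. ennreal (norm h powr p) * (ennreal (norm (G (x + t *R h)) powr p) * I01 t))"
  proof (rule nn_integral_mono)
   fix t :: real
   have "\<bar>G (x + t *R h) \<bullet> h\<bar> powr p <= (norm (G (x + t *R h)) * norm h) powr p"
    using p by (intro powr_mono2 Cauchy_Schwarz_ineq2) auto
   thus "ennreal (\<bar>G (x + t *R h) \<bullet> h\<bar> powr p) * I01 t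
    <= ennreal (norm h powr p) * (ennreal (norm (G (x + t *R h)) powr p) * I01 t)"
    by (cases "t : {0..1}") (auto simp: ennreal_mult[symmetric] powr_mult mult.commute intro!: ennreal_leI)
  qed
  finally show ?thesis .
 next
  case False
  hence "~ integrable lborel (%t. I01 t * (G (x + t *R h) \<bullet> h))"
   by (subst (asm) integrable_restrict_space) auto
  thus ?thesis by (simp add: not_integrable_integral_eq)
 qed
 have "(\<integral>x. ennreal (\<bar>u (x + h) - u x\<bar> powr p) * (indicator B x * indicator B (x + h)))
  <= (\<integral>x. (\<integral>t. ennreal (norm h powr p) * (ennreal (norm (G (x + t *R h)) powr p) * indicator B (x + t *R h) * I01 t)))"
 proof (rule nn_integral_mono_AE)
  show "AE x in lborel. ennreal (\<bar>u (x + h) - u x\<bar> powr p) * (indicator B x * indicator B (x + h))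
   <= (\<integral>t. ennreal (norm h powr p) * (ennreal (norm (G (x + t *R h)) powr p) * indicator B (x + t *R h) * I01 t))"
   using translate_eq_integral[OF wg, of h]
  proof eventually_elim
   case (elim x)
   show ?case
   proof (cases "x : B & x + h : B")
    case True
    have "x + t *R h : B" if "t : {0..1}" for t
     using convexD_alt[OF B(1), of x "x + h" t] True that by (simp add: algebra_simps)
    hence "(\<integral>t. ennreal (norm h powr p) * (ennreal (norm (G (x + t *R h)) powr p) * indicator B (x + t *R h) * I01 t))
     = (\<integral>t. ennreal (norm h powr p) * (ennreal (norm (G (x + t *R h)) powr p) * I01 t))"
     by (intro nn_integral_cong) (auto split: split_indicator)
    thus ?thesis using pt[of x] True elim by simp
   qed auto
  qed
 qed
 also have "... = (\<integral>t. (\<integral>x. ennreal (norm h powr p) * (ennreal (norm (G (x + t *R h)) powr p) * indicator B (x + t *R h) * I01 t)))"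
  by (rule pair_sigma_finite.Fubini'[OF pair_sigma_finite.intro[OF sigma_finite_lborel sigma_finite_lborel]]) measurable
 also have "... = (\<integral>t. ennreal (norm h powr p) * (\<integral>x. ennreal (norm (G x) powr p) * indicator B x) * I01 t)"
 proof (rule nn_integral_cong)
  fix t :: real
  have "(\<integral>x. ennreal (norm h powr p) * (ennreal (norm (G (x + t *R h)) powr p) * indicator B (x + t *R h) * I01 t))
   = (\<integral>x. ennreal (norm h powr p) * (ennreal (norm (G x) powr p) * indicator B x * I01 t))"
   by (rule nn_integral_lborel_shift[where f="%x. ennreal (norm h powr p) * (ennreal (norm (G x) powr p) * indicator B x * I01 t)"]) measurable
  also have "... = ennreal (norm h powr p) * (\<integral>x. ennreal (norm (G x) powr p) * indicator B x) * I01 t"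
   by (subst nn_integral_cmult, measurable, subst nn_integral_multc, measurable, simp add: mult.assoc)
  finally show "(\<integral>x. ennreal (norm h powr p) * (ennreal (norm (G (x + t *R h)) powr p) * indicator B (x + t *R h) * I01 t))
   = ennreal (norm h powr p) * (\<integral>x. ennreal (norm (G x) powr p) * indicator B x) * I01 t" .
 qed
 also have "... = ennreal (norm h powr p) * (\<integral>x. ennreal (norm (G x) powr p) * indicator B x)"
  by (subst nn_integral_cmult) auto
 finally show ?thesis .
qed

subsection \<open>Difference quotients\<close>

lemma L1_translation_continuous:
 fixes f :: "'a::euclidean_space => real"
 assumes "integrable lborel f" and h: "h ----> 0"
 shows "(%n::nat. LINT x|lborel. \<bar>f (x + h n) - f x\<bar>) ----> 0"
 using assms(1)
proof (induction rule: integrable_induct)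
 case (base A c)
 have [measurable]: "A : sets borel" using base by simp
 show ?case
 proof (rule LIMSEQ_I)
  fix r :: real assume r: "0 < r"
  define e where "e = r / (4 * (\<bar>c\<bar> + 1))"
  have e: "0 < e" using r by (simp add: e_def)
  obtain U where U: "open U" "A \<subseteq> U" "emeasure lborel (U - A) < e"
   using outer_regular_lborel[OF _ e, of A] by auto
  have [measurable]: "U : sets borel" using U(1) by simp
  have finUA: "emeasure lborel (U - A) < \<infinity>" using U(3) by (rule less_trans) simp
  have finA: "emeasure lborel A < \<infinity>" using base by simp
  have "emeasure lborel U = emeasure lborel (U - A) + emeasure lborel A"
   using U(2) by (subst plus_emeasure) (auto simp: Un_absorb2)
  also have "... < \<infinity>" using finUA finA by (auto simp: less_top)
  finally have finU: "emeasure lborel U < \<infinity>" .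
  have iS: "integrable lborel (%x. indicator S x :: real)" "integrable lborel (%x. indicator S (x + a) :: real)"
   if "S : sets borel" "emeasure lborel S < \<infinity>" for S :: "'a set" and a
   using that integrable_lborel_shift[of "indicator S :: 'a => real" a] by (auto intro!: integrable_real_indicator)
  have lS: "(LINT x|lborel. indicator S (x + a)) = measure lborel S" if [measurable]: "S : sets borel" for S :: "'a set" and a
   using integral_lborel_shift[of "indicator S :: 'a => real" a] by simp
  have prod: "integrable lborel (%x. indicator U x * indicator U (x + a) :: real)" for a
   by (rule Bochner_Integration.integrable_bound[OF iS(1)[OF \<open>U : sets borel\<close> finU]]) (auto split: split_indicator)
  have "(%n. LINT x|lborel. indicator U x * indicator U (x + h n)) ----> (LINT x|lborel. indicator U x :: real)"
  proof (rule integral_dominated_convergence[where w="indicator U"])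
   show "AE x in lborel. (%n. indicator U x * indicator U (x + h n)) ----> (indicator U x :: real)"
   proof (rule AE_I2)
    fix x
    show "(%n. indicator U x * indicator U (x + h n)) ----> (indicator U x :: real)"
    proof (cases "x : U")
     case True
     have "(%n. x + h n) ----> x" using tendsto_add[OF tendsto_const h, of x] by simp
     hence "\<forall>\<^sub>F n in sequentially. x + h n : U" using U(1) True by (rule topological_tendstoD)
     thus ?thesis by (intro tendsto_eventually) (auto elim!: eventually_mono simp: True)
    qed simp
   qed
  qed (use iS finU in \<open>auto split: split_indicator\<close>)
  hence "(%n. 2 * (measure lborel U - (LINT x|lborel. indicator U x * indicator U (x + h n)))) ----> 2 * (measure lborel U - measure lborel U)"
   by (intro tendsto_intros) simp
  moreover have "(LINT x|lborel. \<bar>indicator U (x + a) - indicator U x\<bar>) = 2 * (measure lborel U - (LINT x|lborel. indicator U x * indicator U (x + a)))" for a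
  proof -
   have "(LINT x|lborel. \<bar>indicator U (x + a) - indicator U x\<bar> :: real) = (LINT x|lborel. indicator U (x + a) + indicator U x - 2 * (indicator U x * indicator U (x + a)))"
    by (intro Bochner_Integration.integral_cong refl) (auto split: split_indicator)
   also have "... = measure lborel U + measure lborel U - 2 * (LINT x|lborel. indicator U x * indicator U (x + a))"
    using prod iS[of U] finU lS[of U] by simp
   finally show ?thesis by simp
  qed
  ultimately have "(%n. LINT x|lborel. \<bar>indicator U (x + h n) - indicator U x\<bar> :: real) ----> 0" by simp
  then obtain n0 where n0: "!!n. n0 <= n ==> (LINT x|lborel. \<bar>indicator U (x + h n) - indicator U x\<bar>) < e"
   using LIMSEQ_D[OF _ e] by fastforce
  have "norm ((LINT x|lborel. \<bar>indicator A (x + h n) *R c - indicator A x *R c\<bar>) - 0) < r" if n: "n0 <= n" for n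
  proof -
   have i1: "integrable lborel (%x. \<bar>indicator U (x + h n) - indicator U x\<bar> :: real)"
    using iS[of U] finU by auto
   have i2: "integrable lborel (%x. indicator (U - A) x :: real)" "integrable lborel (%x. indicator (U - A) (x + h n) :: real)"
    using iS[of "U - A"] finUA by auto
   have "(LINT x|lborel. \<bar>indicator A (x + h n) *R c - indicator A x *R c\<bar>)
    <= (LINT x|lborel. \<bar>c\<bar> * (indicator (U - A) (x + h n) + indicator (U - A) x + \<bar>indicator U (x + h n) - indicator U x\<bar>))"
   proof (rule integral_mono')
    show "integrable lborel (%x. \<bar>c\<bar> * (indicator (U - A) (x + h n) + indicator (U - A) x + \<bar>indicator U (x + h n) - indicator U x\<bar>))"
     using i1 i2 by auto
    show "\<bar>indicator A (x + h n) *R c - indicator A x *R c\<bar> <= \<bar>c\<bar> * (indicator (U - A) (x + h n) + indicator (U - A) x + \<bar>indicator U (x + h n) - indicator U x\<bar>)" for x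
     using U(2) by (auto split: split_indicator)
   qed auto
   also have "... = \<bar>c\<bar> * (measure lborel (U - A) + measure lborel (U - A) + (LINT x|lborel. \<bar>indicator U (x + h n) - indicator U x\<bar>))"
    using i1 i2 lS[of "U - A"] by simp
   also have "... <= \<bar>c\<bar> * (e + e + e)"
   proof (intro mult_left_mono add_mono)
    show "measure lborel (U - A) <= e" using U(3) e by (simp add: measure_def enn2real_leI less_imp_le)
    thus "measure lborel (U - A) <= e" .
    show "(LINT x|lborel. \<bar>indicator U (x + h n) - indicator U x\<bar>) <= e" using n0[OF n] by simp
   qed simp
   also have "... < (\<bar>c\<bar> + 1) * (4 * e)" using e by (simp add: algebra_simps) (smt (verit) mult_nonneg_nonneg abs_ge_zero)
   also have "... = r"
   proof -
    have "d * (4 * (r / (4 * d))) = r" if "d ~= 0" for d :: real using that by simp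
    moreover have "\<bar>c\<bar> + 1 ~= 0" by linarith
    ultimately show ?thesis unfolding e_def by blast
   qed
   finally show ?thesis by simp
  qed
  thus "\<exists>n0. \<forall>n\<ge>n0. norm ((LINT x|lborel. \<bar>indicator A (x + h n) *R c - indicator A x *R c\<bar>) - 0) < r" by blast
 qed
next
 case (add f g)
 note [measurable] = borel_measurable_integrable[OF add.hyps(1)] borel_measurable_integrable[OF add.hyps(2)]
 show ?case
 proof (rule Lim_null_comparison)
  show "\<forall>\<^sub>F n in sequentially. norm (LINT x|lborel. \<bar>f (x + h n) + g (x + h n) - (f x + g x)\<bar>)
   <= (LINT x|lborel. \<bar>f (x + h n) - f x\<bar>) + (LINT x|lborel. \<bar>g (x + h n) - g x\<bar>)"
  proof (rule always_eventually, rule allI)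
   fix n
   have i: "integrable lborel (%x. \<bar>f (x + h n) - f x\<bar>)" "integrable lborel (%x. \<bar>g (x + h n) - g x\<bar>)"
    using add integrable_lborel_shift[of f "h n"] integrable_lborel_shift[of g "h n"] by auto
   have "(LINT x|lborel. \<bar>f (x + h n) + g (x + h n) - (f x + g x)\<bar>) <= (LINT x|lborel. \<bar>f (x + h n) - f x\<bar> + \<bar>g (x + h n) - g x\<bar>)"
    using i by (intro integral_mono') auto
   thus "norm (LINT x|lborel. \<bar>f (x + h n) + g (x + h n) - (f x + g x)\<bar>)
   <= (LINT x|lborel. \<bar>f (x + h n) - f x\<bar>) + (LINT x|lborel. \<bar>g (x + h n) - g x\<bar>)" using i by simp
  qed
  show "(%n. (LINT x|lborel. \<bar>f (x + h n) - f x\<bar>) + (LINT x|lborel. \<bar>g (x + h n) - g x\<bar>)) ----> 0"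
   using tendsto_add[OF add.IH(1) add.IH(2)] by simp
 qed
next
 case (lim f s)
 note [measurable] = borel_measurable_integrable[OF lim.hyps(4)] borel_measurable_integrable[OF lim.hyps(1)]
 have conv: "(%i. LINT x|lborel. \<bar>s i x - f x\<bar>) ----> (LINT x|(lborel::'a measure). 0)"
 proof (rule integral_dominated_convergence[where w="%x. 3 * \<bar>f x\<bar>"])
  show "AE x in lborel. (%i. \<bar>s i x - f x\<bar>) ----> 0"
  proof (rule AE_I2)
   fix x :: 'a
   have "(%i. \<bar>s i x - f x\<bar>) ----> \<bar>f x - f x\<bar>" using lim.hyps(2)[of x] by (intro tendsto_intros) auto
   thus "(%i. \<bar>s i x - f x\<bar>) ----> 0" by simp
  qed
  show "AE x in lborel. norm \<bar>s i x - f x\<bar> <= 3 * \<bar>f x\<bar>" for i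
  proof (rule AE_I2)
   fix x :: 'a
   show "norm \<bar>s i x - f x\<bar> <= 3 * \<bar>f x\<bar>" using lim.hyps(3)[of x i] by (auto simp: abs_if split: if_splits)
  qed
 qed (use lim.hyps(4) in auto)
 show ?case
 proof (rule LIMSEQ_I)
  fix r :: real assume r: "0 < r"
  have "\<exists>n0. \<forall>n\<ge>n0. norm ((LINT x|lborel. \<bar>s n x - f x\<bar>) - (LINT x|(lborel::'a measure). 0)) < r / 3"
   by (rule LIMSEQ_D[OF conv]) (use r in simp)
  then obtain i where "norm ((LINT x|lborel. \<bar>s i x - f x\<bar>) - (LINT x|(lborel::'a measure). 0)) < r / 3" by blast
  hence i: "(LINT x|lborel. \<bar>s i x - f x\<bar>) < r / 3" by simp
  have "\<exists>n0. \<forall>n\<ge>n0. norm ((LINT x|lborel. \<bar>s i (x + h n) - s i x\<bar>) - 0) < r / 3"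
   by (rule LIMSEQ_D[OF lim.IH]) (use r in simp)
  then obtain n0 where n0: "!!n. n0 <= n ==> (LINT x|lborel. \<bar>s i (x + h n) - s i x\<bar>) < r / 3" by fastforce
  have "norm ((LINT x|lborel. \<bar>f (x + h n) - f x\<bar>) - 0) < r" if n: "n0 <= n" for n
  proof -
   have d: "integrable lborel (%x. \<bar>s i x - f x\<bar>)" using lim.hyps(1,4) by auto
   have d': "integrable lborel (%x. \<bar>s i (x + h n) - f (x + h n)\<bar>)" using integrable_lborel_shift[OF d] .
   have m: "integrable lborel (%x. \<bar>s i (x + h n) - s i x\<bar>)" using lim.hyps(1) integrable_lborel_shift[OF lim.hyps(1)] by auto
   have "(LINT x|lborel. \<bar>f (x + h n) - f x\<bar>) <= (LINT x|lborel. \<bar>s i (x + h n) - f (x + h n)\<bar> + \<bar>s i x - f x\<bar> + \<bar>s i (x + h n) - s i x\<bar>)"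
    using d d' m by (intro integral_mono') auto
   also have "... = (LINT x|lborel. \<bar>s i x - f x\<bar>) + (LINT x|lborel. \<bar>s i x - f x\<bar>) + (LINT x|lborel. \<bar>s i (x + h n) - s i x\<bar>)"
    using d d' m integral_lborel_shift[of "%x. \<bar>s i x - f x\<bar>" "h n"] by simp
   also have "... < r" using i n0[OF n] by simp
   finally show ?thesis by simp
  qed
  thus "\<exists>n0. \<forall>n\<ge>n0. norm ((LINT x|lborel. \<bar>f (x + h n) - f x\<bar>) - 0) < r" by blast
 qed
qed

definition L1loc_tendsto :: "(nat => 'a::euclidean_space => 'b::euclidean_space) => ('a => 'b) => bool" where
 "L1loc_tendsto F f \<longleftrightarrow> (\<forall>K. compact K --> (%n. \<integral>\<^sup>+x. ennreal (norm (F n x - f x)) * indicator K x \<partial>lborel) ----> 0)"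

lemma L1loc_tendstoD:
 "L1loc_tendsto F f ==> compact K ==> (%n. \<integral>\<^sup>+x. ennreal (norm (F n x - f x)) * indicator K x \<partial>lborel) ----> 0"
 by (auto simp: L1loc_tendsto_def)

lemma tendsto_0_ennreal_le:
 fixes a b :: "nat => ennreal"
 assumes "b ----> 0" "!!n. a n <= b n"
 shows "a ----> 0"
 using assms by (intro tendsto_sandwich[of "%_. 0" a sequentially b 0]) auto

lemma L1loc_tendsto_dominated:
 fixes F :: "nat => 'a::euclidean_space => 'b::euclidean_space"
 assumes [measurable]: "!!n. F n : Borel" "f : Borel"
  and w: "locally_integrable (w :: 'a => real)"
  and bound: "!!n. AE x in lborel. norm (F n x - f x) <= w x"
  and lim: "AE x in lborel. (%n. F n x) ----> f x"
 shows "L1loc_tendsto F f"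
 unfolding L1loc_tendsto_def
proof (intro allI impI)
 fix K :: "'a set" assume K: "compact K"
 hence [measurable]: "K : sets borel" by (simp add: borel_compact)
 note [measurable] = loc_int_measurable[OF w]
 have "(%n. \<integral>\<^sup>+x. ennreal (norm (F n x - f x)) * indicator K x \<partial>lborel) ----> (\<integral>x::'a. 0)"
 proof (rule nn_integral_dominated_convergence[where w="%x. ennreal (norm (w x)) * indicator K x"])
  show "AE x in lborel. ennreal (norm (F n x - f x)) * indicator K x <= ennreal (norm (w x)) * indicator K x" for n
   using bound[of n] by eventually_elim (auto intro!: mult_right_mono ennreal_leI)
  show "(\<integral>x. ennreal (norm (w x)) * indicator K x) < \<infinity>" using w K by (auto simp: loc_int_iff)
  show "AE x in lborel. (%n. ennreal (norm (F n x - f x)) * indicator K x) ----> 0"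
   using lim
  proof eventually_elim
   case (elim x)
   have "(%n. norm (F n x - f x)) ----> 0" using elim by (simp add: LIM_zero tendsto_norm_zero)
   hence "(%n. ennreal (norm (F n x - f x))) ----> 0" by (simp add: ennreal_tendsto_0_iff)
   thus ?case by (cases "x : K") auto
  qed
 qed auto
 thus "(%n. \<integral>\<^sup>+x. ennreal (norm (F n x - f x)) * indicator K x \<partial>lborel) ----> 0" by simp
qed

lemma L1loc_tendsto_add_le:
 fixes A :: "nat => 'a::euclidean_space => 'b::euclidean_space" and B :: "nat => 'a => 'c::euclidean_space"
  and F :: "nat => 'a => 'd::euclidean_space"
 assumes A: "L1loc_tendsto A a" "!!n. A n : Borel" "a : Borel"
  and B: "L1loc_tendsto B b" "!!n. B n : Borel" "b : Borel"
  and c: "0 <= c"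
  and le: "!!n. AE x in lborel. norm (F n x - f x) <= c * norm (A n x - a x) + norm (B n x - b x)"
 shows "L1loc_tendsto F f"
 unfolding L1loc_tendsto_def
proof (intro allI impI)
 fix K :: "'a set" assume K: "compact K"
 hence [measurable]: "K : sets borel" by (simp add: borel_compact)
 note [measurable] = A(2,3) B(2,3)
 have "(%n. ennreal c * (\<integral>x. ennreal (norm (A n x - a x)) * indicator K x) + (\<integral>x. ennreal (norm (B n x - b x)) * indicator K x)) ----> ennreal c * 0 + 0"
  by (intro tendsto_add ennreal_tendsto_cmult L1loc_tendstoD[OF A(1) K] L1loc_tendstoD[OF B(1) K]) simp
 hence "(%n. ennreal c * (\<integral>x. ennreal (norm (A n x - a x)) * indicator K x) + (\<integral>x. ennreal (norm (B n x - b x)) * indicator K x)) ----> 0"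
  by simp
 thus "(%n. \<integral>\<^sup>+x. ennreal (norm (F n x - f x)) * indicator K x \<partial>lborel) ----> 0"
 proof (rule tendsto_0_ennreal_le)
  fix n
  have "(\<integral>x. ennreal (norm (F n x - f x)) * indicator K x)
   <= (\<integral>x. ennreal c * (ennreal (norm (A n x - a x)) * indicator K x) + ennreal (norm (B n x - b x)) * indicator K x)"
  proof (rule nn_integral_mono_AE)
   show "AE x in lborel. ennreal (norm (F n x - f x)) * indicator K x
    <= ennreal c * (ennreal (norm (A n x - a x)) * indicator K x) + ennreal (norm (B n x - b x)) * indicator K x"
    using le[of n]
   proof eventually_elim
    case (elim x)
    hence "ennreal (norm (F n x - f x)) <= ennreal (c * norm (A n x - a x) + norm (B n x - b x))" by (rule ennreal_leI)
    also have "... = ennreal c * ennreal (norm (A n x - a x)) + ennreal (norm (B n x - b x))"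
     using c by (simp add: ennreal_mult)
    finally show ?case by (cases "x : K") auto
   qed
  qed
  also have "... = ennreal c * (\<integral>x. ennreal (norm (A n x - a x)) * indicator K x) + (\<integral>x. ennreal (norm (B n x - b x)) * indicator K x)"
   by (subst nn_integral_add) (auto simp: nn_integral_cmult)
  finally show "(\<integral>x. ennreal (norm (F n x - f x)) * indicator K x)
   <= ennreal c * (\<integral>x. ennreal (norm (A n x - a x)) * indicator K x) + (\<integral>x. ennreal (norm (B n x - b x)) * indicator K x)" .
 qed
qed

lemma L1loc_test_tendsto:
 fixes F :: "nat => 'a::euclidean_space => real"
 assumes F: "L1loc_tendsto F f" "!!n. locally_integrable (F n)" "locally_integrable f"
  and [measurable]: "\<psi> : Borel" and K: "compact K" "!!x. x ~: K ==> \<psi> x = 0" "!!x. \<bar>\<psi> x\<bar> <= B"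
 shows "(%n. LINT x|lborel. F n x * \<psi> x) ----> (LINT x|lborel. f x * \<psi> x)"
proof -
 note [measurable] = loc_int_measurable[OF F(2)] loc_int_measurable[OF F(3)]
 have [measurable]: "K : sets borel" using K by (simp add: borel_compact)
 have B: "0 <= B" using K(3)[of 0] by linarith
 have i: "integrable lborel (%x. F n x * \<psi> x)" "integrable lborel (%x. f x * \<psi> x)" for n
  using loc_int_mult[OF F(2) _ K(1), of \<psi> B n] loc_int_mult[OF F(3) _ K(1), of \<psi> B] K(2,3)
  by (simp_all add: mult.commute)
 have "(%n. ennreal B * (\<integral>x. ennreal (norm (F n x - f x)) * indicator K x)) ----> ennreal B * 0"
  by (intro ennreal_tendsto_cmult L1loc_tendstoD[OF F(1) K(1)]) simp
 hence "(%n. ennreal B * (\<integral>x. ennreal (norm (F n x - f x)) * indicator K x)) ----> 0" by simp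
 hence "(%n. ennreal (norm ((LINT x|lborel. F n x * \<psi> x) - (LINT x|lborel. f x * \<psi> x)))) ----> 0"
 proof (rule tendsto_0_ennreal_le)
  fix n
  have "ennreal (norm ((LINT x|lborel. F n x * \<psi> x) - (LINT x|lborel. f x * \<psi> x))) = ennreal (norm (LINT x|lborel. F n x * \<psi> x - f x * \<psi> x))"
   using i by simp
  also have "... <= (\<integral>x. ennreal (norm (F n x * \<psi> x - f x * \<psi> x)))"
   using i by (intro integral_norm_bound_ennreal) auto
  also have "... <= (\<integral>x. ennreal B * (ennreal (norm (F n x - f x)) * indicator K x))"
  proof (rule nn_integral_mono)
   fix x
   have "norm (F n x * \<psi> x - f x * \<psi> x) = \<bar>\<psi> x\<bar> * norm (F n x - f x)"
    by (simp add: abs_mult[symmetric] algebra_simps)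
   moreover have "\<bar>\<psi> x\<bar> * norm (F n x - f x) <= B * norm (F n x - f x)" using K(3) by (intro mult_right_mono) auto
   ultimately show "ennreal (norm (F n x * \<psi> x - f x * \<psi> x)) <= ennreal B * (ennreal (norm (F n x - f x)) * indicator K x)"
    using K(2)[of x] B by (cases "x : K") (auto simp: ennreal_mult[symmetric] intro!: ennreal_leI)
  qed
  also have "... = ennreal B * (\<integral>x. ennreal (norm (F n x - f x)) * indicator K x)"
   by (rule nn_integral_cmult) measurable
  finally show "ennreal (norm ((LINT x|lborel. F n x * \<psi> x) - (LINT x|lborel. f x * \<psi> x)))
   <= ennreal B * (\<integral>x. ennreal (norm (F n x - f x)) * indicator K x)" .
 qed
 hence "(%n. norm ((LINT x|lborel. F n x * \<psi> x) - (LINT x|lborel. f x * \<psi> x))) ----> 0"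
  by (simp only: ennreal_tendsto_0_iff norm_ge_zero)
 from LIM_zero_cancel[OF tendsto_norm_zero_cancel[OF this]] show ?thesis .
qed

lemma weak_gradient_limit:
 fixes u :: "nat => 'a::euclidean_space => real"
 assumes wg: "!!n. has_weak_gradient (u n) (G n)" and v: "locally_integrable v" "L1loc_tendsto u v"
  and H: "locally_integrable H" "L1loc_tendsto G H"
 shows "has_weak_gradient v H"
 unfolding has_weak_gradient_def
proof (intro conjI allI impI ballI v(1) H(1))
 fix \<phi> :: "'a => real" and i :: 'a assume \<phi>: "test_function \<phi>" and i: "i : Basis"
 have u: "locally_integrable (u n)" and G: "locally_integrable (G n)" for n
  using wg unfolding has_weak_gradient_def by blast+
 obtain K B where K: "compact K" "!!x. x ~: K ==> \<phi> x = 0" "!!x. \<bar>\<phi> x\<bar> <= B"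
  "!!x i. x ~: K ==> FD \<phi> x i = 0"
  "!!x i. i : Basis ==> \<bar>FD \<phi> x i\<bar> <= B" "0 <= B"
  using test_functionE[OF \<phi>] by blast
 have [measurable]: "\<phi> : Borel" "(%x. FD \<phi> x i) : Borel"
  by (intro borel_measurable_continuous_onI test_function_continuous \<phi> i)+
 have lim1: "(%n. LINT x|lborel. u n x * FD \<phi> x i) ----> (LINT x|lborel. v x * FD \<phi> x i)"
  by (rule L1loc_test_tendsto[OF v(2) u v(1) _ K(1), of _ B]) (use K(4) K(5)[OF i] in auto)
 have lim2: "(%n. LINT x|lborel. (G n x \<bullet> i) * \<phi> x) ----> (LINT x|lborel. (H x \<bullet> i) * \<phi> x)"
 proof (rule L1loc_test_tendsto[OF _ loc_int_inner[OF G] loc_int_inner[OF H(1)] _ K(1-3)])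
  show "L1loc_tendsto (%n x. G n x \<bullet> i) (%x. H x \<bullet> i)"
   unfolding L1loc_tendsto_def
  proof (intro allI impI)
   fix K :: "'a set" assume K: "compact K"
   from L1loc_tendstoD[OF H(2) K]
   show "(%n. \<integral>\<^sup>+x. ennreal (norm (G n x \<bullet> i - H x \<bullet> i)) * indicator K x \<partial>lborel) ----> 0"
   proof (rule tendsto_0_ennreal_le)
    show "(\<integral>x. ennreal (norm (G n x \<bullet> i - H x \<bullet> i)) * indicator K x)
     <= (\<integral>x. ennreal (norm (G n x - H x)) * indicator K x)" for n
     using Basis_le_norm[OF i] by (intro nn_integral_mono mult_right_mono ennreal_leI) (auto simp flip: inner_diff_left)
   qed
  qed
 qed simp
 have "(LINT x|lborel. u n x * FD \<phi> x i) = - (LINT x|lborel. (G n x \<bullet> i) * \<phi> x)" for n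
  using wg \<phi> i unfolding has_weak_gradient_def by blast
 with lim1 have "(%n. - (LINT x|lborel. (G n x \<bullet> i) * \<phi> x)) ----> (LINT x|lborel. v x * FD \<phi> x i)" by simp
 from LIMSEQ_unique[OF this tendsto_minus[OF lim2]]
 show "(LINT x|lborel. v x * FD \<phi> x i) = - (LINT x|lborel. (H x \<bullet> i) * \<phi> x)" .
qed

text \<open>Along steps \<open>2\<^sup>-\<^sup>n\<close>, local \<open>L\<^sup>1\<close> bounds for the difference quotients make
 \<open>u (x + 2\<^sup>-\<^sup>n i)\<close> converge to \<open>u x\<close> almost everywhere along the whole sequence.\<close>

definition dq :: "nat => 'a::euclidean_space => ('a => real) => 'a => real" where
 "dq n i u x = 2 ^ n * (u (x + (1 / 2 ^ n) *R i) - u x)"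

lemma dq_measurable [measurable]:
 assumes [measurable]: "u : Borel"
 shows "dq n i u : Borel"
 unfolding dq_def by measurable

lemma loc_int_dq: "locally_integrable u ==> locally_integrable (dq n i u)"
 unfolding dq_def
 using loc_int_scaleR[OF loc_int_diff[OF loc_int_shift], of u u "2 ^ n"] by simp

lemma step_tendsto: "(%n. (1 / 2 ^ n) *R (i :: 'a::euclidean_space)) ----> 0"
 using tendsto_scaleR[OF LIMSEQ_realpow_zero[of "1/2::real"] tendsto_const[of i]] by (simp add: power_divide)

lemma tube_compact:
 fixes K :: "'a::euclidean_space set"
 assumes "compact K"
 shows "compact ((%(y, t). y + t *R h) ` (K \<times> {0..1::real}))"
 using assms by (intro compact_continuous_image compact_Times) (auto intro!: continuous_intros simp: case_prod_beta)

lemma dq_tendsto_weak_gradient: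
 assumes wg: "has_weak_gradient u G"
 shows "L1loc_tendsto (%n. dq n i u) (%x. G x \<bullet> i)"
 unfolding L1loc_tendsto_def
proof (intro allI impI)
 fix K :: "'a set" assume K: "compact K"
 have u: "locally_integrable u" and G: "locally_integrable G"
  using wg unfolding has_weak_gradient_def by blast+
 note [measurable] = loc_int_measurable[OF u] loc_int_measurable[OF G]
 have [measurable]: "K : sets borel" using K by (simp add: borel_compact)
 define K' where "K' = (%(y, t). y + t *R i) ` (K \<times> {0..1::real})"
 have K': "compact K'" using tube_compact[OF K] by (simp add: K'_def)
 hence [measurable]: "K' : sets borel" by (simp add: borel_compact)
 have K'I: "x + t *R i : K'" if "x : K" "t : {0..1}" for x t
  unfolding K'_def using that by (intro image_eqI[of _ _ "(x, t)"]) auto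
 define f where "f x = indicator K' x * (G x \<bullet> i)" for x
 have f: "integrable lborel f"
  using loc_int_inner[OF G, of i] K' unfolding f_def locally_integrable_def set_integrable_def by auto
 have [measurable]: "f : Borel" using f by auto
 define h where "h n = (1 / 2 ^ n) *R i" for n :: nat
 define \<omega> where "\<omega> y = (\<integral>x. ennreal \<bar>f (x + y) - f x\<bar>)" for y
 have [measurable]: "\<omega> : Borel" unfolding \<omega>_def by measurable
 have \<omega>_lim: "(%n. \<omega> (t *R h n)) ----> 0" for t
 proof -
  have "(%n. t *R h n) ----> 0" unfolding h_def using tendsto_scaleR[OF tendsto_const step_tendsto, of t i] by simp
  hence "(%n. ennreal (LINT x|lborel. \<bar>f (x + t *R h n) - f x\<bar>)) ----> 0"
   using L1_translation_continuous[OF f] by (subst ennreal_tendsto_0_iff) auto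
  moreover have "\<omega> (t *R h n) = ennreal (LINT x|lborel. \<bar>f (x + t *R h n) - f x\<bar>)" for n
   unfolding \<omega>_def using f integrable_lborel_shift[OF f] by (intro nn_integral_eq_integral) auto
  ultimately show ?thesis by simp
 qed
 have \<omega>_le: "\<omega> y <= 2 * (\<integral>x. ennreal \<bar>f x\<bar>)" for y
 proof -
  have "\<omega> y <= (\<integral>x. ennreal \<bar>f (x + y)\<bar> + ennreal \<bar>f x\<bar>)"
   unfolding \<omega>_def by (intro nn_integral_mono) (auto simp flip: ennreal_plus intro!: ennreal_leI)
  also have "... = (\<integral>x. ennreal \<bar>f (x + y)\<bar>) + (\<integral>x. ennreal \<bar>f x\<bar>)"
   by (rule nn_integral_add) measurable
  also have "(\<integral>x. ennreal \<bar>f (x + y)\<bar>) = (\<integral>x. ennreal \<bar>f x\<bar>)"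
   by (rule nn_integral_lborel_shift[where f="%x. ennreal \<bar>f x\<bar>"]) measurable
  finally show ?thesis by (simp add: mult_2)
 qed
 have "(%n. \<integral>\<^sup>+t. \<omega> (t *R h n) * I01 t \<partial>lborel) ----> (\<integral>t::real. 0)"
 proof (rule nn_integral_dominated_convergence[where w="%t. 2 * (\<integral>x. ennreal \<bar>f x\<bar>) * I01 t"])
  show "AE t in lborel. \<omega> (t *R h n) * I01 t <= 2 * (\<integral>x. ennreal \<bar>f x\<bar>) * I01 t" for n
   using \<omega>_le by (intro AE_I2 mult_right_mono) auto
  have "(\<integral>x. ennreal \<bar>f x\<bar>) < \<infinity>" using f by (simp add: integrable_iff_bounded)
  thus "(\<integral>t. 2 * (\<integral>x. ennreal \<bar>f x\<bar>) * I01 t) < \<infinity>"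
   by (subst nn_integral_cmult) (auto simp: ennreal_mult_less_top)
  show "AE t in lborel. (%n. \<omega> (t *R h n) * I01 t) ----> 0"
  proof (rule AE_I2)
   fix t :: real
   show "(%n. \<omega> (t *R h n) * I01 t) ----> 0"
    using \<omega>_lim[of t] by (cases "t : {0..1}") auto
  qed
 qed (unfold h_def, measurable)
 hence "(%n. \<integral>\<^sup>+t. \<omega> (t *R h n) * I01 t \<partial>lborel) ----> 0" by simp
 thus "(%n. \<integral>\<^sup>+x. ennreal (norm (dq n i u x - G x \<bullet> i)) * indicator K x \<partial>lborel) ----> 0"
 proof (rule tendsto_0_ennreal_le)
  fix n
  have [measurable]: "h n : space borel" by simp
  have avg: "ennreal \<bar>(LINT t|lborel. I01 t * g t) - c\<bar> <= (\<integral>t. ennreal \<bar>g t - c\<bar> * I01 t)"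
   if [measurable]: "g : Borel" for g :: "real => real" and c
  proof (cases "(\<integral>t. ennreal \<bar>g t - c\<bar> * I01 t) = \<infinity>")
   case False
   have i1: "integrable lborel (%t. I01 t * (g t - c))"
   proof (rule integrableI_bounded)
    have "(\<integral>t. ennreal (norm (I01 t * (g t - c)))) = (\<integral>t. ennreal \<bar>g t - c\<bar> * I01 t)"
     by (intro nn_integral_cong) (auto split: split_indicator)
    thus "(\<integral>t. ennreal (norm (I01 t * (g t - c)))) < \<infinity>" using False by (simp add: less_top)
   qed measurable
   have ic: "integrable lborel (%t. I01 t * c)" by simp
   have "(LINT t|lborel. I01 t * g t) = (LINT t|lborel. I01 t * (g t - c) + I01 t * c)"
    by (intro Bochner_Integration.integral_cong refl) (auto split: split_indicator)
   also have "... = (LINT t|lborel. I01 t * (g t - c)) + c" using i1 ic by simp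
   finally have "\<bar>(LINT t|lborel. I01 t * g t) - c\<bar> = norm (LINT t|lborel. I01 t * (g t - c))" by simp
   also have "ennreal ... <= (\<integral>t. ennreal (norm (I01 t * (g t - c))))"
    by (rule integral_norm_bound_ennreal[OF i1])
   also have "... = (\<integral>t. ennreal \<bar>g t - c\<bar> * I01 t)"
    by (intro nn_integral_cong) (auto split: split_indicator)
   finally show ?thesis .
  qed simp
  have "(\<integral>x. ennreal (norm (dq n i u x - G x \<bullet> i)) * indicator K x)
   <= (\<integral>x. (\<integral>t. ennreal \<bar>f (x + t *R h n) - f x\<bar> * I01 t))"
  proof (rule nn_integral_mono_AE)
   show "AE x in lborel. ennreal (norm (dq n i u x - G x \<bullet> i)) * indicator K x
    <= (\<integral>t. ennreal \<bar>f (x + t *R h n) - f x\<bar> * I01 t)"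
    using translate_eq_integral[OF wg, of "h n"]
   proof eventually_elim
    case (elim x)
    show ?case
    proof (cases "x : K")
     case True
     have "(LINT t|lborel. I01 t * (G (x + t *R h n) \<bullet> h n)) = (LINT t|lborel. (1 / 2 ^ n) * (I01 t * (G (x + t *R h n) \<bullet> i)))"
      by (intro Bochner_Integration.integral_cong refl) (simp add: h_def)
     also have "... = (1 / 2 ^ n) * (LINT t|lborel. I01 t * (G (x + t *R h n) \<bullet> i))"
      by (rule integral_mult_right_zero)
     finally have "dq n i u x = (LINT t|lborel. I01 t * (G (x + t *R h n) \<bullet> i))"
      using elim unfolding dq_def h_def[symmetric] by simp
     hence "ennreal (norm (dq n i u x - G x \<bullet> i)) <= (\<integral>t. ennreal \<bar>G (x + t *R h n) \<bullet> i - G x \<bullet> i\<bar> * I01 t)"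
      using avg[of "%t. G (x + t *R h n) \<bullet> i" "G x \<bullet> i"] by simp
     also have "... = (\<integral>t. ennreal \<bar>f (x + t *R h n) - f x\<bar> * I01 t)"
     proof (rule nn_integral_cong)
      fix t :: real
      show "ennreal \<bar>G (x + t *R h n) \<bullet> i - G x \<bullet> i\<bar> * I01 t = ennreal \<bar>f (x + t *R h n) - f x\<bar> * I01 t"
      proof (cases "t : {0..1}")
       case t: True
       have "t * (1 / 2 ^ n) <= 1 * 1" using t by (intro mult_mono) auto
       hence "x + t *R h n : K'" using K'I[OF True, of "t * (1 / 2 ^ n)"] t by (simp add: h_def)
       moreover have "x : K'" using K'I[OF True, of 0] by simp
       ultimately show ?thesis by (simp add: f_def)
      qed simp
     qed
     finally show ?thesis using True by simp
    qed simp
   qed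
  qed
  also have "... = (\<integral>t. (\<integral>x. ennreal \<bar>f (x + t *R h n) - f x\<bar> * I01 t))"
   by (rule lborel_pair.Fubini') measurable
  also have "... = (\<integral>t. \<omega> (t *R h n) * I01 t)"
   unfolding \<omega>_def by (intro nn_integral_cong nn_integral_multc) measurable
  finally show "(\<integral>x. ennreal (norm (dq n i u x - G x \<bullet> i)) * indicator K x)
   <= (\<integral>t. \<omega> (t *R h n) * I01 t)" .
 qed
qed

lemma weak_gradientI_dq:
 fixes u :: "'a::euclidean_space => real"
 assumes u: "locally_integrable u" and G: "locally_integrable G"
  and dq: "!!i. i : Basis ==> L1loc_tendsto (%n. dq n i u) (%x. G x \<bullet> i)"
 shows "has_weak_gradient u G"
 unfolding has_weak_gradient_def
proof (intro conjI allI impI ballI u G)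
 fix \<phi> :: "'a => real" and i :: 'a assume \<phi>: "test_function \<phi>" and i: "i : Basis"
 note [measurable] = loc_int_measurable[OF u]
 obtain K B where K: "compact K" "!!x. x ~: K ==> \<phi> x = 0" "!!x. \<bar>\<phi> x\<bar> <= B"
  "!!x i. x ~: K ==> FD \<phi> x i = 0"
  "!!x i. i : Basis ==> \<bar>FD \<phi> x i\<bar> <= B" "0 <= B"
  using test_functionE[OF \<phi>] by blast
 have [measurable]: "\<phi> : Borel" "(%x. FD \<phi> x i) : Borel"
  by (intro borel_measurable_continuous_onI test_function_continuous \<phi> i)+
 define K' where "K' = (%(y, t). y + t *R i) ` (K \<times> {0..1::real})"
 have K': "compact K'" using tube_compact[OF K(1)] by (simp add: K'_def)
 hence [measurable]: "K' : sets borel" by (simp add: borel_compact)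
 have K'I: "x : K'" if "x - t *R i : K" "t : {0..1}" for x t
  unfolding K'_def using that by (intro image_eqI[of _ _ "(x - t *R i, t)"]) auto
 define q where "q n x = 2 ^ n * (\<phi> x - \<phi> (x - (1 / 2 ^ n) *R i))" for n x
 have q_le: "\<bar>q n x\<bar> <= B" for n x
 proof -
  have "\<exists>z>0. z < 1 / 2 ^ n & \<phi> (x - (1 / 2 ^ n) *R i) - \<phi> (x - 0 *R i) = (1 / 2 ^ n - 0) * - frechet_derivative \<phi> (at (x - z *R i)) i"
   using test_function_line[OF \<phi>] by (intro MVT2) auto
  then obtain z where "\<phi> (x - (1 / 2 ^ n) *R i) - \<phi> x = (1 / 2 ^ n) * - frechet_derivative \<phi> (at (x - z *R i)) i" by auto
  hence "\<phi> x - \<phi> (x - (1 / 2 ^ n) *R i) = (1 / 2 ^ n) * frechet_derivative \<phi> (at (x - z *R i)) i" by linarith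
  hence "q n x = frechet_derivative \<phi> (at (x - z *R i)) i" by (simp add: q_def)
  thus ?thesis using K(5)[OF i] by simp
 qed
 have q0: "q n x = 0" if "x ~: K'" for n x
 proof -
  have "x ~: K" using that K'I[of x 0] by auto
  moreover have "x - (1 / 2 ^ n) *R i ~: K" using that K'I[of x "1 / 2 ^ n"] by auto
  ultimately show ?thesis using K(2) by (simp add: q_def)
 qed
 have [measurable]: "q n : Borel" for n unfolding q_def by measurable
 have "(%n. LINT x|lborel. u x * q n x) ----> (LINT x|lborel. u x * FD \<phi> x i)"
 proof (rule integral_dominated_convergence[where w="%x. B * \<bar>indicator K' x *R u x\<bar>"])
  show "integrable lborel (%x. B * \<bar>indicator K' x *R u x\<bar>)"
   using u K' unfolding locally_integrable_def set_integrable_def by (intro integrable_mult_right integrable_abs) blast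
  show "AE x in lborel. norm (u x * q n x) <= B * \<bar>indicator K' x *R u x\<bar>" for n
  proof (rule AE_I2)
   fix x
   show "norm (u x * q n x) <= B * \<bar>indicator K' x *R u x\<bar>"
    using q_le[of n x] q0[of x n] mult_left_mono[OF q_le[of n x], of "\<bar>u x\<bar>"]
    by (cases "x : K'") (auto simp: abs_mult mult.commute)
  qed
  show "AE x in lborel. (%n. u x * q n x) ----> u x * FD \<phi> x i"
  proof (intro AE_I2 tendsto_mult tendsto_const)
   fix x
   have "((%t. \<phi> (x - t *R i)) has_real_derivative - FD \<phi> x i) (at 0)"
    using test_function_line[OF \<phi>, of x i 0] by simp
   hence *: "((%t. (\<phi> (x - t *R i) - \<phi> x) / t) \<longlongrightarrow> - FD \<phi> x i) (at 0)"
    by (simp add: has_field_derivative_iff)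
   have "(%n. (\<phi> (x - (1 / 2 ^ n) *R i) - \<phi> x) / (1 / 2 ^ n)) ----> - FD \<phi> x i"
   proof (rule filterlim_compose[OF *])
    show "filterlim (%n. 1 / 2 ^ n :: real) (at 0) sequentially"
     unfolding filterlim_at using LIMSEQ_realpow_zero[of "1/2::real"] by (auto simp: power_divide)
   qed
   from tendsto_minus[OF this] show "(%n. q n x) ----> FD \<phi> x i"
    by (simp add: q_def algebra_simps)
  qed
 qed auto
 moreover have "(LINT x|lborel. u x * q n x) = - (LINT x|lborel. dq n i u x * \<phi> x)" for n
 proof -
  define s where "s = (1 / 2 ^ n) *R i"
  have i0: "integrable lborel (%x. u x * \<phi> x)" "integrable lborel (%x. u (x + s) * \<phi> x)"
   using loc_int_mult[OF u _ K(1), of \<phi> B]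
    loc_int_mult[OF loc_int_shift[OF u, of s] _ K(1), of \<phi> B] K(2,3) by (simp_all add: mult.commute)
  have i1: "integrable lborel (%x. u x * \<phi> (x - s))" using integrable_lborel_shift[OF i0(2), of "- s"] by simp
  have sh: "(LINT x|lborel. u x * \<phi> (x - s)) = (LINT x|lborel. u (x + s) * \<phi> x)"
   using integral_lborel_shift[of "%x. u x * \<phi> (x - s)" s] by simp
  have "(LINT x|lborel. u x * q n x) = (LINT x|lborel. 2 ^ n * (u x * \<phi> x - u x * \<phi> (x - s)))"
   by (intro Bochner_Integration.integral_cong refl) (simp add: q_def s_def algebra_simps)
  also have "... = 2 ^ n * ((LINT x|lborel. u x * \<phi> x) - (LINT x|lborel. u (x + s) * \<phi> x))"
   using i0 i1 sh by simp
  also have "... = - (2 ^ n * (LINT x|lborel. u (x + s) * \<phi> x - u x * \<phi> x))" using i0 by (simp add: right_diff_distrib)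
  also have "2 ^ n * (LINT x|lborel. u (x + s) * \<phi> x - u x * \<phi> x) = (LINT x|lborel. 2 ^ n * (u (x + s) * \<phi> x - u x * \<phi> x))"
   by (rule integral_mult_right_zero[symmetric])
  also have "... = (LINT x|lborel. dq n i u x * \<phi> x)"
   by (intro Bochner_Integration.integral_cong refl) (simp add: dq_def s_def algebra_simps)
  finally show ?thesis .
 qed
 ultimately have l1: "(%n. - (LINT x|lborel. dq n i u x * \<phi> x)) ----> (LINT x|lborel. u x * FD \<phi> x i)" by simp
 have "(%n. LINT x|lborel. dq n i u x * \<phi> x) ----> (LINT x|lborel. (G x \<bullet> i) * \<phi> x)"
  by (rule L1loc_test_tendsto[OF dq[OF i] loc_int_dq[OF u] loc_int_inner[OF G] _ K(1-3)]) simp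
 from LIMSEQ_unique[OF l1 tendsto_minus[OF this]]
 show "(LINT x|lborel. u x * FD \<phi> x i) = - (LINT x|lborel. (G x \<bullet> i) * \<phi> x)" .
qed

lemma weak_gradient_shift_tendsto:
 fixes u :: "'a::euclidean_space => real"
 assumes wg: "has_weak_gradient u G"
 shows "AE x in lborel. (%n. u (x + (1 / 2 ^ n) *R i)) ----> u x"
proof -
 have u: "locally_integrable u" and G: "locally_integrable G"
  using wg unfolding has_weak_gradient_def by blast+
 note [measurable] = loc_int_measurable[OF u] loc_int_measurable[OF G]
 have "AE x in lborel. x : cball 0 (real m) --> (%n. u (x + (1 / 2 ^ n) *R i)) ----> u x" for m
 proof -
  define K where "K = cball (0::'a) (real m)"
  have K: "compact K" by (simp add: K_def)
  have [measurable]: "K : sets borel" by (simp add: K_def)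
  have "\<forall>\<^sub>F n in sequentially. (\<integral>x. ennreal (norm (dq n i u x - G x \<bullet> i)) * indicator K x) < 1"
   using L1loc_tendstoD[OF dq_tendsto_weak_gradient[OF wg] K, of i] by (rule order_tendstoD) simp
  then obtain n0 where n0: "!!n. n0 <= n ==> (\<integral>x. ennreal (norm (dq n i u x - G x \<bullet> i)) * indicator K x) < 1"
   by (auto simp: eventually_sequentially)
  define M where "M = 1 + (\<integral>x. ennreal (norm (G x \<bullet> i)) * indicator K x)"
  have M: "M < \<infinity>" using loc_int_inner[OF G, of i] K by (auto simp: M_def loc_int_iff)
  have dq_le: "(\<integral>x. ennreal \<bar>dq n i u x\<bar> * indicator K x) <= M" if "n0 <= n" for n
  proof -
   have "(\<integral>x. ennreal \<bar>dq n i u x\<bar> * indicator K x)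
    <= (\<integral>x. ennreal (norm (dq n i u x - G x \<bullet> i)) * indicator K x + ennreal (norm (G x \<bullet> i)) * indicator K x)"
    by (intro nn_integral_mono) (auto simp flip: ennreal_plus intro!: ennreal_leI split: split_indicator)
   also have "... = (\<integral>x. ennreal (norm (dq n i u x - G x \<bullet> i)) * indicator K x) + (\<integral>x. ennreal (norm (G x \<bullet> i)) * indicator K x)"
    by (rule nn_integral_add) measurable
   also have "... <= M" unfolding M_def using n0[OF that] by (intro add_right_mono) simp
   finally show ?thesis .
  qed
  define d where "d n x = \<bar>u (x + (1 / 2 ^ (n + n0)) *R i) - u x\<bar> * indicator K x" for n x
  have [measurable]: "d n : Borel" for n unfolding d_def by measurable
  have d_le: "(\<integral>x. ennreal (d n x)) <= ennreal ((1/2) ^ n) * M" for n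
  proof -
   have "(\<integral>x. ennreal (d n x)) = (\<integral>x. ennreal ((1/2) ^ (n + n0)) * (ennreal \<bar>dq (n + n0) i u x\<bar> * indicator K x))"
    by (intro nn_integral_cong) (auto simp: d_def dq_def abs_mult ennreal_mult[symmetric] power_divide split: split_indicator)
   also have "... = ennreal ((1/2) ^ (n + n0)) * (\<integral>x. ennreal \<bar>dq (n + n0) i u x\<bar> * indicator K x)"
    by (rule nn_integral_cmult) measurable
   also have "... <= ennreal ((1/2) ^ n) * M"
    by (intro mult_mono dq_le ennreal_leI power_decreasing) auto
   finally show ?thesis .
  qed
  have "(\<integral>x. (\<Sum>n. ennreal (d n x))) = (\<Sum>n. \<integral>\<^sup>+x. ennreal (d n x) \<partial>lborel)"
   by (rule nn_integral_suminf) measurable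
  also have "... <= (\<Sum>n. ennreal ((1/2) ^ n) * M)" by (intro suminf_le d_le) auto
  also have "... = (\<Sum>n. ennreal ((1/2) ^ n)) * M" by (rule ennreal_suminf_multc)
  also have "(\<Sum>n. ennreal ((1/2) ^ n)) = ennreal 2"
   using suminf_geometric[of "1/2::real"] by (subst suminf_ennreal2) auto
  also have "ennreal 2 * M < \<infinity>" using M by (simp add: ennreal_mult_less_top)
  finally have "AE x in lborel. (\<Sum>n. ennreal (d n x)) ~= \<infinity>"
   by (intro nn_integral_PInf_AE) auto
  thus ?thesis
  proof eventually_elim
   case (elim x)
   show ?case
   proof
    assume x: "x : cball 0 (real m)"
    have "summable (%n. d n x)" using elim by (intro summable_suminf_not_top) (auto simp: d_def)
    hence "(%n. d n x) ----> 0" by (rule summable_LIMSEQ_zero)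
    hence "(%n. \<bar>u (x + (1 / 2 ^ (n + n0)) *R i) - u x\<bar>) ----> 0" using x by (simp add: d_def K_def)
    hence "(%n. u (x + (1 / 2 ^ (n + n0)) *R i)) ----> u x"
     by (rule LIM_zero_cancel[OF tendsto_rabs_zero_cancel])
    thus "(%n. u (x + (1 / 2 ^ n) *R i)) ----> u x" by (rule LIMSEQ_offset)
   qed
  qed
 qed
 hence "AE x in lborel. \<forall>m::nat. x : cball 0 (real m) --> (%n. u (x + (1 / 2 ^ n) *R i)) ----> u x"
  unfolding AE_all_countable by blast
 thus ?thesis
 proof eventually_elim
  case (elim x)
  obtain m :: nat where "norm x <= real m" using real_arch_simple by blast
  hence "x : cball 0 (real m)" by simp
  with elim show ?case by blast
 qed
qed

subsection \<open>Calculus rules\<close>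

text \<open>In the chain rule the difference quotients of \<open>F \<circ> u\<close> are those of \<open>u\<close> times slopes of
 \<open>F\<close>, which are bounded and converge almost everywhere.\<close>

lemma weak_gradient_chain:
 fixes u :: "'a::euclidean_space => real"
 assumes wg: "has_weak_gradient u G" and I: "convex I" "!!x. u x : I"
  and [measurable]: "F : Borel" "F' : Borel"
  and F: "!!t. t : I ==> (F has_real_derivative F' t) (at t within I)"
  and L: "!!t. t : I ==> \<bar>F' t\<bar> <= L"
 shows "has_weak_gradient (%x. F (u x)) (%x. F' (u x) *R G x)"
proof -
 have u: "locally_integrable u" and G: "locally_integrable G"
  using wg unfolding has_weak_gradient_def by blast+
 note [measurable] = loc_int_measurable[OF u] loc_int_measurable[OF G]
 have L0: "0 <= L" using L[OF I(2)[of 0]] by linarith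
 have lip: "\<bar>F b - F a\<bar> <= L * \<bar>b - a\<bar>" if "a : I" "b : I" for a b
  using field_differentiable_bound[OF I(1) F, of L b a] L that by (simp add: real_norm_def)
 define q where "q a b = (if a = b then F' a else (F b - F a) / (b - a))" for a b
 have q_le: "\<bar>q a b\<bar> <= L" if "a : I" "b : I" for a b
  using lip[OF that] L[OF that(1)] by (auto simp: q_def divide_le_eq)
 have q_eq: "F b - F a = q a b * (b - a)" for a b by (simp add: q_def)
 have q_lim: "(%n. q a (b n)) ----> F' a" if a: "a : I" and b: "!!n. b n : I" "b ----> a" for a b
 proof (rule LIMSEQ_I)
  fix r :: real assume "0 < r"
  have "((%y. (F y - F a) / (y - a)) \<longlongrightarrow> F' a) (at a within I)"
   using F[OF a] by (simp add: has_field_derivative_iff)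
  then obtain \<delta> where \<delta>: "0 < \<delta>" "!!y. y : I ==> y ~= a ==> \<bar>y - a\<bar> < \<delta> ==> \<bar>(F y - F a) / (y - a) - F' a\<bar> < r"
   using \<open>0 < r\<close> unfolding Lim_within dist_real_def by force
  obtain n0 where n0: "!!n. n0 <= n ==> \<bar>b n - a\<bar> < \<delta>" using LIMSEQ_D[OF b(2) \<delta>(1)] by auto
  have "norm (q a (b n) - F' a) < r" if "n0 <= n" for n
   using \<delta>(2)[OF b(1)[of n] _ n0[OF that]] \<open>0 < r\<close> by (auto simp: q_def)
  thus "\<exists>n0. \<forall>n\<ge>n0. norm (q a (b n) - F' a) < r" by blast
 qed
 have [measurable]: "(%x. q (u x) (u (x + h))) : Borel" for h unfolding q_def by measurable
 show ?thesis
 proof (rule weak_gradientI_dq)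
  show "locally_integrable (%x. F (u x))"
  proof (rule loc_int_mono)
   show "locally_integrable (%x. \<bar>F (u 0)\<bar> + L * \<bar>u x - u 0\<bar>)"
    using loc_int_add[OF loc_int_const[of "\<bar>F (u 0)\<bar>"]
      loc_int_scaleR[OF loc_int_mono[OF loc_int_diff[OF u loc_int_const[of "u 0"]], of "%x. \<bar>u x - u 0\<bar>"], of L]] by simp
   show "AE x in lborel. norm (F (u x)) <= norm (\<bar>F (u 0)\<bar> + L * \<bar>u x - u 0\<bar>)"
   proof (rule AE_I2)
    fix x :: 'a
    have "\<bar>F (u x)\<bar> <= \<bar>F (u 0)\<bar> + \<bar>F (u x) - F (u 0)\<bar>" by linarith
    also have "... <= \<bar>F (u 0)\<bar> + L * \<bar>u x - u 0\<bar>" using lip[OF I(2)[of 0] I(2)[of x]] by simp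
    finally show "norm (F (u x)) <= norm (\<bar>F (u 0)\<bar> + L * \<bar>u x - u 0\<bar>)" by simp
   qed
  qed measurable
  show "locally_integrable (%x. F' (u x) *R G x)"
  proof (rule loc_int_mono[OF loc_int_scaleR[OF G, of L]])
   show "AE x in lborel. norm (F' (u x) *R G x) <= norm (L *R G x)"
    using L[OF I(2)] L0 by (intro AE_I2) (auto intro!: mult_right_mono)
  qed measurable
  fix i :: 'a assume i: "i : Basis"
  define Q where "Q n x = q (u x) (u (x + (1 / 2 ^ n) *R i)) * (G x \<bullet> i)" for n x
  have [measurable]: "Q n : Borel" for n unfolding Q_def by measurable
  have Q: "L1loc_tendsto Q (%x. F' (u x) * (G x \<bullet> i))"
  proof (rule L1loc_tendsto_dominated)
   show "locally_integrable (%x. 2 * L * norm (G x))"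
    using loc_int_scaleR[OF loc_int_mono[OF G, of "%x. norm (G x)"], of "2 * L"] by simp
   show "AE x in lborel. norm (Q n x - F' (u x) * (G x \<bullet> i)) <= 2 * L * norm (G x)" for n
   proof (rule AE_I2)
    fix x
    have "Q n x - F' (u x) * (G x \<bullet> i) = (q (u x) (u (x + (1 / 2 ^ n) *R i)) - F' (u x)) * (G x \<bullet> i)"
     by (simp add: Q_def left_diff_distrib)
    moreover have "\<bar>q (u x) (u (x + (1 / 2 ^ n) *R i)) - F' (u x)\<bar> <= 2 * L"
     using q_le[OF I(2)[of x] I(2)[of "x + (1 / 2 ^ n) *R i"]] L[OF I(2)[of x]] by linarith
    ultimately show "norm (Q n x - F' (u x) * (G x \<bullet> i)) <= 2 * L * norm (G x)"
     using Basis_le_norm[OF i, of "G x"] L0 by (simp add: abs_mult mult_mono)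
   qed
   show "AE x in lborel. (%n. Q n x) ----> F' (u x) * (G x \<bullet> i)"
    using weak_gradient_shift_tendsto[OF wg, of i]
   proof eventually_elim
    case (elim x)
    show ?case unfolding Q_def by (intro tendsto_mult tendsto_const q_lim I(2) elim)
   qed
  qed auto
  have "L1loc_tendsto (%n. dq n i (%x. F (u x))) (%x. F' (u x) * (G x \<bullet> i))"
  proof (rule L1loc_tendsto_add_le[OF dq_tendsto_weak_gradient[OF wg, of i] _ _ Q _ _ L0])
   show "AE x in lborel. norm (dq n i (%x. F (u x)) x - F' (u x) * (G x \<bullet> i))
    <= L * norm (dq n i u x - G x \<bullet> i) + norm (Q n x - F' (u x) * (G x \<bullet> i))" for n
   proof (rule AE_I2)
    fix x
    define y where "y = x + (1 / 2 ^ n) *R i"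
    have "dq n i (%x. F (u x)) x = q (u x) (u y) * dq n i u x"
     unfolding dq_def y_def[symmetric] using q_eq[of "u y" "u x"] by (simp add: mult_ac)
    hence "dq n i (%x. F (u x)) x - F' (u x) * (G x \<bullet> i)
     = q (u x) (u y) * (dq n i u x - G x \<bullet> i) + (Q n x - F' (u x) * (G x \<bullet> i))"
     by (simp add: Q_def y_def right_diff_distrib)
    hence "norm (dq n i (%x. F (u x)) x - F' (u x) * (G x \<bullet> i))
     <= norm (q (u x) (u y) * (dq n i u x - G x \<bullet> i)) + norm (Q n x - F' (u x) * (G x \<bullet> i))"
     by (simp only: norm_triangle_ineq)
    also have "norm (q (u x) (u y) * (dq n i u x - G x \<bullet> i)) = \<bar>q (u x) (u y)\<bar> * norm (dq n i u x - G x \<bullet> i)"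
     by (simp add: abs_mult)
    also have "\<bar>q (u x) (u y)\<bar> * norm (dq n i u x - G x \<bullet> i) + norm (Q n x - F' (u x) * (G x \<bullet> i)) <= L * norm (dq n i u x - G x \<bullet> i) + norm (Q n x - F' (u x) * (G x \<bullet> i))"
     using q_le[OF I(2) I(2)] by (intro add_right_mono mult_right_mono) auto
    finally show "norm (dq n i (%x. F (u x)) x - F' (u x) * (G x \<bullet> i))
    <= L * norm (dq n i u x - G x \<bullet> i) + norm (Q n x - F' (u x) * (G x \<bullet> i))" .
   qed
  qed auto
  thus "L1loc_tendsto (%n. dq n i (%x. F (u x))) (%x. (F' (u x) *R G x) \<bullet> i)" by simp
 qed
qed

text \<open>For smooth \<open>\<zeta>\<close> the product \<open>\<zeta> \<phi>\<close> is again a test function, so the rule is the definition for \<open>w\<close>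
 tested with \<open>\<zeta> \<phi>\<close>.\<close>

lemma weak_gradient_mult_smooth:
 fixes w :: "'a::euclidean_space => real"
 assumes wg: "has_weak_gradient w H" and C: "!!n. Ck n \<zeta>"
  and \<zeta>: "!!x. (\<zeta> has_derivative (%h. Z x \<bullet> h)) (at x)" "!!x. \<bar>\<zeta> x\<bar> <= B" "!!x. norm (Z x) <= L"
  and [measurable]: "Z : Borel"
 shows "has_weak_gradient (%x. \<zeta> x * w x) (%x. \<zeta> x *R H x + w x *R Z x)"
proof -
 have w: "locally_integrable w" and H: "locally_integrable H"
  using wg unfolding has_weak_gradient_def by blast+
 note [measurable] = loc_int_measurable[OF w] loc_int_measurable[OF H]
 have [measurable]: "\<zeta> : Borel"
  using C[of 0] by (intro borel_measurable_continuous_onI) simp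
 have B0: "0 <= B" using \<zeta>(2)[of 0] by linarith
 have L0: "0 <= L" using \<zeta>(3)[of 0] norm_ge_zero order_trans by blast
 have wZ: "locally_integrable (%x. w x *R Z x)"
 proof (rule loc_int_mono[OF loc_int_scaleR[OF w, of L]])
  show "AE x in lborel. norm (w x *R Z x) <= norm (L *R w x)"
   using \<zeta>(3) L0 by (intro AE_I2) (auto simp: mult.commute[of L] abs_mult intro!: mult_left_mono)
 qed measurable
 have \<zeta>H: "locally_integrable (%x. \<zeta> x *R H x)"
 proof (rule loc_int_mono[OF loc_int_scaleR[OF H, of B]])
  show "AE x in lborel. norm (\<zeta> x *R H x) <= norm (B *R H x)"
   using \<zeta>(2) B0 by (intro AE_I2) (auto intro!: mult_right_mono)
 qed measurable
 have \<zeta>w: "locally_integrable (%x. \<zeta> x * w x)"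
 proof (rule loc_int_mono[OF loc_int_scaleR[OF w, of B]])
  show "AE x in lborel. norm (\<zeta> x * w x) <= norm (B *R w x)"
   using \<zeta>(2) B0 by (intro AE_I2) (auto simp: abs_mult intro!: mult_right_mono)
 qed measurable
 show ?thesis
  unfolding has_weak_gradient_def
 proof (intro conjI allI impI ballI \<zeta>w loc_int_add[OF \<zeta>H wZ])
  fix \<phi> :: "'a => real" and i :: 'a assume \<phi>: "test_function \<phi>" and i: "i : Basis"
  let ?D = "%x. FD \<phi> x i"
  have [measurable]: "\<phi> : Borel" "?D : Borel"
   by (intro borel_measurable_continuous_onI test_function_continuous \<phi> i)+
  have "((%x. \<zeta> x * \<phi> x) has_derivative (%h. \<zeta> x * FD \<phi> x h + (Z x \<bullet> h) * \<phi> x)) (at x)" for x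
   using test_function_continuous(2)[OF \<phi>] by (intro has_derivative_mult \<zeta>(1)) (simp add: frechet_derivative_works)
  hence FD: "FD (%x. \<zeta> x * \<phi> x) x i = \<zeta> x * ?D x + (Z x \<bullet> i) * \<phi> x" for x
   using frechet_derivative_at by (metis (no_types, lifting))
  have "closure {x. \<zeta> x * \<phi> x ~= 0} \<subseteq> closure {x. \<phi> x ~= 0}" by (intro closure_mono) auto
  hence "compact (closure {x. \<zeta> x * \<phi> x ~= 0})"
   using \<phi> unfolding test_function_def by (meson bounded_subset closed_closure compact_eq_bounded_closed)
  hence "test_function (%x. \<zeta> x * \<phi> x)" using \<phi> C unfolding test_function_def by (auto intro: Ck_mult)
  hence "(LINT x|lborel. w x * FD (%x. \<zeta> x * \<phi> x) x i) = - (LINT x|lborel. (H x \<bullet> i) * (\<zeta> x * \<phi> x))"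
   using wg i unfolding has_weak_gradient_def by blast
  hence E: "(LINT x|lborel. ?D x *R (\<zeta> x * w x) + \<phi> x *R ((w x *R Z x) \<bullet> i)) = - (LINT x|lborel. \<phi> x *R ((\<zeta> x *R H x) \<bullet> i))"
   unfolding FD by (simp add: distrib_left mult_ac)
  obtain K c where K: "compact K" "!!x. x ~: K ==> \<phi> x = 0" "!!x. \<bar>\<phi> x\<bar> <= c"
   "!!x i. x ~: K ==> FD \<phi> x i = 0"
   "!!x i. i : Basis ==> \<bar>FD \<phi> x i\<bar> <= c" "0 <= c"
   using test_functionE[OF \<phi>] by blast
  have I: "integrable lborel (%x. ?D x *R (\<zeta> x * w x))"
   "integrable lborel (%x. \<phi> x *R ((w x *R Z x) \<bullet> i))" "integrable lborel (%x. \<phi> x *R ((\<zeta> x *R H x) \<bullet> i))"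
   using K(4) K(5)[OF i] K(2,3)
   by (intro loc_int_mult[OF \<zeta>w _ K(1), of _ c] loc_int_mult[OF loc_int_inner[OF wZ] _ K(1), of _ c]
    loc_int_mult[OF loc_int_inner[OF \<zeta>H] _ K(1), of _ c]; auto)+
  have "(LINT x|lborel. ?D x *R (\<zeta> x * w x)) + (LINT x|lborel. \<phi> x *R ((w x *R Z x) \<bullet> i)) = - (LINT x|lborel. \<phi> x *R ((\<zeta> x *R H x) \<bullet> i))"
   using E unfolding Bochner_Integration.integral_add[OF I(1,2)] .
  moreover have "(LINT x|lborel. ((\<zeta> x *R H x + w x *R Z x) \<bullet> i) * \<phi> x)
   = (LINT x|lborel. \<phi> x *R ((\<zeta> x *R H x) \<bullet> i)) + (LINT x|lborel. \<phi> x *R ((w x *R Z x) \<bullet> i))"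
   by (subst Bochner_Integration.integral_add[OF I(3,2), symmetric]) (simp add: inner_add_left distrib_left mult_ac)
  moreover have "(LINT x|lborel. \<zeta> x * w x * ?D x) = (LINT x|lborel. ?D x *R (\<zeta> x * w x))" by (simp add: mult_ac)
  ultimately show "(LINT x|lborel. \<zeta> x * w x * ?D x) = - (LINT x|lborel. ((\<zeta> x *R H x + w x *R Z x) \<bullet> i) * \<phi> x)" by linarith
 qed
qed

lemma weak_gradient_const: "has_weak_gradient (%x::'a::euclidean_space. c) (%x. 0)"
 by (rule weak_gradientI_dq) (auto simp: loc_int_const L1loc_tendsto_def dq_def)

text \<open>The chain rule for \<open>\<surd>(t\<^sup>2 + e\<^sup>2)\<close> and \<open>e \<rightarrow> 0\<close>.\<close>

lemma weak_gradient_abs: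
 fixes u :: "'a::euclidean_space => real"
 assumes wg: "has_weak_gradient u G"
 shows "has_weak_gradient (%x. \<bar>u x\<bar>) (%x. sgn (u x) *R G x)"
proof -
 have u: "locally_integrable u" and G: "locally_integrable G"
  using wg unfolding has_weak_gradient_def by blast+
 note [measurable] = loc_int_measurable[OF u] loc_int_measurable[OF G]
 define e :: "nat => real" where "e n = (1 / 2) ^ n" for n
 have e: "0 < e n" "e n <= 1" for n by (auto simp: e_def power_le_one)
 have e_lim: "e ----> 0" unfolding e_def by (rule LIMSEQ_realpow_zero) auto
 define F where "F n t = sqrt (t\<^sup>2 + (e n)\<^sup>2)" for n and t :: real
 define F' where "F' n t = t / sqrt (t\<^sup>2 + (e n)\<^sup>2)" for n and t :: real
 have pos: "0 < t\<^sup>2 + (e n)\<^sup>2" for n t using e[of n] by (simp add: add_nonneg_pos)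
 have F'_le: "\<bar>F' n t\<bar> <= 1" for n t
 proof -
  have "\<bar>t\<bar> <= sqrt (t\<^sup>2 + (e n)\<^sup>2)" by (rule real_le_rsqrt) simp
  thus ?thesis using pos[of t n] by (simp add: F'_def divide_le_eq)
 qed
 have dF: "(F n has_real_derivative F' n t) (at t within UNIV)" for n t
  unfolding F_def F'_def using pos[of t n] by (auto intro!: derivative_eq_intros simp: field_simps)
 have [measurable]: "F n : Borel" "F' n : Borel" for n
  unfolding F_def F'_def by measurable
 have F_bd: "\<bar>F n t - \<bar>t\<bar>\<bar> <= e n" for n t
 proof -
  have "\<bar>t\<bar> <= F n t" unfolding F_def by (rule real_le_rsqrt) simp
  moreover have "F n t <= \<bar>t\<bar> + e n" unfolding F_def
   using e[of n] by (intro real_le_lsqrt) (auto simp: power2_sum)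
  ultimately show ?thesis by linarith
 qed
 have wgn: "has_weak_gradient (%x. F n (u x)) (%x. F' n (u x) *R G x)" for n
  by (rule weak_gradient_chain[OF wg, of UNIV _ _ 1]) (use dF F'_le in auto)
 have sg: "\<bar>F' n t - sgn t\<bar> <= 2" for n t using F'_le[of n t] by (auto simp: sgn_if abs_le_iff)
 show ?thesis
 proof (rule weak_gradient_limit[OF wgn])
  show "locally_integrable (%x. \<bar>u x\<bar>)" by (rule loc_int_mono[OF u]) auto
  show "locally_integrable (%x. sgn (u x) *R G x)"
  proof (rule loc_int_mono[OF G])
   show "AE x in lborel. norm (sgn (u x) *R G x) <= norm (G x)" by (auto simp: abs_sgn_eq)
  qed measurable
  show "L1loc_tendsto (%n x. F n (u x)) (%x. \<bar>u x\<bar>)"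
  proof (rule L1loc_tendsto_dominated[OF _ _ loc_int_const[of 1]])
   show "AE x in lborel. norm (F n (u x) - \<bar>u x\<bar>) <= 1" for n
    using F_bd[of n] e(2)[of n] by (auto intro: order_trans)
   show "AE x in lborel. (%n. F n (u x)) ----> \<bar>u x\<bar>"
   proof (rule AE_I2)
    fix x
    have "(%n. F n (u x) - \<bar>u x\<bar>) ----> 0"
     by (rule Lim_null_comparison[OF _ e_lim]) (use F_bd in auto)
    thus "(%n. F n (u x)) ----> \<bar>u x\<bar>" by (rule LIM_zero_cancel)
   qed
  qed auto
  show "L1loc_tendsto (%n x. F' n (u x) *R G x) (%x. sgn (u x) *R G x)"
  proof (rule L1loc_tendsto_dominated)
   show "locally_integrable (%x. 2 * norm (G x))"
    using loc_int_scaleR[OF loc_int_mono[OF G, of "%x. norm (G x)"], of 2] by simp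
   show "AE x in lborel. norm (F' n (u x) *R G x - sgn (u x) *R G x) <= 2 * norm (G x)" for n
    using sg by (intro AE_I2) (auto simp flip: scaleR_diff_left intro!: mult_right_mono)
   show "AE x in lborel. (%n. F' n (u x) *R G x) ----> sgn (u x) *R G x"
   proof (intro AE_I2 tendsto_scaleR tendsto_const)
    fix x
    have "(%n. sqrt ((u x)\<^sup>2 + (e n)\<^sup>2)) ----> sqrt ((u x)\<^sup>2 + 0\<^sup>2)" by (intro tendsto_intros e_lim)
    hence "(%n. sqrt ((u x)\<^sup>2 + (e n)\<^sup>2)) ----> \<bar>u x\<bar>" by simp
    hence "(%n. F' n (u x)) ----> u x / \<bar>u x\<bar>" if "u x ~= 0"
     unfolding F'_def using that by (intro tendsto_divide tendsto_const) auto
    thus "(%n. F' n (u x)) ----> sgn (u x)"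
     by (cases "u x = 0") (auto simp: F'_def sgn_if)
   qed
  qed auto
 qed
qed

section \<open>Energies\<close>

lemma ennreal_le_add_finite:
 fixes a b c :: ennreal
 assumes "a <= b + c" "b < \<infinity>" "c < \<infinity>"
 shows "a < \<infinity>"
proof -
 have "b + c < \<infinity>" using assms(2,3) by (simp add: less_top)
 thus ?thesis using assms(1) by (rule le_less_trans[rotated])
qed

lemma divide_powr_eq: "(a::real) / b powr c = a * b powr (- c)"
 unfolding powr_minus_divide by simp

lemma gagliardo_energy_eq:
 "gagliardo_energy s p (u :: 'a::euclidean_space => real) =
  (\<integral>x. (\<integral>y. ennreal (quot p u (real DIM('a) + s * p) x y)))"
 unfolding gagliardo_energy_def
 by (intro nn_integral_cong) (simp only: abs_minus_commute norm_minus_commute divide_powr_eq)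

lemma gagliardo_energy_translates:
 fixes u :: "'a::euclidean_space => real"
 assumes [measurable]: "u : Borel" "I : sets borel"
 shows "(\<integral>x. (\<integral>y. ennreal (quot p u c x y) * indicator I (y - x)))
  = (\<integral>h. ennreal (norm h powr (- c)) * indicator I h * (\<integral>x. ennreal (\<bar>u (x + h) - u x\<bar> powr p)))"
proof -
 have "(\<integral>x. (\<integral>y. ennreal (quot p u c x y) * indicator I (y - x)))
  = (\<integral>x. (\<integral>h. ennreal (norm h powr (- c)) * indicator I h * ennreal (\<bar>u (x + h) - u x\<bar> powr p)))"
 proof (rule nn_integral_cong)
  fix x
  have "(\<integral>y. ennreal (quot p u c x y) * indicator I (y - x))
   = (\<integral>h. ennreal (\<bar>u x - u (h + x)\<bar> powr p * norm (x - (h + x)) powr (- c)) * indicator I (h + x - x))"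
   by (rule nn_integral_lborel_shift[where h=x, symmetric]) measurable
  also have "... = (\<integral>h. ennreal (norm h powr (- c)) * indicator I h * ennreal (\<bar>u (x + h) - u x\<bar> powr p))"
   by (intro nn_integral_cong) (simp add: ennreal_mult add.commute abs_minus_commute mult_ac)
  finally show "(\<integral>y. ennreal (quot p u c x y) * indicator I (y - x))
   = (\<integral>h. ennreal (norm h powr (- c)) * indicator I h * ennreal (\<bar>u (x + h) - u x\<bar> powr p))" .
 qed
 also have "... = (\<integral>h. (\<integral>x. ennreal (norm h powr (- c)) * indicator I h * ennreal (\<bar>u (x + h) - u x\<bar> powr p)))"
  by (rule lborel_pair.Fubini') measurable
 also have "... = (\<integral>h. ennreal (norm h powr (- c)) * indicator I h * (\<integral>x. ennreal (\<bar>u (x + h) - u x\<bar> powr p)))"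
  by (intro nn_integral_cong nn_integral_cmult) measurable
 finally show ?thesis .
qed

lemma near_energy_le_gradient:
 fixes u :: "'a::euclidean_space => real"
 assumes p: "1 < p" and k: "k < p" and R: "0 <= R" and wg: "has_weak_gradient u G"
 shows "(\<integral>x. (\<integral>y. ennreal (quot p u (real DIM('a) + k) x y) * indicator (cball x R) y))
  <= ennreal (ball_volume TYPE('a) * DIM('a) / (p - k) * R powr (p - k)) * (Lp p G)"
proof -
 have u: "locally_integrable u" using wg unfolding has_weak_gradient_def by blast
 note [measurable] = loc_int_measurable[OF u]
 have [measurable]: "cball (0::'a) R : sets borel" by simp
 define E where "E = (Lp p G)"
 have "(\<integral>x. (\<integral>y. ennreal (quot p u (real DIM('a) + k) x y) * indicator (cball x R) y))
  = (\<integral>x. (\<integral>y. ennreal (quot p u (real DIM('a) + k) x y) * indicator (cball 0 R) (y - x)))"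
  by (intro nn_integral_cong) (auto simp: dist_norm norm_minus_commute split: split_indicator)
 also have "... = (\<integral>h. ennreal (norm h powr (- (real DIM('a) + k))) * indicator (cball 0 R) h * (\<integral>x. ennreal (\<bar>u (x + h) - u x\<bar> powr p)))"
  by (rule gagliardo_energy_translates) measurable
 also have "... <= (\<integral>h::'a. ennreal (norm h powr (p - k - DIM('a))) * indicator (cball 0 R) h * E)"
 proof (rule nn_integral_mono)
  fix h :: 'a
  have "(\<integral>x. ennreal (\<bar>u (x + h) - u x\<bar> powr p)) <= ennreal (norm h powr p) * E"
   using translate_powr_le[OF p wg, of UNIV h] by (simp add: E_def)
  hence "ennreal (norm h powr (- (real DIM('a) + k))) * indicator (cball 0 R) h * (\<integral>x. ennreal (\<bar>u (x + h) - u x\<bar> powr p))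
   <= ennreal (norm h powr (- (real DIM('a) + k))) * indicator (cball 0 R) h * (ennreal (norm h powr p) * E)"
   by (rule mult_left_mono) simp
  also have "... = ennreal (norm h powr (- (real DIM('a) + k)) * norm h powr p) * indicator (cball 0 R) h * E"
   by (simp add: ennreal_mult mult_ac)
  also have "norm h powr (- (real DIM('a) + k)) * norm h powr p = norm h powr (p - k - DIM('a))"
   unfolding powr_add[symmetric] by (rule arg_cong[where f="%a. norm h powr a"]) simp
  finally show "ennreal (norm h powr (- (real DIM('a) + k))) * indicator (cball 0 R) h * (\<integral>x. ennreal (\<bar>u (x + h) - u x\<bar> powr p))
   <= ennreal (norm h powr (p - k - DIM('a))) * indicator (cball 0 R) h * E" .
 qed
 also have "... = (\<integral>h::'a. ennreal (norm h powr (p - k - DIM('a))) * indicator (cball 0 R) h) * E"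
  by (rule nn_integral_multc) measurable
 also have "... = ennreal (ball_volume TYPE('a) * DIM('a) / (p - k) * R powr (p - k)) * E"
  using nn_integral_powr_cball[of "p - k" R, where 'a='a] k R by simp
 finally show ?thesis by (simp add: E_def)
qed

lemma gagliardo_energy_finite:
 fixes u :: "'a::euclidean_space => real"
 assumes p: "1 < p" and s: "0 < s" "s < 1" and wg: "has_weak_gradient u G"
  and G: "(Lp p G) < \<infinity>"
  and u: "(\<integral>x. ennreal (\<bar>u x\<bar> powr p)) < \<infinity>"
 shows "gagliardo_energy s p u < \<infinity>"
proof -
 have "locally_integrable u" using wg unfolding has_weak_gradient_def by blast
 note [measurable] = loc_int_measurable[OF this]
 define E where "E = (\<integral>x. ennreal (\<bar>u x\<bar> powr p))"
 define k where "k = s * p"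
 have k: "0 < k" "k < p" using p s by (auto simp: k_def)
 let ?f = "%x y. ennreal (quot p u (real DIM('a) + k) x y)"
 have tr: "(\<integral>x. ennreal (\<bar>u (x + h) - u x\<bar> powr p)) <= ennreal (2 * 2 powr p) * E" for h
 proof -
  have "(\<integral>x. ennreal (\<bar>u (x + h) - u x\<bar> powr p)) <= (\<integral>x. ennreal (2 powr p) * (ennreal (\<bar>u (x + h)\<bar> powr p) + ennreal (\<bar>u x\<bar> powr p)))"
  proof (rule nn_integral_mono)
   fix x
   have "\<bar>u (x + h) - u x\<bar> powr p <= (\<bar>u (x + h)\<bar> + \<bar>u x\<bar>) powr p" using p by (intro powr_mono2) auto
   also have "... <= 2 powr p * (\<bar>u (x + h)\<bar> powr p + \<bar>u x\<bar> powr p)" using p by (intro powr_add_le) auto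
   finally have "ennreal (\<bar>u (x + h) - u x\<bar> powr p) <= ennreal (2 powr p * (\<bar>u (x + h)\<bar> powr p + \<bar>u x\<bar> powr p))"
    by (rule ennreal_leI)
   also have "... = ennreal (2 powr p) * (ennreal (\<bar>u (x + h)\<bar> powr p) + ennreal (\<bar>u x\<bar> powr p))"
    by (simp add: ennreal_mult)
   finally show "ennreal (\<bar>u (x + h) - u x\<bar> powr p) <= ennreal (2 powr p) * (ennreal (\<bar>u (x + h)\<bar> powr p) + ennreal (\<bar>u x\<bar> powr p))" .
  qed
  also have "... = ennreal (2 powr p) * (\<integral>x. ennreal (\<bar>u (x + h)\<bar> powr p) + ennreal (\<bar>u x\<bar> powr p))"
   by (rule nn_integral_cmult) measurable
  also have "(\<integral>x. ennreal (\<bar>u (x + h)\<bar> powr p) + ennreal (\<bar>u x\<bar> powr p)) = (\<integral>x. ennreal (\<bar>u (x + h)\<bar> powr p)) + E"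
   unfolding E_def by (rule nn_integral_add) measurable
  also have "(\<integral>x. ennreal (\<bar>u (x + h)\<bar> powr p)) = E"
   unfolding E_def by (rule nn_integral_lborel_shift[where f="%x. ennreal (\<bar>u x\<bar> powr p)"]) measurable
  also have "ennreal (2 powr p) * (E + E) = ennreal (2 * 2 powr p) * E"
  proof -
   have "E + E = 2 * E" by (rule mult_2[symmetric])
   moreover have "ennreal (2 * 2 powr p) = 2 * ennreal (2 powr p)" by (simp add: ennreal_mult)
   ultimately show ?thesis by (simp only: mult.assoc mult.left_commute)
  qed
  finally show ?thesis .
 qed
 define I0 I1 where "I0 = cball (0::'a) 1" and "I1 = {h::'a. 1 <= norm h}"
 have [measurable]: "I0 : sets borel" "I1 : sets borel" unfolding I0_def I1_def by measurable
 have "gagliardo_energy s p u <= (\<integral>x. (\<integral>y. ?f x y * indicator I0 (y - x) + ?f x y * indicator I1 (y - x)))"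
  unfolding gagliardo_energy_eq k_def[symmetric]
  by (intro nn_integral_mono) (auto simp: I0_def I1_def split: split_indicator)
 also have "... = (\<integral>x. (\<integral>y. ?f x y * indicator I0 (y - x)) + (\<integral>y. ?f x y * indicator I1 (y - x)))"
  by (intro nn_integral_cong nn_integral_add) measurable
 also have "... = (\<integral>x. (\<integral>y. ?f x y * indicator I0 (y - x))) + (\<integral>x. (\<integral>y. ?f x y * indicator I1 (y - x)))"
  by (rule nn_integral_add) measurable
 also have "(\<integral>x. (\<integral>y. ?f x y * indicator I0 (y - x))) = (\<integral>x. (\<integral>y. ?f x y * indicator (cball x 1) y))"
  by (intro nn_integral_cong) (auto simp: I0_def dist_norm norm_minus_commute split: split_indicator)
 finally have "gagliardo_energy s p u <= (\<integral>x. (\<integral>y. ?f x y * indicator (cball x 1) y)) + (\<integral>x. (\<integral>y. ?f x y * indicator I1 (y - x)))" .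
 moreover have "(\<integral>x. (\<integral>y. ?f x y * indicator (cball x 1) y)) < \<infinity>"
  by (rule le_less_trans[OF near_energy_le_gradient[OF p k(2) _ wg]]) (use G in \<open>auto simp: ennreal_mult_less_top\<close>)
 moreover have "(\<integral>x. (\<integral>y. ?f x y * indicator I1 (y - x))) < \<infinity>"
 proof -
  have "(\<integral>x. (\<integral>y. ?f x y * indicator I1 (y - x)))
   = (\<integral>h. ennreal (norm h powr (- (real DIM('a) + k))) * indicator I1 h * (\<integral>x. ennreal (\<bar>u (x + h) - u x\<bar> powr p)))"
   by (rule gagliardo_energy_translates) measurable
  also have "... <= (\<integral>h::'a. ennreal (norm h powr (- k - DIM('a))) * indicator I1 h * (ennreal (2 * 2 powr p) * E))"
   using tr by (intro nn_integral_mono mult_mono) (auto simp: algebra_simps)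
  also have "... = (\<integral>h::'a. ennreal (norm h powr (- k - DIM('a))) * indicator I1 h) * (ennreal (2 * 2 powr p) * E)"
   by (rule nn_integral_multc) measurable
  also have "... < \<infinity>" using u k nn_integral_powr_outside[of k 1, where 'a='a, folded I1_def] by (auto simp: ennreal_mult_less_top E_def)
  finally show ?thesis .
 qed
 ultimately show ?thesis by (rule ennreal_le_add_finite)
qed

lemma gradient_energy_eq:
 assumes "has_weak_gradient u G"
 shows "gradient_energy p u = (Lp p G)"
proof -
 have "gradient_energy p u = (Lp p (weak_gradient u))"
  using assms by (auto simp: gradient_energy_def)
 also have "... = (Lp p G)"
  by (intro nn_integral_cong_AE) (use weak_gradient_AE(2)[OF assms] in eventually_elim, simp)
 finally show ?thesis .
qed

lemma gradient_energy_finiteD: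
 assumes "gradient_energy p u < \<infinity>"
 shows "has_weak_gradient u (weak_gradient u)"
proof -
 have "\<exists>G. has_weak_gradient u G" using assms by (auto simp: gradient_energy_def split: if_splits)
 thus ?thesis using weak_gradient_AE(1) by blast
qed

subsection \<open>An explicit rapidly decreasing function\<close>

text \<open>Its gradient is bounded by a multiple of the function itself, which is what a
 logarithmic test function needs of a cut-off.\<close>

definition decay :: "real => 'a::euclidean_space => real" where
 "decay k x = (1 + (norm x)\<^sup>2) powr (- k)"

definition grad_decay :: "real => 'a::euclidean_space => 'a" where
 "grad_decay k x = (- 2 * k * (1 + (norm x)\<^sup>2) powr (- k - 1)) *R x"

lemma decay_pos: "0 < decay k x"
proof -
 have "0 < 1 + (norm x)\<^sup>2" by (simp add: add_pos_nonneg)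
 thus ?thesis by (simp add: decay_def)
qed

lemma decay_le_1: "0 <= k ==> decay k x <= 1"
proof -
 assume "0 <= k"
 hence "(1 + (norm x)\<^sup>2) powr (- k) <= 1 powr (- k)" by (intro powr_mono2') auto
 thus ?thesis by (simp add: decay_def)
qed

lemma decay_measurable [measurable]: "decay k : Borel" "grad_decay k : Borel"
 unfolding decay_def grad_decay_def by measurable

lemma decay_has_derivative:
 fixes x :: "'a::euclidean_space"
 shows "(decay k has_derivative (%h. grad_decay k x \<bullet> h)) (at x)"
proof -
 have pos: "0 < 1 + x \<bullet> x" by (simp add: add_pos_nonneg)
 have 1: "((%x. 1 + x \<bullet> x) has_derivative (%h. 2 * (x \<bullet> h))) (at x)"
  by (auto intro!: derivative_eq_intros simp: inner_commute)
 have "((%t. t powr (- k)) has_derivative (*) (- k * (1 + x \<bullet> x) powr (- k - 1))) (at (1 + x \<bullet> x))"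
  using has_real_derivative_powr[OF pos, of "- k"] by (simp add: has_field_derivative_def)
 from has_derivative_compose[OF 1 this]
 have "((%x. (1 + x \<bullet> x) powr (- k)) has_derivative (%h. (- k * (1 + x \<bullet> x) powr (- k - 1)) * (2 * (x \<bullet> h)))) (at x)" .
 moreover have "decay k = (%x::'a. (1 + x \<bullet> x) powr (- k))" by (auto simp: decay_def power2_norm_eq_inner)
 moreover have "(%h. (- k * (1 + x \<bullet> x) powr (- k - 1)) * (2 * (x \<bullet> h))) = (%h. grad_decay k x \<bullet> h)"
  by (auto simp: grad_decay_def power2_norm_eq_inner)
 ultimately show ?thesis by simp
qed

text \<open>Each partial derivative of \<open>decay k\<close> is a linear function times \<open>decay (k + 1)\<close>, so the induction
 closes when \<open>k\<close> is arbitrary.\<close>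

lemma Ck_decay: "Ck n (decay k :: 'a::euclidean_space => real)"
proof (induction n arbitrary: k)
 case 0
 have "isCont (decay k) x" for x :: 'a by (rule has_derivative_continuous[OF decay_has_derivative])
 thus ?case by (simp add: continuous_on_eq_continuous_at)
next
 case (Suc n)
 have lin: "Ck m (%x::'a. x \<bullet> i)" for m i
 proof (cases m)
  case (Suc l)
  have d: "((%x::'a. x \<bullet> i) has_derivative (%h. h \<bullet> i)) (at x)" for x by (auto intro!: derivative_eq_intros)
  show ?thesis using d Ck_const unfolding Suc by (auto simp: frechet_derivative_at[OF d, symmetric] differentiable_def)
 qed (auto intro!: continuous_intros)
 have "FD (decay k) x i = (- 2 * k) * (decay (k + 1) x * (x \<bullet> i))" for x i :: 'a
  unfolding frechet_derivative_at[OF decay_has_derivative, symmetric] by (simp add: grad_decay_def decay_def)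
 moreover have "Ck n (%x::'a. (- 2 * k) * (decay (k + 1) x * (x \<bullet> i)))" for i
  by (intro Ck_mult Ck_const lin Suc.IH)
 moreover have "(decay k :: 'a => real) differentiable (at x)" for x by (rule differentiableI[OF decay_has_derivative])
 ultimately show ?case by simp
qed

lemma norm_grad_decay_le: "0 <= k ==> norm (grad_decay k x) <= k * decay k x"
proof -
 assume k: "0 <= k"
 have pos: "0 < 1 + (norm x)\<^sup>2" by (simp add: add_pos_nonneg)
 have "2 * norm x <= 1 + (norm x)\<^sup>2" using zero_le_power2[of "1 - norm x"] by (simp add: power2_diff)
 hence "(1 + (norm x)\<^sup>2) powr (- k - 1) * (2 * norm x) <= (1 + (norm x)\<^sup>2) powr (- k - 1) * (1 + (norm x)\<^sup>2)"
  by (intro mult_left_mono) auto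
 also have "... = decay k x" using pos by (simp add: decay_def powr_diff)
 finally have "k * ((1 + (norm x)\<^sup>2) powr (- k - 1) * (2 * norm x)) <= k * decay k x" using k by (rule mult_left_mono)
 thus ?thesis using k by (simp add: grad_decay_def abs_mult mult_ac)
qed

lemma decay_moment:
 fixes m c k :: real
 assumes c: "0 <= c" and m: "0 < m" and k: "0 < k" and big: "c + DIM('a) < 2 * k * m"
 shows "(\<integral>\<^sup>+x. ennreal (norm x powr c * decay k x powr m) \<partial>(lborel::'a::euclidean_space measure)) < \<infinity>"
proof -
 define b where "b = 2 * k * m - c - DIM('a)"
 have b: "0 < b" using big by (simp add: b_def)
 have "(\<integral>x::'a. ennreal (norm x powr c * decay k x powr m))
  <= (\<integral>x::'a. indicator (cball 0 1) x + ennreal (norm x powr (- b - DIM('a))) * indicator {x. 1 <= norm x} x)"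
 proof (rule nn_integral_mono)
  fix x :: 'a
  show "ennreal (norm x powr c * decay k x powr m) <= indicator (cball 0 1) x + ennreal (norm x powr (- b - DIM('a))) * indicator {x. 1 <= norm x} x"
  proof (cases "1 <= norm x")
   case True
   have "decay k x <= ((norm x)\<^sup>2) powr (- k)" unfolding decay_def using k True by (intro powr_mono2') auto
   also have "... = norm x powr (- 2 * k)" using True powr_powr[of "norm x" 2 "- k"] by simp
   finally have "decay k x powr m <= (norm x powr (- 2 * k)) powr m" using m decay_pos[of k x] by (intro powr_mono2) auto
   hence "norm x powr c * decay k x powr m <= norm x powr c * norm x powr (- 2 * k * m)"
    by (intro mult_left_mono) (auto simp: powr_powr)
   also have "... = norm x powr (- b - DIM('a))" by (simp add: powr_add[symmetric] b_def)
   finally have "ennreal (norm x powr c * decay k x powr m) <= ennreal (norm x powr (- b - DIM('a)))" by (rule ennreal_leI)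
   thus ?thesis using True by (auto intro: order_trans simp: add_increasing)
  next
   case False
   have "norm x powr c <= 1" using False c by (intro powr_le1) auto
   moreover have "decay k x powr m <= 1" using decay_le_1[of k x] decay_pos[of k x] k m by (intro powr_le1) auto
   ultimately have "norm x powr c * decay k x powr m <= 1" by (intro mult_le_one) auto
   hence "ennreal (norm x powr c * decay k x powr m) <= ennreal 1" by (rule ennreal_leI)
   thus ?thesis using False by simp
  qed
 qed
 also have "... = emeasure lborel (cball (0::'a) 1) + (\<integral>x::'a. ennreal (norm x powr (- b - DIM('a))) * indicator {x. 1 <= norm x} x)"
  by (subst nn_integral_add) (auto intro!: borel_measurable_indicator)
 also have "... < \<infinity>"
  using nn_integral_powr_outside[OF b, of 1, where 'a='a] emeasure_lborel_cball_finite[of "0::'a" 1] by (simp add: less_top)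
 finally show ?thesis .
qed

lemma weak_gradient_decay:
 assumes k: "0 < k"
 shows "has_weak_gradient (decay k) (grad_decay k)"
proof -
 have "has_weak_gradient (%x. decay k x * 1) (%x. decay k x *R 0 + 1 *R grad_decay k x)"
 proof (rule weak_gradient_mult_smooth[OF weak_gradient_const Ck_decay decay_has_derivative])
  show "\<bar>decay k x\<bar> <= 1" for x using decay_pos[of k x] decay_le_1[of k x] k by simp
  show "norm (grad_decay k x) <= k * 1" for x
  proof -
   have "k * decay k x <= k * 1" using decay_le_1[of k x] k by (intro mult_left_mono) auto
   thus ?thesis using norm_grad_decay_le[of k x] k by linarith
  qed
 qed measurable
 thus ?thesis by simp
qed

section \<open>The function space of the problem\<close>

locale radial_problem =
 fixes p q s \<alpha> \<beta> \<gamma> :: real and T :: "'a::euclidean_space itself"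
 assumes p: "1 < p" and \<beta>: "0 < \<beta>" and \<gamma>: "0 <= \<gamma>" "\<gamma> <= 1"
  and s_nonlocal: "\<gamma> < 1 ==> 0 < s & s < 1" and s_local: "\<gamma> = 1 ==> s = 1"
  and sp: "1 / p < s" "s < real DIM('a) / p" and pN: "0 < \<gamma> ==> p < real DIM('a)"
  and \<alpha>: "- s * p < \<alpha>" and q: "p < q" "q < critical_exponent (real DIM('a)) p \<gamma> s \<alpha>"
  and tail_exponent: "\<alpha> - \<beta> + (q - p) * ((1 - real DIM('a)) / p) < 0"
begin

text \<open>\<open>S\<close> is the order of differentiability of the space, \<open>\<mu>\<close> the growth rate at the origin that its
 scaling dictates, \<open>\<tau>\<close> the decay rate of radial functions at infinity.\<close>

definition S :: real where "S = (if \<gamma> = 0 then s else 1)"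
definition \<mu> :: real where "\<mu> = (real DIM('a) - S * p) / p"
definition \<tau> :: real where "\<tau> = (real DIM('a) - 1) / p"

definition X :: "('a => real) set" where "X = solution_space \<gamma> s p \<beta>"

definition A0 :: "('a => real) => ennreal" where
 "A0 u = (if \<gamma> = 0 then gagliardo_energy s p u else ennreal \<gamma> * gradient_energy p u) + weighted_energy p \<beta> u"

definition A :: "('a => real) => ennreal" where
 "A u = ennreal \<gamma> * gradient_energy p u + ennreal (1 - \<gamma>) * gagliardo_energy s p u + weighted_energy p \<beta> u"

definition B :: "('a => real) => ennreal" where
 "B u = (\<integral>x. ennreal (norm x powr \<alpha> * \<bar>u x\<bar> powr q))"

lemma S_bounds: "1 < S * p" "S * p < real DIM('a)" "S <= 1" "s <= S" "0 < S"
proof -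
 have "1 < s * p" "s * p < real DIM('a)" using sp p by (simp_all add: field_simps)
 moreover have "s <= 1" using s_nonlocal s_local \<gamma> by (cases "\<gamma> = 1") auto
 moreover have "0 < s" using sp(1) p by (metis less_trans zero_less_divide_1_iff zero_less_one)
 ultimately show "1 < S * p" "S * p < real DIM('a)" "S <= 1" "s <= S" "0 < S"
  using p pN \<gamma> by (auto simp: S_def)
qed

lemma \<mu>_bounds: "0 < \<mu>" "\<mu> * p < real DIM('a)" "\<mu> < real DIM('a)" "\<mu> * q < real DIM('a) + \<alpha>"
proof -
 have mp: "\<mu> * p = real DIM('a) - S * p" using p by (simp add: \<mu>_def)
 show \<mu>0: "0 < \<mu>" using S_bounds p by (simp add: \<mu>_def)
 show "\<mu> * p < real DIM('a)" using mp S_bounds by simp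
 have "\<mu> * 1 <= \<mu> * p" using \<mu>0 p by (intro mult_left_mono) auto
 thus "\<mu> < real DIM('a)" using mp S_bounds by simp
 have "q < p * (real DIM('a) + \<alpha>) / (real DIM('a) - S * p)"
  using q(2) by (auto simp: critical_exponent_def S_def)
 hence "q * (real DIM('a) - S * p) < p * (real DIM('a) + \<alpha>)"
  using S_bounds by (simp add: pos_less_divide_eq)
 moreover have "(\<mu> * q) * p = q * (real DIM('a) - S * p)" using mp by (simp only: mult.commute[of \<mu> q] mult.assoc)
 ultimately have "(\<mu> * q) * p < (real DIM('a) + \<alpha>) * p" by (simp only: mult.commute)
 thus "\<mu> * q < real DIM('a) + \<alpha>" using p by (simp only: mult_less_cancel_right_pos)
qed

lemma \<tau>_nonneg: "0 <= \<tau>"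
 using DIM_positive[where 'a='a] p by (simp add: \<tau>_def)

lemma X_iff: "u : X \<longleftrightarrow> u : Borel & weighted_energy p \<beta> u < \<infinity> & radial u &
  (\<gamma> = 0 --> gagliardo_energy s p u < \<infinity>) & (\<gamma> ~= 0 --> gradient_energy p u < \<infinity>)"
 using s_nonlocal unfolding X_def solution_space_def radial_sobolev_def weighted_sobolev_def weighted_Lp_def
 by auto

lemma X_measurable: "u : X ==> u : Borel" by (simp add: X_iff)

lemma X_gradient: "u : X ==> \<gamma> ~= 0 ==> has_weak_gradient u (weak_gradient u)"
 using gradient_energy_finiteD[of p u] by (simp add: X_iff)

lemma A0_finite: "u : X ==> A0 u < \<infinity>"
 by (auto simp: X_iff A0_def ennreal_mult_less_top less_top)

lemma A0_le_A: "A0 u <= A u"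
proof (cases "\<gamma> = 0")
 case True
 thus ?thesis unfolding A0_def A_def by simp
next
 case False
 thus ?thesis unfolding A0_def A_def by (simp add: add_right_mono)
qed

lemma A0_cases:
 assumes "u : X"
 obtains M where "0 <= M" "A0 u <= ennreal (M powr p)"
proof -
 obtain a where a: "A0 u = ennreal a" "0 <= a" using A0_finite[OF assms] unfolding infinity_ennreal_def less_top_ennreal by blast
 thus thesis using that[of "a powr (1 / p)"] p by (simp add: powr_powr)
qed

text \<open>For \<open>\<gamma> = 0\<close> this is the fractional estimate itself.  If there is a gradient, the translation
 estimate bounds a fractional energy of order \<open>k/p < 1\<close> near the diagonal by \<open>l\<^bsup>p-k\<^esup> \<integral>\<bar>\<nabla>u\<bar>\<^sup>p\<close>, which is
 what the general estimate takes as input.\<close>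

lemma radial_Hoelder_X:
 obtains C where "0 < C"
  "!!u M. u : X ==> 0 <= M ==> A0 u <= ennreal (M powr p) ==>
   \<exists>Z\<in>null_sets lborel. \<forall>x y. x ~: Z --> y ~: Z --> norm x <= norm y --> norm y <= 2 * norm x -->
    \<bar>u x - u y\<bar> <= C * M * (norm y - norm x) powr (S - 1 / p) * norm x powr (- \<tau>)"
proof (cases "\<gamma> = 0")
 case True
 hence S: "S = s" unfolding S_def by simp
 have sp1: "1 < s * p" using S_bounds(1) S by simp
 show thesis
 proof (rule radial_Hoelder[OF p sp1, where 'a='a])
  fix C :: real assume C: "0 < C"
  "!!(u :: 'a => real) K e. u : Borel ==> radial u ==> 0 <= K ==>
   (!!l. 0 < l ==> (\<integral>x. (\<integral>y. ennreal (quot p u (real DIM('a) + s * p) x y) * indicator (cball x (3 * l)) y))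
     <= ennreal (K powr p * l powr e)) ==>
   \<exists>Z\<in>null_sets lborel. \<forall>x y. x ~: Z --> y ~: Z --> norm x <= norm y --> norm y <= 2 * norm x -->
    \<bar>u x - u y\<bar> <= C * K * (norm y - norm x) powr ((e + s * p - 1) / p) * norm x powr (- (real DIM('a) - 1) / p)"
 show thesis
 proof (rule that[OF C(1)])
  fix u M assume u: "u : X" and M: "0 <= M" "A0 u <= ennreal (M powr p)"
  have e: "(0 + s * p - 1) / p = S - 1 / p" using p S by (simp add: field_simps)
  have t: "- (real DIM('a) - 1) / p = - \<tau>" by (simp add: \<tau>_def minus_divide_left)
  have "\<exists>Z\<in>null_sets lborel. \<forall>x y. x ~: Z --> y ~: Z --> norm x <= norm y --> norm y <= 2 * norm x -->
    \<bar>u x - u y\<bar> <= C * M * (norm y - norm x) powr ((0 + s * p - 1) / p) * norm x powr (- (real DIM('a) - 1) / p)"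
  proof (rule C(2))
   fix l :: real assume l: "0 < l"
   have "(\<integral>x. (\<integral>y. ennreal (quot p u (real DIM('a) + s * p) x y) * indicator (cball x (3 * l)) y))
    <= gagliardo_energy s p u" unfolding gagliardo_energy_eq
    by (intro nn_integral_mono) (auto split: split_indicator)
   also have "... <= A0 u" unfolding A0_def using True by simp
   also have "... <= ennreal (M powr p * l powr 0)" using M l by simp
   finally show "(\<integral>x. (\<integral>y. ennreal (quot p u (real DIM('a) + s * p) x y) * indicator (cball x (3 * l)) y))
    <= ennreal (M powr p * l powr 0)" .
  qed (use u M in \<open>auto simp: X_iff\<close>)
  thus "\<exists>Z\<in>null_sets lborel. \<forall>x y. x ~: Z --> y ~: Z --> norm x <= norm y --> norm y <= 2 * norm x -->
    \<bar>u x - u y\<bar> <= C * M * (norm y - norm x) powr (S - 1 / p) * norm x powr (- \<tau>)" unfolding e t .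
 qed
 qed
next
 case False
 hence \<gamma>0: "0 < \<gamma>" and S: "S = 1" using \<gamma> by (auto simp: S_def)
 \<comment> \<open>Any order strictly between \<open>1/p\<close> and \<open>1\<close> would do for the auxiliary fractional energy.\<close>
 define k where "k = (p + 1) / 2"
 have k: "1 < k" "k < p" using p by (auto simp: k_def)
 define c0 where "c0 = ball_volume TYPE('a) * DIM('a) / (p - k) * 3 powr (p - k) / \<gamma>"
 have c0: "0 < c0" using k \<gamma>0 ball_volume_pos[where 'a='a] DIM_positive[where 'a='a] by (simp add: c0_def)
 show thesis
 proof (rule radial_Hoelder[OF p k(1), where 'a='a])
  fix C :: real assume C: "0 < C"
  "!!(u :: 'a => real) K e. u : Borel ==> radial u ==> 0 <= K ==>
   (!!l. 0 < l ==> (\<integral>x. (\<integral>y. ennreal (quot p u (real DIM('a) + k) x y) * indicator (cball x (3 * l)) y))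
     <= ennreal (K powr p * l powr e)) ==>
   \<exists>Z\<in>null_sets lborel. \<forall>x y. x ~: Z --> y ~: Z --> norm x <= norm y --> norm y <= 2 * norm x -->
    \<bar>u x - u y\<bar> <= C * K * (norm y - norm x) powr ((e + k - 1) / p) * norm x powr (- (real DIM('a) - 1) / p)"
 show thesis
 proof (rule that[of "C * c0 powr (1 / p)"])
  show "0 < C * c0 powr (1 / p)" using C c0 by simp
  fix u M assume u: "u : X" and M: "0 <= M" "A0 u <= ennreal (M powr p)"
  have e: "(p - k + k - 1) / p = S - 1 / p" using p S by (simp add: field_simps)
  have t: "- (real DIM('a) - 1) / p = - \<tau>" by (simp add: \<tau>_def minus_divide_left)
  have wg: "has_weak_gradient u (weak_gradient u)" by (rule X_gradient[OF u False])
  define E where "E = (Lp p (weak_gradient u))"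
  have E: "E <= ennreal (M powr p / \<gamma>)"
  proof -
   have "ennreal \<gamma> * E <= A0 u" using False gradient_energy_eq[OF wg, of p] by (simp add: A0_def E_def)
   hence "ennreal \<gamma> * E <= ennreal (M powr p)" using M(2) by (rule order_trans)
   hence "ennreal (1 / \<gamma>) * (ennreal \<gamma> * E) <= ennreal (1 / \<gamma>) * ennreal (M powr p)" by (rule mult_left_mono) simp
   moreover have "ennreal (1 / \<gamma>) * ennreal \<gamma> = 1" using \<gamma>0 by (simp add: ennreal_mult[symmetric])
   ultimately show ?thesis using \<gamma>0 by (simp add: mult.assoc[symmetric] ennreal_mult[symmetric])
  qed
  have "\<exists>Z\<in>null_sets lborel. \<forall>x y. x ~: Z --> y ~: Z --> norm x <= norm y --> norm y <= 2 * norm x -->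
    \<bar>u x - u y\<bar> <= C * (c0 powr (1 / p) * M) * (norm y - norm x) powr ((p - k + k - 1) / p) * norm x powr (- (real DIM('a) - 1) / p)"
  proof (rule C(2))
   fix l :: real assume l: "0 < l"
   have "(\<integral>x. (\<integral>y. ennreal (quot p u (real DIM('a) + k) x y) * indicator (cball x (3 * l)) y))
    <= ennreal (ball_volume TYPE('a) * DIM('a) / (p - k) * (3 * l) powr (p - k)) * E"
    unfolding E_def using l by (intro near_energy_le_gradient[OF p k(2) _ wg]) simp
   also have "... <= ennreal (ball_volume TYPE('a) * DIM('a) / (p - k) * (3 * l) powr (p - k)) * ennreal (M powr p / \<gamma>)"
    using E by (rule mult_left_mono) simp
   also have "... = ennreal ((ball_volume TYPE('a) * DIM('a) / (p - k) * (3 * l) powr (p - k)) * (M powr p / \<gamma>))"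
    using k \<gamma>0 by (intro ennreal_mult[symmetric]) auto
   also have "(ball_volume TYPE('a) * DIM('a) / (p - k) * (3 * l) powr (p - k)) * (M powr p / \<gamma>) = (c0 powr (1 / p) * M) powr p * l powr (p - k)"
    using p M c0 l by (simp add: powr_mult powr_powr) (simp add: c0_def)
   finally show "(\<integral>x. (\<integral>y. ennreal (quot p u (real DIM('a) + k) x y) * indicator (cball x (3 * l)) y))
    <= ennreal ((c0 powr (1 / p) * M) powr p * l powr (p - k))" .
  qed (use u M in \<open>auto simp: X_iff\<close>)
  thus "\<exists>Z\<in>null_sets lborel. \<forall>x y. x ~: Z --> y ~: Z --> norm x <= norm y --> norm y <= 2 * norm x -->
    \<bar>u x - u y\<bar> <= C * c0 powr (1 / p) * M * (norm y - norm x) powr (S - 1 / p) * norm x powr (- \<tau>)"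
   unfolding e t by (simp add: mult.assoc)
 qed
 qed
qed

end

lemma ex_outside_null_set:
 fixes U :: "'a::euclidean_space set"
 assumes "Z : null_sets lborel" "open U" "U ~= {}"
 shows "\<exists>x\<in>U. x ~: Z"
proof (rule ccontr)
 assume "~ (\<exists>x\<in>U. x ~: Z)"
 hence "U \<subseteq> Z" by blast
 moreover have "negligible Z" using assms(1) by (simp add: negligible_iff_null_sets null_sets_completionI)
 ultimately have "negligible U" using negligible_subset by blast
 thus False using open_not_negligible[OF assms(2,3)] by simp
qed

context radial_problem
begin

definition profile :: "'a => real" where
 "profile x = (if norm x < 1 then norm x powr (- \<mu>) else norm x powr (- \<tau>))"

lemma profile_measurable [measurable]: "profile : Borel"
 unfolding profile_def by measurable

text \<open>Strauss-type bounds.  Away from the origin the Hoelder estimate is averaged over an annulus of unit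
 width against the weighted norm; the bound then propagates inwards, because each step from
 \<open>\<bar>x\<bar>\<close> to about \<open>2 \<bar>x\<bar>\<close> costs \<open>\<bar>x\<bar>\<^bsup>-\<mu>\<^esup>\<close> and the geometric series converges.\<close>

lemma pointwise_bound:
 obtains a where "0 < a"
  "!!u M. u : X ==> 0 <= M ==> A0 u <= ennreal (M powr p) ==> AE x in lborel. \<bar>u x\<bar> <= a * M * profile x"
proof -
 obtain C where C0: "0 < C" and C:
  "!!u M. u : X ==> 0 <= M ==> A0 u <= ennreal (M powr p) ==>
   \<exists>Z\<in>null_sets lborel. \<forall>x y. x ~: Z --> y ~: Z --> norm x <= norm y --> norm y <= 2 * norm x -->
    \<bar>u x - u y\<bar> <= C * M * (norm y - norm x) powr (S - 1 / p) * norm x powr (- \<tau>)"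
  using radial_Hoelder_X by blast
 define w where "w = ball_volume TYPE('a) * DIM('a)"
 have w: "0 < w" using ball_volume_pos[where 'a='a] DIM_positive[where 'a='a] by (simp add: w_def)
 define a1 where "a1 = (2 powr p * (1 / w + C powr p)) powr (1 / p)"
 have "0 < 1 / w + C powr p" using w by (simp add: add_pos_nonneg)
 hence a1: "0 < a1" by (simp add: a1_def)
 define \<theta> where "\<theta> = (3 / 2 :: real) powr (- \<mu>)"
 have \<theta>: "0 < \<theta>" "\<theta> < 1" using \<mu>_bounds(1) powr_less_mono2_neg[of "- \<mu>" 1 "3/2"] by (auto simp: \<theta>_def)
 define a where "a = max (a1 + C) (C / (1 - \<theta>))"
 have a: "a1 + C <= a" "C + a * \<theta> <= a" "a1 <= a"
 proof -
  show "a1 + C <= a" by (simp add: a_def)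
  thus "a1 <= a" using C0 by simp
  have "C / (1 - \<theta>) <= a" by (simp add: a_def)
  hence "C <= a * (1 - \<theta>)" using \<theta> by (simp add: pos_divide_le_eq)
  thus "C + a * \<theta> <= a" by (simp add: algebra_simps)
 qed
 have e0: "0 < S - 1 / p" using S_bounds(1) p by (simp add: field_simps)
 show thesis
 proof (rule that[of a])
  show "0 < a" using a a1 by linarith
  fix u M assume u: "u : X" and M: "0 <= M" "A0 u <= ennreal (M powr p)"
  have [measurable]: "u : Borel" using u by (rule X_measurable)
  obtain Z where Z: "Z : null_sets lborel" and ZH: "!!x y. x ~: Z ==> y ~: Z ==> norm x <= norm y ==> norm y <= 2 * norm x ==>
    \<bar>u x - u y\<bar> <= C * M * (norm y - norm x) powr (S - 1 / p) * norm x powr (- \<tau>)"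
   using C[OF u M] by blast
  have AEZ: "AE y in lborel. y ~: Z" by (rule AE_not_in[OF Z])
  have outer: "\<bar>u x\<bar> <= a1 * M * norm x powr (- \<tau>)" if x: "x ~: Z" "1 <= norm x" for x
  proof -
   define r where "r = norm x"
   define D where "D = (C * M * r powr (- \<tau>)) powr p"
   define R where "R = {y::'a. r < norm y & norm y < r + 1}"
   have [measurable]: "R : sets borel" unfolding R_def by measurable
   have "emeasure lborel R <= emeasure lborel (cball (0::'a) (r + 1))" by (intro emeasure_mono) (auto simp: R_def)
   hence Rfin: "emeasure lborel R < \<infinity>" using emeasure_lborel_cball_finite[of "0::'a" "r + 1"] by (rule le_less_trans)
   then obtain V where V: "emeasure lborel R = ennreal V" "0 <= V" unfolding infinity_ennreal_def less_top_ennreal by blast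
   have "ennreal (w * r ^ (DIM('a) - 1)) = (\<integral>t. ennreal (w * r ^ (DIM('a) - 1)) * indicator {r<..<r + 1} t)"
    by (subst nn_integral_cmult) auto
   also have "... <= (\<integral>t. indicator {r<..<r + 1} t * ennreal (w * t ^ (DIM('a) - 1)) * indicator {0..} t)"
    using x w by (intro nn_integral_mono) (auto simp: r_def split: split_indicator intro!: ennreal_leI mult_left_mono power_mono)
   also have "... = (\<integral>y::'a. indicator {r<..<r + 1} (norm y))"
    unfolding w_def by (rule nn_integral_radial[symmetric]) measurable
   also have "... = (\<integral>y::'a. indicator R y)"
    by (intro nn_integral_cong) (auto simp: R_def split: split_indicator)
   also have "... = ennreal V" using V by simp
   finally have Vr: "w * r ^ (DIM('a) - 1) <= V" using V by simp
   have rN: "r ^ (DIM('a) - 1) = r powr (\<tau> * p)"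
   proof -
    have "0 < r" using x unfolding r_def by linarith
    hence "r powr real (DIM('a) - 1) = r ^ (DIM('a) - 1)" by (rule powr_realpow)
    moreover have "real (DIM('a) - 1) = \<tau> * p" using p DIM_positive[where 'a='a] by (simp add: \<tau>_def of_nat_diff)
    ultimately show ?thesis by simp
   qed
   have Vpos: "0 < V" using Vr w x by (smt (verit) mult_pos_pos r_def zero_less_power)
   have "ennreal (\<bar>u x\<bar> powr p * V) = (\<integral>y. ennreal (\<bar>u x\<bar> powr p) * indicator R y)"
    using V by (subst nn_integral_cmult) (auto simp: ennreal_mult)
   also have "... <= (\<integral>y. ennreal (2 powr p) * (ennreal (norm y powr \<beta> * \<bar>u y\<bar> powr p) + ennreal D * indicator R y))"
   proof (rule nn_integral_mono_AE)
    show "AE y in lborel. ennreal (\<bar>u x\<bar> powr p) * indicator R y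
     <= ennreal (2 powr p) * (ennreal (norm y powr \<beta> * \<bar>u y\<bar> powr p) + ennreal D * indicator R y)"
     using AEZ
    proof eventually_elim
     case (elim y)
     show ?case
     proof (cases "y : R")
      case True
      hence y: "r < norm y" "norm y < r + 1" by (auto simp: R_def)
      have "\<bar>u x - u y\<bar> <= C * M * (norm y - norm x) powr (S - 1 / p) * norm x powr (- \<tau>)"
       using ZH[OF x(1) elim] y x by (simp add: r_def)
      also have "... <= C * M * 1 * norm x powr (- \<tau>)"
       using y e0 C0 M by (intro mult_right_mono mult_left_mono powr_le1) (auto simp: r_def)
      finally have "\<bar>u x\<bar> <= \<bar>u y\<bar> + C * M * r powr (- \<tau>)" by (simp add: r_def)
      hence "\<bar>u x\<bar> powr p <= (\<bar>u y\<bar> + C * M * r powr (- \<tau>)) powr p" using p by (intro powr_mono2) auto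
      also have "... <= 2 powr p * (\<bar>u y\<bar> powr p + D)"
       unfolding D_def using p C0 M by (intro powr_add_le) auto
      also have "... <= 2 powr p * (norm y powr \<beta> * \<bar>u y\<bar> powr p + D)"
      proof (intro mult_left_mono add_right_mono)
       have "1 <= norm y powr \<beta>" using y x \<beta> by (intro ge_one_powr_ge_zero) (auto simp: r_def)
       thus "\<bar>u y\<bar> powr p <= norm y powr \<beta> * \<bar>u y\<bar> powr p" using mult_right_mono[of 1 "norm y powr \<beta>" "\<bar>u y\<bar> powr p"] by simp
      qed simp
      finally have "ennreal (\<bar>u x\<bar> powr p) <= ennreal (2 powr p * (norm y powr \<beta> * \<bar>u y\<bar> powr p + D))" by (rule ennreal_leI)
      also have "... = ennreal (2 powr p) * (ennreal (norm y powr \<beta> * \<bar>u y\<bar> powr p) + ennreal D)"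
       by (simp add: ennreal_mult D_def)
      finally show ?thesis using True by simp
     qed simp
    qed
   qed
   also have "... = ennreal (2 powr p) * (\<integral>y. ennreal (norm y powr \<beta> * \<bar>u y\<bar> powr p) + ennreal D * indicator R y)"
    by (rule nn_integral_cmult) measurable
   also have "(\<integral>y. ennreal (norm y powr \<beta> * \<bar>u y\<bar> powr p) + ennreal D * indicator R y) = weighted_energy p \<beta> u + (\<integral>y. ennreal D * indicator R y)"
    unfolding weighted_energy_def by (rule nn_integral_add) measurable
   also have "(\<integral>y. ennreal D * indicator R y) = ennreal (D * V)"
    using V by (subst nn_integral_cmult) (auto simp: ennreal_mult D_def)
   also have "ennreal (2 powr p) * (weighted_energy p \<beta> u + ennreal (D * V)) <= ennreal (2 powr p) * (ennreal (M powr p) + ennreal (D * V))"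
   proof (intro mult_left_mono add_right_mono)
    have "weighted_energy p \<beta> u <= A0 u" by (simp add: A0_def)
    thus "weighted_energy p \<beta> u <= ennreal (M powr p)" using M(2) by (rule order_trans)
   qed simp
   also have "... = ennreal (2 powr p * (M powr p + D * V))" using V by (simp add: ennreal_mult D_def)
   finally have "\<bar>u x\<bar> powr p * V <= 2 powr p * (M powr p + D * V)"
    using V by (subst (asm) ennreal_le_iff) (auto simp: D_def)
   hence "\<bar>u x\<bar> powr p <= 2 powr p * (M powr p + D * V) / V" using Vpos by (simp add: pos_le_divide_eq)
   also have "... = 2 powr p * (M powr p / V + D)" using Vpos by (simp add: field_simps)
   also have "... <= 2 powr p * (M powr p / (w * r ^ (DIM('a) - 1)) + D)"
   proof -
    have "0 < r" using x unfolding r_def by linarith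
    hence "0 < w * r ^ (DIM('a) - 1)" using w by simp
    thus ?thesis using Vr Vpos w \<open>0 < r\<close> by (intro mult_left_mono add_right_mono divide_left_mono mult_pos_pos) auto
   qed
   also have "... = (a1 * M * r powr (- \<tau>)) powr p"
   proof -
    have "D = C powr p * M powr p * r powr (- \<tau> * p)" using C0 M by (simp add: D_def powr_mult powr_powr)
    moreover have "M powr p / (w * r ^ (DIM('a) - 1)) = (1 / w) * M powr p * r powr (- \<tau> * p)"
     unfolding rN by (simp add: powr_minus divide_inverse)
    moreover have "(a1 * M * r powr (- \<tau>)) powr p = (2 powr p * (1 / w + C powr p)) * M powr p * r powr (- \<tau> * p)"
     using M w a1 p by (simp add: powr_mult powr_powr) (simp add: a1_def powr_powr)
    ultimately show ?thesis by (simp add: algebra_simps)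
   qed
   finally have "\<bar>u x\<bar> powr p <= (a1 * M * r powr (- \<tau>)) powr p" .
   moreover have "0 <= a1 * M * r powr (- \<tau>)" using M a1 by simp
   ultimately show ?thesis
    using powr_less_mono2[of p "a1 * M * r powr (- \<tau>)" "\<bar>u x\<bar>"] p unfolding r_def by linarith
  qed
  have inner: "\<bar>u x\<bar> <= a * M * norm x powr (- \<mu>)" if "x ~: Z" "x ~= 0" "norm x < 1" "1 <= (3/2) ^ n * norm x" for x n
   using that
  proof (induction n arbitrary: x)
   case 0
   thus ?case by simp
  next
   case (Suc n)
   define r where "r = norm x"
   have r: "0 < r" "r < 1" using Suc by (auto simp: r_def)
   have "open {y::'a. 3/2 * r < norm y & norm y < 2 * r}"
    by (intro open_Collect_conj open_Collect_less continuous_intros)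
   moreover have "(7/4) *R x : {y::'a. 3/2 * r < norm y & norm y < 2 * r}" using r by (simp add: r_def)
   ultimately obtain y where y: "3/2 * r < norm y" "norm y < 2 * r" "y ~: Z"
    using ex_outside_null_set[OF Z] by blast
   have "\<bar>u x - u y\<bar> <= C * M * (norm y - norm x) powr (S - 1 / p) * norm x powr (- \<tau>)"
    using ZH[OF Suc.prems(1) y(3)] y r by (simp add: r_def)
   also have "... <= C * M * r powr (S - 1 / p) * r powr (- \<tau>)"
    using y r e0 C0 M unfolding r_def[symmetric] by (intro mult_right_mono mult_left_mono powr_mono2) auto
   also have "... = C * M * r powr (- \<mu>)"
   proof -
    have "S - 1 / p + - \<tau> = - \<mu>" using p by (simp add: \<mu>_def \<tau>_def field_simps)
    thus ?thesis by (simp add: mult.assoc powr_add[symmetric] del: add_uminus_conv_diff)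
   qed
   finally have d: "\<bar>u x\<bar> <= \<bar>u y\<bar> + C * M * r powr (- \<mu>)" by linarith
   have r\<mu>: "1 <= r powr (- \<mu>)" using r \<mu>_bounds(1) powr_mono2'[of "- \<mu>" r 1] by simp
   show ?case
   proof (cases "norm y < 1")
    case True
    have "1 <= (3/2) ^ n * norm y"
    proof -
     have "1 <= (3/2) ^ n * (3/2 * r)" using Suc.prems(4) by (simp add: r_def mult_ac)
     also have "... <= (3/2) ^ n * norm y" using y by (intro mult_left_mono) auto
     finally show ?thesis .
    qed
    have "\<bar>u y\<bar> <= a * M * norm y powr (- \<mu>)"
    proof -
     have "y ~= 0" using y(1) r by auto
     thus ?thesis using Suc.IH[of y] y \<open>1 <= (3/2) ^ n * norm y\<close> True by blast
    qed
    also have "... <= a * M * (3/2 * r) powr (- \<mu>)"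
     using y r \<mu>_bounds(1) a a1 M by (intro mult_left_mono powr_mono2') auto
    also have "... = a * \<theta> * M * r powr (- \<mu>)" using r by (subst powr_mult) (auto simp: \<theta>_def)
    finally have "\<bar>u x\<bar> <= (C + a * \<theta>) * (M * r powr (- \<mu>))" using d by (simp add: algebra_simps)
    also have "... <= a * (M * r powr (- \<mu>))" using a(2) M by (intro mult_right_mono) auto
    finally show ?thesis by (simp add: r_def mult.assoc)
   next
    case False
    hence "\<bar>u y\<bar> <= a1 * M * norm y powr (- \<tau>)" using outer[OF y(3)] by simp
    also have "... <= a1 * M * 1"
     using False \<tau>_nonneg a1 M powr_mono2'[of "- \<tau>" 1 "norm y"] by (intro mult_left_mono) auto
    also have "... <= a1 * M * r powr (- \<mu>)" using r\<mu> a1 M by (intro mult_left_mono) auto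
    finally have "\<bar>u x\<bar> <= (a1 + C) * (M * r powr (- \<mu>))" using d by (simp add: algebra_simps)
    also have "... <= a * (M * r powr (- \<mu>))" using a(1) M by (intro mult_right_mono) auto
    finally show ?thesis by (simp add: r_def mult.assoc)
   qed
  qed
  have "AE x::'a in lborel. x ~= 0" by (rule AE_lborel_singleton)
  with AEZ show "AE x in lborel. \<bar>u x\<bar> <= a * M * profile x"
  proof eventually_elim
   case (elim x)
   show ?case
   proof (cases "norm x < 1")
    case True
    obtain n where "1 / norm x < (3/2) ^ n" using real_arch_pow[of "3/2" "1 / norm x"] by auto
    hence "1 <= (3/2) ^ n * norm x" using elim by (simp add: pos_divide_less_eq)
    thus ?thesis using inner[of x n] elim True by (simp add: profile_def)
   next
    case False
    have "\<bar>u x\<bar> <= a1 * M * norm x powr (- \<tau>)" using outer[of x] elim False by simp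
    also have "... <= a * M * norm x powr (- \<tau>)" using a M by (intro mult_right_mono) auto
    finally show ?thesis using False by (simp add: profile_def)
   qed
  qed
 qed
qed

end

context radial_problem
begin

lemma profile_nonneg: "0 <= profile x" by (simp add: profile_def)

lemma profile_moment:
 assumes m: "0 < m" "\<mu> * m < real DIM('a) + c"
 shows "(\<integral>x. ennreal (norm x powr c * profile x powr m) * indicator (cball 0 \<rho>) x) < \<infinity>"
proof -
 define b where "b = c - \<mu> * m + real DIM('a)"
 have b: "0 < b" using m by (simp add: b_def)
 define D where "D = max 1 \<rho> powr \<bar>c - \<tau> * m\<bar>"
 have [measurable]: "cball (0::'a) 1 : sets borel" "cball (0::'a) \<rho> : sets borel" by simp_all
 have "(\<integral>x. ennreal (norm x powr c * profile x powr m) * indicator (cball 0 \<rho>) x)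
  <= (\<integral>x::'a. ennreal (norm x powr (b - DIM('a))) * indicator (cball 0 1) x + ennreal D * indicator (cball 0 \<rho>) x)"
 proof (rule nn_integral_mono)
  fix x :: 'a
  show "ennreal (norm x powr c * profile x powr m) * indicator (cball 0 \<rho>) x
   <= ennreal (norm x powr (b - DIM('a))) * indicator (cball 0 1) x + ennreal D * indicator (cball 0 \<rho>) x"
  proof (cases "x : cball 0 \<rho>")
   case x: True
   show ?thesis
   proof (cases "norm x < 1")
    case True
    have "norm x powr c * profile x powr m = norm x powr (b - DIM('a))"
     using True by (simp add: profile_def powr_powr b_def flip: powr_add)
    thus ?thesis using True x by (auto intro: order_trans simp: add_increasing2)
   next
    case False
    have "norm x powr c * profile x powr m = norm x powr (c - \<tau> * m)"
     using False by (simp add: profile_def powr_powr flip: powr_add)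
    also have "... <= norm x powr \<bar>c - \<tau> * m\<bar>" using False by (intro powr_mono) auto
    also have "... <= D" unfolding D_def using x by (intro powr_mono2) auto
    finally have "ennreal (norm x powr c * profile x powr m) <= ennreal D" by (rule ennreal_leI)
    thus ?thesis using x by (auto intro: order_trans simp: add_increasing)
   qed
  qed simp
 qed
 also have "... = (\<integral>x::'a. ennreal (norm x powr (b - DIM('a))) * indicator (cball 0 1) x) + (\<integral>x::'a. ennreal D * indicator (cball 0 \<rho>) x)"
  by (rule nn_integral_add) measurable
 also have "... < \<infinity>"
  using nn_integral_powr_cball[OF b, of 1, where 'a='a] emeasure_lborel_cball_finite[of "0::'a" \<rho>]
  by (subst nn_integral_cmult) (auto simp: ennreal_mult_less_top)
 finally show ?thesis .
qed

lemma loc_int_profile: "locally_integrable profile"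
 unfolding loc_int_iff
proof (intro conjI allI impI)
 fix K :: "'a set" assume "compact K"
 then obtain \<rho> where \<rho>: "!!x. x : K ==> norm x <= \<rho>" using compact_imp_bounded bounded_iff by metis
 have "(\<integral>x. ennreal (norm (profile x)) * indicator K x)
  <= (\<integral>x. ennreal (norm x powr 0 * profile x powr 1) * indicator (cball 0 \<rho>) x)"
 proof (rule nn_integral_mono)
  fix x :: 'a
  show "ennreal (norm (profile x)) * indicator K x <= ennreal (norm x powr 0 * profile x powr 1) * indicator (cball 0 \<rho>) x"
   using \<rho>[of x] profile_nonneg[of x] by (cases "x = 0") (auto simp: profile_def split: split_indicator)
 qed
 also have "... < \<infinity>" using profile_moment[of 1 0 \<rho>] \<mu>_bounds(3) by simp
 finally show "(\<integral>x. ennreal (norm (profile x)) * indicator K x) < \<infinity>" .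
qed simp

lemma Lp_X:
 assumes u: "u : X"
 shows "(\<integral>x. ennreal (\<bar>u x\<bar> powr p)) < \<infinity>"
proof -
 have [measurable]: "u : Borel" using u by (rule X_measurable)
 have [measurable]: "cball (0::'a) 1 : sets borel" by simp
 obtain a where a: "0 < a"
  "!!u M. u : X ==> 0 <= M ==> A0 u <= ennreal (M powr p) ==> AE x in lborel. \<bar>u x\<bar> <= a * M * profile x"
  using pointwise_bound by blast
 obtain M where M: "0 <= M" "A0 u <= ennreal (M powr p)" using A0_cases[OF u] by blast
 have "(\<integral>x. ennreal (\<bar>u x\<bar> powr p))
  <= (\<integral>x. ennreal ((a * M) powr p) * (ennreal (norm x powr 0 * profile x powr p) * indicator (cball 0 1) x) + ennreal (norm x powr \<beta> * \<bar>u x\<bar> powr p))"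
 proof (rule nn_integral_mono_AE)
  have "AE x::'a in lborel. x ~= 0" by (rule AE_lborel_singleton)
  with a(2)[OF u M] show "AE x in lborel. ennreal (\<bar>u x\<bar> powr p)
   <= ennreal ((a * M) powr p) * (ennreal (norm x powr 0 * profile x powr p) * indicator (cball 0 1) x) + ennreal (norm x powr \<beta> * \<bar>u x\<bar> powr p)"
  proof eventually_elim
   case (elim x)
   show ?case
   proof (cases "norm x <= 1")
    case True
    have "\<bar>u x\<bar> powr p <= (a * M * profile x) powr p" using elim p by (intro powr_mono2) auto
    also have "... = (a * M) powr p * (norm x powr 0 * profile x powr p)" using elim a M profile_nonneg by (simp add: powr_mult)
    finally have "ennreal (\<bar>u x\<bar> powr p) <= ennreal ((a * M) powr p * (norm x powr 0 * profile x powr p))" by (rule ennreal_leI)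
    thus ?thesis using True by (auto simp: ennreal_mult intro: order_trans add_increasing2)
   next
    case False
    hence "1 <= norm x powr \<beta>" using \<beta> by (intro ge_one_powr_ge_zero) auto
    hence "\<bar>u x\<bar> powr p <= norm x powr \<beta> * \<bar>u x\<bar> powr p" using mult_right_mono[of 1 "norm x powr \<beta>" "\<bar>u x\<bar> powr p"] by simp
    hence "ennreal (\<bar>u x\<bar> powr p) <= ennreal (norm x powr \<beta> * \<bar>u x\<bar> powr p)" by (rule ennreal_leI)
    thus ?thesis by (rule order_trans) simp
   qed
  qed
 qed
 also have "... = ennreal ((a * M) powr p) * (\<integral>x. ennreal (norm x powr 0 * profile x powr p) * indicator (cball 0 1) x) + weighted_energy p \<beta> u"
  unfolding weighted_energy_def by (subst nn_integral_add) (auto simp: nn_integral_cmult)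
 also have "... < \<infinity>"
  using profile_moment[of p 0 1] p \<mu>_bounds(2) u by (auto simp: X_iff ennreal_mult_less_top)
 finally show ?thesis .
qed

lemma gagliardo_X:
 assumes u: "u : X" and "\<gamma> < 1"
 shows "gagliardo_energy s p u < \<infinity>"
proof (cases "\<gamma> = 0")
 case True
 thus ?thesis using u unfolding X_iff by blast
next
 case False
 show ?thesis
 proof (rule gagliardo_energy_finite[OF p _ _ X_gradient[OF u False] _ Lp_X[OF u]])
  show "0 < s" "s < 1" using s_nonlocal assms by auto
  show "(Lp p (weak_gradient u)) < \<infinity>"
   using u False gradient_energy_eq[OF X_gradient[OF u False], of p] by (simp add: X_iff)
 qed
qed

lemma A_finite:
 assumes u: "u : X"
 shows "A u < \<infinity>"
proof -
 have "ennreal \<gamma> * gradient_energy p u < \<infinity>" using u by (cases "\<gamma> = 0") (auto simp: X_iff ennreal_mult_less_top)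
 moreover have "ennreal (1 - \<gamma>) * gagliardo_energy s p u < \<infinity>"
  using gagliardo_X[OF u] \<gamma> by (cases "\<gamma> = 1") (auto simp: ennreal_mult_less_top)
 moreover have "weighted_energy p \<beta> u < \<infinity>" using u by (simp add: X_iff)
 ultimately show ?thesis by (simp add: A_def less_top)
qed

text \<open>Outside a large ball the weighted norm and the decay of \<open>u\<close> leave the factor
 \<open>\<bar>x\<bar>\<^bsup>\<alpha> - \<beta> - (q - p) \<tau>\<^esup>\<close>, which tends to zero: this is where the last hypothesis
 on the exponents enters.\<close>

definition \<kappa> :: real where "\<kappa> = - (\<alpha> - \<beta> - (q - p) * \<tau>)"

lemma \<kappa>_pos: "0 < \<kappa>"
proof -
 have "(1 - real DIM('a)) / p = - \<tau>" by (simp add: \<tau>_def minus_divide_left)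
 thus ?thesis using tail_exponent by (simp add: \<kappa>_def)
qed

lemma tail_bound:
 assumes a: "0 < a" "0 <= M" and [measurable]: "u : Borel"
  and le: "AE x in lborel. \<bar>u x\<bar> <= a * M * profile x" and W: "weighted_energy p \<beta> u <= ennreal (M powr p)"
  and \<rho>: "1 <= \<rho>"
 shows "(\<integral>x. ennreal (norm x powr \<alpha> * \<bar>u x\<bar> powr q) * indicator {x. \<rho> <= norm x} x)
  <= ennreal ((a * M) powr (q - p) * M powr p * \<rho> powr (- \<kappa>))"
proof -
 have "(\<integral>x. ennreal (norm x powr \<alpha> * \<bar>u x\<bar> powr q) * indicator {x. \<rho> <= norm x} x)
  <= (\<integral>x. ennreal ((a * M) powr (q - p) * \<rho> powr (- \<kappa>)) * ennreal (norm x powr \<beta> * \<bar>u x\<bar> powr p))"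
 proof (rule nn_integral_mono_AE)
  show "AE x in lborel. ennreal (norm x powr \<alpha> * \<bar>u x\<bar> powr q) * indicator {x. \<rho> <= norm x} x
   <= ennreal ((a * M) powr (q - p) * \<rho> powr (- \<kappa>)) * ennreal (norm x powr \<beta> * \<bar>u x\<bar> powr p)"
   using le
  proof eventually_elim
   case (elim x)
   show ?case
   proof (cases "\<rho> <= norm x & u x ~= 0")
    case True
    hence x: "1 <= norm x" "\<rho> <= norm x" using \<rho> by auto
    have "\<bar>u x\<bar> powr (q - p) <= (a * M * norm x powr (- \<tau>)) powr (q - p)"
     using elim x q by (intro powr_mono2) (auto simp: profile_def)
    also have "... = (a * M) powr (q - p) * norm x powr (- \<tau> * (q - p))" using a by (simp add: powr_mult powr_powr)
    finally have 1: "\<bar>u x\<bar> powr (q - p) <= (a * M) powr (q - p) * norm x powr (- \<tau> * (q - p))" .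
    have "norm x powr \<alpha> * \<bar>u x\<bar> powr q = norm x powr \<alpha> * \<bar>u x\<bar> powr (q - p) * \<bar>u x\<bar> powr p"
     using True by (simp add: powr_diff)
    also have "... <= norm x powr \<alpha> * ((a * M) powr (q - p) * norm x powr (- \<tau> * (q - p))) * \<bar>u x\<bar> powr p"
     using 1 by (intro mult_right_mono mult_left_mono) auto
    also have "... = (a * M) powr (q - p) * (norm x powr \<alpha> * norm x powr (- \<tau> * (q - p))) * \<bar>u x\<bar> powr p" by (simp add: mult_ac)
    also have "norm x powr \<alpha> * norm x powr (- \<tau> * (q - p)) = norm x powr (- \<kappa>) * norm x powr \<beta>"
     unfolding powr_add[symmetric] by (rule arg_cong[where f="%e. norm x powr e"]) (simp add: \<kappa>_def algebra_simps)
    also have "(a * M) powr (q - p) * (norm x powr (- \<kappa>) * norm x powr \<beta>) * \<bar>u x\<bar> powr p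
     <= (a * M) powr (q - p) * (\<rho> powr (- \<kappa>) * norm x powr \<beta>) * \<bar>u x\<bar> powr p"
     using x \<rho> \<kappa>_pos by (intro mult_right_mono mult_left_mono powr_mono2') auto
    finally have "norm x powr \<alpha> * \<bar>u x\<bar> powr q <= (a * M) powr (q - p) * \<rho> powr (- \<kappa>) * (norm x powr \<beta> * \<bar>u x\<bar> powr p)" by (simp add: mult_ac)
    thus ?thesis using True by (simp add: ennreal_mult[symmetric] ennreal_leI)
   qed auto
  qed
 qed
 also have "... = ennreal ((a * M) powr (q - p) * \<rho> powr (- \<kappa>)) * weighted_energy p \<beta> u"
  unfolding weighted_energy_def by (rule nn_integral_cmult) measurable
 also have "... <= ennreal ((a * M) powr (q - p) * \<rho> powr (- \<kappa>)) * ennreal (M powr p)"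
  using W by (rule mult_left_mono) simp
 also have "... = ennreal ((a * M) powr (q - p) * M powr p * \<rho> powr (- \<kappa>))"
  by (simp add: ennreal_mult[symmetric] mult_ac)
 finally show ?thesis .
qed

text \<open>Dominated convergence inside a large ball, where the pointwise bound is integrable to the power
 \<open>q\<close> against \<open>\<bar>x\<bar>\<^sup>\<alpha>\<close> because \<open>q\<close> is subcritical; outside, the tail is uniformly small.\<close>

lemma B_tendsto:
 assumes w: "!!n. w n : X" "!!n. A0 (w n) <= ennreal (M powr p)" "0 <= M"
  and [measurable]: "v : Borel" and lim: "AE x in lborel. (%n. w n x) ----> v x"
 shows "B v < \<infinity>" "(%n. B (w n)) ----> B v"
proof -
 have [measurable]: "w n : Borel" for n using w(1) by (rule X_measurable)
 obtain a where a: "0 < a"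
  "!!u M. u : X ==> 0 <= M ==> A0 u <= ennreal (M powr p) ==> AE x in lborel. \<bar>u x\<bar> <= a * M * profile x"
  using pointwise_bound by blast
 have wb: "AE x in lborel. \<forall>n. \<bar>w n x\<bar> <= a * M * profile x"
  unfolding AE_all_countable using a(2)[OF w(1) w(3) w(2)] by blast
 have W: "weighted_energy p \<beta> (w n) <= ennreal (M powr p)" for n
  using w(2)[of n] by (rule order_trans[rotated]) (simp add: A0_def)
 define f where "f u x = ennreal (norm x powr \<alpha> * \<bar>u x\<bar> powr q)" for u :: "'a => real" and x
 have [measurable]: "f u : Borel" if [measurable]: "u : Borel" for u unfolding f_def by measurable
 define core where "core \<rho> u = (\<integral>x. f u x * indicator (cball 0 \<rho>) x)" for \<rho> u
 define tail where "tail \<rho> u = (\<integral>x. f u x * indicator {x. \<rho> <= norm x} x)" for \<rho> u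
 define t where "t \<rho> = (a * M) powr (q - p) * M powr p * \<rho> powr (- \<kappa>)" for \<rho>
 have [measurable]: "cball (0::'a) \<rho> : sets borel" for \<rho> by simp
 have split: "B u <= core \<rho> u + tail \<rho> u" if [measurable]: "u : Borel" for u \<rho>
 proof -
  have "B u <= (\<integral>x. f u x * indicator (cball 0 \<rho>) x + f u x * indicator {x. \<rho> <= norm x} x)"
   unfolding B_def f_def by (intro nn_integral_mono) (auto split: split_indicator)
  also have "... = core \<rho> u + tail \<rho> u" unfolding core_def tail_def by (rule nn_integral_add) measurable
  finally show ?thesis .
 qed
 have core_le: "core \<rho> u <= B u" for \<rho> u
  unfolding core_def B_def f_def by (intro nn_integral_mono) (auto split: split_indicator)
 have flim: "AE x in lborel. (%n. f (w n) x) ----> f v x"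
  using lim
 proof eventually_elim
  case (elim x)
  have "(%n. norm x powr \<alpha> * \<bar>w n x\<bar> powr q) ----> norm x powr \<alpha> * \<bar>v x\<bar> powr q"
   using q p by (intro tendsto_intros tendsto_powr' elim) auto
  thus ?case unfolding f_def by (intro tendsto_ennrealI)
 qed
 have fatou: "(\<integral>x. f v x * indicator I x) <= liminf (%n. \<integral>\<^sup>+x. f (w n) x * indicator I x \<partial>lborel)" if [measurable]: "I : sets borel" for I
 proof -
  have "(\<integral>x. f v x * indicator I x) = (\<integral>x. liminf (%n. f (w n) x * indicator I x))"
  proof (rule nn_integral_cong_AE)
   show "AE x in lborel. f v x * indicator I x = liminf (%n. f (w n) x * indicator I x)"
    using flim
   proof eventually_elim
    case (elim x)
    have "(%n. f (w n) x * indicator I x) ----> f v x * indicator I x"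
     using elim by (cases "x : I") auto
    thus ?case by (simp add: lim_imp_Liminf)
   qed
  qed
  also have "... <= liminf (%n. \<integral>\<^sup>+x. f (w n) x * indicator I x \<partial>lborel)"
   by (rule nn_integral_liminf) measurable
  finally show ?thesis .
 qed
 have tail_w: "tail \<rho> (w n) <= ennreal (t \<rho>)" if "1 <= \<rho>" for \<rho> n
  unfolding tail_def f_def t_def using tail_bound[OF a(1) w(3) _ a(2)[OF w(1) w(3) w(2)] W that, of n] by simp
 have tail_v: "tail \<rho> v <= ennreal (t \<rho>)" if "1 <= \<rho>" for \<rho>
 proof -
  have "tail \<rho> v <= liminf (%n. tail \<rho> (w n))" unfolding tail_def by (rule fatou) measurable
  also have "... <= liminf (%n. ennreal (t \<rho>))" using tail_w[OF that] by (intro Liminf_mono) auto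
  finally show ?thesis by (simp add: Liminf_const)
 qed
 define g where "g x = ennreal ((a * M) powr q) * ennreal (norm x powr \<alpha> * profile x powr q)" for x
 have [measurable]: "g : Borel" unfolding g_def by measurable
 have g_fin: "(\<integral>x. g x * indicator (cball 0 \<rho>) x) < \<infinity>" for \<rho>
 proof -
  have "(\<integral>x. g x * indicator (cball 0 \<rho>) x) = ennreal ((a * M) powr q) * (\<integral>x. ennreal (norm x powr \<alpha> * profile x powr q) * indicator (cball 0 \<rho>) x)"
   unfolding g_def by (subst nn_integral_cmult[symmetric]) (auto simp: mult.assoc)
  also have "... < \<infinity>" using profile_moment[of q \<alpha> \<rho>] \<mu>_bounds(4) q p by (simp add: ennreal_mult_less_top)
  finally show ?thesis .
 qed
 have core_lim: "(%n. core \<rho> (w n)) ----> core \<rho> v" for \<rho>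
  unfolding core_def
 proof (rule nn_integral_dominated_convergence[where w="%x. g x * indicator (cball 0 \<rho>) x"])
  show "AE x in lborel. f (w n) x * indicator (cball 0 \<rho>) x <= g x * indicator (cball 0 \<rho>) x" for n
   using wb
  proof eventually_elim
   case (elim x)
   have "\<bar>w n x\<bar> powr q <= (a * M * profile x) powr q" using elim q p by (intro powr_mono2) auto
   also have "... = (a * M) powr q * profile x powr q" using a(1) w(3) profile_nonneg by (simp add: powr_mult)
   finally have "norm x powr \<alpha> * \<bar>w n x\<bar> powr q <= norm x powr \<alpha> * ((a * M) powr q * profile x powr q)" by (rule mult_left_mono) simp
   hence "f (w n) x <= g x" unfolding f_def g_def by (simp add: ennreal_mult[symmetric] mult_ac ennreal_leI)
   thus ?case by (rule mult_right_mono) simp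
  qed
  show "(\<integral>x. g x * indicator (cball 0 \<rho>) x) < \<infinity>" by (rule g_fin)
  show "AE x in lborel. (%n. f (w n) x * indicator (cball 0 \<rho>) x) ----> f v x * indicator (cball 0 \<rho>) x"
   using flim
  proof eventually_elim
   case (elim x)
   thus ?case by (cases "x : cball 0 \<rho>") auto
  qed
 qed auto
 have core_fin: "core \<rho> v < \<infinity>" for \<rho>
 proof -
  have "core \<rho> (w n) <= (\<integral>x. g x * indicator (cball 0 \<rho>) x)" for n
   unfolding core_def
  proof (rule nn_integral_mono_AE)
   show "AE x in lborel. f (w n) x * indicator (cball 0 \<rho>) x <= g x * indicator (cball 0 \<rho>) x"
    using wb
   proof eventually_elim
    case (elim x)
    have "\<bar>w n x\<bar> powr q <= (a * M * profile x) powr q" using elim q p by (intro powr_mono2) auto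
    also have "... = (a * M) powr q * profile x powr q" using a(1) w(3) profile_nonneg by (simp add: powr_mult)
    finally have "norm x powr \<alpha> * \<bar>w n x\<bar> powr q <= norm x powr \<alpha> * ((a * M) powr q * profile x powr q)" by (rule mult_left_mono) simp
    hence "f (w n) x <= g x" unfolding f_def g_def by (simp add: ennreal_mult[symmetric] mult_ac ennreal_leI)
    thus ?case by (rule mult_right_mono) simp
   qed
  qed
  hence "core \<rho> v <= (\<integral>x. g x * indicator (cball 0 \<rho>) x)"
   by (intro LIMSEQ_le_const2[OF core_lim]) auto
  thus ?thesis using g_fin by (rule le_less_trans)
 qed
 show Bfin: "B v < \<infinity>"
  by (rule ennreal_le_add_finite[OF split[of v 1] core_fin]) (use tail_v[of 1] in \<open>auto intro: le_less_trans\<close>)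
 have tn: "(%n. ennreal (t (real (Suc n)))) ----> 0"
 proof -
  have "(%n. real (Suc n) powr (- \<kappa>)) ----> 0"
   using \<kappa>_pos by (intro tendsto_neg_powr filterlim_compose[OF filterlim_real_sequentially filterlim_Suc]) auto
  hence "(%n. t (real (Suc n))) ----> 0" unfolding t_def by (rule tendsto_mult_right_zero)
  thus ?thesis using tendsto_ennrealI by fastforce
 qed
 show "(%n. B (w n)) ----> B v"
 proof (rule order_tendstoI)
  fix c assume "c < B v"
  also have "B v <= liminf (%n. B (w n))" using fatou[of UNIV] by (simp add: B_def f_def)
  finally show "\<forall>\<^sub>F n in sequentially. c < B (w n)" by (rule less_LiminfD)
 next
  fix c assume c: "B v < c"
  have "(%n. B v + ennreal (t (real (Suc n)))) ----> B v + 0" by (intro tendsto_add tendsto_const tn)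
  hence "\<forall>\<^sub>F n in sequentially. B v + ennreal (t (real (Suc n))) < c" using c by (intro order_tendstoD) auto
  then obtain m where m: "B v + ennreal (t (real (Suc m))) < c" by (auto simp: eventually_sequentially)
  define \<rho> where "\<rho> = real (Suc m)"
  have \<rho>: "1 <= \<rho>" by (simp add: \<rho>_def)
  have "core \<rho> v + ennreal (t \<rho>) < c" using m core_le[of \<rho> v] unfolding \<rho>_def by (meson add_right_mono le_less_trans)
  moreover have "(%n. core \<rho> (w n) + ennreal (t \<rho>)) ----> core \<rho> v + ennreal (t \<rho>)" by (intro tendsto_add tendsto_const core_lim)
  ultimately have "\<forall>\<^sub>F n in sequentially. core \<rho> (w n) + ennreal (t \<rho>) < c" by (intro order_tendstoD) auto
  thus "\<forall>\<^sub>F n in sequentially. B (w n) < c"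
  proof eventually_elim
   case (elim n)
   have "B (w n) <= core \<rho> (w n) + tail \<rho> (w n)" by (rule split) simp
   also have "... <= core \<rho> (w n) + ennreal (t \<rho>)" by (rule add_left_mono[OF tail_w[OF \<rho>]])
   finally show ?case using elim by simp
  qed
 qed
qed

lemma B_finite:
 assumes u: "u : X"
 shows "B u < \<infinity>"
proof -
 obtain M where "0 <= M" "A0 u <= ennreal (M powr p)" using A0_cases[OF u] by blast
 thus ?thesis using B_tendsto(1)[of "%_. u" M u] u X_measurable by simp
qed

text \<open>Compactness: a bounded sequence is equi-Hoelder away from the origin, so it is enough to make it
 converge on a countable dense set.\<close>

lemma X_compact:
 assumes u: "!!n. u n : X" "!!n. A0 (u n) <= ennreal (M powr p)" "0 <= M"
 obtains r :: "nat => nat" and w where "strict_mono r" "w : Borel" "radial w"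
  "AE x in lborel. (%n. u (r n) x) ----> w x"
proof -
 have [measurable]: "u n : Borel" for n using u(1) by (rule X_measurable)
 obtain a where a: "0 < a"
  "!!u M. u : X ==> 0 <= M ==> A0 u <= ennreal (M powr p) ==> AE x in lborel. \<bar>u x\<bar> <= a * M * profile x"
  using pointwise_bound by blast
 obtain C where C: "0 < C"
  "!!u M. u : X ==> 0 <= M ==> A0 u <= ennreal (M powr p) ==>
   \<exists>Z\<in>null_sets lborel. \<forall>x y. x ~: Z --> y ~: Z --> norm x <= norm y --> norm y <= 2 * norm x -->
    \<bar>u x - u y\<bar> <= C * M * (norm y - norm x) powr (S - 1 / p) * norm x powr (- \<tau>)"
  using radial_Hoelder_X by blast
 have "\<exists>Z. Z : null_sets lborel & (\<forall>x y. x ~: Z --> y ~: Z --> norm x <= norm y --> norm y <= 2 * norm x -->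
    \<bar>u n x - u n y\<bar> <= C * M * (norm y - norm x) powr (S - 1 / p) * norm x powr (- \<tau>))" for n
  using C(2)[OF u(1) u(3) u(2)] by blast
 then obtain Z where Z: "!!n. Z n : null_sets lborel" "!!n x y. x ~: Z n ==> y ~: Z n ==> norm x <= norm y ==> norm y <= 2 * norm x ==>
    \<bar>u n x - u n y\<bar> <= C * M * (norm y - norm x) powr (S - 1 / p) * norm x powr (- \<tau>)"
  by metis
 have "AE x in lborel. \<forall>n. \<bar>u n x\<bar> <= a * M * profile x"
  unfolding AE_all_countable using a(2)[OF u(1) u(3) u(2)] by blast
 then obtain Y where Y: "!!x. x : space lborel - Y ==> \<forall>n. \<bar>u n x\<bar> <= a * M * profile x" "Y : null_sets lborel"
  by (rule AE_E3) blast
 define N where "N = (\<Union>n. Z n) \<union> Y \<union> {0}"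
 have N: "N : null_sets lborel" unfolding N_def using Z(1) Y(2) by (intro null_sets.Un null_sets_UN) auto
 define D where "D = - N"
 obtain Q where Q: "countable Q" "Q \<subseteq> D" "D \<subseteq> closure Q" using separable[of D] by blast
 define f where "f n x = u n x / (1 + profile x)" for n x
 have f_le: "norm (f n x) <= a * M" if "x : Q" for n x
 proof -
  have "\<bar>u n x\<bar> <= a * M * profile x" using Y(1)[of x] that Q(2) by (auto simp: D_def N_def)
  also have "... <= a * M * (1 + profile x)" using a u(3) by (intro mult_left_mono) auto
  finally show ?thesis using profile_nonneg[of x] by (simp add: f_def pos_divide_le_eq add_pos_nonneg)
 qed
 obtain r where r: "strict_mono (r :: nat => nat)" "!!x. x : Q ==> \<exists>l. (%n. f (r n) x) ----> l"
  using function_convergent_subsequence[where f=f and S=Q and M="a * M", OF Q(1) f_le] by blast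
 have Qconv: "convergent (%n. u (r n) x)" if x: "x : Q" for x
 proof -
  obtain l where "(%n. f (r n) x) ----> l" using r(2)[OF x] by blast
  hence "(%n. f (r n) x * (1 + profile x)) ----> l * (1 + profile x)" by (intro tendsto_intros)
  moreover have "f n x * (1 + profile x) = u n x" for n using profile_nonneg[of x] by (simp add: f_def add_nonneg_eq_0_iff)
  ultimately show ?thesis by (auto simp: convergent_def)
 qed
 have e0: "0 < S - 1 / p" using S_bounds(1) p by (simp add: field_simps)
 have Dconv: "convergent (%n. u (r n) x)" if x: "x : D" for x
 proof (rule Cauchy_convergent, rule metric_CauchyI)
  fix e :: real assume e: "0 < e"
  have x0: "0 < norm x" using x by (auto simp: D_def N_def)
  define c where "c = C * M * (3/4 * norm x) powr (- \<tau>)"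
  have c: "0 <= c" using C(1) u(3) by (simp add: c_def)
  have near: "\<bar>u n x - u n y\<bar> <= c * \<bar>norm y - norm x\<bar> powr (S - 1 / p)" if y: "y : D" "\<bar>norm y - norm x\<bar> <= norm x / 4" for n y
  proof -
   have *: "\<bar>u n v - u n w\<bar> <= c * \<bar>norm y - norm x\<bar> powr (S - 1 / p)"
    if "norm v <= norm w" "v : D" "w : D" "3/4 * norm x <= norm v" "norm w <= 5/4 * norm x" "norm w - norm v = \<bar>norm y - norm x\<bar>" for v w
   proof -
    have "\<bar>u n v - u n w\<bar> <= C * M * (norm w - norm v) powr (S - 1 / p) * norm v powr (- \<tau>)"
     using that x0 by (intro Z(2)) (auto simp: D_def N_def)
    also have "... <= C * M * (norm w - norm v) powr (S - 1 / p) * (3/4 * norm x) powr (- \<tau>)"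
     using C(1) u(3) that x0 \<tau>_nonneg by (intro mult_left_mono powr_mono2') auto
    finally show ?thesis using that(6) by (simp add: c_def mult_ac)
   qed
   show ?thesis
   proof (cases "norm x <= norm y")
    case True
    thus ?thesis using *[of x y] x y x0 by auto
   next
    case False
    thus ?thesis using *[of y x] x y x0 by (auto simp: abs_minus_commute)
   qed
  qed
  obtain \<delta> where \<delta>: "0 < \<delta>" "\<delta> <= norm x / 4" "c * \<delta> powr (S - 1 / p) < e / 3"
  proof -
   have "((%t. c * t powr (S - 1 / p)) \<longlongrightarrow> c * 0) (at_right 0)"
    using e0 by (intro tendsto_mult tendsto_const tendsto_zero_powrI[where b="S - 1 / p"]) (auto simp: eventually_at_filter)
   hence "\<forall>\<^sub>F t in at_right 0. c * t powr (S - 1 / p) < e / 3" using e by (intro order_tendstoD) auto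
   moreover have "\<forall>\<^sub>F t in at_right (0::real). 0 < t & t < norm x / 4"
    by (rule eventually_at_rightI[of 0 "norm x / 4"]) (use x0 in auto)
   ultimately have "\<forall>\<^sub>F t in at_right 0. c * t powr (S - 1 / p) < e / 3 & 0 < t & t < norm x / 4"
    by eventually_elim simp
   then obtain t where "c * t powr (S - 1 / p) < e / 3 & 0 < t & t < norm x / 4"
    using eventually_happens'[OF trivial_limit_at_right_real] by blast
   thus thesis using that[of t] by auto
  qed
  obtain y where y: "y : Q" "dist y x < \<delta>" using Q(3) x \<delta>(1) by (meson closure_approachable subsetD)
  have yD: "y : D" using y Q by blast
  have d: "\<bar>norm y - norm x\<bar> <= \<delta>" using y(2) norm_triangle_ineq3[of y x] by (simp add: dist_norm)
  have near': "\<bar>u n x - u n y\<bar> < e / 3" for n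
  proof -
   have "\<bar>u n x - u n y\<bar> <= c * \<bar>norm y - norm x\<bar> powr (S - 1 / p)" using near[OF yD] d \<delta>(2) by auto
   also have "... <= c * \<delta> powr (S - 1 / p)" using d c e0 by (intro mult_left_mono powr_mono2) auto
   finally show ?thesis using \<delta>(3) by simp
  qed
  obtain n0 where n0: "!!m n. n0 <= m ==> n0 <= n ==> dist (u (r m) y) (u (r n) y) < e / 3"
   using metric_CauchyD[OF convergent_Cauchy[OF Qconv[OF y(1)]], of "e / 3"] e by auto
  have "dist (u (r m) x) (u (r n) x) < e" if "n0 <= m" "n0 <= n" for m n
   using near'[of "r m"] near'[of "r n"] n0[OF that] unfolding dist_real_def by linarith
  thus "\<exists>n0. \<forall>m\<ge>n0. \<forall>n\<ge>n0. dist (u (r m) x) (u (r n) x) < e" by blast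
 qed
 define w where "w x = lim (%n. u (r n) x)" for x
 have [measurable]: "w : Borel" unfolding w_def by measurable
 have "AE x in lborel. x ~: N" by (rule AE_not_in[OF N])
 hence conv: "AE x in lborel. (%n. u (r n) x) ----> w x"
  by eventually_elim (use Dconv in \<open>simp add: D_def w_def convergent_LIMSEQ_iff\<close>)
 have "\<exists>g. AE x in lborel. u n x = g (norm x)" for n using u(1)[of n] by (simp add: X_iff radial_def)
 then obtain g where g: "!!n. AE x in lborel. u n x = g n (norm x)" by metis
 hence "AE x in lborel. \<forall>n. u n x = g n (norm x)" by (simp add: AE_all_countable)
 hence "AE x in lborel. w x = lim (%n. g (r n) (norm x))" by eventually_elim (simp add: w_def)
 hence "radial w" unfolding radial_def by (intro exI[of _ "%t. lim (%n. g (r n) t)"])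
 thus thesis using that[OF r(1) _ _ conv] by simp
qed

end

section \<open>A minimiser\<close>

text \<open>Riesz-Fischer: along a subsequence the increments are so small in norm that
 \<open>2\<^sup>k \<bar>f\<^sub>k\<^sub>+\<^sub>1 - f\<^sub>k\<bar>\<close> is summable almost everywhere to the power \<open>p\<close>.\<close>

lemma Lp_Cauchy_subsequence:
 fixes f :: "nat => 'a::euclidean_space => 'b::euclidean_space"
 assumes p: "1 < p" and [measurable]: "!!n. f n : Borel"
  and Cauchy: "!!e. 0 < e ==> \<exists>N. \<forall>n\<ge>N. \<forall>m\<ge>N. (\<integral>x. ennreal (norm (f n x - f m x) powr p)) <= ennreal e"
 obtains r :: "nat => nat" and g where "strict_mono r" "g : Borel"
  "AE x in lborel. (%k. f (r k) x) ----> g x"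
  "!!e. 0 < e ==> \<exists>N. \<forall>n\<ge>N. (\<integral>x. ennreal (norm (f (r n) x - g x) powr p)) <= ennreal e"
proof -
 have "\<exists>N. \<forall>n\<ge>N. \<forall>m\<ge>N. (\<integral>x. ennreal (norm (f n x - f m x) powr p)) <= ennreal ((1/2) powr (real k * (p + 1)))" for k :: nat
  by (rule Cauchy) simp
 then obtain N where N: "!!k n m. N k <= n ==> N k <= m ==>
   (\<integral>x. ennreal (norm (f n x - f m x) powr p)) <= ennreal ((1/2) powr (real k * (p + 1)))" by metis
 define r where "r k = (\<Sum>i\<le>k. N i) + k" for k
 have rN: "N k <= r k" for k
  unfolding r_def using member_le_sum[of k "{..k}" N] by simp
 have r: "strict_mono r" unfolding strict_mono_Suc_iff r_def by simp
 have rmono: "r k <= r l" if "k <= l" for k l using r that by (simp add: strict_mono_less_eq)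
 define d where "d k x = norm (f (r (Suc k)) x - f (r k) x)" for k x
 have [measurable]: "d k : Borel" for k unfolding d_def by measurable
 have d_int: "(\<integral>x. ennreal (d k x powr p)) <= ennreal ((1/2) powr (real k * (p + 1)))" for k
  unfolding d_def using N[of k "r (Suc k)" "r k"] rN[of k] rmono[of k "Suc k"] by simp
 have "(\<integral>x. (\<Sum>k. ennreal (2 powr (real k * p) * d k x powr p))) = (\<Sum>k. \<integral>\<^sup>+x. ennreal (2 powr (real k * p) * d k x powr p) \<partial>lborel)"
  by (rule nn_integral_suminf) measurable
 also have "... <= (\<Sum>k. ennreal ((1/2) ^ k))"
 proof (rule suminf_le)
  fix k
  have "(\<integral>x. ennreal (2 powr (real k * p) * d k x powr p)) = ennreal (2 powr (real k * p)) * (\<integral>x. ennreal (d k x powr p))"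
   by (simp add: ennreal_mult nn_integral_cmult)
  also have "... <= ennreal (2 powr (real k * p)) * ennreal ((1/2) powr (real k * (p + 1)))" by (intro mult_left_mono d_int) simp
  also have "... = ennreal (2 powr (real k * p) * (1/2) powr (real k * (p + 1)))" by (simp add: ennreal_mult)
  also have "2 powr (real k * p) * (1/2) powr (real k * (p + 1)) = (1/2) ^ k"
  proof -
   have h: "(1/2::real) = 2 powr (- 1)" by (simp add: powr_minus)
   have "(1/2::real) powr (real k * (p + 1)) = 2 powr (- (real k * (p + 1)))" unfolding h powr_powr by simp
   hence "2 powr (real k * p) * (1/2) powr (real k * (p + 1)) = 2 powr (- real k)"
    by (simp add: powr_add[symmetric] algebra_simps)
   also have "... = (1/2) ^ k" by (simp add: powr_minus_divide powr_realpow power_one_over)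
   finally show ?thesis .
  qed
  finally show "(\<integral>x. ennreal (2 powr (real k * p) * d k x powr p)) <= ennreal ((1/2) ^ k)" .
 qed auto
 also have "... = ennreal 2" using suminf_geometric[of "1/2::real"] by (subst suminf_ennreal2) auto
 also have "... < \<infinity>" by simp
 finally have "AE x in lborel. (\<Sum>k. ennreal (2 powr (real k * p) * d k x powr p)) ~= \<infinity>"
  by (intro nn_integral_PInf_AE) auto
 hence conv: "AE x in lborel. convergent (%k. f (r k) x)"
 proof eventually_elim
  case (elim x)
  have "summable (%k. 2 powr (real k * p) * d k x powr p)"
   using elim by (intro summable_suminf_not_top) auto
  hence "(%k. 2 powr (real k * p) * d k x powr p) ----> 0" by (rule summable_LIMSEQ_zero)
  hence "\<forall>\<^sub>F k in sequentially. 2 powr (real k * p) * d k x powr p < 1" by (rule order_tendstoD) simp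
  hence ev: "\<forall>\<^sub>F k in sequentially. norm (f (r (Suc k)) x - f (r k) x) <= (1/2) ^ k"
  proof eventually_elim
   case (elim k)
   have "2 powr (real k * p) * d k x powr p = (2 ^ k * d k x) powr p"
    by (simp add: powr_mult d_def powr_powr flip: powr_realpow)
   hence "(2 ^ k * d k x) powr p < 1 powr p" using elim by simp
   hence "2 ^ k * d k x <= 1"
    using powr_less_mono2[of p 1 "2 ^ k * d k x"] p by linarith
   thus ?case by (simp add: d_def power_divide field_simps)
  qed
  have "summable (%k. f (r (Suc k)) x - f (r k) x)"
   by (rule summable_comparison_test_ev[OF ev]) (rule summable_geometric, simp)
  hence "convergent (%n. \<Sum>k<n. f (r (Suc k)) x - f (r k) x)" by (simp add: summable_iff_convergent)
  hence "convergent (%n. f (r n) x - f (r 0) x)" by (simp add: sum_lessThan_telescope[of "%k. f (r k) x"])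
  from convergent_add[OF this convergent_const[of "f (r 0) x"]] show ?case by simp
 qed
 define g where "g x = lim (%k. f (r k) x)" for x
 have [measurable]: "g : Borel" unfolding g_def by measurable
 have lim: "AE x in lborel. (%k. f (r k) x) ----> g x"
  using conv by eventually_elim (simp add: g_def convergent_LIMSEQ_iff)
 show thesis
 proof (rule that[OF r _ lim])
  fix e :: real assume "0 < e"
  then obtain N0 where N0: "!!n m. N0 <= n ==> N0 <= m ==> (\<integral>x. ennreal (norm (f n x - f m x) powr p)) <= ennreal e"
   using Cauchy by blast
  have rge: "n <= r n" for n using r by (rule strict_mono_imp_increasing)
  have "(\<integral>x. ennreal (norm (f (r n) x - g x) powr p)) <= ennreal e" if n: "N0 <= n" for n
  proof -
   have "(\<integral>x. ennreal (norm (f (r n) x - g x) powr p)) = (\<integral>x. liminf (%k. ennreal (norm (f (r n) x - f (r k) x) powr p)))"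
   proof (rule nn_integral_cong_AE)
    show "AE x in lborel. ennreal (norm (f (r n) x - g x) powr p) = liminf (%k. ennreal (norm (f (r n) x - f (r k) x) powr p))"
     using lim
    proof eventually_elim
     case (elim x)
     have "(%k. ennreal (norm (f (r n) x - f (r k) x) powr p)) ----> ennreal (norm (f (r n) x - g x) powr p)"
      using p by (intro tendsto_ennrealI tendsto_powr' tendsto_intros elim) auto
     thus ?case by (rule lim_imp_Liminf[OF sequentially_bot, symmetric])
    qed
   qed
   also have "... <= liminf (%k. \<integral>\<^sup>+x. ennreal (norm (f (r n) x - f (r k) x) powr p) \<partial>lborel)"
    by (rule nn_integral_liminf) measurable
   also have "... <= liminf (%k::nat. ennreal e)"
   proof (rule Liminf_mono)
    have "(\<integral>x. ennreal (norm (f (r n) x - f (r k) x) powr p)) <= ennreal e" if "N0 <= k" for k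
     using N0[of "r n" "r k"] rge[of n] rge[of k] n that by linarith
    thus "\<forall>\<^sub>F k in sequentially. (\<integral>x. ennreal (norm (f (r n) x - f (r k) x) powr p)) <= ennreal e"
     by (auto simp: eventually_sequentially)
   qed
   finally show ?thesis by (simp add: Liminf_const)
  qed
  thus "\<exists>N. \<forall>n\<ge>N. (\<integral>x. ennreal (norm (f (r n) x - g x) powr p)) <= ennreal e" by blast
 qed measurable
qed

lemma Lp_imp_L1loc_tendsto:
 fixes f :: "nat => 'a::euclidean_space => 'b::euclidean_space"
 assumes p: "1 < p" and [measurable]: "!!n. f n : Borel" "g : Borel"
  and lim: "!!e. 0 < e ==> \<exists>N. \<forall>n\<ge>N. (\<integral>x. ennreal (norm (f n x - g x) powr p)) <= ennreal e"
 shows "L1loc_tendsto f g"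
 unfolding L1loc_tendsto_def
proof (intro allI impI)
 fix K :: "'a set" assume K: "compact K"
 hence [measurable]: "K : sets borel" by (simp add: borel_compact)
 obtain k where k: "emeasure lborel K = ennreal k" "0 <= k"
  using emeasure_compact_finite[OF K] unfolding infinity_ennreal_def less_top_ennreal by blast
 show "(%n. \<integral>\<^sup>+x. ennreal (norm (f n x - g x)) * indicator K x \<partial>lborel) ----> 0"
 proof (rule order_tendstoI)
  fix c :: ennreal assume "0 < c"
  then obtain c' where c': "0 < c'" "ennreal c' < c"
   by (metis dense ennreal_cases ennreal_less_zero_iff infinity_ennreal_def not_less_iff_gr_or_eq top.extremum_strict)
  define \<delta> where "\<delta> = c' / (2 * (k + 1))"
  have \<delta>: "0 < \<delta>" using c' k by (simp add: \<delta>_def)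
  define e where "e = c' / 2 * \<delta> powr (p - 1)"
  have e: "0 < e" using c' \<delta> by (simp add: e_def)
  obtain N where N: "!!n. N <= n ==> (\<integral>x. ennreal (norm (f n x - g x) powr p)) <= ennreal e"
   using lim[OF e] by blast
  have "(\<integral>x. ennreal (norm (f n x - g x)) * indicator K x) < c" if n: "N <= n" for n
  proof -
   have pt: "t <= \<delta> + \<delta> powr (1 - p) * t powr p" if t: "0 <= t" for t
   proof (cases "t <= \<delta>")
    case False
    hence "1 <= (t / \<delta>) powr (p - 1)" using \<delta> p by (intro ge_one_powr_ge_zero) auto
    hence "t * 1 <= t * (t / \<delta>) powr (p - 1)" using t by (intro mult_left_mono) auto
    also have "... = \<delta> powr (1 - p) * t powr p"
    proof -
     have "\<delta> powr (1 - p) = 1 / \<delta> powr (p - 1)" using powr_minus_divide[of \<delta> "p - 1"] by simp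
     moreover have "t * t powr (p - 1) = t powr p" using False \<delta> by (simp add: powr_diff)
     ultimately show ?thesis using t \<delta> by (simp add: powr_divide)
    qed
    finally show ?thesis using \<delta> by simp
   qed (simp add: add_increasing2)
   have "(\<integral>x. ennreal (norm (f n x - g x)) * indicator K x)
    <= (\<integral>x. ennreal \<delta> * indicator K x + ennreal (\<delta> powr (1 - p)) * ennreal (norm (f n x - g x) powr p))"
   proof (rule nn_integral_mono)
    fix x
    have "ennreal (norm (f n x - g x)) <= ennreal (\<delta> + \<delta> powr (1 - p) * norm (f n x - g x) powr p)" by (rule ennreal_leI[OF pt]) simp
    also have "... = ennreal \<delta> + ennreal (\<delta> powr (1 - p)) * ennreal (norm (f n x - g x) powr p)" using \<delta> by (simp add: ennreal_mult)
    finally show "ennreal (norm (f n x - g x)) * indicator K x <= ennreal \<delta> * indicator K x + ennreal (\<delta> powr (1 - p)) * ennreal (norm (f n x - g x) powr p)"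
     by (cases "x : K") auto
   qed
   also have "... = ennreal \<delta> * emeasure lborel K + ennreal (\<delta> powr (1 - p)) * (\<integral>x. ennreal (norm (f n x - g x) powr p))"
    by (subst nn_integral_add) (auto simp: nn_integral_cmult)
   also have "... <= ennreal \<delta> * ennreal k + ennreal (\<delta> powr (1 - p)) * ennreal e"
    using N[OF n] k by (intro add_mono mult_left_mono) auto
   also have "... = ennreal (\<delta> * k + \<delta> powr (1 - p) * e)" using \<delta> k e by (simp add: ennreal_mult)
   also have "... <= ennreal c'"
   proof (rule ennreal_leI)
    have "\<delta> powr (1 - p) * e = c' / 2" using \<delta> unfolding e_def by (simp add: powr_add[symmetric] mult.left_commute[of "\<delta> powr (1 - p)"])
    moreover have "\<delta> * k <= \<delta> * (k + 1)" using \<delta> by simp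
    moreover have "\<delta> * (k + 1) = c' / 2"
    proof -
     have "k + 1 ~= 0" using k by linarith
     thus ?thesis unfolding \<delta>_def times_divide_eq_left by (rule nonzero_mult_divide_mult_cancel_right)
    qed
    ultimately show "\<delta> * k + \<delta> powr (1 - p) * e <= c'" by linarith
   qed
   finally show ?thesis using c'(2) by (rule le_less_trans)
  qed
  thus "\<forall>\<^sub>F n in sequentially. (\<integral>x. ennreal (norm (f n x - g x)) * indicator K x) < c"
   by (auto simp: eventually_sequentially)
 qed simp
qed

lemma nn_powr_lincomb_finite:
 fixes f g :: "'x => 'b::euclidean_space"
 assumes p: "1 < p" and [measurable]: "f : borel_measurable M" "g : borel_measurable M"
  and f: "(\<integral>\<^sup>+x. ennreal (norm (f x) powr p) \<partial>M) < \<infinity>" and g: "(\<integral>\<^sup>+x. ennreal (norm (g x) powr p) \<partial>M) < \<infinity>"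
 shows "(\<integral>\<^sup>+x. ennreal (norm (a *R f x + c *R g x) powr p) \<partial>M) < \<infinity>"
proof -
 have "(\<integral>\<^sup>+x. ennreal (norm (a *R f x + c *R g x) powr p) \<partial>M)
  <= (\<integral>\<^sup>+x. ennreal (2 powr p * \<bar>a\<bar> powr p) * ennreal (norm (f x) powr p) + ennreal (2 powr p * \<bar>c\<bar> powr p) * ennreal (norm (g x) powr p) \<partial>M)"
 proof (rule nn_integral_mono)
  fix x
  have "norm (a *R f x + c *R g x) powr p <= (norm (a *R f x) + norm (c *R g x)) powr p"
   using p by (intro powr_mono2 norm_triangle_ineq) auto
  also have "... <= 2 powr p * (norm (a *R f x) powr p + norm (c *R g x) powr p)" using p by (intro powr_add_le) auto
  also have "... = 2 powr p * \<bar>a\<bar> powr p * norm (f x) powr p + 2 powr p * \<bar>c\<bar> powr p * norm (g x) powr p"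
   by (simp add: powr_mult algebra_simps)
  finally have "ennreal (norm (a *R f x + c *R g x) powr p) <= ennreal (2 powr p * \<bar>a\<bar> powr p * norm (f x) powr p + 2 powr p * \<bar>c\<bar> powr p * norm (g x) powr p)"
   by (rule ennreal_leI)
  thus "ennreal (norm (a *R f x + c *R g x) powr p)
   <= ennreal (2 powr p * \<bar>a\<bar> powr p) * ennreal (norm (f x) powr p) + ennreal (2 powr p * \<bar>c\<bar> powr p) * ennreal (norm (g x) powr p)"
   by (simp add: ennreal_mult)
 qed
 also have "... = ennreal (2 powr p * \<bar>a\<bar> powr p) * (\<integral>\<^sup>+x. ennreal (norm (f x) powr p) \<partial>M) + ennreal (2 powr p * \<bar>c\<bar> powr p) * (\<integral>\<^sup>+x. ennreal (norm (g x) powr p) \<partial>M)"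
  by (subst nn_integral_add) (auto simp: nn_integral_cmult)
 also have "... < \<infinity>" using f g by (auto simp: ennreal_mult_less_top)
 finally show ?thesis .
qed

lemma nn_powr_scale:
 fixes f :: "'x => 'b::euclidean_space"
 assumes [measurable]: "f : borel_measurable M"
 shows "(\<integral>\<^sup>+x. ennreal (norm (a *R f x) powr p) \<partial>M) = ennreal (\<bar>a\<bar> powr p) * (\<integral>\<^sup>+x. ennreal (norm (f x) powr p) \<partial>M)"
 by (subst nn_integral_cmult[symmetric]) (auto simp: powr_mult ennreal_mult)

lemma nn_powr_midpoint:
 fixes f g :: "'x => 'b::euclidean_space"
 assumes p: "1 < p" and [measurable]: "f : borel_measurable M" "g : borel_measurable M"
 shows "2 * ((\<integral>\<^sup>+x. ennreal (norm ((1/2) *R f x + (1/2) *R g x) powr p) \<partial>M) + (\<integral>\<^sup>+x. ennreal (convexity_gap p (f x) (g x)) \<partial>M))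
  = (\<integral>\<^sup>+x. ennreal (norm (f x) powr p) \<partial>M) + (\<integral>\<^sup>+x. ennreal (norm (g x) powr p) \<partial>M)"
proof -
 have [measurable]: "(%x. convexity_gap p (f x) (g x)) : borel_measurable M" unfolding convexity_gap_def by measurable
 have "2 * ((\<integral>\<^sup>+x. ennreal (norm ((1/2) *R f x + (1/2) *R g x) powr p) \<partial>M) + (\<integral>\<^sup>+x. ennreal (convexity_gap p (f x) (g x)) \<partial>M))
  = (\<integral>\<^sup>+x. 2 * (ennreal (norm ((1/2) *R f x + (1/2) *R g x) powr p) + ennreal (convexity_gap p (f x) (g x))) \<partial>M)"
  by (simp add: nn_integral_add nn_integral_cmult)
 also have "... = (\<integral>\<^sup>+x. ennreal (norm (f x) powr p) + ennreal (norm (g x) powr p) \<partial>M)"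
 proof (rule nn_integral_cong)
  fix x
  have "2 * (norm ((1/2) *R f x + (1/2) *R g x) powr p + convexity_gap p (f x) (g x)) = norm (f x) powr p + norm (g x) powr p"
   by (simp add: convexity_gap_def scaleR_add_right)
  hence "ennreal (2 * (norm ((1/2) *R f x + (1/2) *R g x) powr p + convexity_gap p (f x) (g x))) = ennreal (norm (f x) powr p + norm (g x) powr p)" by simp
  thus "2 * (ennreal (norm ((1/2) *R f x + (1/2) *R g x) powr p) + ennreal (convexity_gap p (f x) (g x))) = ennreal (norm (f x) powr p) + ennreal (norm (g x) powr p)"
   using convexity_gap_nonneg[OF p] by (metis ennreal_plus ennreal_mult ennreal_numeral zero_le_numeral add_nonneg_nonneg powr_ge_zero)
 qed
 also have "... = (\<integral>\<^sup>+x. ennreal (norm (f x) powr p) \<partial>M) + (\<integral>\<^sup>+x. ennreal (norm (g x) powr p) \<partial>M)" by (rule nn_integral_add) measurable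
 finally show ?thesis .
qed

lemma nn_powr_liminf:
 fixes f :: "nat => 'x => 'b::euclidean_space"
 assumes p: "0 < p" and [measurable]: "!!n. f n : borel_measurable M" and lim: "AE x in M. (%n. f n x) ----> g x"
 shows "(\<integral>\<^sup>+x. ennreal (norm (g x) powr p) \<partial>M) <= liminf (%n. \<integral>\<^sup>+x. ennreal (norm (f n x) powr p) \<partial>M)"
proof -
 have "(\<integral>\<^sup>+x. ennreal (norm (g x) powr p) \<partial>M) = (\<integral>\<^sup>+x. liminf (%n. ennreal (norm (f n x) powr p)) \<partial>M)"
 proof (rule nn_integral_cong_AE)
  show "AE x in M. ennreal (norm (g x) powr p) = liminf (%n. ennreal (norm (f n x) powr p))"
   using lim
  proof eventually_elim
   case (elim x)
   have "(%n. ennreal (norm (f n x) powr p)) ----> ennreal (norm (g x) powr p)"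
    using p by (intro tendsto_ennrealI tendsto_powr' tendsto_intros elim) auto
   thus ?case by (rule lim_imp_Liminf[OF sequentially_bot, symmetric])
  qed
 qed
 also have "... <= liminf (%n. \<integral>\<^sup>+x. ennreal (norm (f n x) powr p) \<partial>M)"
  by (rule nn_integral_liminf) measurable
 finally show ?thesis .
qed

subsection \<open>The energies as \<open>L\<^sup>p\<close> norms of linear images\<close>

definition weighted_map :: "real => ('a::euclidean_space => real) => 'a => real" where
 "weighted_map c u x = norm x powr c * u x"

definition difference_map :: "real => ('a::euclidean_space => real) => 'a \<times> 'a => real" where
 "difference_map c u z = norm (fst z - snd z) powr (- c) * (u (fst z) - u (snd z))"

lemma weighted_map_measurable [measurable]:
 assumes [measurable]: "u : Borel"
 shows "weighted_map c u : Borel"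
 unfolding weighted_map_def by measurable

lemma difference_map_measurable [measurable]:
 assumes [measurable]: "u : Borel"
 shows "difference_map c u : borel_measurable lborel2"
 unfolding difference_map_def by measurable

lemma weighted_map_lincomb: "weighted_map c (%x. a * u x + b * v x) x = a *R weighted_map c u x + b *R weighted_map c v x"
 by (simp add: weighted_map_def algebra_simps)

lemma difference_map_lincomb: "difference_map c (%x. a * u x + b * v x) z = a *R difference_map c u z + b *R difference_map c v z"
 by (simp add: difference_map_def algebra_simps)

lemma weighted_power_eq:
 assumes "0 < p"
 shows "(\<integral>\<^sup>+x. ennreal (norm x powr c * \<bar>u x\<bar> powr p) \<partial>(lborel::'a::euclidean_space measure)) = (Lp p (weighted_map (c / p) u))"
 using assms by (intro nn_integral_cong) (simp add: weighted_map_def abs_mult powr_mult powr_powr)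

lemma gagliardo_energy_pair:
 assumes p: "0 < p" and [measurable]: "u : Borel"
 shows "gagliardo_energy s p (u :: 'a::euclidean_space => real) =
  (\<integral>\<^sup>+z. ennreal (norm (difference_map ((real DIM('a) + s * p) / p) u z) powr p) \<partial>lborel2)"
proof -
 have "(\<integral>\<^sup>+z. ennreal (norm (difference_map ((real DIM('a) + s * p) / p) u z) powr p) \<partial>lborel2)
  = (\<integral>x. (\<integral>y. ennreal (norm (difference_map ((real DIM('a) + s * p) / p) u (x, y)) powr p)))"
  by (rule lborel.nn_integral_fst[symmetric]) measurable
 also have "... = gagliardo_energy s p u"
  unfolding gagliardo_energy_eq
 proof (intro nn_integral_cong arg_cong[where f=ennreal])
  fix x y :: 'a
  have "norm (difference_map ((real DIM('a) + s * p) / p) u (x, y)) powr p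
   = (norm (x - y) powr (- ((real DIM('a) + s * p) / p))) powr p * \<bar>u x - u y\<bar> powr p"
   by (simp add: difference_map_def abs_mult powr_mult)
  also have "(norm (x - y) powr (- ((real DIM('a) + s * p) / p))) powr p = norm (x - y) powr (- (real DIM('a) + s * p))"
   unfolding powr_powr using p by simp
  finally show "norm (difference_map ((real DIM('a) + s * p) / p) u (x, y)) powr p = quot p u (real DIM('a) + s * p) x y"
   by (simp add: mult.commute)
 qed
 finally show ?thesis by simp
qed

lemma radial_lincomb:
 assumes "radial u" "radial v"
 shows "radial (%x. a * u x + b * v x)"
proof -
 obtain g h where "AE x in lborel. u x = g (norm x)" "AE x in lborel. v x = h (norm x)"
  using assms by (auto simp: radial_def)
 hence "AE x in lborel. a * u x + b * v x = (%t. a * g t + b * h t) (norm x)" by eventually_elim simp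
 thus ?thesis unfolding radial_def by (intro exI[of _ "%t. a * g t + b * h t"])
qed

context radial_problem
begin

abbreviation Tw :: "('a => real) => 'a => real" where "Tw \<equiv> weighted_map (\<beta> / p)"
abbreviation Tq :: "('a => real) => 'a => real" where "Tq \<equiv> weighted_map (\<alpha> / q)"
abbreviation Td :: "('a => real) => 'a \<times> 'a => real" where "Td \<equiv> difference_map ((real DIM('a) + s * p) / p)"

lemma weighted_eq: "weighted_energy p \<beta> u = (Lp p (Tw u))"
 unfolding weighted_energy_def using weighted_power_eq[of p \<beta> u] p by simp

lemma B_eq: "B u = (\<integral>x. ennreal (norm (Tq u x) powr q))"
 unfolding B_def using weighted_power_eq[of q \<alpha> u] p q by simp

lemma gagliardo_eq:
 "u : Borel ==> gagliardo_energy s p u = (\<integral>\<^sup>+z. ennreal (norm (Td u z) powr p) \<partial>lborel2)"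
 using gagliardo_energy_pair[of p u s] p by simp

lemma X_gradient_measurable:
 assumes "u : X" "\<gamma> ~= 0"
 shows "weak_gradient u : Borel"
 using X_gradient[OF assms] by (auto simp: has_weak_gradient_def intro: loc_int_measurable)

lemma X_gradient_lincomb:
 assumes "u : X" "v : X" "\<gamma> ~= 0"
 shows "has_weak_gradient (%x. a * u x + b * v x) (%x. a *R weak_gradient u x + b *R weak_gradient v x)"
 by (intro has_weak_gradient_lincomb X_gradient assms)

lemma X_gradient_finite:
 assumes "u : X" "\<gamma> ~= 0"
 shows "(Lp p (weak_gradient u)) < \<infinity>"
 using assms gradient_energy_eq[OF X_gradient[OF assms], of p] by (simp add: X_iff)

lemma X_lincomb:
 assumes u: "u : X" and v: "v : X"
 shows "(%x. a * u x + b * v x) : X"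
proof -
 have m [measurable]: "u : Borel" "v : Borel" using u v by (auto intro: X_measurable)
 have fin: "weighted_energy p \<beta> u < \<infinity>" "weighted_energy p \<beta> v < \<infinity>" "radial u" "radial v" using u v by (simp_all add: X_iff)
 show ?thesis
  unfolding X_iff
 proof (intro conjI impI)
  show "weighted_energy p \<beta> (%x. a * u x + b * v x) < \<infinity>"
   using fin unfolding weighted_eq weighted_map_lincomb by (intro nn_powr_lincomb_finite[OF p]) auto
  show "radial (%x. a * u x + b * v x)" by (rule radial_lincomb[OF fin(3,4)])
  show "gagliardo_energy s p (%x. a * u x + b * v x) < \<infinity>" if "\<gamma> = 0"
  proof -
   have "gagliardo_energy s p u < \<infinity>" "gagliardo_energy s p v < \<infinity>" using u v that unfolding X_iff by blast+
   thus ?thesis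
    by (subst gagliardo_eq, measurable, subst difference_map_lincomb, intro nn_powr_lincomb_finite[OF p]) (auto simp: gagliardo_eq)
  qed
  show "gradient_energy p (%x. a * u x + b * v x) < \<infinity>" if \<gamma>: "\<gamma> ~= 0"
   unfolding gradient_energy_eq[OF X_gradient_lincomb[OF u v \<gamma>]]
   using X_gradient_finite[OF u \<gamma>] X_gradient_finite[OF v \<gamma>] X_gradient_measurable[OF u \<gamma>] X_gradient_measurable[OF v \<gamma>]
   by (intro nn_powr_lincomb_finite[OF p]) auto
 qed measurable
qed

lemma X_scale: "u : X ==> (%x. c * u x) : X"
 using X_lincomb[of u u c 0] by simp

lemma A_scale:
 assumes u: "u : X"
 shows "A (%x. c * u x) = ennreal (\<bar>c\<bar> powr p) * A u"
proof -
 have [measurable]: "u : Borel" using u by (rule X_measurable)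
 have W: "weighted_energy p \<beta> (%x. c * u x) = ennreal (\<bar>c\<bar> powr p) * weighted_energy p \<beta> u"
  unfolding weighted_eq using nn_powr_scale[of "Tw u" lborel c p] weighted_map_lincomb[of "\<beta> / p" c u 0 u] by simp
 have "gagliardo_energy s p (%x. c * u x) = ennreal (\<bar>c\<bar> powr p) * gagliardo_energy s p u"
  using nn_powr_scale[of "Td u" "lborel \<Otimes>\<^sub>M lborel" c p] difference_map_lincomb[of "(real DIM('a) + s * p) / p" c u 0 u]
  by (simp add: gagliardo_eq)
 moreover have "ennreal \<gamma> * gradient_energy p (%x. c * u x) = ennreal (\<bar>c\<bar> powr p) * (ennreal \<gamma> * gradient_energy p u)"
 proof (cases "\<gamma> = 0")
  case False
  have wg: "has_weak_gradient (%x. c * u x) (%x. c *R weak_gradient u x)"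
   using X_gradient_lincomb[OF u u False, of c 0] by simp
  note [measurable] = X_gradient_measurable[OF u False]
  show ?thesis unfolding gradient_energy_eq[OF wg] gradient_energy_eq[OF X_gradient[OF u False]]
   using nn_powr_scale[of "weak_gradient u" lborel c p] by (simp add: mult.left_commute)
 qed simp
 ultimately show ?thesis unfolding A_def W by (simp add: distrib_left mult.left_commute)
qed

lemma B_scale:
 assumes [measurable]: "u : Borel"
 shows "B (%x. c * u x) = ennreal (\<bar>c\<bar> powr q) * B u"
 unfolding B_eq using nn_powr_scale[of "Tq u" lborel c q] weighted_map_lincomb[of "\<alpha> / q" c u 0 u] by simp

lemma X_abs:
 assumes u: "u : X"
 shows "(%x. \<bar>u x\<bar>) : X" "A (%x. \<bar>u x\<bar>) <= A u" "B (%x. \<bar>u x\<bar>) = B u"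
proof -
 have [measurable]: "u : Borel" using u by (rule X_measurable)
 have W: "weighted_energy p \<beta> (%x. \<bar>u x\<bar>) = weighted_energy p \<beta> u" by (simp add: weighted_energy_def)
 have Ga: "gagliardo_energy s p (%x. \<bar>u x\<bar>) <= gagliardo_energy s p u"
  unfolding gagliardo_energy_eq using p
  by (intro nn_integral_mono ennreal_leI mult_right_mono powr_mono2) auto
 have Gr: "gradient_energy p (%x. \<bar>u x\<bar>) <= gradient_energy p u" if \<gamma>: "\<gamma> ~= 0"
  unfolding gradient_energy_eq[OF weak_gradient_abs[OF X_gradient[OF u \<gamma>]]] gradient_energy_eq[OF X_gradient[OF u \<gamma>]]
  using p by (intro nn_integral_mono ennreal_leI powr_mono2) (auto simp: abs_sgn_eq)
 have "radial (%x. \<bar>u x\<bar>)"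
 proof -
  obtain g where "AE x in lborel. u x = g (norm x)" using u by (auto simp: X_iff radial_def)
  hence "AE x in lborel. \<bar>u x\<bar> = (%t. \<bar>g t\<bar>) (norm x)" by eventually_elim simp
  thus ?thesis unfolding radial_def by (intro exI[of _ "%t. \<bar>g t\<bar>"])
 qed
 thus "(%x. \<bar>u x\<bar>) : X" using u W Ga Gr unfolding X_iff by (auto intro: le_less_trans)
 have "ennreal \<gamma> * gradient_energy p (%x. \<bar>u x\<bar>) <= ennreal \<gamma> * gradient_energy p u"
  using Gr by (cases "\<gamma> = 0") (auto intro: mult_left_mono)
 thus "A (%x. \<bar>u x\<bar>) <= A u" unfolding A_def W using Ga by (intro add_mono mult_left_mono[of _ _ "ennreal (1 - \<gamma>)"]) auto
 show "B (%x. \<bar>u x\<bar>) = B u" by (simp add: B_def)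
qed

text \<open>The gap in the convexity of \<open>A\<close> is kept for the gradient term only: it forces the gradients of a
 minimising sequence to converge.\<close>

lemma A_midpoint:
 assumes u: "u : X" and v: "v : X"
 shows "2 * (A (%x. (1/2) * u x + (1/2) * v x) + ennreal \<gamma> * (\<integral>x. ennreal (convexity_gap p (weak_gradient u x) (weak_gradient v x)))) <= A u + A v"
proof -
 define w where "w x = (1/2) * u x + (1/2) * v x" for x
 define g where "g = (\<integral>x. ennreal (convexity_gap p (weak_gradient u x) (weak_gradient v x)))"
 have [measurable]: "u : Borel" "v : Borel" using u v by (auto intro: X_measurable)
 have [measurable]: "w : Borel" unfolding w_def by measurable
 have le: "2 * a <= b" if "2 * (a + c) = b" for a b c :: ennreal
  using that by (metis add_increasing2 distrib_left order_refl zero_le)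
 have W: "2 * weighted_energy p \<beta> w <= weighted_energy p \<beta> u + weighted_energy p \<beta> v"
  unfolding weighted_eq w_def weighted_map_lincomb by (rule le[OF nn_powr_midpoint[OF p]]) measurable
 have Ga: "2 * gagliardo_energy s p w <= gagliardo_energy s p u + gagliardo_energy s p v"
 proof -
  have weq: "w = (%x. (1/2) * u x + (1/2) * v x)" by (rule ext) (rule w_def)
  have e: "gagliardo_energy s p f = (\<integral>\<^sup>+z. ennreal (norm (Td f z) powr p) \<partial>lborel2)"
   if "f : Borel" for f using that by (rule gagliardo_eq)
  show ?thesis
   unfolding e[OF \<open>w : Borel\<close>] e[OF \<open>u : Borel\<close>] e[OF \<open>v : Borel\<close>]
   unfolding weq difference_map_lincomb by (rule le[OF nn_powr_midpoint[OF p]]) measurable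
 qed
 have Gr: "2 * (ennreal \<gamma> * gradient_energy p w + ennreal \<gamma> * g) = ennreal \<gamma> * gradient_energy p u + ennreal \<gamma> * gradient_energy p v"
 proof (cases "\<gamma> = 0")
  case False
  note [measurable] = X_gradient_measurable[OF u False] X_gradient_measurable[OF v False]
  have "2 * (gradient_energy p w + g) = gradient_energy p u + gradient_energy p v"
   unfolding w_def gradient_energy_eq[OF X_gradient_lincomb[OF u v False]] g_def
    gradient_energy_eq[OF X_gradient[OF u False]] gradient_energy_eq[OF X_gradient[OF v False]]
   by (rule nn_powr_midpoint[OF p]) measurable
  hence "ennreal \<gamma> * (2 * (gradient_energy p w + g)) = ennreal \<gamma> * (gradient_energy p u + gradient_energy p v)" by simp
  thus ?thesis by (simp add: distrib_left mult.left_commute)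
 qed simp
 have "2 * (A w + ennreal \<gamma> * g) = 2 * (ennreal \<gamma> * gradient_energy p w + ennreal \<gamma> * g) + ennreal (1 - \<gamma>) * (2 * gagliardo_energy s p w) + 2 * weighted_energy p \<beta> w"
  unfolding A_def by (simp add: distrib_left mult.left_commute add_ac)
 also have "... <= (ennreal \<gamma> * gradient_energy p u + ennreal \<gamma> * gradient_energy p v) + ennreal (1 - \<gamma>) * (gagliardo_energy s p u + gagliardo_energy s p v) + (weighted_energy p \<beta> u + weighted_energy p \<beta> v)"
  unfolding Gr using W Ga by (intro add_mono mult_left_mono) auto
 also have "... = A u + A v" unfolding A_def by (simp add: distrib_left add_ac)
 finally show ?thesis unfolding w_def[abs_def] g_def .
qed

text \<open>The second condition makes \<open>decay k\<close> integrable against \<open>1\<close> and \<open>\<bar>x\<bar>\<^sup>\<beta>\<close>, as the positivity argument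
 requires.\<close>

lemma decay_in_X: "\<exists>k>0. \<beta> + real DIM('a) < 2 * k & decay k : X"
proof -
 define k where "k = \<beta> + real DIM('a)"
 have k: "0 < k" using \<beta> by (simp add: k_def)
 have kp: "\<beta> + real DIM('a) < 2 * k * p" "0 + real DIM('a) < 2 * k * p"
 proof -
  have "k * 1 < k * (2 * p)" using k p by (intro mult_strict_left_mono) auto
  thus "\<beta> + real DIM('a) < 2 * k * p" "0 + real DIM('a) < 2 * k * p" using \<beta> by (simp_all add: k_def mult_ac)
 qed
 have Lp: "(\<integral>x::'a. ennreal (\<bar>decay k x\<bar> powr p)) < \<infinity>"
 proof -
  have "(\<integral>x::'a. ennreal (\<bar>decay k x\<bar> powr p)) = (\<integral>x::'a. ennreal (norm x powr 0 * decay k x powr p))"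
  proof (rule nn_integral_cong_AE)
   have "AE x::'a in lborel. x ~= 0" by (rule AE_lborel_singleton)
   thus "AE x::'a in lborel. ennreal (\<bar>decay k x\<bar> powr p) = ennreal (norm x powr 0 * decay k x powr p)"
    by eventually_elim (simp add: abs_of_pos decay_pos)
  qed
  thus ?thesis using decay_moment[of 0 p k, where 'a='a] k kp p by simp
 qed
 have wg: "has_weak_gradient (decay k) (grad_decay k :: 'a => 'a)" by (rule weak_gradient_decay[OF k])
 have Gr: "(\<integral>x::'a. ennreal (norm (grad_decay k x) powr p)) < \<infinity>"
 proof -
  have "(\<integral>x::'a. ennreal (norm (grad_decay k x) powr p)) <= (\<integral>x::'a. ennreal (k powr p) * ennreal (\<bar>decay k x\<bar> powr p))"
  proof (rule nn_integral_mono)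
   fix x :: 'a
   have "norm (grad_decay k x) powr p <= (k * decay k x) powr p" using norm_grad_decay_le[of k x] k p by (intro powr_mono2) auto
   thus "ennreal (norm (grad_decay k x) powr p) <= ennreal (k powr p) * ennreal (\<bar>decay k x\<bar> powr p)"
    using k decay_pos[of k x] by (simp add: powr_mult ennreal_mult[symmetric] ennreal_leI)
  qed
  also have "... = ennreal (k powr p) * (\<integral>x::'a. ennreal (\<bar>decay k x\<bar> powr p))"
   by (rule nn_integral_cmult) measurable
  also have "... < \<infinity>" using Lp by (simp add: ennreal_mult_less_top)
  finally show ?thesis .
 qed
 have "(decay k :: 'a => real) : X"
  unfolding X_iff
 proof (intro conjI impI)
  show "weighted_energy p \<beta> (decay k :: 'a => real) < \<infinity>"
   unfolding weighted_energy_def using decay_moment[of \<beta> p k, where 'a='a] k kp p \<beta> by (simp add: abs_of_pos[OF decay_pos])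
  show "radial (decay k :: 'a => real)" unfolding radial_def decay_def by (intro exI[of _ "%t. (1 + t\<^sup>2) powr (- k)"]) simp
  show "gagliardo_energy s p (decay k :: 'a => real) < \<infinity>" if "\<gamma> = 0"
   using gagliardo_energy_finite[OF p _ _ wg Gr Lp, of s] s_nonlocal that by simp
  show "gradient_energy p (decay k :: 'a => real) < \<infinity>" using gradient_energy_eq[OF wg] Gr by simp
 qed measurable
 moreover have "\<beta> + real DIM('a) < 2 * k" using k by (simp add: k_def)
 ultimately show ?thesis using k by blast
qed

end

lemma liminf_add_ennreal: "liminf f + liminf g <= liminf (%n. f n + g n :: ennreal)"
proof -
 have "liminf f + liminf g = (SUP n. (INF m\<in>{n..}. f m) + (INF m\<in>{n..}. g m))"
  unfolding liminf_SUP_INF by (intro ennreal_SUP_add[symmetric] incseq_SucI INF_superset_mono) auto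
 also have "... <= liminf (%n. f n + g n)"
  unfolding liminf_SUP_INF by (intro SUP_mono' INF_greatest add_mono INF_lower) auto
 finally show ?thesis .
qed

lemma liminf_cmult_ennreal: "c * liminf f <= liminf (%n. c * f n :: ennreal)"
proof -
 have "c * liminf f = (SUP n. c * (INF m\<in>{n..}. f m))"
  unfolding liminf_SUP_INF by (rule SUP_mult_left_ennreal)
 also have "... <= liminf (%n. c * f n)"
  unfolding liminf_SUP_INF by (intro SUP_mono' INF_greatest mult_left_mono INF_lower) auto
 finally show ?thesis .
qed

context radial_problem
begin

lemma B_eq_0_imp:
 assumes [measurable]: "u : Borel" and "B u = 0"
 shows "AE x in lborel. u x = 0"
proof -
 have "AE x in lborel. ennreal (norm x powr \<alpha> * \<bar>u x\<bar> powr q) = 0"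
  using assms(2) unfolding B_def by (subst (asm) nn_integral_0_iff_AE) auto
 moreover have "AE x::'a in lborel. x ~= 0" by (rule AE_lborel_singleton)
 ultimately show ?thesis
 proof eventually_elim
  case (elim x)
  hence "norm x powr \<alpha> * \<bar>u x\<bar> powr q <= 0" by (simp add: ennreal_eq_0_iff)
  moreover have "0 < norm x powr \<alpha>" using elim by simp
  ultimately have "~ 0 < \<bar>u x\<bar> powr q" by (meson mult_pos_pos not_le)
  thus ?case by simp
 qed
qed

text \<open>Rescale \<open>z\<close> to satisfy the constraint; \<open>A\<close> is homogeneous of degree \<open>p\<close> and \<open>B\<close> of degree \<open>q\<close>.\<close>

lemma A_lower:
 assumes min: "\<forall>v\<in>X. B v = 1 --> ennreal m <= A v" and z: "z : X" and m: "0 <= m"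
 shows "ennreal (m * enn2real (B z) powr (p / q)) <= A z"
proof (cases "B z = 0")
 case False
 define b where "b = enn2real (B z)"
 have Bz: "B z = ennreal b" using B_finite[OF z] by (simp add: b_def)
 have b: "0 < b"
 proof (rule ccontr)
  assume "~ 0 < b"
  hence "ennreal b = 0" by (simp add: ennreal_neg)
  thus False using False unfolding Bz by blast
 qed
 define c where "c = b powr (- 1 / q)"
 have c: "0 < c" using b by (simp add: c_def)
 have q0: "0 < q" using p q by simp
 have "c powr q = 1 / b" unfolding c_def powr_powr using b q0 by (simp add: powr_minus_divide)
 hence "B (%x. c * z x) = ennreal (1 / b) * ennreal b"
  using B_scale[OF X_measurable[OF z], of c] c Bz by simp
 also have "... = 1" using b by (simp add: ennreal_mult[symmetric])
 finally have "ennreal m <= A (%x. c * z x)" using min X_scale[OF z, of c] by blast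
 hence "ennreal m <= ennreal (c powr p) * A z" using A_scale[OF z, of c] c by simp
 hence "ennreal (b powr (p / q)) * ennreal m <= ennreal (b powr (p / q)) * (ennreal (c powr p) * A z)" by (rule mult_left_mono) simp
 also have "... = ennreal (b powr (p / q) * c powr p) * A z" by (simp add: ennreal_mult mult.assoc)
 also have "b powr (p / q) * c powr p = 1" unfolding c_def powr_powr using b by (simp add: powr_add[symmetric])
 finally have "ennreal (b powr (p / q)) * ennreal m <= A z" by simp
 thus ?thesis using m unfolding b_def by (simp add: ennreal_mult[symmetric] mult.commute)
qed simp

text \<open>Otherwise there are midpoints of members arbitrarily far out whose gradients stay \<open>e\<close> apart.  The
 midpoints still converge to \<open>v\<close>, so \<open>B\<close> tends to \<open>1\<close> on them and \<open>A\<close> cannot fall below \<open>m\<close> in the limit.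
 Hence the convexity gap tends to zero, and with it the distance of the gradients.\<close>

lemma minimizing_gradients_Cauchy:
 assumes \<gamma>0: "\<gamma> ~= 0" and m: "0 <= m" and min: "\<forall>v\<in>X. B v = 1 --> ennreal m <= A v"
  and w: "!!n. w n : X" and Aw: "!!n. A (w n) <= ennreal (m + 1 / real (Suc n))"
  and v: "v : Borel" "AE x in lborel. (%n. w n x) ----> v x" "B v = 1" and e: "0 < e"
 shows "\<exists>N. \<forall>n\<ge>N. \<forall>k\<ge>N. (\<integral>x. ennreal (norm (weak_gradient (w n) x - weak_gradient (w k) x) powr p)) <= ennreal e"
proof (rule ccontr)
 assume "~ ?thesis"
 hence "\<forall>N. \<exists>n k. N <= n & N <= k & ~ (\<integral>x. ennreal (norm (weak_gradient (w n) x - weak_gradient (w k) x) powr p)) <= ennreal e" by meson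
 then obtain f g where fN: "!!N. N <= f N" and gN: "!!N. N <= g N"
  and big: "!!N. ~ (\<integral>x. ennreal (norm (weak_gradient (w (f N)) x - weak_gradient (w (g N)) x) powr p)) <= ennreal e" by metis
 note [measurable] = X_gradient_measurable[OF w \<gamma>0]
 have \<gamma>p: "0 < \<gamma>" using \<gamma> \<gamma>0 by simp
 define z where "z N = (%x. (1/2) * w (f N) x + (1/2) * w (g N) x)" for N
 define gap where "gap N = (\<integral>x. ennreal (convexity_gap p (weak_gradient (w (f N)) x) (weak_gradient (w (g N)) x)))" for N
 have z: "z N : X" for N unfolding z_def by (rule X_lincomb[OF w w])
 have mono: "A (w n) <= ennreal (m + 1 / real (Suc N))" if "N <= n" for n N
 proof -
  have "1 / real (Suc n) <= 1 / real (Suc N)" using that by (intro divide_left_mono) auto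
  thus ?thesis by (intro order_trans[OF Aw] ennreal_leI) simp
 qed
 have Az: "A (z N) + ennreal \<gamma> * gap N <= ennreal (m + 1 / real (Suc N))" for N
 proof -
  have "2 * (A (z N) + ennreal \<gamma> * gap N) <= A (w (f N)) + A (w (g N))"
   unfolding z_def gap_def by (rule A_midpoint[OF w w])
  also have "... <= ennreal (m + 1 / real (Suc N)) + ennreal (m + 1 / real (Suc N))" by (intro add_mono mono fN gN)
  also have "... = 2 * ennreal (m + 1 / real (Suc N))" by (rule mult_2[symmetric])
  finally show ?thesis by (subst (asm) ennreal_mult_le_mult_iff) auto
 qed
 define M where "M = (m + 1) powr (1 / p)"
 have M: "0 <= M" "M powr p = m + 1" using p m by (simp_all add: M_def powr_powr)
 have A0z: "A0 (z N) <= ennreal (M powr p)" for N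
 proof -
  have "A0 (z N) <= A (z N) + ennreal \<gamma> * gap N" by (intro order_trans[OF A0_le_A]) simp
  also have "... <= ennreal (m + 1 / real (Suc N))" by (rule Az)
  also have "... <= ennreal (M powr p)" unfolding M by (intro ennreal_leI) simp
  finally show ?thesis .
 qed
 have zlim: "AE x in lborel. (%N. z N x) ----> v x"
  using v(2)
 proof eventually_elim
  case (elim x)
  have F: "filterlim f at_top sequentially" by (rule filterlim_at_top_mono[OF filterlim_ident]) (simp add: fN)
  have G: "filterlim g at_top sequentially" by (rule filterlim_at_top_mono[OF filterlim_ident]) (simp add: gN)
  have "(%N. (1/2) * w (f N) x + (1/2) * w (g N) x) ----> (1/2) * v x + (1/2) * v x"
   by (intro tendsto_intros filterlim_compose[OF elim F] filterlim_compose[OF elim G])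
  thus ?case by (simp add: z_def)
 qed
 have "(%N. B (z N)) ----> 1" using B_tendsto(2)[OF z A0z M(1) v(1) zlim] v(3) by simp
 hence "(%N. enn2real (B (z N))) ----> enn2real 1" by (intro tendsto_enn2real) auto
 hence "(%N. (m + 1 / real (Suc N) - m * enn2real (B (z N)) powr (p / q)) / \<gamma>) ----> (m + 0 - m * 1 powr (p / q)) / \<gamma>"
  by (intro tendsto_divide tendsto_diff tendsto_add tendsto_mult tendsto_powr tendsto_const LIMSEQ_Suc[OF lim_1_over_n]) (use \<gamma>0 in auto)
 hence small: "(%N. (m + 1 / real (Suc N) - m * enn2real (B (z N)) powr (p / q)) / \<gamma>) ----> 0" by simp
 \<comment> \<open>Half of \<open>e\<close> is spent on the bounded energies, the other half on the gap.\<close>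
 define e' where "e' = e * \<gamma> / (4 * (m + 1))"
 have e': "0 < e'" using e \<gamma>p m by (simp add: e'_def)
 obtain c where c: "0 < c" "!!a b :: 'a. norm (a - b) powr p <= e' * (norm a powr p + norm b powr p) + c * convexity_gap p a b"
  using norm_diff_powr_le_gap[OF p e'] by blast
 have "\<forall>\<^sub>F N in sequentially. (m + 1 / real (Suc N) - m * enn2real (B (z N)) powr (p / q)) / \<gamma> < e / (2 * c)"
  by (rule order_tendstoD(2)[OF small]) (use e c in simp)
 then obtain N where N: "(m + 1 / real (Suc N) - m * enn2real (B (z N)) powr (p / q)) / \<gamma> < e / (2 * c)"
  unfolding eventually_sequentially by blast
 have gapN: "gap N <= ennreal (e / (2 * c))"
 proof -
  have *: "ennreal (m * enn2real (B (z N)) powr (p / q)) + ennreal \<gamma> * gap N <= ennreal (m + 1 / real (Suc N))"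
   using A_lower[OF min z m, of N] Az[of N] by (meson add_right_mono order_trans)
  have "ennreal \<gamma> * gap N <= A (z N) + ennreal \<gamma> * gap N" by simp
  hence "ennreal \<gamma> * gap N <= ennreal (m + 1 / real (Suc N))" using Az[of N] by (rule order_trans)
  hence "ennreal \<gamma> * gap N < top" using ennreal_less_top le_less_trans by blast
  hence "gap N < top" using \<gamma>p by (auto simp: ennreal_mult_less_top)
  then obtain h where h: "gap N = ennreal h" "0 <= h" by (cases "gap N") auto
  have "m * enn2real (B (z N)) powr (p / q) + \<gamma> * h <= m + 1 / real (Suc N)"
   using * m \<gamma>p h by (simp add: ennreal_mult[symmetric] ennreal_plus[symmetric] del: ennreal_plus)
  hence "h <= (m + 1 / real (Suc N) - m * enn2real (B (z N)) powr (p / q)) / \<gamma>"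
   using \<gamma>p by (simp add: pos_le_divide_eq mult.commute)
  thus ?thesis using N h by (simp add: ennreal_leI)
 qed
 have Gr: "(Lp p (weak_gradient (w n))) <= ennreal ((m + 1) / \<gamma>)" for n
 proof -
  have "ennreal \<gamma> * gradient_energy p (w n) <= A (w n)" unfolding A_def by (simp add: add.assoc)
  also have "... <= ennreal (m + 1)" using m by (intro order_trans[OF Aw] ennreal_leI) simp
  also have "... = ennreal \<gamma> * ennreal ((m + 1) / \<gamma>)" using \<gamma>p m by (simp add: ennreal_mult[symmetric])
  finally have "gradient_energy p (w n) <= ennreal ((m + 1) / \<gamma>)" using \<gamma>p by (subst (asm) ennreal_mult_le_mult_iff) auto
  thus ?thesis unfolding gradient_energy_eq[OF X_gradient[OF w \<gamma>0]] .
 qed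
 have [measurable]: "(%x. convexity_gap p (weak_gradient (w (f N)) x) (weak_gradient (w (g N)) x)) : Borel"
  unfolding convexity_gap_def by measurable
 have "(\<integral>x. ennreal (norm (weak_gradient (w (f N)) x - weak_gradient (w (g N)) x) powr p))
  <= (\<integral>x. ennreal e' * (ennreal (norm (weak_gradient (w (f N)) x) powr p) + ennreal (norm (weak_gradient (w (g N)) x) powr p))
    + ennreal c * ennreal (convexity_gap p (weak_gradient (w (f N)) x) (weak_gradient (w (g N)) x)))"
 proof (rule nn_integral_mono)
  fix x :: 'a
  let ?a = "weak_gradient (w (f N)) x" and ?b = "weak_gradient (w (g N)) x"
  have "ennreal (norm (?a - ?b) powr p) <= ennreal (e' * (norm ?a powr p + norm ?b powr p) + c * convexity_gap p ?a ?b)"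
   by (rule ennreal_leI[OF c(2)])
  also have "... = ennreal (e' * (norm ?a powr p + norm ?b powr p)) + ennreal (c * convexity_gap p ?a ?b)"
   using e' c convexity_gap_nonneg[OF p, of ?a ?b] by (intro ennreal_plus) auto
  also have "... = ennreal e' * (ennreal (norm ?a powr p) + ennreal (norm ?b powr p)) + ennreal c * ennreal (convexity_gap p ?a ?b)"
   using e' c convexity_gap_nonneg[OF p, of ?a ?b] by (subst (1 2) ennreal_mult) auto
  finally show "ennreal (norm (?a - ?b) powr p) <= ennreal e' * (ennreal (norm ?a powr p) + ennreal (norm ?b powr p)) + ennreal c * ennreal (convexity_gap p ?a ?b)" .
 qed
 also have "... = ennreal e' * ((\<integral>x. ennreal (norm (weak_gradient (w (f N)) x) powr p)) + (\<integral>x. ennreal (norm (weak_gradient (w (g N)) x) powr p))) + ennreal c * gap N"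
  unfolding gap_def by (subst nn_integral_add, simp, simp, subst (1 2) nn_integral_cmult, simp, simp, subst nn_integral_add) auto
 also have "... <= ennreal e' * (ennreal ((m + 1) / \<gamma>) + ennreal ((m + 1) / \<gamma>)) + ennreal c * ennreal (e / (2 * c))"
  by (intro add_mono mult_left_mono Gr gapN) auto
 also have "... = ennreal (e' * ((m + 1) / \<gamma> + (m + 1) / \<gamma>) + c * (e / (2 * c)))"
  using e' c e \<gamma>p m by (subst ennreal_plus, simp, simp, subst (1 2) ennreal_mult, simp, simp, simp, simp, subst ennreal_plus) auto
 also have "e' * ((m + 1) / \<gamma> + (m + 1) / \<gamma>) + c * (e / (2 * c)) = e"
 proof -
  have "m + 1 ~= 0" using m by linarith
  hence 1: "e' * ((m + 1) / \<gamma>) = e / 4" unfolding e'_def using \<gamma>0 by (simp add: divide_simps)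
  have 2: "c * (e / (2 * c)) = e / 2" using c by simp
  show ?thesis unfolding distrib_left 1 2 by simp
 qed
 finally show False using big[of N] by simp
qed

text \<open>The direct method: the functions converge almost everywhere by
 compactness, the gradients by uniform convexity, and Fatou's lemma bounds every part of \<open>A\<close>.\<close>

lemma minimizer_exists: "\<exists>w\<in>X. B w = 1 & (\<forall>v\<in>X. B v = 1 --> A w <= A v)"
proof -
 obtain k where k: "0 < k" "(decay k :: 'a => real) : X" using decay_in_X by blast
 have Bd0: "B (decay k) ~= 0"
 proof
  assume "B (decay k) = 0"
  hence "AE x::'a in lborel. decay k x = 0" by (intro B_eq_0_imp) auto
  hence "AE x::'a in lborel. False" by eventually_elim (use decay_pos in \<open>metis less_irrefl\<close>)
  thus False by (simp add: eventually_False ae_filter_eq_bot_iff)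
 qed
 define b where "b = enn2real (B (decay k))"
 have Bd: "B (decay k) = ennreal b" using B_finite[OF k(2)] by (simp add: b_def)
 have b: "0 < b"
 proof (rule ccontr)
  assume "~ 0 < b"
  hence "ennreal b = 0" by (simp add: ennreal_neg)
  thus False using Bd0 unfolding Bd by blast
 qed
 have q0: "0 < q" using p q by simp
 have "(b powr (- 1 / q)) powr q = 1 / b" unfolding powr_powr using b q0 by (simp add: powr_minus_divide)
 hence "B (%x. b powr (- 1 / q) * decay k x) = ennreal (1 / b) * ennreal b"
  using B_scale[OF X_measurable[OF k(2)], of "b powr (- 1 / q)"] b Bd by simp
 also have "... = 1" using b by (simp add: ennreal_mult[symmetric])
 finally have ex: "\<exists>v\<in>X. B v = 1" using X_scale[OF k(2)] by blast
 define V where "V = (%v. enn2real (A v)) ` {v\<in>X. B v = 1}"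
 define m where "m = Inf V"
 have V0: "V ~= {}" "bdd_below V" "!!t. t : V ==> 0 <= t" using ex by (auto simp: V_def intro!: bdd_belowI[of _ 0])
 have m: "0 <= m" unfolding m_def using V0 by (intro cInf_greatest) auto
 have Areal: "A v = ennreal (enn2real (A v))" if "v : X" for v using A_finite[OF that] by simp
 have min: "\<forall>v\<in>X. B v = 1 --> ennreal m <= A v"
 proof (intro ballI impI)
  fix v assume v: "v : X" "B v = 1"
  have "m <= enn2real (A v)" unfolding m_def by (rule cInf_lower[OF _ V0(2)]) (use v in \<open>auto simp: V_def\<close>)
  thus "ennreal m <= A v" by (subst Areal[OF v(1)]) (rule ennreal_leI)
 qed
 have "\<exists>v. v : X & B v = 1 & A v <= ennreal (m + 1 / real (Suc n))" for n
 proof -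
  obtain t where "t : V" "t < m + 1 / real (Suc n)" using cInf_lessD[OF V0(1), of "m + 1 / real (Suc n)"] by (auto simp: m_def)
  then obtain v where v: "v : X" "B v = 1" "enn2real (A v) < m + 1 / real (Suc n)" by (auto simp: V_def)
  hence "A v <= ennreal (m + 1 / real (Suc n))" by (subst Areal[OF v(1)]) (intro ennreal_leI less_imp_le)
  thus ?thesis using v by blast
 qed
 then obtain u where u: "!!n. u n : X" "!!n. B (u n) = 1" "!!n. A (u n) <= ennreal (m + 1 / real (Suc n))" by metis
 define M where "M = (m + 1) powr (1 / p)"
 have M: "0 <= M" "M powr p = m + 1" using p m by (simp_all add: M_def powr_powr)
 have A0u: "A0 (u n) <= ennreal (M powr p)" for n
  using A0_le_A[of "u n"] u(3)[of n] M m
  by (auto intro!: order_trans[OF A0_le_A] order_trans[OF u(3)] ennreal_leI)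
 obtain r :: "nat => nat" and w where r: "strict_mono r" and wm [measurable]: "w : Borel" and wr: "radial w"
  and wlim: "AE x in lborel. (%n. u (r n) x) ----> w x"
  using X_compact[of u, OF u(1) A0u M(1)] by blast
 have Bw: "B w = 1"
  using B_tendsto(2)[of "%n. u (r n)", OF u(1) A0u M(1) wm wlim] LIMSEQ_unique[OF _ tendsto_const] by (simp add: u(2))
 have rge: "n <= r n" for n using r by (rule strict_mono_imp_increasing)
 have Aur: "A (u (r n)) <= ennreal (m + 1 / real (Suc n))" for n
 proof -
  have "1 / real (Suc (r n)) <= 1 / real (Suc n)" using rge[of n] by (intro divide_left_mono) auto
  thus ?thesis by (intro order_trans[OF u(3)] ennreal_leI) simp
 qed
 have Wu [measurable]: "u n : Borel" for n using u(1) by (rule X_measurable)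
 \<comment> \<open>For a local part, a further subsequence makes the gradients converge; then they converge to
  the gradient of the limit.\<close>
 have "\<exists>r' :: nat => nat. strict_mono r' & ennreal \<gamma> * gradient_energy p w <= liminf (%n. ennreal \<gamma> * gradient_energy p (u (r (r' n))))"
 proof (cases "\<gamma> = 0")
  case True
  thus ?thesis by (intro exI[of _ id]) (simp add: strict_mono_id)
 next
  case False
  note Gm [measurable] = X_gradient_measurable[OF u(1) False]
  obtain r' G where r': "strict_mono r'" and [measurable]: "G : Borel"
   and Glim: "AE x in lborel. (%k. weak_gradient (u (r (r' k))) x) ----> G x"
   and GLp: "!!e. 0 < e ==> \<exists>N. \<forall>n\<ge>N. (\<integral>x. ennreal (norm (weak_gradient (u (r (r' n))) x - G x) powr p)) <= ennreal e"
   using Lp_Cauchy_subsequence[of p "%n. weak_gradient (u (r n))", OF p Gm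
    minimizing_gradients_Cauchy[of m "%n. u (r n)", OF False m min u(1) Aur wm wlim Bw]] by auto
  have F: "(Lp p G) <= liminf (%n. gradient_energy p (u (r (r' n))))"
   unfolding gradient_energy_eq[OF X_gradient[OF u(1) False]] by (rule nn_powr_liminf[OF _ _ Glim]) (use p in auto)
  hence F': "ennreal \<gamma> * (Lp p G) <= liminf (%n. ennreal \<gamma> * gradient_energy p (u (r (r' n))))"
   by (intro order_trans[OF mult_left_mono liminf_cmult_ennreal]) auto
  obtain n0 where n0: "(\<integral>x. ennreal (norm (weak_gradient (u (r (r' n0))) x - G x) powr p)) <= ennreal 1"
   using GLp[of 1] by auto
  have "(\<integral>x. ennreal (norm (1 *R weak_gradient (u (r (r' n0))) x + (-1) *R (weak_gradient (u (r (r' n0))) x - G x)) powr p)) < \<infinity>"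
   by (rule nn_powr_lincomb_finite[OF p]) (use n0 X_gradient_finite[OF u(1) False] in \<open>auto intro: le_less_trans\<close>)
  hence Gfin: "(Lp p G) < \<infinity>" by simp
  have Gloc: "locally_integrable G" by (rule loc_int_powr_norm[OF p _ Gfin]) simp
  obtain a where a: "0 < a"
   "!!u M. u : X ==> 0 <= M ==> A0 u <= ennreal (M powr p) ==> AE x in lborel. \<bar>u x\<bar> <= a * M * profile x"
   using pointwise_bound by blast
  have ub: "AE x in lborel. \<bar>u n x\<bar> <= a * M * profile x" for n by (rule a(2)[OF u(1) M(1) A0u])
  have "AE x in lborel. \<forall>n. \<bar>u n x\<bar> <= a * M * profile x" unfolding AE_all_countable using ub by blast
  hence wb: "AE x in lborel. \<bar>w x\<bar> <= a * M * profile x"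
   using wlim
  proof eventually_elim
   case (elim x)
   show ?case by (rule tendsto_upperbound[OF tendsto_rabs[OF elim(2)]]) (use elim(1) in auto)
  qed
  have loc: "locally_integrable (%x. c * profile x)" for c :: real
   using loc_int_scaleR[OF loc_int_profile, of c] by simp
  have wloc: "locally_integrable w"
  proof (rule loc_int_mono[OF loc[of "a * M"] wm])
   show "AE x in lborel. norm (w x) <= norm (a * M * profile x)"
    using wb by eventually_elim (metis abs_ge_self order_trans real_norm_def)
  qed
  have "L1loc_tendsto (%n. u (r (r' n))) w"
  proof (rule L1loc_tendsto_dominated[OF _ wm loc])
   show "AE x in lborel. norm (u (r (r' n)) x - w x) <= (2 * (a * M)) * profile x" for n
    using ub[of "r (r' n)"] wb by eventually_elim simp
   show "AE x in lborel. (%n. u (r (r' n)) x) ----> w x"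
    using wlim by eventually_elim (rule LIMSEQ_subseq_LIMSEQ[OF _ r', unfolded comp_def])
  qed simp
  moreover have "L1loc_tendsto (%n. weak_gradient (u (r (r' n)))) G" by (rule Lp_imp_L1loc_tendsto[OF p _ _ GLp]) auto
  ultimately have wg: "has_weak_gradient w G"
   by (intro weak_gradient_limit[OF X_gradient[OF u(1) False] wloc _ Gloc])
  show ?thesis using F' r' unfolding gradient_energy_eq[OF wg] by blast
 qed
 then obtain r' :: "nat => nat" where r': "strict_mono r'"
  and Gr: "ennreal \<gamma> * gradient_energy p w <= liminf (%n. ennreal \<gamma> * gradient_energy p (u (r (r' n))))" by blast
 have wlim': "AE x in lborel. (%n. u (r (r' n)) x) ----> w x"
  using wlim by eventually_elim (rule LIMSEQ_subseq_LIMSEQ[OF _ r', unfolded comp_def])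
 have We: "weighted_energy p \<beta> w <= liminf (%n. weighted_energy p \<beta> (u (r (r' n))))"
  unfolding weighted_eq
 proof (rule nn_powr_liminf)
  show "AE x in lborel. (%n. Tw (u (r (r' n))) x) ----> Tw w x"
   using wlim' unfolding weighted_map_def by eventually_elim (intro tendsto_intros)
 qed (use p in auto)
 have "gagliardo_energy s p w <= liminf (%n. gagliardo_energy s p (u (r (r' n))))"
  unfolding gagliardo_eq[OF wm] gagliardo_eq[OF Wu]
 proof (rule nn_powr_liminf)
  have "AE z in (lborel :: 'a measure) \<Otimes>\<^sub>M lborel. (%n. u (r (r' n)) (fst z)) ----> w (fst z) & (%n. u (r (r' n)) (snd z)) ----> w (snd z)"
  proof (rule lborel_pair.AE_pair_measure)
   show "AE x in lborel. AE y in lborel. (%n. u (r (r' n)) (fst (x, y))) ----> w (fst (x, y)) & (%n. u (r (r' n)) (snd (x, y))) ----> w (snd (x, y))"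
    using wlim'
   proof eventually_elim
    case (elim x)
    hence 1: "(%n. u (r (r' n)) x) ----> w x" .
    show ?case using wlim' by eventually_elim (use 1 in simp)
   qed
  qed measurable
  thus "AE z in lborel \<Otimes>\<^sub>M lborel. (%n. Td (u (r (r' n))) z) ----> Td w z"
   unfolding difference_map_def by eventually_elim (auto intro!: tendsto_intros)
 qed (use p in auto)
 hence Ga: "ennreal (1 - \<gamma>) * gagliardo_energy s p w <= liminf (%n. ennreal (1 - \<gamma>) * gagliardo_energy s p (u (r (r' n))))"
  by (intro order_trans[OF mult_left_mono liminf_cmult_ennreal]) auto
 have "A w <= liminf (%n. A (u (r (r' n))))"
  unfolding A_def by (intro order_trans[OF add_mono[OF order_trans[OF add_mono[OF Gr Ga] liminf_add_ennreal] We] liminf_add_ennreal])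
 also have "... <= liminf (%n. ennreal (m + 1 / real (Suc n)))"
 proof (rule Liminf_mono, rule always_eventually, rule allI)
  fix n
  have "n <= r' n" using r' by (rule strict_mono_imp_increasing)
  hence "1 / real (Suc (r' n)) <= 1 / real (Suc n)" by (intro divide_left_mono) auto
  thus "A (u (r (r' n))) <= ennreal (m + 1 / real (Suc n))" by (intro order_trans[OF Aur] ennreal_leI) simp
 qed
 also have "... = ennreal m"
 proof (rule lim_imp_Liminf)
  have "(%n. ennreal (m + 1 / real (Suc n))) ----> ennreal (m + 0)"
   by (intro tendsto_ennrealI tendsto_add tendsto_const LIMSEQ_Suc[OF lim_1_over_n])
  thus "(%n. ennreal (m + 1 / real (Suc n))) ----> ennreal m" by simp
 qed simp
 finally have Aw: "A w <= ennreal m" .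
 hence fin: "A w < top" using ennreal_less_top le_less_trans by blast
 have "w : X"
  unfolding X_iff
 proof (intro conjI impI wm wr)
  show "weighted_energy p \<beta> w < \<infinity>" using fin unfolding A_def by simp
  show "gagliardo_energy s p w < \<infinity>" if "\<gamma> = 0" using fin that unfolding A_def by simp
  show "gradient_energy p w < \<infinity>" if "\<gamma> ~= 0" using fin that \<gamma> unfolding A_def by (auto simp: ennreal_mult_less_top)
 qed
 thus ?thesis using Bw min Aw by (meson order_trans)
qed

end

section \<open>The Euler-Lagrange equation\<close>

lemma energy_derivative:
 fixes f g :: "'x => 'b::euclidean_space"
 assumes p: "1 < p" and [measurable]: "f : borel_measurable M" "g : borel_measurable M"
  and f: "(\<integral>\<^sup>+x. ennreal (norm (f x) powr p) \<partial>M) < \<infinity>"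
  and g: "(\<integral>\<^sup>+x. ennreal (norm (g x) powr p) \<partial>M) < \<infinity>"
 shows "((%t. enn2real (\<integral>\<^sup>+x. ennreal (norm (f x + t *R g x) powr p) \<partial>M)) has_real_derivative
      p * (\<integral>x. Phi p (f x) \<bullet> g x \<partial>M)) (at 0)"
proof -
 have "enn2real (\<integral>\<^sup>+x. ennreal (norm (f x + t *R g x) powr p) \<partial>M) = (\<integral>x. norm (f x + t *R g x) powr p \<partial>M)" for t
  by (rule integral_eq_nn_integral[symmetric]) auto
 thus ?thesis using has_derivative_integral_norm_powr[OF assms] by simp
qed

lemma Phi_mult:
 fixes a b k :: real
 assumes "1 < p" "0 <= k"
 shows "Phi p (k * a) * (k * b) = k powr p * (Phi p a * b)"
proof -
 have "Phi p (k * a) = k powr (p - 1) * Phi p a" using Phi_scaleR[OF assms(2), of p a] by simp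
 moreover have "k powr (p - 1) * k = k powr p" using assms by (cases "k = 0") (simp_all add: powr_diff)
 ultimately show ?thesis by (metis mult.assoc mult.left_commute)
qed

lemma Phi_weighted_map:
 assumes p: "1 < p"
 shows "Phi p (weighted_map (c / p) u x) * weighted_map (c / p) v x = norm x powr c * Phi p (u x) * v x"
proof -
 have "(norm x powr (c / p)) powr p = norm x powr c" unfolding powr_powr using p by simp
 thus ?thesis unfolding weighted_map_def using Phi_mult[OF p, of "norm x powr (c / p)" "u x" "v x"] by simp
qed

lemma Phi_difference_map:
 fixes u v :: "'a::euclidean_space => real"
 assumes p: "1 < p"
 shows "Phi p (difference_map ((real DIM('a) + s * p) / p) u z) * difference_map ((real DIM('a) + s * p) / p) v z = nonlocal_integrand s p u v z"
proof -
 obtain x y where z: "z = (x, y)" by (cases z)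
 let ?D = "real DIM('a) + s * p"
 have "(norm (x - y) powr (- (?D / p))) powr p = norm (x - y) powr (- ?D)" unfolding powr_powr using p by simp
 thus ?thesis
  using Phi_mult[OF p, of "norm (x - y) powr (- (?D / p))" "u x - u y" "v x - v y"]
  by (simp add: difference_map_def nonlocal_integrand_def z divide_powr_eq mult.commute)
qed

context radial_problem
begin

definition form :: "('a => real) => ('a => real) => real" where
 "form u v = operator_form \<gamma> s p u v + (LINT x|lborel. norm x powr \<beta> * Phi p (u x) * v x)"

lemma X_step: "u : X ==> v : X ==> (%x. u x + t * v x) : X"
 using X_lincomb[of u v 1 t] by simp

lemma Tw_finite: "u : X ==> (Lp p (Tw u)) < \<infinity>"
 using weighted_eq[of u] by (simp add: X_iff)

lemma Tq_finite: "u : X ==> (\<integral>x. ennreal (norm (Tq u x) powr q)) < \<infinity>"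
 using B_eq[of u] B_finite[of u] by simp

lemma Td_finite: "u : X ==> \<gamma> ~= 1 ==> (\<integral>\<^sup>+z. ennreal (norm (Td u z) powr p) \<partial>lborel2) < \<infinity>"
 using gagliardo_eq[of u] gagliardo_X[of u] \<gamma> X_measurable[of u] by simp

lemma solution_integrable:
 assumes u: "u : X" and v: "v : X"
 shows "\<gamma> ~= 0 ==> integrable lborel (local_integrand p u v)"
  "\<gamma> ~= 1 ==> integrable lborel2 (nonlocal_integrand s p u v)"
  "integrable lborel (%x. norm x powr \<beta> * Phi p (u x) * v x)"
  "integrable lborel (%x. norm x powr \<alpha> * Phi q (u x) * v x)"
proof -
 note [measurable] = X_measurable[OF u] X_measurable[OF v]
 have q1: "1 < q" using p q by simp
 show "integrable lborel (local_integrand p u v)" if "\<gamma> ~= 0"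
 proof -
  note [measurable] = X_gradient_measurable[OF u that] X_gradient_measurable[OF v that]
  show ?thesis unfolding local_integrand_def[abs_def]
   by (rule integrable_Phi_inner[OF p _ _ X_gradient_finite[OF u that] X_gradient_finite[OF v that]]) auto
 qed
 show "integrable lborel2 (nonlocal_integrand s p u v)" if "\<gamma> ~= 1"
  using integrable_Phi_inner[OF p _ _ Td_finite[OF u that] Td_finite[OF v that]]
  by (simp add: Phi_difference_map[OF p, where 'a='a])
 show "integrable lborel (%x. norm x powr \<beta> * Phi p (u x) * v x)"
  using integrable_Phi_inner[OF p _ _ Tw_finite[OF u] Tw_finite[OF v]]
  by (simp add: Phi_weighted_map[OF p])
 show "integrable lborel (%x. norm x powr \<alpha> * Phi q (u x) * v x)"
  using integrable_Phi_inner[OF q1 _ _ Tq_finite[OF u] Tq_finite[OF v]]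
  by (simp add: Phi_weighted_map[OF q1])
qed

lemma B_derivative:
 assumes u: "u : X" and v: "v : X"
 shows "((%t. enn2real (B (%x. u x + t * v x))) has_real_derivative
  q * (LINT x|lborel. norm x powr \<alpha> * Phi q (u x) * v x)) (at 0)"
proof -
 note [measurable] = X_measurable[OF u] X_measurable[OF v]
 have q1: "1 < q" using p q by simp
 have "Tq (%x. u x + t * v x) x = Tq u x + t *R Tq v x" for t x
  using weighted_map_lincomb[of "\<alpha> / q" 1 u t v x] by simp
 thus ?thesis
  unfolding B_eq using energy_derivative[OF q1 _ _ Tq_finite[OF u] Tq_finite[OF v]]
  by (simp add: Phi_weighted_map[OF q1])
qed

lemma A_derivative:
 assumes u: "u : X" and v: "v : X"
 shows "((%t. enn2real (A (%x. u x + t * v x))) has_real_derivative p * form u v) (at 0)"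
proof -
 note um [measurable] = X_measurable[OF u] X_measurable[OF v]
 let ?w = "%t x. u x + t * v x"
 have w: "?w t : X" for t by (rule X_step[OF u v])
 have D1: "((%t. \<gamma> * enn2real (gradient_energy p (?w t))) has_real_derivative p * (\<gamma> * (LINT x|lborel. local_integrand p u v x))) (at 0)"
 proof (cases "\<gamma> = 0")
  case False
  note [measurable] = X_gradient_measurable[OF u False] X_gradient_measurable[OF v False]
  have "has_weak_gradient (?w t) (%x. weak_gradient u x + t *R weak_gradient v x)" for t
   using X_gradient_lincomb[OF u v False, of 1 t] by simp
  hence eq: "gradient_energy p (?w t) = (\<integral>x. ennreal (norm (weak_gradient u x + t *R weak_gradient v x) powr p))" for t
   by (rule gradient_energy_eq)
  show ?thesis
   unfolding eq local_integrand_def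
   using DERIV_cmult[OF energy_derivative[OF p _ _ X_gradient_finite[OF u False] X_gradient_finite[OF v False]], of \<gamma>]
   by (simp add: mult.left_commute)
 qed simp
 have D2: "((%t. (1 - \<gamma>) * enn2real (gagliardo_energy s p (?w t))) has_real_derivative
   p * ((1 - \<gamma>) * (LINT z|lborel2. nonlocal_integrand s p u v z))) (at 0)"
 proof (cases "\<gamma> = 1")
  case False
  have "Td (?w t) z = Td u z + t *R Td v z" for t z
   using difference_map_lincomb[of "(real DIM('a) + s * p) / p" 1 u t v z] by simp
  hence eq: "gagliardo_energy s p (?w t) = (\<integral>\<^sup>+z. ennreal (norm (Td u z + t *R Td v z) powr p) \<partial>lborel2)" for t
   using gagliardo_eq[of "?w t"] by simp
  show ?thesis
   unfolding eq Phi_difference_map[OF p, where 'a='a, symmetric]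
   using DERIV_cmult[OF energy_derivative[OF p _ _ Td_finite[OF u False] Td_finite[OF v False]], of "1 - \<gamma>"]
   by (simp add: mult.left_commute)
 qed simp
 have D3: "((%t. enn2real (weighted_energy p \<beta> (?w t))) has_real_derivative p * (LINT x|lborel. norm x powr \<beta> * Phi p (u x) * v x)) (at 0)"
 proof -
  have "Tw (?w t) x = Tw u x + t *R Tw v x" for t x
   using weighted_map_lincomb[of "\<beta> / p" 1 u t v x] by simp
  thus ?thesis
   unfolding weighted_eq using energy_derivative[OF p _ _ Tw_finite[OF u] Tw_finite[OF v]]
   by (simp add: Phi_weighted_map[OF p])
 qed
 have "enn2real (A (?w t)) = \<gamma> * enn2real (gradient_energy p (?w t)) + (1 - \<gamma>) * enn2real (gagliardo_energy s p (?w t))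
   + enn2real (weighted_energy p \<beta> (?w t))" for t
 proof -
  have f: "ennreal \<gamma> * gradient_energy p (?w t) < top" "ennreal (1 - \<gamma>) * gagliardo_energy s p (?w t) < top" "weighted_energy p \<beta> (?w t) < top"
   using A_finite[OF w[of t]] unfolding A_def by auto
  have f12: "ennreal \<gamma> * gradient_energy p (?w t) + ennreal (1 - \<gamma>) * gagliardo_energy s p (?w t) < top"
   using f(1,2) by (simp only: ennreal_add_less_top)
  show ?thesis
   unfolding A_def enn2real_plus[OF f12 f(3)] enn2real_plus[OF f(1,2)] enn2real_mult using \<gamma> by simp
 qed
 thus ?thesis
  using DERIV_add[OF DERIV_add[OF D1 D2] D3] unfolding form_def operator_form_def by (simp add: distrib_left)
qed

text \<open>\<open>A (u + t v) - m B (u + t v)\<^bsup>p/q\<^esup>\<close> is nonnegative for all \<open>t\<close> and zero at \<open>t = 0\<close>, so its derivative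
 there vanishes.  Since \<open>p \<noteq> q\<close>, scaling the minimiser by \<open>m\<^bsup>1/(q-p)\<^esup>\<close> turns the Lagrange multiplier
 into \<open>1\<close>; taking the absolute value first does not increase \<open>A\<close>.\<close>

lemma nonneg_weak_solution_exists:
 "\<exists>u. weak_solution \<gamma> s p q \<alpha> \<beta> u & (\<forall>x. 0 <= u x) & B u ~= 0"
proof -
 obtain w where w: "w : X" "B w = 1" and wmin: "\<forall>v\<in>X. B v = 1 --> A w <= A v" using minimizer_exists by blast
 have q1: "1 < q" "q ~= 0" using p q by simp_all
 define m where "m = enn2real (A w)"
 have Aw: "A w = ennreal m" using A_finite[OF w(1)] by (simp add: m_def)
 have m: "0 < m"
 proof (rule ccontr)
  assume "~ 0 < m"
  hence "ennreal m = 0" by (simp add: ennreal_neg)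
  hence A0w: "A0 w <= ennreal (0 powr p)" using A0_le_A[of w] Aw by simp
  obtain a where a: "0 < a"
   "!!u M. u : X ==> 0 <= M ==> A0 u <= ennreal (M powr p) ==> AE x in lborel. \<bar>u x\<bar> <= a * M * profile x"
   using pointwise_bound by blast
  have "AE x in lborel. \<bar>w x\<bar> <= a * 0 * profile x" by (rule a(2)[OF w(1) order_refl A0w])
  hence "AE x in lborel. ennreal (norm x powr \<alpha> * \<bar>w x\<bar> powr q) = 0" by eventually_elim simp
  hence "B w = 0" unfolding B_def using X_measurable[OF w(1)] by (subst nn_integral_0_iff_AE) auto
  thus False using w(2) by simp
 qed
 have min: "\<forall>v\<in>X. B v = 1 --> ennreal m <= A v" using wmin Aw by simp
 define c where "c = m powr (1 / (q - p))"
 have c: "0 < c" using m by (simp add: c_def)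
 define u where "u = (%x. c * \<bar>w x\<bar>)"
 have u: "u : X" unfolding u_def by (rule X_scale[OF X_abs(1)[OF w(1)]])
 have Bu: "B u = ennreal (c powr q)"
  unfolding u_def using B_scale[OF X_measurable[OF X_abs(1)[OF w(1)]], of c] X_abs(3)[OF w(1)] w(2) c by simp
 have "A u = ennreal (c powr p) * A (%x. \<bar>w x\<bar>)" unfolding u_def using A_scale[OF X_abs(1)[OF w(1)], of c] c by simp
 also have "... <= ennreal (c powr p) * ennreal m" using X_abs(2)[OF w(1)] Aw by (intro mult_left_mono) auto
 also have "... = ennreal (m * c powr p)" using m by (simp add: ennreal_mult mult.commute)
 finally have Au: "A u <= ennreal (m * c powr p)" .
 have weak: "form u v = (LINT x|lborel. norm x powr \<alpha> * Phi q (u x) * v x)" if v: "v : X" for v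
 proof -
  let ?w = "%t x. u x + t * v x"
  define J where "J = (LINT x|lborel. norm x powr \<alpha> * Phi q (u x) * v x)"
  define \<phi> where "\<phi> t = enn2real (A (?w t)) - m * enn2real (B (?w t)) powr (p / q)" for t
  have B0: "enn2real (B (?w 0)) = c powr q" using Bu by simp
  have "((%t. enn2real (B (?w t)) powr (p / q)) has_real_derivative (p / q) * (c powr q) powr (p / q - 1) * (q * J)) (at 0)"
  proof (rule DERIV_chain2[where f="%x. x powr (p / q)"])
   show "((%x. x powr (p / q)) has_real_derivative (p / q) * (c powr q) powr (p / q - 1)) (at (enn2real (B (?w 0))))"
    unfolding B0 using c by (intro has_real_derivative_powr) simp
   show "((%t. enn2real (B (?w t))) has_real_derivative q * J) (at 0)" unfolding J_def by (rule B_derivative[OF u v])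
  qed
  hence D: "(\<phi> has_real_derivative p * form u v - m * ((p / q) * (c powr q) powr (p / q - 1) * (q * J))) (at 0)"
   unfolding \<phi>_def[abs_def] by (intro DERIV_diff A_derivative[OF u v] DERIV_cmult)
  have nonneg: "0 <= \<phi> t" for t
  proof -
   have "ennreal (m * enn2real (B (?w t)) powr (p / q)) <= A (?w t)"
    using A_lower[OF min X_step[OF u v, of t]] m by simp
   hence "enn2real (ennreal (m * enn2real (B (?w t)) powr (p / q))) <= enn2real (A (?w t))"
    using A_finite[OF X_step[OF u v, of t]] by (intro enn2real_mono) auto
   thus ?thesis using m by (simp add: \<phi>_def)
  qed
  have "enn2real (A u) <= enn2real (ennreal (m * c powr p))" using Au by (rule enn2real_mono) simp
  hence "enn2real (A u) <= m * c powr p" using m c by simp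
  moreover have "(c powr q) powr (p / q) = c powr p" unfolding powr_powr using q1 by simp
  ultimately have "\<phi> 0 <= 0" using B0 by (simp add: \<phi>_def)
  hence "p * form u v - m * ((p / q) * (c powr q) powr (p / q - 1) * (q * J)) = 0"
   using nonneg by (intro DERIV_local_min[OF D, of 1]) (auto intro: order_trans)
  moreover have mK: "m * (c powr q) powr (p / q - 1) = 1"
  proof -
   have "1 / (q - p) * (q * (p / q - 1)) = - 1" using q q1 by (simp add: field_simps)
   hence "(c powr q) powr (p / q - 1) = m powr (- 1)" unfolding c_def powr_powr by (simp add: mult.assoc)
   thus ?thesis using m by (simp add: powr_minus_divide)
  qed
  have "m * ((p / q) * (c powr q) powr (p / q - 1) * (q * J)) = (m * (c powr q) powr (p / q - 1)) * ((p / q) * (q * J))"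
   by (simp only: mult_ac)
  hence "m * ((p / q) * (c powr q) powr (p / q - 1) * (q * J)) = (p / q) * (q * J)" unfolding mK by simp
  moreover have "(p / q) * (q * J) = p * J" using q1 by simp
  ultimately have "p * form u v = p * J" by linarith
  thus ?thesis using p unfolding J_def by simp
 qed
 have "weak_solution \<gamma> s p q \<alpha> \<beta> u"
  unfolding weak_solution_def X_def[symmetric]
 proof (intro conjI ballI impI u)
  fix v assume v: "v : X"
  note I = solution_integrable[OF u v]
  show "\<gamma> ~= 0 ==> integrable lborel (local_integrand p u v)" by (rule I)
  show "\<gamma> ~= 1 ==> integrable lborel2 (nonlocal_integrand s p u v)" by (rule I)
  show "integrable lborel (%x. norm x powr \<beta> * Phi p (u x) * v x)" by (rule I)
  show "integrable lborel (%x. norm x powr \<alpha> * Phi q (u x) * v x)" by (rule I)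
  show "operator_form \<gamma> s p u v + (LINT x|lborel. norm x powr \<beta> * Phi p (u x) * v x) = (LINT x|lborel. norm x powr \<alpha> * Phi q (u x) * v x)"
   using weak[OF v] unfolding form_def .
 qed
 moreover have "\<forall>x. 0 <= u x" using c by (simp add: u_def)
 moreover have "B u ~= 0" using Bu c by simp
 ultimately show ?thesis by blast
qed

end

section \<open>Positivity\<close>

text \<open>\<open>\<epsilon>\<^sup>r (t + \<epsilon>)\<^sup>-\<^sup>r\<close>, normalised to be at most \<open>1\<close>; as \<open>\<epsilon> \<rightarrow> 0\<close> it tends to the indicator of \<open>t = 0\<close>.\<close>

definition damp :: "real => real => real => real" where
 "damp r e t = (e / (t + e)) powr r"

lemma damp_nonneg: "0 <= damp r e t" by (simp add: damp_def)

lemma damp_measurable [measurable]: "damp r e : Borel"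
 unfolding damp_def by measurable

lemma damp_le_1: "0 <= r ==> 0 < e ==> 0 <= t ==> damp r e t <= 1"
 unfolding damp_def by (rule order_trans[OF powr_mono2[of r _ 1]]) auto

lemma damp_antimono: "0 <= r ==> 0 < e ==> 0 <= a ==> a <= b ==> damp r e b <= damp r e a"
 unfolding damp_def by (intro powr_mono2 divide_left_mono) auto

lemma damp_eq: "0 < e ==> 0 <= t ==> damp r e t = e powr r / (t + e) powr r"
 unfolding damp_def by (simp add: powr_divide)

lemma damp_has_derivative:
 assumes e: "0 < e" "0 <= t"
 shows "(damp r e has_real_derivative - r * damp r e t / (t + e)) (at t)"
proof -
 define Z where "Z = e / (t + e)"
 have Z: "0 < Z" "Z * (t + e) = e" using e by (auto simp: Z_def)
 have 1: "((%t. e / (t + e)) has_real_derivative - (Z / (t + e))) (at t)"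
  using e by (auto intro!: derivative_eq_intros simp: Z_def power2_eq_square)
 have 2: "((%z. z powr r) has_real_derivative r * Z powr (r - 1)) (at (e / (t + e)))"
  unfolding Z_def[symmetric] by (rule has_real_derivative_powr[OF Z(1)])
 have "r * Z powr (r - 1) * - (Z / (t + e)) = - r * Z powr r / (t + e)"
  using Z(1) by (simp add: powr_diff)
 thus ?thesis using DERIV_chain2[OF 2 1] unfolding damp_def[abs_def] Z_def by simp
qed

lemma damp_derivative_bound:
 assumes r: "0 <= r" and e: "0 < e" "0 <= t"
 shows "\<bar>- r * damp r e t / (t + e)\<bar> <= r / e"
proof -
 have "r * damp r e t <= r * 1" by (rule mult_left_mono[OF damp_le_1[OF r e] r])
 hence "r * damp r e t / (t + e) <= r / e" using r e damp_nonneg[of r e t] by (intro frac_le) auto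
 moreover have "\<bar>- r * damp r e t / (t + e)\<bar> = r * damp r e t / (t + e)" using r e damp_nonneg[of r e t] by (simp add: abs_mult)
 ultimately show ?thesis by simp
qed

lemma damp_Lipschitz:
 assumes r: "0 <= r" and e: "0 < e" and "0 <= a" "0 <= b"
 shows "\<bar>damp r e a - damp r e b\<bar> <= r / e * \<bar>a - b\<bar>"
 using field_differentiable_bound[of "{0..}" "damp r e" "%t. - r * damp r e t / (t + e)" "r / e" a b]
  DERIV_subset[OF damp_has_derivative[OF e]] damp_derivative_bound[OF r e] assms by auto

lemma damp_tendsto:
 assumes r: "0 < r" and t: "0 <= t"
 shows "(%n. damp r (1 / real (Suc n)) t) ----> (if t = 0 then 1 else 0)"
proof (cases "t = 0")
 case True
 thus ?thesis by (simp add: damp_def)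
next
 case False
 have "(%n. (1 / real (Suc n)) / (t + 1 / real (Suc n))) ----> 0 / (t + 0)"
  using False by (intro tendsto_divide tendsto_add tendsto_const LIMSEQ_Suc[OF lim_1_over_n]) auto
 hence "(%n. ((1 / real (Suc n)) / (t + 1 / real (Suc n))) powr r) ----> (0 / (t + 0)) powr r"
  using r t by (intro tendsto_powr' tendsto_const) auto
 thus ?thesis using False r by (simp add: damp_def)
qed

lemma Phi_inner_self:
 fixes G :: "'b::euclidean_space"
 shows "Phi p G \<bullet> G = norm G powr p"
proof (cases "G = 0")
 case False
 have "norm G powr p = norm G powr ((p - 2) + 2)" by simp
 also have "... = norm G powr (p - 2) * (norm G)\<^sup>2" unfolding powr_add using False by simp
 finally show ?thesis by (simp add: Phi_def power2_norm_eq_inner)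
qed (simp add: Phi_def)

text \<open>With \<open>X = \<bar>G\<bar> / (t + e)\<close> the left side is at most \<open>e\<^bsup>p-1\<^esup> \<zeta> (k X\<^bsup>p-1\<^esup> - (p - 1) X\<^sup>p)\<close>; Young's inequality
 absorbs the first term into half of the second.  \<open>X\<close> is the length of \<open>\<nabla> ln (u + e)\<close>.\<close>

lemma log_test_bound:
 fixes G Z :: "'b::euclidean_space"
 assumes p: "1 < p" and k: "0 < k" and e: "0 < e" "0 <= t" and \<zeta>: "0 <= \<zeta>" and Z: "norm Z <= k * \<zeta>"
 shows "Phi p G \<bullet> ((\<zeta> * (- (p - 1) * damp (p - 1) e t / (t + e))) *R G + damp (p - 1) e t *R Z)
  <= e powr (p - 1) * (\<zeta> * (k * (2 * k / (p - 1)) powr (p - 1)) - (p - 1) / 2 * (\<zeta> * (norm G / (t + e)) powr p))"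
proof -
 define Y where "Y = t + e"
 define x where "x = norm G / Y"
 define d where "d = damp (p - 1) e t"
 have Y: "0 < Y" using e by (simp add: Y_def)
 have x: "0 <= x" "norm G = x * Y" using Y by (simp_all add: x_def)
 have d: "0 <= d" "d * Y powr (p - 1) = e powr (p - 1)"
  using Y e damp_nonneg by (simp_all add: d_def damp_eq Y_def)
 have Gp: "norm G powr p / Y = x powr p * Y powr (p - 1)" "norm G powr (p - 1) = x powr (p - 1) * Y powr (p - 1)"
  using x Y by (simp_all add: powr_mult powr_diff)
 have young: "k * x powr (p - 1) <= k * (2 * k / (p - 1)) powr (p - 1) + (p - 1) / 2 * x powr p"
 proof (cases "x <= 2 * k / (p - 1)")
  case True
  hence "k * x powr (p - 1) <= k * (2 * k / (p - 1)) powr (p - 1)" using x p k by (intro mult_left_mono powr_mono2) auto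
  thus ?thesis using p by (simp add: add_increasing2)
 next
  case False
  hence "k <= (p - 1) / 2 * x" using p by (simp add: field_simps)
  hence "k * x powr (p - 1) <= (p - 1) / 2 * x * x powr (p - 1)" by (rule mult_right_mono) simp
  also have "... = (p - 1) / 2 * x powr p"
  proof -
   have "0 < 2 * k / (p - 1)" using k p by simp
   hence "0 < x" using False by linarith
   hence "x * x powr (p - 1) = x powr p" by (simp add: powr_diff)
   thus ?thesis by (simp only: mult.assoc)
  qed
  finally show ?thesis using k by (simp add: add_increasing)
 qed
 have "Phi p G \<bullet> Z <= norm (Phi p G) * norm Z" by (rule norm_cauchy_schwarz)
 also have "... <= norm G powr (p - 1) * (k * \<zeta>)" unfolding norm_Phi by (rule mult_left_mono[OF Z]) simp
 finally have 1: "d * (Phi p G \<bullet> Z) <= d * (norm G powr (p - 1) * (k * \<zeta>))" using d by (intro mult_left_mono)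
 have "Phi p G \<bullet> ((\<zeta> * (- (p - 1) * d / Y)) *R G + d *R Z) = - (\<zeta> * (p - 1) * d * (norm G powr p / Y)) + d * (Phi p G \<bullet> Z)"
  using Y by (simp add: inner_add_right Phi_inner_self field_simps)
 also have "... <= - (\<zeta> * (p - 1) * d * (norm G powr p / Y)) + d * (norm G powr (p - 1) * (k * \<zeta>))" using 1 by simp
 also have "... = (d * Y powr (p - 1)) * (\<zeta> * (k * x powr (p - 1) - (p - 1) * x powr p))"
  unfolding Gp by (simp add: algebra_simps)
 also have "... = e powr (p - 1) * (\<zeta> * (k * x powr (p - 1) - (p - 1) * x powr p))" unfolding d(2) ..
 also have "... <= e powr (p - 1) * (\<zeta> * (k * (2 * k / (p - 1)) powr (p - 1) - (p - 1) / 2 * x powr p))"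
 proof (intro mult_left_mono \<zeta>)
  have "(p - 1) * x powr p = (p - 1) / 2 * x powr p + (p - 1) / 2 * x powr p" by simp
  thus "k * x powr (p - 1) - (p - 1) * x powr p <= k * (2 * k / (p - 1)) powr (p - 1) - (p - 1) / 2 * x powr p" using young by linarith
 qed simp
 also have "... = e powr (p - 1) * (\<zeta> * (k * (2 * k / (p - 1)) powr (p - 1)) - (p - 1) / 2 * (\<zeta> * x powr p))"
  by (simp only: right_diff_distrib mult_ac)
 finally show ?thesis unfolding d_def x_def Y_def .
qed

lemma Phi_real_nonneg: "0 <= t ==> 0 <= Phi p (t::real)" by (simp add: Phi_def)

lemma Phi_real_nonneg_eq: "0 <= t ==> Phi p (t::real) = t powr (p - 1)"
 using norm_Phi[of p t] Phi_real_nonneg[of t p] by simp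

context radial_problem
begin

definition test :: "real => real => ('a => real) => 'a => real" where
 "test k e u x = decay k x * damp (p - 1) e (u x)"

context
 fixes k e :: real and u :: "'a => real"
 assumes k: "0 < k" "(decay k :: 'a => real) : X" and e: "0 < e" and u: "u : X" "!!x. 0 <= u x"
begin

lemma test_gradient:
 assumes \<gamma>0: "\<gamma> ~= 0"
 shows "has_weak_gradient (test k e u) (%x. decay k x *R ((- (p - 1) * damp (p - 1) e (u x) / (u x + e)) *R weak_gradient u x)
  + damp (p - 1) e (u x) *R grad_decay k x)"
 unfolding test_def[abs_def]
proof (rule weak_gradient_mult_smooth[OF _ Ck_decay decay_has_derivative])
 show "has_weak_gradient (%x. damp (p - 1) e (u x)) (%x. (- (p - 1) * damp (p - 1) e (u x) / (u x + e)) *R weak_gradient u x)"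
 proof (rule weak_gradient_chain[OF X_gradient[OF u(1) \<gamma>0], where I="{0..}" and L="(p - 1) / e"])
  show "(damp (p - 1) e has_real_derivative - (p - 1) * damp (p - 1) e t / (t + e)) (at t within {0..})" if "t : {0..}" for t
   by (rule has_field_derivative_at_within[OF damp_has_derivative[OF e]]) (use that in auto)
  show "\<bar>- (p - 1) * damp (p - 1) e t / (t + e)\<bar> <= (p - 1) / e" if "t : {0..}" for t
   using damp_derivative_bound[of "p - 1" e t] e p that by auto
 qed (use u in auto)
 show "\<bar>decay k x\<bar> <= 1" for x :: 'a using decay_pos[of k x] decay_le_1[of k x] k by simp
 show "norm (grad_decay k x) <= k" for x :: 'a
 proof -
  have "k * decay k x <= k * 1" using decay_le_1[of k x] k by (intro mult_left_mono) auto
  moreover have "norm (grad_decay k x) <= k * decay k x" using k by (intro norm_grad_decay_le) simp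
  ultimately show ?thesis by linarith
 qed
qed measurable

lemma test_in_X: "test k e u : X"
 unfolding X_iff
proof (intro conjI impI)
 note [measurable] = X_measurable[OF u(1)]
 have \<zeta>: "0 <= decay k x" "decay k x <= 1" for x :: 'a using decay_pos[of k x] decay_le_1[of k x] k by auto
 have d: "0 <= damp (p - 1) e (u x)" "damp (p - 1) e (u x) <= 1" for x using damp_nonneg damp_le_1[of "p - 1" e "u x"] p e u by auto
 show mt: "test k e u : Borel" unfolding test_def[abs_def] by measurable
 have "weighted_energy p \<beta> (test k e u) <= weighted_energy p \<beta> (decay k :: 'a => real)"
  unfolding weighted_energy_def
 proof (intro nn_integral_mono ennreal_leI mult_left_mono powr_mono2)
  show "\<bar>test k e u x\<bar> <= \<bar>decay k x\<bar>" for x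
   using \<zeta>[of x] d[of x] by (simp add: test_def abs_mult mult_left_le)
 qed (use p in auto)
 thus "weighted_energy p \<beta> (test k e u) < \<infinity>" using k(2) by (auto simp: X_iff intro: le_less_trans)
 show "radial (test k e u)"
 proof -
  obtain g where "AE x in lborel. u x = g (norm x)" using u by (auto simp: X_iff radial_def)
  hence "AE x in lborel. test k e u x = (%t. (1 + t\<^sup>2) powr (- k) * damp (p - 1) e (g t)) (norm x)"
   by eventually_elim (simp add: test_def decay_def)
  thus ?thesis unfolding radial_def by (intro exI[of _ "%t. (1 + t\<^sup>2) powr (- k) * damp (p - 1) e (g t)"])
 qed
 show "gagliardo_energy s p (test k e u) < \<infinity>" if "\<gamma> = 0"
 proof -
  have \<gamma>1: "\<gamma> ~= 1" using that by simp
  let ?L = "(p - 1) / e"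
  have m: "(%z. \<bar>Td (decay k) z\<bar>) : borel_measurable lborel2" "(%z. \<bar>Td u z\<bar>) : borel_measurable lborel2" by measurable
  have "(\<integral>\<^sup>+z. ennreal (norm (Td (test k e u) z) powr p) \<partial>lborel2)
   <= (\<integral>\<^sup>+z. ennreal (norm (1 *R \<bar>Td (decay k) z\<bar> + ?L *R \<bar>Td u z\<bar>) powr p) \<partial>lborel2)"
  proof (intro nn_integral_mono ennreal_leI powr_mono2)
   fix z :: "'a \<times> 'a"
   obtain x y where z: "z = (x, y)" by (cases z)
   let ?k = "norm (x - y) powr (- ((real DIM('a) + s * p) / p))"
   have "test k e u x - test k e u y = (decay k x - decay k y) * damp (p - 1) e (u x) + decay k y * (damp (p - 1) e (u x) - damp (p - 1) e (u y))"
    by (simp add: test_def algebra_simps)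
   also have "\<bar>...\<bar> <= \<bar>decay k x - decay k y\<bar> * 1 + 1 * (?L * \<bar>u x - u y\<bar>)"
   proof (intro order_trans[OF abs_triangle_ineq] add_mono)
    show "\<bar>(decay k x - decay k y) * damp (p - 1) e (u x)\<bar> <= \<bar>decay k x - decay k y\<bar> * 1"
     unfolding abs_mult using d[of x] by (intro mult_left_mono) auto
    show "\<bar>decay k y * (damp (p - 1) e (u x) - damp (p - 1) e (u y))\<bar> <= 1 * (?L * \<bar>u x - u y\<bar>)"
     unfolding abs_mult using \<zeta>[of y] damp_Lipschitz[of "p - 1" e "u x" "u y"] p e u(2) by (intro mult_mono) auto
   qed
   finally have "?k * \<bar>test k e u x - test k e u y\<bar> <= ?k * (\<bar>decay k x - decay k y\<bar> + ?L * \<bar>u x - u y\<bar>)"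
    by (intro mult_left_mono) auto
   also have "... = ?k * \<bar>decay k x - decay k y\<bar> + ?L * (?k * \<bar>u x - u y\<bar>)" by (simp only: distrib_left mult.left_commute)
   finally have "norm (Td (test k e u) z) <= 1 *R \<bar>Td (decay k) z\<bar> + ?L *R \<bar>Td u z\<bar>"
    by (simp add: z difference_map_def abs_mult)
   thus "norm (Td (test k e u) z) <= norm (1 *R \<bar>Td (decay k) z\<bar> + ?L *R \<bar>Td u z\<bar>)" by simp
  qed (use p in auto)
  also have "... < \<infinity>"
   using Td_finite[OF k(2) \<gamma>1] Td_finite[OF u(1) \<gamma>1] by (intro nn_powr_lincomb_finite[OF p m]) auto
  finally show ?thesis using gagliardo_eq[OF mt] by simp
 qed
 show "gradient_energy p (test k e u) < \<infinity>" if \<gamma>0: "\<gamma> ~= 0"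
 proof -
  let ?L = "(p - 1) / e"
  note [measurable] = X_gradient_measurable[OF u(1) \<gamma>0]
  have "gradient_energy p (decay k :: 'a => real) < \<infinity>" using k(2) \<gamma>0 by (simp add: X_iff)
  hence Z: "(\<integral>x. ennreal (norm (norm (grad_decay k x :: 'a)) powr p)) < \<infinity>"
   using gradient_energy_eq[OF weak_gradient_decay[OF k(1), where 'a='a], of p] by simp
  have U: "(\<integral>x. ennreal (norm (norm (weak_gradient u x)) powr p)) < \<infinity>" using X_gradient_finite[OF u(1) \<gamma>0] by simp
  have "gradient_energy p (test k e u) <= (\<integral>x. ennreal (norm (?L *R norm (weak_gradient u x) + 1 *R norm (grad_decay k x)) powr p))"
   unfolding gradient_energy_eq[OF test_gradient[OF \<gamma>0]]
  proof (intro nn_integral_mono ennreal_leI powr_mono2)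
   fix x :: 'a
   have "norm (decay k x *R ((- (p - 1) * damp (p - 1) e (u x) / (u x + e)) *R weak_gradient u x) + damp (p - 1) e (u x) *R grad_decay k x)
    <= norm (decay k x *R ((- (p - 1) * damp (p - 1) e (u x) / (u x + e)) *R weak_gradient u x)) + norm (damp (p - 1) e (u x) *R grad_decay k x)"
    by (rule norm_triangle_ineq)
   also have "norm (decay k x *R ((- (p - 1) * damp (p - 1) e (u x) / (u x + e)) *R weak_gradient u x)) <= 1 * (?L * norm (weak_gradient u x))"
    unfolding norm_scaleR using \<zeta>[of x] damp_derivative_bound[of "p - 1" e "u x"] p e u(2)[of x]
    by (intro mult_mono mult_nonneg_nonneg) auto
   also have "norm (damp (p - 1) e (u x) *R grad_decay k x) <= 1 * norm (grad_decay k x)"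
    unfolding norm_scaleR using d[of x] by (intro mult_right_mono) auto
   finally show "norm (decay k x *R ((- (p - 1) * damp (p - 1) e (u x) / (u x + e)) *R weak_gradient u x) + damp (p - 1) e (u x) *R grad_decay k x)
    <= norm (?L *R norm (weak_gradient u x) + 1 *R norm (grad_decay k x))" by simp
  qed (use p in auto)
  also have "... < \<infinity>" by (rule nn_powr_lincomb_finite[OF p _ _ U Z]) auto
  finally show ?thesis .
 qed
qed

end

end

context radial_problem
begin

lemma decay_integrable:
 assumes k: "0 < k" "\<beta> + real DIM('a) < 2 * k"
 shows "integrable lborel (decay k :: 'a => real)" "integrable lborel (%x::'a. norm x powr \<beta> * decay k x)"
proof -
 have \<zeta>: "0 <= decay k x" for x :: 'a using decay_pos[of k x] by simp
 have "(\<integral>x::'a. ennreal (norm (decay k x))) = (\<integral>x::'a. ennreal (norm x powr 0 * decay k x powr 1))"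
 proof (rule nn_integral_cong_AE)
  have "AE x::'a in lborel. x ~= 0" by (rule AE_lborel_singleton)
  thus "AE x::'a in lborel. ennreal (norm (decay k x)) = ennreal (norm x powr 0 * decay k x powr 1)"
   by eventually_elim (simp add: \<zeta>)
 qed
 also have "... < \<infinity>" using decay_moment[of 0 1 k, where 'a='a] k \<beta> by simp
 finally show "integrable lborel (decay k :: 'a => real)" by (intro integrableI_bounded) auto
 have "(\<integral>x::'a. ennreal (norm (norm x powr \<beta> * decay k x))) = (\<integral>x::'a. ennreal (norm x powr \<beta> * decay k x powr 1))"
  by (simp add: \<zeta>)
 also have "... < \<infinity>" using decay_moment[of \<beta> 1 k, where 'a='a] k \<beta> by simp
 finally show "integrable lborel (%x::'a. norm x powr \<beta> * decay k x)" by (intro integrableI_bounded) auto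
qed

context
 fixes k :: real and u :: "'a => real"
 assumes k: "0 < k" "\<beta> + real DIM('a) < 2 * k" "(decay k :: 'a => real) : X"
  and weak: "weak_solution \<gamma> s p q \<alpha> \<beta> u" and u0: "!!x. 0 <= u x"
begin

lemma u_X: "u : X" using weak by (simp add: weak_solution_def X_def)

lemma u_measurable [measurable]: "u : Borel" by (rule X_measurable[OF u_X])

lemma log_gradient_integrable:
 assumes e: "0 < e" and \<gamma>0: "\<gamma> ~= 0"
 shows "integrable lborel (%x. decay k x * (norm (weak_gradient u x) / (u x + e)) powr p)"
proof (rule Bochner_Integration.integrable_bound)
 note [measurable] = X_gradient_measurable[OF u_X \<gamma>0]
 show "integrable lborel (%x. (1 / e) powr p * norm (weak_gradient u x) powr p)"
  by (intro integrable_mult_right integrable_norm_powr X_gradient_finite[OF u_X \<gamma>0]) simp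
 show "(%x. decay k x * (norm (weak_gradient u x) / (u x + e)) powr p) : borel_measurable lborel" by measurable
 show "AE x in lborel. norm (decay k x * (norm (weak_gradient u x) / (u x + e)) powr p) <= norm ((1 / e) powr p * norm (weak_gradient u x) powr p)"
 proof (rule AE_I2)
  fix x :: 'a
  have "norm (weak_gradient u x) / (u x + e) <= 1 / e * norm (weak_gradient u x)"
   using e u0[of x] by (simp add: divide_left_mono)
  hence "(norm (weak_gradient u x) / (u x + e)) powr p <= (1 / e * norm (weak_gradient u x)) powr p"
   using p e u0[of x] by (intro powr_mono2) auto
  also have "... = (1 / e) powr p * norm (weak_gradient u x) powr p" by (rule powr_mult)
  finally have "decay k x * (norm (weak_gradient u x) / (u x + e)) powr p <= 1 * ((1 / e) powr p * norm (weak_gradient u x) powr p)"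
   using decay_pos[of k x] decay_le_1[of k x] k by (intro mult_mono) auto
  thus "norm (decay k x * (norm (weak_gradient u x) / (u x + e)) powr p) <= norm ((1 / e) powr p * norm (weak_gradient u x) powr p)"
   using decay_pos[of k x] by (simp add: abs_mult)
 qed
qed

text \<open>The right side of the weak equation is nonnegative and drops out.  On the left
 \<open>\<Phi>\<^sub>p(u) damp(u) \<le> e\<^bsup>p-1\<^esup>\<close>, so every term but the nonlocal one carries the factor \<open>e\<^bsup>p-1\<^esup>\<close>.\<close>

lemma test_inequality:
 assumes e: "0 < e"
 shows "\<gamma> * (e powr (p - 1) * ((p - 1) / 2 * (LINT x|lborel. decay k x * (norm (weak_gradient u x) / (u x + e)) powr p)))
  <= e powr (p - 1) * (\<gamma> * (k * (2 * k / (p - 1)) powr (p - 1) * (LINT x|(lborel::'a measure). decay k x)) + (LINT x|(lborel::'a measure). norm x powr \<beta> * decay k x))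
   + (1 - \<gamma>) * (LINT z|lborel2. nonlocal_integrand s p u (test k e u) z)"
proof -
 let ?v = "test k e u" and ?C = "k * (2 * k / (p - 1)) powr (p - 1)"
 let ?P = "%x. decay k x * (norm (weak_gradient u x) / (u x + e)) powr p"
 have v: "?v : X" by (rule test_in_X[OF k(1,3) e u_X u0])
 note I = solution_integrable[OF u_X v]
 have \<zeta>: "0 <= decay k x" for x :: 'a using decay_pos[of k x] by simp
 have v0: "0 <= ?v x" for x using \<zeta>[of x] damp_nonneg by (simp add: test_def)
 have eq: "operator_form \<gamma> s p u ?v + (LINT x|lborel. norm x powr \<beta> * Phi p (u x) * ?v x) = (LINT x|lborel. norm x powr \<alpha> * Phi q (u x) * ?v x)"
  using weak v unfolding weak_solution_def X_def[symmetric] by blast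
 have R: "0 <= (LINT x|lborel. norm x powr \<alpha> * Phi q (u x) * ?v x)"
  using v0 Phi_real_nonneg[OF u0] by (intro Bochner_Integration.integral_nonneg mult_nonneg_nonneg) auto
 have W: "(LINT x|lborel. norm x powr \<beta> * Phi p (u x) * ?v x) <= (LINT x|(lborel::'a measure). e powr (p - 1) * (norm x powr \<beta> * decay k x))"
 proof (rule integral_mono[OF I(3)])
  show "integrable lborel (%x::'a. e powr (p - 1) * (norm x powr \<beta> * decay k x))"
   by (intro integrable_mult_right decay_integrable k(1,2))
  fix x :: 'a
  have "Phi p (u x) * damp (p - 1) e (u x) = (u x * (e / (u x + e))) powr (p - 1)"
   using u0[of x] e p by (simp only: Phi_real_nonneg_eq damp_def powr_mult)
  also have "... <= e powr (p - 1)"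
  proof (rule powr_mono2)
   show "u x * (e / (u x + e)) <= e" using u0[of x] e by (simp add: field_simps)
  qed (use u0[of x] e p in auto)
  finally have "norm x powr \<beta> * decay k x * (Phi p (u x) * damp (p - 1) e (u x)) <= norm x powr \<beta> * decay k x * e powr (p - 1)"
   using \<zeta>[of x] by (intro mult_left_mono) auto
  thus "norm x powr \<beta> * Phi p (u x) * ?v x <= e powr (p - 1) * (norm x powr \<beta> * decay k x)"
   by (simp add: test_def mult_ac)
 qed
 have L: "\<gamma> * (LINT x|lborel. local_integrand p u ?v x) <= \<gamma> * (e powr (p - 1) * (?C * (LINT x|(lborel::'a measure). decay k x) - (p - 1) / 2 * (LINT x|lborel. ?P x)))"
 proof (cases "\<gamma> = 0")
  case False
  note P = log_gradient_integrable[OF e False] and D = decay_integrable(1)[OF k(1,2)]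
  have "(LINT x|lborel. local_integrand p u ?v x) <= (LINT x|lborel. e powr (p - 1) * (decay k x * ?C - (p - 1) / 2 * ?P x))"
  proof (rule integral_mono_AE[OF I(1)[OF False]])
   show "integrable lborel (%x. e powr (p - 1) * (decay k x * ?C - (p - 1) / 2 * ?P x))"
    by (intro integrable_mult_right Bochner_Integration.integrable_diff integrable_mult_left D P)
   show "AE x in lborel. local_integrand p u ?v x <= e powr (p - 1) * (decay k x * ?C - (p - 1) / 2 * ?P x)"
    using weak_gradient_AE(2)[OF test_gradient[OF k(1,3) e u_X u0 False]]
   proof eventually_elim
    case (elim x)
    have "Phi p (weak_gradient u x) \<bullet> ((decay k x * (- (p - 1) * damp (p - 1) e (u x) / (u x + e))) *R weak_gradient u x + damp (p - 1) e (u x) *R grad_decay k x)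
     <= e powr (p - 1) * (decay k x * ?C - (p - 1) / 2 * ?P x)"
     using k(1) by (intro log_test_bound p e u0 \<zeta> norm_grad_decay_le) auto
    thus ?case unfolding local_integrand_def elim scaleR_scaleR .
   qed
  qed
  also have "... = e powr (p - 1) * (?C * (LINT x|(lborel::'a measure). decay k x) - (p - 1) / 2 * (LINT x|lborel. ?P x))"
   using P D by (subst integral_mult_right_zero, subst Bochner_Integration.integral_diff) (auto simp: mult.commute)
  finally show ?thesis using \<gamma>(1) by (rule mult_left_mono)
 qed simp
 have "0 <= \<gamma> * (LINT x|lborel. local_integrand p u ?v x) + (1 - \<gamma>) * (LINT z|lborel2. nonlocal_integrand s p u ?v z)
   + (LINT x|lborel. norm x powr \<beta> * Phi p (u x) * ?v x)"
  using R eq unfolding operator_form_def by simp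
 also have "... <= \<gamma> * (e powr (p - 1) * (?C * (LINT x|(lborel::'a measure). decay k x) - (p - 1) / 2 * (LINT x|lborel. ?P x)))
   + (1 - \<gamma>) * (LINT z|lborel2. nonlocal_integrand s p u ?v z) + e powr (p - 1) * (LINT x|(lborel::'a measure). norm x powr \<beta> * decay k x)"
  using L W by (intro add_mono order_refl) simp_all
 finally have "0 <= \<gamma> * (e powr (p - 1) * (?C * (LINT x|(lborel::'a measure). decay k x) - (p - 1) / 2 * (LINT x|lborel. ?P x)))
   + (1 - \<gamma>) * (LINT z|lborel2. nonlocal_integrand s p u ?v z) + e powr (p - 1) * (LINT x|(lborel::'a measure). norm x powr \<beta> * decay k x)" .
 moreover have "g * (E * b) <= E * (g * a + w) + n" if "0 <= g * (E * (a - b)) + n + E * w" for g E a b n w :: real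
  using that by (simp add: algebra_simps)
 ultimately show ?thesis by blast
qed

text \<open>The test functions tend to \<open>\<zeta>\<close> on the zero set and to \<open>0\<close> elsewhere, and as \<open>damp\<close> decreases the
 nonlocal integrand is at most \<open>\<bar>\<Phi>\<^sub>p(u x - u y)\<bar> \<bar>\<zeta> x - \<zeta> y\<bar>\<close> times the kernel.  By Fatou's lemma the limit
 integrand, which is nonpositive, has nonnegative integral; it is negative wherever exactly one of
 \<open>u x\<close>, \<open>u y\<close> is zero.\<close>

lemma zero_set_dichotomy_nonlocal:
 assumes \<gamma>1: "\<gamma> < 1"
 shows "AE x in lborel. AE y in lborel. ~ (u x = 0 & 0 < u y)"
proof -
 define e where "e n = 1 / real (Suc n)" for n
 have e: "0 < e n" for n by (simp add: e_def)
 have \<zeta>: "0 < decay k x" for x :: 'a by (rule decay_pos)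
 define H where "H z = \<bar>Phi p (Td u z) * Td (decay k) z\<bar>" for z
 define I where "I n z = Phi p (Td u z) * Td (test k (e n) u) z" for n z
 define v where "v x = (if u x = 0 then decay k x else 0)" for x
 define M where "M z = - (Phi p (Td u z) * Td v z)" for z
 have [measurable]: "v : Borel" unfolding v_def by measurable
 have [measurable]: "test k (e n) u : Borel" for n by (rule X_measurable[OF test_in_X[OF k(1,3) e u_X u0]])
 have [measurable]: "H : borel_measurable lborel2" "I n : borel_measurable lborel2" "M : borel_measurable lborel2" for n
  unfolding H_def[abs_def] I_def[abs_def] M_def[abs_def] by measurable
 let ?k = "%x y :: 'a. norm (x - y) powr (- ((real DIM('a) + s * p) / p))"
 have Td: "Td f (x, y) = ?k x y * (f x - f y)" for f :: "'a => real" and x y by (simp add: difference_map_def)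
 have neg: "t <= 0 ==> Phi p t <= 0" for t :: real by (simp add: Phi_def mult_nonneg_nonpos)
 have Hint: "integrable lborel2 H"
  using solution_integrable(2)[OF u_X k(3)] \<gamma>1 unfolding H_def[abs_def] Phi_difference_map[OF p, where 'a='a] by simp
 have Iint: "integrable lborel2 (I n)" for n
  using solution_integrable(2)[OF u_X test_in_X[OF k(1,3) e u_X u0]] \<gamma>1 unfolding I_def[abs_def] Phi_difference_map[OF p, where 'a='a] by simp
 have IH: "I n z <= H z" for n z
 proof -
  obtain x y where z: "z = (x, y)" by (cases z)
  let ?d = "%x. damp (p - 1) (e n) (u x)"
  have d: "0 <= ?d x" "?d x <= 1" for x using damp_nonneg damp_le_1[of "p - 1" "e n" "u x"] p e u0 by auto
  have b: "\<bar>(decay k x - decay k y) * ?d y\<bar> <= \<bar>decay k x - decay k y\<bar>"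
   unfolding abs_mult using d[of y] by (simp add: mult_left_le)
  have aTd: "\<bar>Td (decay k) z\<bar> = ?k x y * \<bar>decay k x - decay k y\<bar>" by (simp add: z Td abs_mult)
  show ?thesis
  proof (cases "u y <= u x")
   case True
   hence "?d x <= ?d y" using p e u0 by (intro damp_antimono) auto
   hence "decay k x * ?d x <= decay k x * ?d y" using \<zeta>[of x] by (intro mult_left_mono) auto
   hence "test k (e n) u x - test k (e n) u y <= (decay k x - decay k y) * ?d y" by (simp add: test_def left_diff_distrib)
   hence "test k (e n) u x - test k (e n) u y <= \<bar>decay k x - decay k y\<bar>" using b by linarith
   hence 1: "Td (test k (e n) u) z <= \<bar>Td (decay k) z\<bar>" unfolding aTd by (simp add: z Td mult_left_mono)
   have "0 <= Phi p (Td u z)" using True by (intro Phi_real_nonneg) (simp add: z Td)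
   thus ?thesis using mult_left_mono[OF 1, of "Phi p (Td u z)"] by (simp add: I_def H_def abs_mult)
  next
   case False
   hence "?d y <= ?d x" using p e u0 by (intro damp_antimono) auto
   hence "decay k x * ?d y <= decay k x * ?d x" using \<zeta>[of x] by (intro mult_left_mono) auto
   hence "(decay k x - decay k y) * ?d y <= test k (e n) u x - test k (e n) u y" by (simp add: test_def left_diff_distrib)
   hence "- \<bar>decay k x - decay k y\<bar> <= test k (e n) u x - test k (e n) u y" using b by linarith
   hence "?k x y * - \<bar>decay k x - decay k y\<bar> <= ?k x y * (test k (e n) u x - test k (e n) u y)" by (rule mult_left_mono) simp
   hence 1: "- \<bar>Td (decay k) z\<bar> <= Td (test k (e n) u) z" unfolding aTd by (simp add: z Td)
   have n: "Phi p (Td u z) <= 0" using False by (intro neg) (simp add: z Td mult_nonneg_nonpos)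
   show ?thesis using mult_left_mono_neg[OF 1 n] n by (simp add: I_def H_def abs_mult)
  qed
 qed
 have M0: "0 <= M z" for z
 proof -
  obtain x y where z: "z = (x, y)" by (cases z)
  consider "u x = 0" "u y = 0" | "u x ~= 0" "u y ~= 0" | "u x = 0" "0 < u y" | "0 < u x" "u y = 0" using u0[of x] u0[of y] by linarith
  thus ?thesis
  proof cases
   case 1 thus ?thesis by (simp add: M_def z Td Phi_def)
  next
   case 2 thus ?thesis by (simp add: M_def z Td v_def)
  next
   case 3
   have "Phi p (Td u z) <= 0" using 3 by (intro neg) (simp add: z Td)
   moreover have "0 <= Td v z" using 3 \<zeta>[of x] by (simp add: z Td v_def)
   ultimately show ?thesis unfolding M_def by (simp add: mult_nonpos_nonneg)
  next
   case 4
   have "0 <= Phi p (Td u z)" using 4 by (intro Phi_real_nonneg) (simp add: z Td)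
   moreover have "Td v z <= 0" using 4 \<zeta>[of y] by (simp add: z Td v_def)
   ultimately show ?thesis unfolding M_def by (simp add: mult_nonneg_nonpos)
  qed
 qed
 have lim: "(%n. H z - I n z) ----> H z + M z" for z
 proof -
  have t: "(%n. test k (e n) u x) ----> v x" for x
  proof -
   have "(%n. decay k x * damp (p - 1) (e n) (u x)) ----> decay k x * (if u x = 0 then 1 else 0)"
    unfolding e_def using p u0[of x] by (intro tendsto_intros damp_tendsto) auto
   thus ?thesis by (simp add: test_def v_def if_distrib cong: if_cong)
  qed
  have "(%n. H z - I n z) ----> H z - Phi p (Td u z) * Td v z"
   unfolding I_def difference_map_def by (intro tendsto_intros t)
  thus ?thesis by (simp add: M_def)
 qed
 define K where "K = \<gamma> * (k * (2 * k / (p - 1)) powr (p - 1) * (LINT x|(lborel::'a measure). decay k x)) + (LINT x|(lborel::'a measure). norm x powr \<beta> * decay k x)"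
 define c where "c n = integral\<^sup>L lborel2 H + e n powr (p - 1) * K / (1 - \<gamma>)" for n
 have Ic: "integral\<^sup>L lborel2 H - integral\<^sup>L lborel2 (I n) <= c n" for n
 proof -
  have "0 <= \<gamma> * (e n powr (p - 1) * ((p - 1) / 2 * (LINT x|lborel. decay k x * (norm (weak_gradient u x) / (u x + e n)) powr p)))"
   using \<gamma> p \<zeta> by (intro mult_nonneg_nonneg Bochner_Integration.integral_nonneg) (auto intro: less_imp_le)
  also have "... <= e n powr (p - 1) * K + (1 - \<gamma>) * integral\<^sup>L lborel2 (I n)"
   using test_inequality[OF e, of n] unfolding K_def I_def[abs_def] Phi_difference_map[OF p, where 'a='a] .
  finally have "- integral\<^sup>L lborel2 (I n) <= e n powr (p - 1) * K / (1 - \<gamma>)"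
   using \<gamma>1 by (simp add: pos_le_divide_eq algebra_simps)
  thus ?thesis by (simp add: c_def)
 qed
 have clim: "(%n. ennreal (c n)) ----> ennreal (integral\<^sup>L lborel2 H)"
 proof -
  have "e ----> 0" unfolding e_def by (rule LIMSEQ_Suc[OF lim_1_over_n])
  hence ep: "(%n. e n powr (p - 1)) ----> 0 powr (p - 1)"
   using p e by (intro tendsto_powr' tendsto_const) (auto simp: less_imp_le)
  hence "c ----> integral\<^sup>L lborel2 H + 0 powr (p - 1) * K / (1 - \<gamma>)"
   unfolding c_def using \<gamma>1 by (intro tendsto_add tendsto_divide tendsto_mult tendsto_const ep) auto
  thus ?thesis by (intro tendsto_ennrealI) simp
 qed
 have "(\<integral>\<^sup>+z. ennreal (H z) \<partial>lborel2) + (\<integral>\<^sup>+z. ennreal (M z) \<partial>lborel2) = (\<integral>\<^sup>+z. liminf (%n. ennreal (H z - I n z)) \<partial>lborel2)"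
 proof (subst nn_integral_add[symmetric], simp, simp, rule nn_integral_cong)
  fix z :: "'a \<times> 'a"
  have "(%n. ennreal (H z - I n z)) ----> ennreal (H z + M z)" by (rule tendsto_ennrealI[OF lim])
  hence "liminf (%n. ennreal (H z - I n z)) = ennreal (H z + M z)" by (rule lim_imp_Liminf[OF sequentially_bot])
  thus "ennreal (H z) + ennreal (M z) = liminf (%n. ennreal (H z - I n z))"
   using M0[of z] by (simp add: H_def)
 qed
 also have "... <= liminf (%n. \<integral>\<^sup>+z. ennreal (H z - I n z) \<partial>lborel2)"
  by (rule nn_integral_liminf) measurable
 also have "... <= liminf (%n. ennreal (c n))"
 proof (rule Liminf_mono, rule always_eventually, rule allI)
  fix n
  have "(\<integral>\<^sup>+z. ennreal (H z - I n z) \<partial>lborel2) = ennreal (integral\<^sup>L lborel2 (%z. H z - I n z))"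
   using Hint Iint IH by (intro nn_integral_eq_integral) auto
  also have "... <= ennreal (c n)" using Ic[of n] Hint Iint by (intro ennreal_leI) simp
  finally show "(\<integral>\<^sup>+z. ennreal (H z - I n z) \<partial>lborel2) <= ennreal (c n)" .
 qed
 also have "... = ennreal (integral\<^sup>L lborel2 H)" by (rule lim_imp_Liminf[OF sequentially_bot clim])
 also have "... = (\<integral>\<^sup>+z. ennreal (H z) \<partial>lborel2) + 0"
  using nn_integral_eq_integral[OF Hint] by (simp add: H_def)
 finally have "(\<integral>\<^sup>+z. ennreal (M z) \<partial>lborel2) <= 0"
  using nn_integral_eq_integral[OF Hint] by (simp add: ennreal_add_left_cancel_le H_def)
 hence "AE z in lborel2. ennreal (M z) = 0" by (subst nn_integral_0_iff_AE[symmetric]) auto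
 hence "AE x in lborel. AE y in lborel. ennreal (M (x, y)) = 0" by (rule lborel_pair.AE_pair)
 thus ?thesis
 proof eventually_elim
  case (elim x)
  have "AE y in lborel. y ~= x" by (rule AE_lborel_singleton)
  with elim show ?case
  proof eventually_elim
   case (elim y)
   show ?case
   proof
    assume a: "u x = 0 & 0 < u y"
    have K: "0 < ?k x y" using elim by simp
    have "Td u (x, y) < 0" using a mult_pos_pos[OF K, of "u y"] by (simp add: Td)
    hence 1: "Phi p (Td u (x, y)) < 0" by (simp add: Phi_def mult_pos_neg)
    have 2: "0 < Td v (x, y)" using a mult_pos_pos[OF K \<zeta>[of x]] by (simp add: Td v_def)
    have "0 < M (x, y)" using mult_neg_pos[OF 1 2] by (simp add: M_def)
    thus False using elim by (simp add: ennreal_eq_0_iff)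
   qed
  qed
 qed
qed

text \<open>The \<open>L\<^sup>p\<close> norm of \<open>\<nabla> ln (u + e)\<close> on a ball is bounded independently of \<open>e\<close>, and so are the differences of
 \<open>ln (u + e)\<close> under a translation.  As \<open>e \<rightarrow> 0\<close> they become infinite between a zero and a positive
 value of \<open>u\<close>.\<close>

lemma zero_set_dichotomy_local:
 assumes \<gamma>1: "\<gamma> = 1"
 shows "AE x in lborel. AE y in lborel. ~ (u x = 0 & 0 < u y)"
proof -
 have \<gamma>0: "\<gamma> ~= 0" using \<gamma>1 by simp
 note [measurable] = X_gradient_measurable[OF u_X \<gamma>0]
 define e where "e n = 1 / real (Suc n)" for n
 have e: "0 < e n" for n by (simp add: e_def)
 define L where "L n x = ln (u x + e n)" for n x
 have [measurable]: "L n : Borel" for n unfolding L_def by measurable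
 have wg: "has_weak_gradient (L n) (%x. (1 / (u x + e n)) *R weak_gradient u x)" for n
  unfolding L_def
 proof (rule weak_gradient_chain[OF X_gradient[OF u_X \<gamma>0], where I="{0..}" and L="1 / e n"])
  show "((%t. ln (t + e n)) has_real_derivative 1 / (t + e n)) (at t within {0..})" if "t : {0..}" for t
   using that e[of n] by (auto intro!: derivative_eq_intros)
  show "\<bar>1 / (t + e n)\<bar> <= 1 / e n" if "t : {0..}" for t
   using that e[of n] by (simp add: divide_left_mono)
 qed (use u0 in auto)
 define K where "K = 2 / (p - 1) * (k * (2 * k / (p - 1)) powr (p - 1) * (LINT x|(lborel::'a measure). decay k x) + (LINT x|(lborel::'a measure). norm x powr \<beta> * decay k x))"
 have PK: "(LINT x|lborel. decay k x * (norm (weak_gradient u x) / (u x + e n)) powr p) <= K" for n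
 proof -
  let ?P = "LINT x|lborel. decay k x * (norm (weak_gradient u x) / (u x + e n)) powr p"
  let ?K = "k * (2 * k / (p - 1)) powr (p - 1) * (LINT x|(lborel::'a measure). decay k x) + (LINT x|(lborel::'a measure). norm x powr \<beta> * decay k x)"
  have "e n powr (p - 1) * ((p - 1) / 2 * ?P) <= e n powr (p - 1) * ?K" using test_inequality[OF e, of n] \<gamma>1 by simp
  moreover have "0 < e n powr (p - 1)" using e[of n] by simp
  ultimately have "(p - 1) / 2 * ?P <= ?K" by (rule mult_left_le_imp_le)
  hence "2 / (p - 1) * ((p - 1) / 2 * ?P) <= 2 / (p - 1) * ?K" using p by (intro mult_left_mono) auto
  moreover have "2 / (p - 1) * ((p - 1) / 2 * ?P) = ?P" using p by simp
  ultimately show ?thesis unfolding K_def by linarith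
 qed
 have null: "AE x in lborel. ~ (u x = 0 & 0 < u (x + h))" for h :: 'a
 proof -
  have "AE x in lborel. x : cball 0 (real R) & x + h : cball 0 (real R) --> ~ (u x = 0 & 0 < u (x + h))" for R :: nat
  proof -
   define B :: "'a set" where "B = cball 0 (real R)"
   have B: "convex B" "B : sets borel" by (simp_all add: B_def)
   note [measurable] = B(2)
   define b where "b = (1 + (real R)\<^sup>2) powr (- k)"
   have R1: "0 < 1 + (real R)\<^sup>2" by (simp add: add_pos_nonneg)
   hence b: "0 < b" unfolding b_def by (metis less_irrefl powr_gt_zero)
   have bB: "b <= decay k x" if "x : B" for x
   proof -
    have "(norm x)\<^sup>2 <= (real R)\<^sup>2" using that by (intro power_mono) (auto simp: B_def)
    thus ?thesis unfolding b_def decay_def using k(1) by (intro powr_mono2') (auto simp: add_pos_nonneg)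
   qed
   define f where "f n x = ennreal (\<bar>L n (x + h) - L n x\<bar> powr p) * (indicator B x * indicator B (x + h))" for n x
   have [measurable]: "f n : Borel" for n unfolding f_def[abs_def] by measurable
   have fle: "(\<integral>x. f n x) <= ennreal (norm h powr p) * ennreal (1 / b * K)" for n
   proof -
    have "(\<integral>x. ennreal (norm ((1 / (u x + e n)) *R weak_gradient u x) powr p) * indicator B x)
     <= (\<integral>x. ennreal (1 / b) * ennreal (decay k x * (norm (weak_gradient u x) / (u x + e n)) powr p))"
    proof (rule nn_integral_mono)
     fix x :: 'a
     let ?X = "(norm (weak_gradient u x) / (u x + e n)) powr p"
     have eq: "norm ((1 / (u x + e n)) *R weak_gradient u x) powr p = ?X" using u0[of x] e[of n] by simp
     show "ennreal (norm ((1 / (u x + e n)) *R weak_gradient u x) powr p) * indicator B x <= ennreal (1 / b) * ennreal (decay k x * ?X)"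
     proof (cases "x : B")
      case True
      have "1 <= 1 / b * decay k x" using bB[OF True] b by simp
      hence "1 * ?X <= 1 / b * decay k x * ?X" by (rule mult_right_mono) simp
      hence "ennreal ?X <= ennreal (1 / b * (decay k x * ?X))" by (intro ennreal_leI) (simp add: mult.assoc)
      also have "... = ennreal (1 / b) * ennreal (decay k x * ?X)" using b decay_pos[of k x] by (intro ennreal_mult) (auto intro: less_imp_le)
      finally show ?thesis unfolding eq using True by simp
     qed simp
    qed
    also have "... = ennreal (1 / b) * (\<integral>x. ennreal (decay k x * (norm (weak_gradient u x) / (u x + e n)) powr p))"
     by (rule nn_integral_cmult) measurable
    also have "(\<integral>x. ennreal (decay k x * (norm (weak_gradient u x) / (u x + e n)) powr p))
     = ennreal (LINT x|lborel. decay k x * (norm (weak_gradient u x) / (u x + e n)) powr p)"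
     by (rule nn_integral_eq_integral[OF log_gradient_integrable[OF e \<gamma>0]]) (auto intro!: mult_nonneg_nonneg less_imp_le[OF decay_pos])
    also have "ennreal (1 / b) * ... <= ennreal (1 / b) * ennreal K" by (intro mult_left_mono ennreal_leI PK) simp
    also have "... = ennreal (1 / b * K)" using b by (intro ennreal_mult'[symmetric]) simp
    finally have "(\<integral>x. ennreal (norm ((1 / (u x + e n)) *R weak_gradient u x) powr p) * indicator B x) <= ennreal (1 / b * K)" .
    thus ?thesis unfolding f_def
     by (intro order_trans[OF translate_powr_le[OF p wg B]] mult_left_mono) auto
   qed
   have "(\<integral>x. liminf (%n. f n x)) <= liminf (%n. \<integral>\<^sup>+x. f n x \<partial>lborel)" by (rule nn_integral_liminf) measurable
   also have "... <= liminf (%n::nat. ennreal (norm h powr p) * ennreal (1 / b * K))"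
    by (rule Liminf_mono, rule always_eventually, rule allI, rule fle)
   also have "... < \<infinity>" by (simp add: Liminf_const ennreal_mult_less_top)
   finally have "AE x in lborel. liminf (%n. f n x) ~= \<infinity>" by (intro nn_integral_PInf_AE) auto
   thus ?thesis
   proof eventually_elim
    case (elim x)
    show ?case
    proof (intro impI notI)
     assume xB: "x : cball 0 (real R) & x + h : cball 0 (real R)" and z: "u x = 0 & 0 < u (x + h)"
     let ?t = "%n. ln (u (x + h)) + ln (real (Suc n))"
     have T: "filterlim ?t at_top sequentially"
      by (intro filterlim_tendsto_add_at_top[OF tendsto_const] filterlim_compose[OF ln_at_top]
        filterlim_compose[OF filterlim_real_sequentially filterlim_Suc])
     have "filterlim (%n. \<bar>L n (x + h) - L n x\<bar> powr p) at_top sequentially"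
     proof (rule filterlim_at_top_mono[OF T])
      have "\<forall>\<^sub>F n in sequentially. 1 <= ?t n" using T by (auto simp: filterlim_at_top)
      thus "\<forall>\<^sub>F n in sequentially. ?t n <= \<bar>L n (x + h) - L n x\<bar> powr p"
      proof eventually_elim
       case (elim n)
       have "ln (u (x + h)) <= ln (u (x + h) + e n)" using z e[of n] by simp
       moreover have "L n x = - ln (real (Suc n))" using z by (simp add: L_def e_def ln_div)
       ultimately have 1: "?t n <= \<bar>L n (x + h) - L n x\<bar>" by (simp add: L_def)
       hence "\<bar>L n (x + h) - L n x\<bar> powr 1 <= \<bar>L n (x + h) - L n x\<bar> powr p" using elim p by (intro powr_mono) auto
       thus ?case using 1 elim by simp
      qed
     qed
     hence "(%n. ennreal (\<bar>L n (x + h) - L n x\<bar> powr p)) ----> top"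
      by (simp add: ennreal_tendsto_top_eq_at_top)
     moreover have "f n x = ennreal (\<bar>L n (x + h) - L n x\<bar> powr p)" for n using xB by (simp add: f_def B_def)
     ultimately have "(%n. f n x) ----> top" by simp
     hence "liminf (%n. f n x) = top" by (rule lim_imp_Liminf[OF sequentially_bot])
     thus False using elim by simp
    qed
   qed
  qed
  hence "AE x in lborel. \<forall>R::nat. x : cball 0 (real R) & x + h : cball 0 (real R) --> ~ (u x = 0 & 0 < u (x + h))"
   unfolding AE_all_countable by blast
  thus ?thesis
  proof eventually_elim
   case (elim x)
   obtain R :: nat where "max (norm x) (norm (x + h)) <= real R" using real_arch_simple by blast
   moreover from elim have "x : cball 0 (real R) & x + h : cball 0 (real R) --> ~ (u x = 0 & 0 < u (x + h))" by (rule spec)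
   ultimately show ?case by simp
  qed
 qed
 have "AE h in lborel. AE x in lborel. ~ (u x = 0 & 0 < u (x + h))" using null by simp
 hence "AE x in lborel. AE h in lborel. ~ (u x = 0 & 0 < u (x + h))"
 proof (subst (asm) lborel_pair.AE_commute)
  have "Measurable.pred ((lborel :: 'a measure) \<Otimes>\<^sub>M lborel) (%z. ~ (u (snd z) = 0 & 0 < u (snd z + fst z)))"
   by measurable
  thus "{z : space ((lborel :: 'a measure) \<Otimes>\<^sub>M lborel). ~ (u (snd z) = 0 & 0 < u (snd z + fst z))} : sets lborel2"
   unfolding pred_def .
 qed
 thus ?thesis
 proof eventually_elim
  case (elim x)
  from AE_lborel_shift[of "%h. ~ (u x = 0 & 0 < u (x + h))" "- x"] elim show ?case by (simp add: add.commute)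
 qed
qed

lemma positive_if_nonzero:
 assumes Bu: "B u ~= 0"
 shows "AE x in lborel. 0 < u x"
proof (rule ccontr)
 assume not: "~ (AE x in lborel. 0 < u x)"
 have di: "AE x in lborel. AE y in lborel. ~ (u x = 0 & 0 < u y)"
  using zero_set_dichotomy_nonlocal zero_set_dichotomy_local \<gamma> by (cases "\<gamma> = 1") auto
 have "\<exists>x. (AE y in lborel. ~ (u x = 0 & 0 < u y)) & ~ 0 < u x"
 proof (rule ccontr)
  assume *: "~ ?thesis"
  from di have "AE x in lborel. 0 < u x" by eventually_elim (use * in blast)
  thus False using not by blast
 qed
 then obtain x where x: "AE y in lborel. ~ (u x = 0 & 0 < u y)" "~ 0 < u x" by blast
 have "u x = 0" using x(2) u0[of x] by linarith
 have "AE y in lborel. ennreal (norm y powr \<alpha> * \<bar>u y\<bar> powr q) = 0"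
  using x(1)
 proof eventually_elim
  case (elim y)
  hence "u y = 0" using \<open>u x = 0\<close> u0[of y] by linarith
  thus ?case by simp
 qed
 hence "B u = 0" unfolding B_def by (subst nn_integral_0_iff_AE) auto
 thus False using Bu by blast
qed

end

end

section \<open>Existence of a positive radial solution\<close>

theorem theorem1p1:
  fixes p q s \<alpha> \<beta> \<gamma> N :: real
  defines "N \<equiv> real DIM('a::euclidean_space)"
  assumes "p > 1" and "\<beta> > 0" and "0 \<le> \<gamma>" and "\<gamma> \<le> 1"
    and "\<gamma> < 1 \<Longrightarrow> 0 < s \<and> s < 1"
    and "\<gamma> = 1 \<Longrightarrow> s = 1"
    and "1 / p < s" and "s < N / p"
    and "\<gamma> > 0 \<Longrightarrow> p < N"
    and "\<alpha> > - s * p"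
    and "p < q" and "q < critical_exponent N p \<gamma> s \<alpha>"
    and "\<alpha> - \<beta> + (q - p) * ((1 - N) / p) < 0"
  shows "\<exists>u :: 'a \<Rightarrow> real.
    weak_solution \<gamma> s p q \<alpha> \<beta> u \<and> radial u \<and> (AE x in lborel. u x > 0)"
proof -
  interpret radial_problem p q s \<alpha> \<beta> \<gamma> "TYPE('a)"
    using assms unfolding N_def by unfold_locales auto
  obtain u :: "'a \<Rightarrow> real" where u: "weak_solution \<gamma> s p q \<alpha> \<beta> u" "\<And>x. 0 \<le> u x" "B u \<noteq> 0"
    using nonneg_weak_solution_exists by blast
  obtain k where k: "0 < k" "\<beta> + real DIM('a) < 2 * k" "(decay k :: 'a \<Rightarrow> real) \<in> X"
    using decay_in_X by blast
  have "AE x in lborel. 0 < u x" by (rule positive_if_nonzero[OF k u])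
  moreover have "radial u" using u_X[OF k u(1,2)] by (simp add: X_iff)
  ultimately show ?thesis using u(1) by blast
qed

end
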